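(* Let $S$ be a set of $d$ patterns, each a string of pairwise distinct integers from $[n]$, with longest pattern of length $r$, and let $t=t_1\ldots t_n$ be a permutation of $[n]$. Assume the Aho-Corasick automaton $\mathcal{AC}(S)$ has already been built. Then all occurrences of all patterns of $S$ in $t$ can be found in randomized $O(n\tau)$ time, where $\tau=\min\left(\log\log n,\sqrt{\frac{\log r}{\log\log r}},d\right)$.
   Context: Strings $u_1\ldots u_k$, $v_1\ldots v_k$ with pairwise distinct entries are order-isomorphic if for all $a<b$, $u_a>u_b \iff v_a>v_b$. A pattern $q=q_1\ldots q_k$ occurs in $t$ at position $i$ if $q$ is order-isomorphic to $t_i\ldots t_{i+k-1}$. Let $P$ be the set of prefixes of patterns in $S$ ($S$ is assumed prefix-free), where prefixes of the same length that are order-isomorphic are identified. $\mathcal{AC}(S)$ has one state per (identified) element of $P$; there is a forward transition from the state of $u\in P$ to the state of $uc\in P$ ($c$ a single symbol), labelled by the pair (positions in $uc$ of the predecessor and successor of the last symbol $c$ among the preceding symbols of $uc$); and a failure transition from the state of $u$ to the state of the longest proper suffix of $u$ that is order-isomorphic to an element of $P$. The computational model is the word RAM. *)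

theory Defs
  imports "HOL-Probability.Probability" "HOL-Library.Sublist"
begin

section \<open>Order isomorphism and occurrences\<close>

definition order_iso :: "nat list \<Rightarrow> nat list \<Rightarrow> bool" where
  "order_iso u v \<longleftrightarrow> length u = length v \<and>
     (\<forall>a b. a < b \<and> b < length u \<longrightarrow> (u ! a > u ! b \<longleftrightarrow> v ! a > v ! b))"

text \<open>Positions in the text are counted from 1.\<close>

definition occurs_at :: "nat list \<Rightarrow> nat list \<Rightarrow> nat \<Rightarrow> bool" where
  "occurs_at q t i \<longleftrightarrow> 1 \<le> i \<and> i + length q \<le> length t + 1 \<and>
     order_iso q (take (length q) (drop (i - 1) t))"

text \<open>Prefix-freeness is meant up to order isomorphism, since order-isomorphic prefixes are
  identified: no pattern is order-isomorphic to a prefix of another one.\<close>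

definition iso_prefix_free :: "nat list set \<Rightarrow> bool" where
  "iso_prefix_free S \<longleftrightarrow>
     (\<forall>p\<in>S. \<forall>q\<in>S. p \<noteq> q \<longrightarrow> \<not> (\<exists>v. prefix v q \<and> order_iso p v))"

definition pattern_set :: "nat \<Rightarrow> nat list set \<Rightarrow> bool" where
  "pattern_set n S \<longleftrightarrow> finite S \<and> S \<noteq> {} \<and>
     (\<forall>q\<in>S. q \<noteq> [] \<and> distinct q \<and> set q \<subseteq> {1..n}) \<and> iso_prefix_free S"


section \<open>The Aho-Corasick automaton\<close>

definition pattern_prefixes :: "nat list set \<Rightarrow> nat list set" where
  "pattern_prefixes S = {u. \<exists>q\<in>S. prefix u q}"

definition ac_states :: "nat list set \<Rightarrow> nat list set set" where
  "ac_states S = pattern_prefixes S //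
     {(u, v). u \<in> pattern_prefixes S \<and> v \<in> pattern_prefixes S \<and> order_iso u v}"

text \<open>The state of any string that is order-isomorphic to a prefix of a pattern; it is the empty
  set, which is not a state, for all other strings.\<close>

definition state_of :: "nat list set \<Rightarrow> nat list \<Rightarrow> nat list set" where
  "state_of S u = {v \<in> pattern_prefixes S. order_iso u v}"

text \<open>Positions (from 1) in \<open>u\<close> of the predecessor and of the successor of \<open>c\<close> among the
  symbols of \<open>u\<close>, where 0 stands for a missing predecessor or successor.\<close>

definition pred_pos :: "nat list \<Rightarrow> nat \<Rightarrow> nat" where
  "pred_pos u c = (if \<exists>x\<in>set u. x < c
     then Suc (THE j. j < length u \<and> u ! j = Max {x \<in> set u. x < c}) else 0)"

definition succ_pos :: "nat list \<Rightarrow> nat \<Rightarrow> nat" where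
  "succ_pos u c = (if \<exists>x\<in>set u. x > c
     then Suc (THE j. j < length u \<and> u ! j = Min {x \<in> set u. x > c}) else 0)"

definition ac_forward :: "nat list set \<Rightarrow> (nat list set \<times> (nat \<times> nat) \<times> nat list set) set" where
  "ac_forward S = {(state_of S u, (pred_pos u c, succ_pos u c), state_of S (u @ [c])) | u c.
     u @ [c] \<in> pattern_prefixes S}"

definition ac_failure :: "nat list set \<Rightarrow> (nat list set \<times> nat list set) set" where
  "ac_failure S = {(state_of S u, state_of S v) | u v.
     u \<in> pattern_prefixes S \<and> strict_suffix v u \<and> state_of S v \<in> ac_states S \<and>
     (\<forall>v'. strict_suffix v' u \<and> state_of S v' \<in> ac_states S \<longrightarrow> length v' \<le> length v)}"

text \<open>The output function of an Aho-Corasick automaton assigns to the state of \<open>u\<close> all patterns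
  that are order-isomorphic to a suffix of \<open>u\<close>. As usual it is stored in constant space per state:
  a state points to the accepting state of the longest such pattern (the state itself if it is
  accepting). The complete output set is read off by going on from the failure state of that
  accepting state.\<close>

definition ac_output :: "nat list set \<Rightarrow> (nat list set \<times> nat list set) set" where
  "ac_output S = {(state_of S u, state_of S v) | u v.
     u \<in> pattern_prefixes S \<and> suffix v u \<and> (\<exists>q\<in>S. order_iso v q) \<and>
     (\<forall>v'. suffix v' u \<and> (\<exists>q\<in>S. order_iso v' q) \<longrightarrow> length v' \<le> length v)}"

text \<open>A built automaton: states are numbered from 1, the root being state 1, and 0 stands for an
  undefined transition. \<open>ac_edges\<close> lists the outgoing forward transitions of a state as
  triples (predecessor position, successor position, target); \<open>ac_lookup\<close> is the dictionary
  access to the same transitions by their label.\<close>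

record ac_tables =
  ac_edges :: "nat \<Rightarrow> (nat \<times> nat \<times> nat) list"
  ac_lookup :: "nat \<Rightarrow> nat \<Rightarrow> nat \<Rightarrow> nat"
  ac_fail :: "nat \<Rightarrow> nat"
  ac_out :: "nat \<Rightarrow> nat"
  ac_depth :: "nat \<Rightarrow> nat"

definition stores_AC :: "nat list set \<Rightarrow> (nat list set \<Rightarrow> nat) \<Rightarrow> ac_tables \<Rightarrow> bool" where
  "stores_AC S num A \<longleftrightarrow>
     bij_betw num (ac_states S) {1..card (ac_states S)} \<and>
     num (state_of S []) = 1 \<and>
     (\<forall>s\<in>ac_states S.
        distinct (ac_edges A (num s)) \<and>
        set (ac_edges A (num s)) = {(a, b, num s') | a b s'. (s, (a, b), s') \<in> ac_forward S}) \<and>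
     (\<forall>s\<in>ac_states S. \<forall>a b.
        (\<forall>s'. (s, (a, b), s') \<in> ac_forward S \<longrightarrow> ac_lookup A (num s) a b = num s') \<and>
        ((\<nexists>s'. (s, (a, b), s') \<in> ac_forward S) \<longrightarrow> ac_lookup A (num s) a b = 0)) \<and>
     (\<forall>s\<in>ac_states S.
        (\<forall>s'. (s, s') \<in> ac_failure S \<longrightarrow> ac_fail A (num s) = num s') \<and>
        ((\<nexists>s'. (s, s') \<in> ac_failure S) \<longrightarrow> ac_fail A (num s) = 0)) \<and>
     (\<forall>s\<in>ac_states S.
        (\<forall>s'. (s, s') \<in> ac_output S \<longrightarrow> ac_out A (num s) = num s') \<and>
        ((\<nexists>s'. (s, s') \<in> ac_output S) \<longrightarrow> ac_out A (num s) = 0)) \<and>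
     (\<forall>u\<in>pattern_prefixes S. ac_depth A (num (state_of S u)) = length u)"


section \<open>The randomized word RAM\<close>

text \<open>Words are the numbers below \<open>2 ^ w\<close>, and every instruction takes unit time. The already
  built automaton is read-only data, accessed by one instruction per table.\<close>

datatype alu_op = Add | Sub | Mul | Div | Mod | And | Or | Xor | Shl | Shr

datatype instr =
    Const nat nat                   \<comment> \<open>target register, constant\<close>
  | Alu alu_op nat nat nat          \<comment> \<open>operation, target register, two operand registers\<close>
  | Load nat nat                    \<comment> \<open>target register, address register\<close>
  | Store nat nat                   \<comment> \<open>address register, source register\<close>
  | Rand nat                        \<comment> \<open>load a uniformly random word\<close>
  | Jump nat
  | Jump_less nat nat nat           \<comment> \<open>jump to the third argument if first register < second\<close>
  | Degree nat nat                  \<comment> \<open>target register, state\<close>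
  | Edge_pred nat nat nat           \<comment> \<open>target register, state, index of the edge (from 0)\<close>
  | Edge_succ nat nat nat
  | Edge_target nat nat nat
  | Lookup nat nat nat nat          \<comment> \<open>target register, state, label\<close>
  | Fail nat nat                    \<comment> \<open>target register, state\<close>
  | Out nat nat
  | Depth nat nat
  | Report nat nat                  \<comment> \<open>text position, accepting state of the pattern\<close>

record config =
  pc :: nat
  reg :: "nat \<Rightarrow> nat"
  mem :: "nat \<Rightarrow> nat"
  reported :: "(nat \<times> nat) list"

fun alu :: "nat \<Rightarrow> alu_op \<Rightarrow> nat \<Rightarrow> nat \<Rightarrow> nat" where
  "alu w Add x y = x + y"
| "alu w Sub x y = x + (2 ^ w - y)"   \<comment> \<open>truncated to \<open>w\<close> bits by \<open>set_reg\<close>\<close>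
| "alu w Mul x y = x * y"
| "alu w Div x y = x div y"
| "alu w Mod x y = x mod y"
| "alu w And x y = Bit_Operations.and x y"
| "alu w Or x y = Bit_Operations.or x y"
| "alu w Xor x y = Bit_Operations.xor x y"
| "alu w Shl x y = push_bit y x"
| "alu w Shr x y = drop_bit y x"

definition set_reg :: "nat \<Rightarrow> nat \<Rightarrow> nat \<Rightarrow> config \<Rightarrow> config" where
  "set_reg w r x c = c\<lparr>pc := Suc (pc c), reg := (reg c)(r := x mod 2 ^ w)\<rparr>"

definition edge :: "ac_tables \<Rightarrow> nat \<Rightarrow> nat \<Rightarrow> nat \<times> nat \<times> nat" where
  "edge A s k = (if k < length (ac_edges A s) then ac_edges A s ! k else (0, 0, 0))"

text \<open>One step; \<open>x\<close> is the random word that is used if the instruction is \<open>Rand\<close>.\<close>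

fun exec_instr :: "nat \<Rightarrow> ac_tables \<Rightarrow> nat \<Rightarrow> instr \<Rightarrow> config \<Rightarrow> config" where
  "exec_instr w A x (Const r v) c = set_reg w r v c"
| "exec_instr w A x (Alu f r a b) c = set_reg w r (alu w f (reg c a) (reg c b)) c"
| "exec_instr w A x (Load r a) c = set_reg w r (mem c (reg c a)) c"
| "exec_instr w A x (Store a r) c = c\<lparr>pc := Suc (pc c), mem := (mem c)(reg c a := reg c r)\<rparr>"
| "exec_instr w A x (Rand r) c = set_reg w r x c"
| "exec_instr w A x (Jump l) c = c\<lparr>pc := l\<rparr>"
| "exec_instr w A x (Jump_less a b l) c =
     c\<lparr>pc := (if reg c a < reg c b then l else Suc (pc c))\<rparr>"
| "exec_instr w A x (Degree r s) c = set_reg w r (length (ac_edges A (reg c s))) c"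
| "exec_instr w A x (Edge_pred r s k) c = set_reg w r (fst (edge A (reg c s) (reg c k))) c"
| "exec_instr w A x (Edge_succ r s k) c = set_reg w r (fst (snd (edge A (reg c s) (reg c k)))) c"
| "exec_instr w A x (Edge_target r s k) c = set_reg w r (snd (snd (edge A (reg c s) (reg c k)))) c"
| "exec_instr w A x (Lookup r s a b) c = set_reg w r (ac_lookup A (reg c s) (reg c a) (reg c b)) c"
| "exec_instr w A x (Fail r s) c = set_reg w r (ac_fail A (reg c s)) c"
| "exec_instr w A x (Out r s) c = set_reg w r (ac_out A (reg c s)) c"
| "exec_instr w A x (Depth r s) c = set_reg w r (ac_depth A (reg c s)) c"
| "exec_instr w A x (Report i s) c =
     c\<lparr>pc := Suc (pc c), reported := (reg c i, reg c s) # reported c\<rparr>"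

text \<open>A program halts by leaving its code.\<close>

definition halted :: "instr list \<Rightarrow> config \<Rightarrow> bool" where
  "halted prog c \<longleftrightarrow> pc c \<ge> length prog"

primrec run :: "nat \<Rightarrow> ac_tables \<Rightarrow> instr list \<Rightarrow> config \<Rightarrow> nat stream \<Rightarrow> nat \<Rightarrow> config" where
  "run w A prog c \<omega> 0 = c"
| "run w A prog c \<omega> (Suc k) =
     (let c' = run w A prog c \<omega> k
      in if halted prog c' then c' else exec_instr w A (\<omega> !! k) (prog ! pc c') c')"

definition coins :: "nat \<Rightarrow> nat stream measure" where
  "coins w = stream_space (measure_pmf (pmf_of_set {..<2 ^ w}))"

text \<open>The running time, infinite if the program does not halt.\<close>

definition running_time ::
    "nat \<Rightarrow> ac_tables \<Rightarrow> instr list \<Rightarrow> config \<Rightarrow> nat stream \<Rightarrow> ennreal" where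
  "running_time w A prog c \<omega> = (INF k\<in>{k. halted prog (run w A prog c \<omega> k)}. of_nat k)"

definition expected_time :: "nat \<Rightarrow> ac_tables \<Rightarrow> instr list \<Rightarrow> config \<Rightarrow> ennreal" where
  "expected_time w A prog c = (\<integral>\<^sup>+ \<omega>. running_time w A prog c \<omega> \<partial>coins w)"

text \<open>The text is stored in the memory cells 1, ..., \<open>n\<close>, and registers 0 to 3 hold the
  parameters. All other cells and registers are 0.\<close>

definition initial_config :: "nat \<Rightarrow> nat \<Rightarrow> nat \<Rightarrow> nat list \<Rightarrow> config" where
  "initial_config w d r t = \<lparr>
     pc = 0,
     reg = (\<lambda>_. 0)(0 := length t, 1 := d, 2 := r, 3 := w),
     mem = (\<lambda>a. if 1 \<le> a \<and> a \<le> length t then t ! (a - 1) else 0),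
     reported = []\<rparr>"

text \<open>An occurrence is reported as its text position together with the accepting state of the
  pattern, which identifies the pattern.\<close>

definition all_occurrences ::
    "nat list set \<Rightarrow> (nat list set \<Rightarrow> nat) \<Rightarrow> nat list \<Rightarrow> (nat \<times> nat) set" where
  "all_occurrences S num t = {(i, num (state_of S q)) | i q. q \<in> S \<and> occurs_at q t i}"

definition finds_all ::
    "nat \<Rightarrow> ac_tables \<Rightarrow> instr list \<Rightarrow> config \<Rightarrow> (nat \<times> nat) set \<Rightarrow> bool" where
  "finds_all w A prog c occs \<longleftrightarrow>
     (\<forall>\<omega> k. halted prog (run w A prog c \<omega> k) \<longrightarrow> set (reported (run w A prog c \<omega> k)) = occs)"


section \<open>The time bound\<close>

text \<open>As usual in an asymptotic bound, the arguments of the iterated logarithms are raised to the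
  constant 4, so that all terms are defined and at least 1.\<close>

definition tau :: "nat \<Rightarrow> nat \<Rightarrow> nat \<Rightarrow> real" where
  "tau n r d = Min {log 2 (log 2 (max 4 (real n))),
                    sqrt (log 2 (max 4 (real r)) / log 2 (log 2 (max 4 (real r)))),
                    real d}"

end

theory Submission
  imports Defs
begin

text \<open>The text is cut into blocks of length \<open>2 * r\<close> that start at the multiples of \<open>r\<close>, so that every
  occurrence lies in a block. One pass over the inverse of the text, which visits the symbols in
  increasing order, replaces the symbols of all blocks by their ranks. Each block is then run through
  the automaton with amortized \<open>O(1)\<close> transition attempts and window updates per symbol. If
  \<open>d\<close> is small, the transition is found by comparing the next symbol with the two symbols named
  by each of the at most \<open>d\<close> outgoing edges. Otherwise the window is kept in van Emde Boas sets
  over the universe of ranks, whose predecessor and successor queries give the label to look up.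
  They cost \<open>O(log log r)\<close>, which is both at most \<open>log log n\<close> and, up to a constant,
  at most \<open>sqrt (log r / log log r)\<close>. By prefix-freeness at most one pattern
  starts at each position, so the number of reports is linear. No random words are needed.\<close>

section \<open>A structured language\<close>

text \<open>The bound is claimed for one concrete instruction list, so correctness and cost must
  both survive compilation. Programs are therefore written in a small structured language whose
  semantics counts one unit per command or test. A single simulation turns each unit into at most as
  many machine steps as the program has instructions, and that length is a constant because one
  program serves all inputs.

  Ranking inside blocks is what makes \<open>log log r\<close> reachable: the sets only hold numbers
  below \<open>2 * r\<close>, so a whole structure fits into \<open>O(r)\<close> directly addressed
  cells. The sets are emptied by the same deletions that move the window, so nothing has to be
  cleared between blocks. The search method is chosen at run time by comparing \<open>d\<close> with
  the recursion depth of the sets, which makes the cost of an attempt the minimum of the two. The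
  square root term is met by comparing functions: with \<open>x = log 2 (log 2 r)\<close>, the
  inequality \<open>x \<le> 10 * sqrt (2 powr x / x)\<close> amounts to
  \<open>x ^ 3 \<le> 100 * 2 powr x\<close>.\<close>

datatype aexp = N nat | V nat | Bin alu_op aexp aexp | Arr nat aexp
  | Edges aexp | EPred aexp aexp | ESucc aexp aexp | ETarget aexp aexp
  | Look aexp aexp aexp | Failure aexp | Output aexp | Level aexp

datatype com = Asg nat aexp | St nat aexp aexp | Rep aexp aexp | Seq com com
  | Cond aexp aexp com com  \<comment> \<open>the test is: first expression < second\<close>
  | Loop aexp aexp com | Skip

abbreviation (input) nvars :: nat where "nvars \<equiv> 60"
abbreviation (input) narrays :: nat where "narrays \<equiv> 12"

text \<open>Values are natural numbers here, so subtraction is the truncated one; it agrees with the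
  wrap-around subtraction of the machine under the condition that \<open>ok\<close> imposes. The
  other operations ignore the word length, hence the dummy \<open>0\<close> for
  \<open>alu\<close>.\<close>

fun opv :: "alu_op \<Rightarrow> nat \<Rightarrow> nat \<Rightarrow> nat" where
  "opv Sub x y = x - y"
| "opv f x y = alu 0 f x y"

locale ram =
  fixes w B :: nat and A :: ac_tables
begin

primrec val :: "(nat \<Rightarrow> nat) \<Rightarrow> (nat \<Rightarrow> nat \<Rightarrow> nat) \<Rightarrow> aexp \<Rightarrow> nat" where
  "val r h (N c) = c"
| "val r h (V v) = r v"
| "val r h (Bin f a b) = opv f (val r h a) (val r h b)"
| "val r h (Arr k e) = h k (val r h e)"
| "val r h (Edges e) = length (ac_edges A (val r h e))"
| "val r h (EPred e k) = fst (edge A (val r h e) (val r h k))"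
| "val r h (ESucc e k) = fst (snd (edge A (val r h e) (val r h k)))"
| "val r h (ETarget e k) = snd (snd (edge A (val r h e) (val r h k)))"
| "val r h (Look e a b) = ac_lookup A (val r h e) (val r h a) (val r h b)"
| "val r h (Failure e) = ac_fail A (val r h e)"
| "val r h (Output e) = ac_out A (val r h e)"
| "val r h (Level e) = ac_depth A (val r h e)"

text \<open>Side conditions under which machine evaluation neither overflows nor underflows nor
  leaves an array. For variables and stored array entries the word bound comes from the simulation
  relation \<open>rel\<close> instead.\<close>

primrec ok :: "(nat \<Rightarrow> nat) \<Rightarrow> (nat \<Rightarrow> nat \<Rightarrow> nat) \<Rightarrow> aexp \<Rightarrow> bool" where
  "ok r h (N c) \<longleftrightarrow> c < 2 ^ w"
| "ok r h (V v) \<longleftrightarrow> True"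
| "ok r h (Bin f a b) \<longleftrightarrow> ok r h a \<and> ok r h b \<and> (f = Sub \<longrightarrow> val r h b \<le> val r h a) \<and>
     val r h (Bin f a b) < 2 ^ w"
| "ok r h (Arr k e) \<longleftrightarrow> ok r h e \<and> val r h e < B"
| "ok r h (Edges e) \<longleftrightarrow> ok r h e \<and> val r h (Edges e) < 2 ^ w"
| "ok r h (EPred e k) \<longleftrightarrow> ok r h e \<and> ok r h k \<and> val r h (EPred e k) < 2 ^ w"
| "ok r h (ESucc e k) \<longleftrightarrow> ok r h e \<and> ok r h k \<and> val r h (ESucc e k) < 2 ^ w"
| "ok r h (ETarget e k) \<longleftrightarrow> ok r h e \<and> ok r h k \<and> val r h (ETarget e k) < 2 ^ w"
| "ok r h (Look e a b) \<longleftrightarrow> ok r h e \<and> ok r h a \<and> ok r h b \<and> val r h (Look e a b) < 2 ^ w"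
| "ok r h (Failure e) \<longleftrightarrow> ok r h e \<and> val r h (Failure e) < 2 ^ w"
| "ok r h (Output e) \<longleftrightarrow> ok r h e \<and> val r h (Output e) < 2 ^ w"
| "ok r h (Level e) \<longleftrightarrow> ok r h e \<and> val r h (Level e) < 2 ^ w"

text \<open>The last component is a clock: one unit per assignment, store, report and test,
  including the failing test that ends a loop. Machine instructions are not counted here; their
  number per unit is bounded once, in \<open>sim\<close>. No rule applies when a side condition
  fails, so a derivation certifies all of them.\<close>

inductive big :: "com \<Rightarrow> (nat \<Rightarrow> nat) \<times> (nat \<Rightarrow> nat \<Rightarrow> nat) \<times> (nat \<times> nat) list \<times> nat \<Rightarrow>
    (nat \<Rightarrow> nat) \<times> (nat \<Rightarrow> nat \<Rightarrow> nat) \<times> (nat \<times> nat) list \<times> nat \<Rightarrow> bool" where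
  big_Asg: "ok r h e \<Longrightarrow> big (Asg v e) (r, h, out, t) (r(v := val r h e), h, out, Suc t)"
| big_St: "ok r h i \<Longrightarrow> ok r h e \<Longrightarrow> val r h i < B \<Longrightarrow>
    big (St k i e) (r, h, out, t) (r, h(k := (h k)(val r h i := val r h e)), out, Suc t)"
| big_Rep: "ok r h i \<Longrightarrow> ok r h e \<Longrightarrow>
    big (Rep i e) (r, h, out, t) (r, h, (val r h i, val r h e) # out, Suc t)"
| big_Skip: "big Skip s s"
| big_Seq: "big c1 s s' \<Longrightarrow> big c2 s' s'' \<Longrightarrow> big (Seq c1 c2) s s''"
| big_CondT: "ok r h a \<Longrightarrow> ok r h b \<Longrightarrow> val r h a < val r h b \<Longrightarrow> big c1 (r, h, out, Suc t) s \<Longrightarrow>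
    big (Cond a b c1 c2) (r, h, out, t) s"
| big_CondF: "ok r h a \<Longrightarrow> ok r h b \<Longrightarrow> \<not> val r h a < val r h b \<Longrightarrow> big c2 (r, h, out, Suc t) s \<Longrightarrow>
    big (Cond a b c1 c2) (r, h, out, t) s"
| big_LoopT: "ok r h a \<Longrightarrow> ok r h b \<Longrightarrow> val r h a < val r h b \<Longrightarrow> big c (r, h, out, Suc t) s \<Longrightarrow>
    big (Loop a b c) s s' \<Longrightarrow> big (Loop a b c) (r, h, out, t) s'"
| big_LoopF: "ok r h a \<Longrightarrow> ok r h b \<Longrightarrow> \<not> val r h a < val r h b \<Longrightarrow>
    big (Loop a b c) (r, h, out, t) (r, h, out, Suc t)"

inductive_cases big_AsgE: "big (Asg v e) s s'"
inductive_cases big_StE: "big (St k i e) s s'"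
inductive_cases big_RepE: "big (Rep i e) s s'"
inductive_cases big_SkipE: "big Skip s s'"
inductive_cases big_SeqE: "big (Seq c1 c2) s s'"
inductive_cases big_CondE: "big (Cond a b c1 c2) s s'"
inductive_cases big_LoopE: "big (Loop a b c) s s'"

text \<open>Total correctness: some terminating derivation reaches \<open>Q\<close>, and since
  \<open>Q\<close> sees the clock, it can bound the running time. Existence suffices, because that
  derivation is the one replayed on the machine.\<close>

definition wp where
  "wp c Q r h out t \<longleftrightarrow> (\<exists>r' h' out' t'. big c (r, h, out, t) (r', h', out', t') \<and> Q r' h' out' t')"

lemma wp_Asg [simp]: "wp (Asg v e) Q r h out t \<longleftrightarrow> ok r h e \<and> Q (r(v := val r h e)) h out (Suc t)"
  unfolding wp_def by (blast elim: big_AsgE intro: big_Asg)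

lemma wp_St [simp]: "wp (St k i e) Q r h out t \<longleftrightarrow> ok r h i \<and> ok r h e \<and> val r h i < B \<and>
    Q r (h(k := (h k)(val r h i := val r h e))) out (Suc t)"
  unfolding wp_def by (blast elim: big_StE intro: big_St)

lemma wp_Rep [simp]: "wp (Rep i e) Q r h out t \<longleftrightarrow> ok r h i \<and> ok r h e \<and>
    Q r h ((val r h i, val r h e) # out) (Suc t)"
  unfolding wp_def by (blast elim: big_RepE intro: big_Rep)

lemma wp_Skip [simp]: "wp Skip Q r h out t \<longleftrightarrow> Q r h out t"
  unfolding wp_def by (blast elim: big_SkipE intro: big_Skip)

lemma wp_Seq [simp]: "wp (Seq c1 c2) Q r h out t \<longleftrightarrow> wp c1 (wp c2 Q) r h out t"
  unfolding wp_def by (rule iffI, (fastforce elim: big_SeqE)[1]) (blast intro: big_Seq)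

lemma wp_Cond [simp]: "wp (Cond a b c1 c2) Q r h out t \<longleftrightarrow> ok r h a \<and> ok r h b \<and>
    (if val r h a < val r h b then wp c1 Q r h out (Suc t) else wp c2 Q r h out (Suc t))"
  unfolding wp_def by (auto elim!: big_CondE) (blast intro: big_CondT big_CondF)+

lemma wp_Loop: "wp (Loop a b c) Q r h out t \<longleftrightarrow> ok r h a \<and> ok r h b \<and>
    (if val r h a < val r h b then wp c (wp (Loop a b c) Q) r h out (Suc t) else Q r h out (Suc t))"
  (is "?L \<longleftrightarrow> ?R")
proof
  assume ?L
  then obtain r' h' out' t' where b: "big (Loop a b c) (r, h, out, t) (r', h', out', t')"
    and Q: "Q r' h' out' t'" unfolding wp_def by blast
  from b show ?R
    apply (rule big_LoopE)
    subgoal for _ _ _ _ s using Q by (cases s) (auto simp: wp_def, blast)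
    subgoal using Q by simp
    done
next
  assume R: ?R
  show ?L
  proof (cases "val r h a < val r h b")
    case True
    then show ?thesis using R by (simp add: wp_def) (blast intro: big_LoopT)
  next
    case False
    then have "big (Loop a b c) (r, h, out, t) (r, h, out, Suc t)" using R by (intro big_LoopF) auto
    then show ?thesis using R False unfolding wp_def by auto
  qed
qed

lemma wp_mono:
  assumes "wp c Q r h out t" "\<And>r' h' out' t'. Q r' h' out' t' \<Longrightarrow> Q' r' h' out' t'"
  shows "wp c Q' r h out t"
  using assms unfolding wp_def by blast

text \<open>\<open>\<mu>\<close> only gives termination. Time bounds belong to \<open>I\<close>,
  which sees the clock, so an amortized bound is stated as an invariant between the clock and the
  registers.\<close>

lemma wp_Loop_inv:
  assumes "I r h out t"
    and "\<And>r h out t. I r h out t \<Longrightarrow> ok r h a \<and> ok r h b \<and>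
      (if val r h a < val r h b
       then wp c (\<lambda>r' h' out' t'. I r' h' out' t' \<and> \<mu> r' h' < (\<mu> r h :: nat)) r h out (Suc t)
       else Q r h out (Suc t))"
  shows "wp (Loop a b c) Q r h out t"
  using assms(1)
proof (induction "\<mu> r h" arbitrary: r h out t rule: less_induct)
  case less
  have inv: "ok r h a \<and> ok r h b \<and>
      (if val r h a < val r h b
       then wp c (\<lambda>r' h' out' t'. I r' h' out' t' \<and> \<mu> r' h' < \<mu> r h) r h out (Suc t)
       else Q r h out (Suc t))"
    by (rule assms(2)) (rule less.prems)
  show ?case
    apply (subst wp_Loop)
    using inv by (auto split: if_splits elim!: wp_mono intro: less.hyps)
qed

end


section \<open>Compilation\<close>

text \<open>\<open>d\<close> is the top of an evaluation stack kept in registers: the value arrives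
  in register \<open>d\<close>, and operands use the registers above it. \<open>And\<close> of a
  register with itself serves as a move, and an array access forms \<open>k * B + i\<close> with
  \<open>B\<close> taken from register \<open>nvars\<close>.\<close>

primrec compE :: "aexp \<Rightarrow> nat \<Rightarrow> instr list" where
  "compE (N c) d = [Const d c]"
| "compE (V v) d = [Alu And d v v]"
| "compE (Bin f a b) d = compE a d @ compE b (Suc d) @ [Alu f d d (Suc d)]"
| "compE (Arr k e) d = compE e d @
     [Const (Suc d) k, Alu Mul (Suc d) (Suc d) nvars, Alu Add d d (Suc d), Load d d]"
| "compE (Edges e) d = compE e d @ [Degree d d]"
| "compE (EPred e k) d = compE e d @ compE k (Suc d) @ [Edge_pred d d (Suc d)]"
| "compE (ESucc e k) d = compE e d @ compE k (Suc d) @ [Edge_succ d d (Suc d)]"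
| "compE (ETarget e k) d = compE e d @ compE k (Suc d) @ [Edge_target d d (Suc d)]"
| "compE (Look e a b) d = compE e d @ compE a (Suc d) @ compE b (Suc (Suc d)) @
     [Lookup d d (Suc d) (Suc (Suc d))]"
| "compE (Failure e) d = compE e d @ [Fail d d]"
| "compE (Output e) d = compE e d @ [Out d d]"
| "compE (Level e) d = compE e d @ [Depth d d]"

abbreviation (input) T0 :: nat where "T0 \<equiv> Suc nvars"

definition comp2 :: "aexp \<Rightarrow> aexp \<Rightarrow> instr list" where
  "comp2 a b = compE a T0 @ compE b (Suc T0)"

text \<open>Jump targets are absolute addresses, so code lengths must be known before code is
  generated; they do not depend on where the code is placed.\<close>

primrec size_com :: "com \<Rightarrow> nat" where
  "size_com (Asg v e) = length (compE e T0) + 1"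
| "size_com (St k i e) = length (comp2 i e) + 4"
| "size_com (Rep i e) = length (comp2 i e) + 1"
| "size_com (Seq c1 c2) = size_com c1 + size_com c2"
| "size_com (Cond a b c1 c2) = length (comp2 a b) + size_com c1 + size_com c2 + 2"
| "size_com (Loop a b c) = length (comp2 a b) + size_com c + 3"
| "size_com Skip = 0"

text \<open>The first argument is the address of the first instruction. Register \<open>nvars\<close> holds the
  length \<open>B\<close> that is reserved for each array: entry \<open>i\<close> of array \<open>k\<close> is cell \<open>k * B + i\<close>.\<close>

primrec compile :: "nat \<Rightarrow> com \<Rightarrow> instr list" where
  "compile p (Asg v e) = compE e T0 @ [Alu And v T0 T0]"
| "compile p (St k i e) = comp2 i e @ [Const (T0 + 2) k, Alu Mul (T0 + 2) (T0 + 2) nvars,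
     Alu Add T0 T0 (T0 + 2), Store T0 (Suc T0)]"
| "compile p (Rep i e) = comp2 i e @ [Report T0 (Suc T0)]"
| "compile p (Seq c1 c2) = compile p c1 @ compile (p + size_com c1) c2"
| "compile p (Cond a b c1 c2) = (let q = p + length (comp2 a b); l = q + size_com c2 + 2 in
     comp2 a b @ [Jump_less T0 (Suc T0) l] @ compile (Suc q) c2 @ [Jump (l + size_com c1)] @ compile l c1)"
| "compile p (Loop a b c) = (let q = p + length (comp2 a b) in
     comp2 a b @ [Jump_less T0 (Suc T0) (q + 2), Jump (q + size_com c + 3)] @ compile (q + 2) c @ [Jump p])"
| "compile p Skip = []"

lemma length_compile [simp]: "length (compile p c) = size_com c"
  by (induction c arbitrary: p) (auto simp: Let_def)

primrec wfe :: "aexp \<Rightarrow> bool" where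
  "wfe (N c) \<longleftrightarrow> True"
| "wfe (V v) \<longleftrightarrow> v < nvars"
| "wfe (Bin f a b) \<longleftrightarrow> wfe a \<and> wfe b"
| "wfe (Arr k e) \<longleftrightarrow> k < narrays \<and> wfe e"
| "wfe (Edges e) \<longleftrightarrow> wfe e"
| "wfe (EPred e k) \<longleftrightarrow> wfe e \<and> wfe k"
| "wfe (ESucc e k) \<longleftrightarrow> wfe e \<and> wfe k"
| "wfe (ETarget e k) \<longleftrightarrow> wfe e \<and> wfe k"
| "wfe (Look e a b) \<longleftrightarrow> wfe e \<and> wfe a \<and> wfe b"
| "wfe (Failure e) \<longleftrightarrow> wfe e"
| "wfe (Output e) \<longleftrightarrow> wfe e"
| "wfe (Level e) \<longleftrightarrow> wfe e"

primrec wfc :: "com \<Rightarrow> bool" where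
  "wfc (Asg v e) \<longleftrightarrow> v < nvars \<and> wfe e"
| "wfc (St k i e) \<longleftrightarrow> k < narrays \<and> wfe i \<and> wfe e"
| "wfc (Rep i e) \<longleftrightarrow> wfe i \<and> wfe e"
| "wfc (Seq c1 c2) \<longleftrightarrow> wfc c1 \<and> wfc c2"
| "wfc (Cond a b c1 c2) \<longleftrightarrow> wfe a \<and> wfe b \<and> wfc c1 \<and> wfc c2"
| "wfc (Loop a b c) \<longleftrightarrow> wfe a \<and> wfe b \<and> wfc c"
| "wfc Skip \<longleftrightarrow> True"

section \<open>Runs without random words, and straight-line code\<close>

definition step :: "nat \<Rightarrow> ac_tables \<Rightarrow> instr list \<Rightarrow> config \<Rightarrow> config" where
  "step w A prog c = (if halted prog c then c else exec_instr w A 0 (prog ! pc c) c)"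

abbreviation is_Rand :: "instr \<Rightarrow> bool" where "is_Rand i \<equiv> (\<exists>v. i = Rand v)"

lemma exec_instr_det: "\<not> is_Rand i \<Longrightarrow> exec_instr w A x i c = exec_instr w A 0 i c"
  by (cases i) auto

lemma run_det:
  assumes "\<And>i. i \<in> set prog \<Longrightarrow> \<not> is_Rand i"
  shows "run w A prog c \<omega> k = (step w A prog ^^ k) c"
proof (induction k)
  case (Suc k)
  then show ?case
    using assms nth_mem[of _ prog]
    by (auto simp: Let_def step_def halted_def not_le intro!: exec_instr_det)
qed simp

lemma steps_halted: "halted prog c \<Longrightarrow> (step w A prog ^^ k) c = c"
  by (induction k) (auto simp: step_def)

lemma steps_comp:
  "(step w A prog ^^ k) c = c' \<Longrightarrow> (step w A prog ^^ l) c' = c'' \<Longrightarrow> (step w A prog ^^ (l + k)) c = c''"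
  by (simp add: funpow_add)

lemma no_Rand_compE: "i \<in> set (compE e d) \<Longrightarrow> \<not> is_Rand i"
  by (induction e arbitrary: d) auto

lemma no_Rand_compile: "i \<in> set (compile p c) \<Longrightarrow> \<not> is_Rand i"
  by (induction c arbitrary: p) (auto simp: Let_def comp2_def dest: no_Rand_compE)

definition straight :: "instr list \<Rightarrow> bool" where
  "straight is \<longleftrightarrow> (\<forall>i\<in>set is. \<forall>w A c. pc (exec_instr w A 0 i c) = Suc (pc c))"

lemma straight_simps [simp]:
  "straight []"
  "straight (i # is) \<longleftrightarrow> (\<forall>w A c. pc (exec_instr w A 0 i c) = Suc (pc c)) \<and> straight is"
  "straight (is @ js) \<longleftrightarrow> straight is \<and> straight js"
  by (auto simp: straight_def)

lemma set_reg_sel [simp]: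
  "pc (set_reg w r x c) = Suc (pc c)"
  "mem (set_reg w r x c) = mem c"
  "reported (set_reg w r x c) = reported c"
  "reg (set_reg w r x c) = (reg c)(r := x mod 2 ^ w)"
  by (simp_all add: set_reg_def)

lemma straight_compE [simp]: "straight (compE e d)"
  by (induction e arbitrary: d) auto

abbreviation execs :: "nat \<Rightarrow> ac_tables \<Rightarrow> instr list \<Rightarrow> config \<Rightarrow> config" where
  "execs w A is c \<equiv> fold (exec_instr w A 0) is c"

lemma steps_straight:
  assumes "straight is" "prog = pre @ is @ post" "pc c = length pre"
  shows "(step w A prog ^^ length is) c = execs w A is c \<and> pc (execs w A is c) = pc c + length is"
  using assms
proof (induction "is" arbitrary: pre c)
  case (Cons i "is")
  let ?c = "exec_instr w A 0 i c"
  have 1: "step w A prog c = ?c"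
    using Cons.prems by (simp add: step_def halted_def nth_append)
  have 2: "pc ?c = Suc (pc c)"
    using Cons.prems by simp
  have IH: "(step w A prog ^^ length is) ?c = execs w A is ?c \<and>
      pc (execs w A is ?c) = pc ?c + length is"
    using Cons.prems 2 by (intro Cons.IH[of "pre @ [i]"]) auto
  have "(step w A prog ^^ length (i # is)) c = (step w A prog ^^ length is) (step w A prog c)"
    unfolding list.size add_0_right add_Suc_right funpow_Suc_right by simp
  then show ?case using IH unfolding 1 by (simp add: 2)
qed simp

section \<open>Simulation of the structured language by machine steps\<close>

context ram
begin

text \<open>Registers below \<open>nvars\<close> are the variables, register \<open>nvars\<close>
  holds \<open>B\<close>, and everything above is unconstrained, which leaves it free as the
  evaluation stack. The word bounds of variables and array entries are carried here because
  \<open>ok\<close> does not state them.\<close>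

definition rel where
  "rel r h out c \<longleftrightarrow> (\<forall>v<nvars. reg c v = r v \<and> r v < 2 ^ w) \<and> reg c nvars = B \<and>
     (\<forall>k<narrays. \<forall>i<B. mem c (k * B + i) = h k i \<and> h k i < 2 ^ w) \<and> reported c = out"

end

locale big_ram = ram +
  assumes space: "narrays * B \<le> 2 ^ w" and B_pos: "0 < B"
begin

lemma const_less: "k < narrays \<Longrightarrow> k < 2 ^ w"
  using space B_pos mult_le_mono2[of 1 B narrays] by linarith

lemma cell_less: "k < narrays \<Longrightarrow> i < B \<Longrightarrow> k * B + i < 2 ^ w"
proof -
  assume "k < narrays" "i < B"
  then have "k * B + i < (k + 1) * B" by simp
  also have "\<dots> \<le> narrays * B" using \<open>k < narrays\<close> by (intro mult_le_mono1) simp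
  finally show ?thesis using space by linarith
qed

lemma cell_inj:
  assumes "k * B + i = k' * B + i'" "i < B" "i' < B"
  shows "k = k' \<and> i = i'"
proof -
  have "(k * B + i) div B = k" using assms(2) by simp
  moreover have "(k' * B + i') div B = k'" using assms(3) by simp
  ultimately have "k = k'" unfolding assms(1) by simp
  then show ?thesis using assms by simp
qed

text \<open>Only subtraction needs an argument: for \<open>y \<le> x\<close> the machine computes
  \<open>(x - y) + 2 ^ w\<close>, and the truncation to \<open>w\<close> bits removes the
  excess.\<close>

lemma alu_opv: "x < 2 ^ w \<Longrightarrow> y < 2 ^ w \<Longrightarrow> (f = Sub \<longrightarrow> y \<le> x) \<Longrightarrow> opv f x y < 2 ^ w \<Longrightarrow>
    alu w f x y mod 2 ^ w = opv f x y"
proof (cases f)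
  case Sub
  assume *: "x < 2 ^ w" "y < 2 ^ w" "f = Sub \<longrightarrow> y \<le> x"
  then have e: "x + (2 ^ w - y) = (x - y) + 2 ^ w" using Sub by simp
  show ?thesis unfolding Sub alu.simps opv.simps e using * by simp
qed auto

lemma rel_set_reg: "rel r h out c \<Longrightarrow> nvars < d \<Longrightarrow> rel r h out (set_reg w d x c)"
  by (auto simp: rel_def)

lemma rel_cell: "rel r h out c \<Longrightarrow> k < narrays \<Longrightarrow> i < B \<Longrightarrow> mem c (k * B + i) = h k i \<and> h k i < 2 ^ w"
  by (auto simp: rel_def)

text \<open>The last conjunct, that no register below \<open>d\<close> changes, keeps partial
  results alive while the next operand is evaluated one register higher.\<close>

lemma compE_correct:
  assumes "rel r h out c" "wfe e" "ok r h e" "nvars < d"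
  shows "rel r h out (execs w A (compE e d) c) \<and> reg (execs w A (compE e d) c) d = val r h e \<and>
    val r h e < 2 ^ w \<and> (\<forall>v<d. reg (execs w A (compE e d) c) v = reg c v)"
  using assms
proof (induction e arbitrary: d c)
  case (N k)
  then show ?case by (simp add: rel_set_reg)
next
  case (V v)
  then have "reg c v = r v" "r v < 2 ^ w" by (auto simp: rel_def)
  with V show ?case by (simp add: rel_set_reg)
next
  case (Bin f a b)
  define c1 where "c1 = execs w A (compE a d) c"
  define c2 where "c2 = execs w A (compE b (Suc d)) c1"
  have 1: "rel r h out c1 \<and> reg c1 d = val r h a \<and> val r h a < 2 ^ w \<and> (\<forall>v<d. reg c1 v = reg c v)"
    unfolding c1_def using Bin.prems by (intro Bin.IH(1)) auto
  have 2: "rel r h out c2 \<and> reg c2 (Suc d) = val r h b \<and> val r h b < 2 ^ w \<and>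
      (\<forall>v<Suc d. reg c2 v = reg c1 v)"
    unfolding c2_def using Bin.prems 1 by (intro Bin.IH(2)) auto
  have "alu w f (val r h a) (val r h b) mod 2 ^ w = opv f (val r h a) (val r h b)"
    using 1 2 Bin.prems by (intro alu_opv) auto
  then show ?case
    using 1 2 Bin.prems by (simp add: c1_def[symmetric] c2_def[symmetric] rel_set_reg)
next
  case (Arr k e)
  define c1 where "c1 = execs w A (compE e d) c"
  have 1: "rel r h out c1 \<and> reg c1 d = val r h e \<and> val r h e < 2 ^ w \<and> (\<forall>v<d. reg c1 v = reg c v)"
    unfolding c1_def using Arr.prems by (intro Arr.IH) auto
  have k: "k < narrays" "val r h e < B" using Arr.prems by auto
  have 2: "k < 2 ^ w" "k * B < 2 ^ w" "val r h e + k * B < 2 ^ w"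
    using k const_less cell_less[of k 0] cell_less[of k "val r h e"] B_pos by (auto simp: add.commute)
  have 3: "mem c1 (val r h e + k * B) = h k (val r h e)" "h k (val r h e) < 2 ^ w"
    using rel_cell[of r h out c1 k "val r h e"] 1 k by (auto simp: add.commute)
  have 4: "reg c1 nvars = B" using 1 by (auto simp: rel_def)
  have "nvars < d" using Arr.prems by simp
  then show ?case
    using 1 2 3 4 by (simp add: c1_def[symmetric] rel_set_reg)
next
  case (Look e a b)
  define c1 where "c1 = execs w A (compE e d) c"
  define c2 where "c2 = execs w A (compE a (Suc d)) c1"
  define c3 where "c3 = execs w A (compE b (Suc (Suc d))) c2"
  have 1: "rel r h out c1 \<and> reg c1 d = val r h e \<and> val r h e < 2 ^ w \<and> (\<forall>v<d. reg c1 v = reg c v)"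
    unfolding c1_def using Look.prems by (intro Look.IH(1)) auto
  have 2: "rel r h out c2 \<and> reg c2 (Suc d) = val r h a \<and> val r h a < 2 ^ w \<and>
      (\<forall>v<Suc d. reg c2 v = reg c1 v)"
    unfolding c2_def using Look.prems 1 by (intro Look.IH(2)) auto
  have 3: "rel r h out c3 \<and> reg c3 (Suc (Suc d)) = val r h b \<and> val r h b < 2 ^ w \<and>
      (\<forall>v<Suc (Suc d). reg c3 v = reg c2 v)"
    unfolding c3_def using Look.prems 2 by (intro Look.IH(3)) auto
  show ?case
    using 1 2 3 Look.prems by (simp add: c1_def[symmetric] c2_def[symmetric] c3_def[symmetric] rel_set_reg)
next
  case (EPred e k)
  define c1 where "c1 = execs w A (compE e d) c"
  define c2 where "c2 = execs w A (compE k (Suc d)) c1"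
  have 1: "rel r h out c1 \<and> reg c1 d = val r h e \<and> val r h e < 2 ^ w \<and> (\<forall>v<d. reg c1 v = reg c v)"
    unfolding c1_def using EPred.prems by (intro EPred.IH(1)) auto
  have 2: "rel r h out c2 \<and> reg c2 (Suc d) = val r h k \<and> val r h k < 2 ^ w \<and>
      (\<forall>v<Suc d. reg c2 v = reg c1 v)"
    unfolding c2_def using EPred.prems 1 by (intro EPred.IH(2)) auto
  show ?case
    using 1 2 EPred.prems by (simp add: c1_def[symmetric] c2_def[symmetric] rel_set_reg)
next
  case (ESucc e k)
  define c1 where "c1 = execs w A (compE e d) c"
  define c2 where "c2 = execs w A (compE k (Suc d)) c1"
  have 1: "rel r h out c1 \<and> reg c1 d = val r h e \<and> val r h e < 2 ^ w \<and> (\<forall>v<d. reg c1 v = reg c v)"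
    unfolding c1_def using ESucc.prems by (intro ESucc.IH(1)) auto
  have 2: "rel r h out c2 \<and> reg c2 (Suc d) = val r h k \<and> val r h k < 2 ^ w \<and>
      (\<forall>v<Suc d. reg c2 v = reg c1 v)"
    unfolding c2_def using ESucc.prems 1 by (intro ESucc.IH(2)) auto
  show ?case
    using 1 2 ESucc.prems by (simp add: c1_def[symmetric] c2_def[symmetric] rel_set_reg)
next
  case (ETarget e k)
  define c1 where "c1 = execs w A (compE e d) c"
  define c2 where "c2 = execs w A (compE k (Suc d)) c1"
  have 1: "rel r h out c1 \<and> reg c1 d = val r h e \<and> val r h e < 2 ^ w \<and> (\<forall>v<d. reg c1 v = reg c v)"
    unfolding c1_def using ETarget.prems by (intro ETarget.IH(1)) auto
  have 2: "rel r h out c2 \<and> reg c2 (Suc d) = val r h k \<and> val r h k < 2 ^ w \<and>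
      (\<forall>v<Suc d. reg c2 v = reg c1 v)"
    unfolding c2_def using ETarget.prems 1 by (intro ETarget.IH(2)) auto
  show ?case
    using 1 2 ETarget.prems by (simp add: c1_def[symmetric] c2_def[symmetric] rel_set_reg)
next
  case (Edges e)
  then show ?case using Edges.IH[OF Edges.prems(1) _ _ Edges.prems(4)] by (simp add: rel_set_reg)
next
  case (Failure e)
  then show ?case using Failure.IH[OF Failure.prems(1) _ _ Failure.prems(4)] by (simp add: rel_set_reg)
next
  case (Output e)
  then show ?case using Output.IH[OF Output.prems(1) _ _ Output.prems(4)] by (simp add: rel_set_reg)
next
  case (Level e)
  then show ?case using Level.IH[OF Level.prems(1) _ _ Level.prems(4)] by (simp add: rel_set_reg)
qed

lemma comp2_correct:
  assumes "rel r h out c" "wfe a" "ok r h a" "wfe b" "ok r h b"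
  shows "rel r h out (execs w A (comp2 a b) c)" "reg (execs w A (comp2 a b) c) T0 = val r h a"
    "reg (execs w A (comp2 a b) c) (Suc T0) = val r h b" "val r h a < 2 ^ w" "val r h b < 2 ^ w"
  using compE_correct[OF assms(1-3), of T0] 
    compE_correct[of r h out "execs w A (compE a T0) c" b "Suc T0"] assms
  by (auto simp: comp2_def)

lemma big_time: "big c s s' \<Longrightarrow> snd (snd (snd s)) \<le> snd (snd (snd s'))"
  by (induction rule: big.induct) auto

definition srel where
  "srel s c \<longleftrightarrow> (case s of (r, h, out, t) \<Rightarrow> rel r h out c)"

lemma srel_simp [simp]: "srel (r, h, out, t) c \<longleftrightarrow> rel r h out c"
  by (simp add: srel_def)

lemma rel_set_pc: "rel r h out c \<Longrightarrow> rel r h out (c\<lparr>pc := p\<rparr>)"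
  by (simp add: rel_def)

lemma step_at: "prog = pre @ i # post \<Longrightarrow> pc c = length pre \<Longrightarrow> step w A prog c = exec_instr w A 0 i c"
  by (simp add: step_def halted_def)

lemma straight_comp2 [simp]: "straight (comp2 a b)"
  by (simp add: comp2_def)

lemma test_steps:
  assumes "prog = pre @ comp2 a b @ Jump_less T0 (Suc T0) l # post" "pc c = length pre"
    and "rel r h out c" "wfe a" "ok r h a" "wfe b" "ok r h b"
  shows "\<exists>c'. (step w A prog ^^ Suc (length (comp2 a b))) c = c' \<and> rel r h out c' \<and>
    pc c' = (if val r h a < val r h b then l else length pre + length (comp2 a b) + 1)"
proof -
  let ?c1 = "execs w A (comp2 a b) c"
  have 1: "(step w A prog ^^ length (comp2 a b)) c = ?c1" "pc ?c1 = length pre + length (comp2 a b)"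
    using steps_straight[OF straight_comp2 assms(1,2)] assms(2) by auto
  have 2: "step w A prog ?c1 = exec_instr w A 0 (Jump_less T0 (Suc T0) l) ?c1"
    by (rule step_at[where pre = "pre @ comp2 a b" and post = post]) (simp_all add: assms(1) 1)
  have 3: "(step w A prog ^^ Suc (length (comp2 a b))) c = exec_instr w A 0 (Jump_less T0 (Suc T0) l) ?c1"
    using 1 2 by simp
  show ?thesis unfolding 3
    using comp2_correct[OF assms(3-7)] 1 by (auto intro: rel_set_pc)
qed

text \<open>The machine steps charged to one unit of the clock are distinct instructions of
  \<open>prog\<close>, so \<open>length prog\<close> bounds their number. The factor is crude, but
  constant for a fixed program.\<close>

lemma sim:
  assumes "big c s s'" "wfc c" "prog = pre @ compile (length pre) c @ post" "srel s cfg"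
    "pc cfg = length pre"
  shows "\<exists>k cfg'. k \<le> (snd (snd (snd s')) - snd (snd (snd s))) * length prog \<and>
    (step w A prog ^^ k) cfg = cfg' \<and> srel s' cfg' \<and> pc cfg' = length pre + size_com c"
  using assms
proof (induction arbitrary: pre post cfg rule: big.induct)
  case (big_Asg r h e v out t)
  let ?c1 = "execs w A (compE e T0) cfg"
  have 0: "rel r h out ?c1" "reg ?c1 T0 = val r h e" "val r h e < 2 ^ w"
    using compE_correct[of r h out cfg e T0] big_Asg by auto
  have "straight (compile (length pre) (Asg v e))" by simp
  from steps_straight[OF this big_Asg(3) big_Asg(5)]
  have "(step w A prog ^^ size_com (Asg v e)) cfg = set_reg w v (val r h e) ?c1"
    "pc (set_reg w v (val r h e) ?c1) = length pre + size_com (Asg v e)"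
    using 0 big_Asg(5) by simp_all
  moreover have "rel (r(v := val r h e)) h out (set_reg w v (val r h e) ?c1)"
    using 0 big_Asg(2) by (auto simp: rel_def)
  moreover have "size_com (Asg v e) \<le> length prog" using big_Asg(3) by simp
  ultimately show ?case by fastforce
next
  case (big_St r h i e k out t)
  let ?c1 = "execs w A (comp2 i e) cfg"
  let ?c2 = "set_reg w T0 (val r h i + k * B) (set_reg w (T0 + 2) (k * B) (set_reg w (T0 + 2) k ?c1))"
  let ?c3 = "?c2\<lparr>pc := Suc (pc ?c2), mem := (mem ?c2)(val r h i + k * B := val r h e)\<rparr>"
  have 0: "rel r h out ?c1" "reg ?c1 T0 = val r h i" "reg ?c1 (Suc T0) = val r h e"
    "val r h i < 2 ^ w" "val r h e < 2 ^ w"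
    using comp2_correct[of r h out cfg i e] big_St by auto
  have k: "k < narrays" using big_St by simp
  have lt: "k < 2 ^ w" "k * B < 2 ^ w" "val r h i + k * B < 2 ^ w"
    using k big_St const_less cell_less[of k 0] cell_less[of k "val r h i"] B_pos
    by (auto simp: add.commute)
  have B: "reg ?c1 nvars = B" using 0(1) by (simp add: rel_def)
  have "straight (compile (length pre) (St k i e))" by simp
  moreover have ex: "execs w A (compile (length pre) (St k i e)) cfg = ?c3"
    using 0 lt B by simp
  ultimately
  have "(step w A prog ^^ size_com (St k i e)) cfg = ?c3"
    "pc ?c3 = length pre + size_com (St k i e)"
    using steps_straight[OF _ big_St(5) big_St(7), of w A] big_St(7) unfolding ex
    by (simp_all del: straight_simps compile.simps)
  moreover have "rel r (h(k := (h k)(val r h i := val r h e))) out ?c3"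
  proof -
    have r2: "rel r h out ?c2" by (intro rel_set_reg 0(1)) simp_all
    have "mem ?c3 (k' * B + j) = (h(k := (h k)(val r h i := val r h e))) k' j \<and>
        (h(k := (h k)(val r h i := val r h e))) k' j < 2 ^ w"
      if "k' < narrays" "j < B" for k' j
    proof (cases "k' = k \<and> j = val r h i")
      case True
      then show ?thesis using 0 by (simp add: add.commute)
    next
      case False
      then have "k' * B + j \<noteq> val r h i + k * B" unfolding add.commute[of "val r h i"] using cell_inj that(2) big_St(3) by blast
      then show ?thesis using rel_cell[OF r2 that] False by auto
    qed
    then show ?thesis using r2 by (auto simp: rel_def)
  qed
  moreover have "size_com (St k i e) \<le> length prog" using big_St(5) by simp
  ultimately show ?case by fastforce
next
  case (big_Rep r h i e out t)
  let ?c1 = "execs w A (comp2 i e) cfg"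
  let ?c2 = "?c1\<lparr>pc := Suc (pc ?c1), reported := (val r h i, val r h e) # reported ?c1\<rparr>"
  have 0: "rel r h out ?c1" "reg ?c1 T0 = val r h i" "reg ?c1 (Suc T0) = val r h e"
    using comp2_correct[of r h out cfg i e] big_Rep by auto
  have "straight (compile (length pre) (Rep i e))" by simp
  from steps_straight[OF this big_Rep(4) big_Rep(6)]
  have "(step w A prog ^^ size_com (Rep i e)) cfg = ?c2" "pc ?c2 = length pre + size_com (Rep i e)"
    using 0 big_Rep(6) by simp_all
  moreover have "rel r h ((val r h i, val r h e) # out) ?c2"
    using 0 by (simp add: rel_def)
  moreover have "size_com (Rep i e) \<le> length prog" using big_Rep(4) by simp
  ultimately show ?case by fastforce
next
  case (big_Skip s)
  then show ?case by (intro exI[of _ 0]) simp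
next
  case (big_Seq c1 s s' c2 s'')
  obtain k1 cfg1 where 1: "k1 \<le> (snd (snd (snd s')) - snd (snd (snd s))) * length prog"
    "(step w A prog ^^ k1) cfg = cfg1" "srel s' cfg1" "pc cfg1 = length pre + size_com c1"
    using big_Seq.IH(1)[of pre "compile (length pre + size_com c1) c2 @ post" cfg] big_Seq.prems
    by simp blast
  obtain k2 cfg2 where 2: "k2 \<le> (snd (snd (snd s'')) - snd (snd (snd s'))) * length prog"
    "(step w A prog ^^ k2) cfg1 = cfg2" "srel s'' cfg2"
    "pc cfg2 = length pre + size_com c1 + size_com c2"
    using big_Seq.IH(2)[of "pre @ compile (length pre) c1" post cfg1] big_Seq.prems 1
    by (simp add: add.assoc) blast
  have "snd (snd (snd s)) \<le> snd (snd (snd s'))" "snd (snd (snd s')) \<le> snd (snd (snd s''))"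
    using big_time big_Seq.hyps by blast+
  then have "k2 + k1 \<le> (snd (snd (snd s'')) - snd (snd (snd s))) * length prog"
    using add_mono[OF 2(1) 1(1)] by (simp add: add_mult_distrib[symmetric])
  then show ?case using steps_comp[OF 1(2) 2(2)] 2 by (intro exI[of _ "k2 + k1"]) auto
next
  case (big_CondT r h a b c1 out t s c2)
  let ?l = "length pre + length (comp2 a b) + size_com c2 + 2"
  let ?pre = "pre @ comp2 a b @ [Jump_less T0 (Suc T0) ?l] @
    compile (Suc (length pre + length (comp2 a b))) c2 @ [Jump (?l + size_com c1)]"
  have p: "prog = pre @ comp2 a b @ Jump_less T0 (Suc T0) ?l #
     (compile (Suc (length pre + length (comp2 a b))) c2 @ [Jump (?l + size_com c1)] @
      compile ?l c1 @ post)"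
    using big_CondT.prems(2) by (simp add: Let_def)
  have p': "prog = ?pre @ compile (length ?pre) c1 @ post" unfolding p by (simp add: add.assoc)
  obtain cfg1 where 1: "(step w A prog ^^ Suc (length (comp2 a b))) cfg = cfg1" "rel r h out cfg1"
    "pc cfg1 = ?l"
    using test_steps[OF p, of cfg] big_CondT by auto
  obtain k2 cfg2 where 2: "k2 \<le> (snd (snd (snd s)) - Suc t) * length prog"
    "(step w A prog ^^ k2) cfg1 = cfg2" "srel s cfg2" "pc cfg2 = ?l + size_com c1"
    using big_CondT.IH[OF _ p', of cfg1] big_CondT.prems(1) 1 by auto
  have "Suc t \<le> snd (snd (snd s))" using big_time[OF big_CondT.hyps(4)] by simp
  then obtain e where e: "snd (snd (snd s)) = Suc t + e" using le_Suc_ex by blast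
  have "Suc (length (comp2 a b)) \<le> length prog" unfolding p by simp
  then have "k2 + Suc (length (comp2 a b)) \<le> (snd (snd (snd s)) - t) * length prog"
    using 2(1) unfolding e by simp
  then show ?case using steps_comp[OF 1(1) 2(2)] 2 
    by (intro exI[of _ "k2 + Suc (length (comp2 a b))"]) auto
next
  case (big_CondF r h a b c2 out t s c1)
  let ?l = "length pre + length (comp2 a b) + size_com c2 + 2"
  let ?pre = "pre @ comp2 a b @ [Jump_less T0 (Suc T0) ?l]"
  have p: "prog = pre @ comp2 a b @ Jump_less T0 (Suc T0) ?l #
     (compile (Suc (length pre + length (comp2 a b))) c2 @ [Jump (?l + size_com c1)] @
      compile ?l c1 @ post)"
    using big_CondF.prems(2) by (simp add: Let_def)
  obtain cfg1 where 1: "(step w A prog ^^ Suc (length (comp2 a b))) cfg = cfg1" "rel r h out cfg1"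
    "pc cfg1 = length pre + length (comp2 a b) + 1"
    using test_steps[OF p, of cfg] big_CondF by auto
  have p': "prog = ?pre @ compile (length ?pre) c2 @ ([Jump (?l + size_com c1)] @ compile ?l c1 @ post)"
    unfolding p by simp
  obtain k2 cfg2 where 2: "k2 \<le> (snd (snd (snd s)) - Suc t) * length prog"
    "(step w A prog ^^ k2) cfg1 = cfg2" "srel s cfg2" "pc cfg2 = length ?pre + size_com c2"
    using big_CondF.IH[OF _ p', of cfg1] big_CondF.prems(1) 1 by auto
  have 3: "step w A prog cfg2 = exec_instr w A 0 (Jump (?l + size_com c1)) cfg2"
    by (rule step_at[where pre = "?pre @ compile (Suc (length pre + length (comp2 a b))) c2"
          and post = "compile ?l c1 @ post"]) (simp_all add: p 2)
  have 4: "(step w A prog ^^ (Suc (k2 + Suc (length (comp2 a b))))) cfg = cfg2\<lparr>pc := ?l + size_com c1\<rparr>"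
    using steps_comp[OF 1(1) 2(2)] 3 by simp
  have 5: "srel s (cfg2\<lparr>pc := ?l + size_com c1\<rparr>)"
    using 2(3) by (cases s) (auto intro: rel_set_pc)
  have "Suc t \<le> snd (snd (snd s))" using big_time[OF big_CondF.hyps(4)] by simp
  then obtain e where e: "snd (snd (snd s)) = Suc t + e" using le_Suc_ex by blast
  \<comment> \<open>The unit spent on the test also pays for the jump over the other branch.\<close>
  have "Suc (Suc (length (comp2 a b))) \<le> length prog" unfolding p by simp
  then have "Suc (k2 + Suc (length (comp2 a b))) \<le> (snd (snd (snd s)) - t) * length prog"
    using 2(1) unfolding e by simp
  then show ?case using 4 5
    by (intro exI[of _ "Suc (k2 + Suc (length (comp2 a b)))"]) auto
next
  case (big_LoopT r h a b c out t s s')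
  let ?q = "length pre + length (comp2 a b)"
  let ?pre = "pre @ comp2 a b @ [Jump_less T0 (Suc T0) (?q + 2), Jump (?q + size_com c + 3)]"
  have p: "prog = pre @ comp2 a b @ Jump_less T0 (Suc T0) (?q + 2) #
     (Jump (?q + size_com c + 3) # compile (?q + 2) c @ [Jump (length pre)] @ post)"
    using big_LoopT.prems(2) by (simp add: Let_def)
  obtain cfg1 where 1: "(step w A prog ^^ Suc (length (comp2 a b))) cfg = cfg1" "rel r h out cfg1"
    "pc cfg1 = ?q + 2"
    using test_steps[OF p, of cfg] big_LoopT by auto
  have p': "prog = ?pre @ compile (length ?pre) c @ ([Jump (length pre)] @ post)"
    unfolding p by (simp add: numeral_2_eq_2)
  obtain k2 cfg2 where 2: "k2 \<le> (snd (snd (snd s)) - Suc t) * length prog"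
    "(step w A prog ^^ k2) cfg1 = cfg2" "srel s cfg2" "pc cfg2 = length ?pre + size_com c"
    using big_LoopT.IH(1)[OF _ p', of cfg1] big_LoopT.prems(1) 1 by auto
  have 3: "step w A prog cfg2 = exec_instr w A 0 (Jump (length pre)) cfg2"
    by (rule step_at[where pre = "?pre @ compile (?q + 2) c" and post = post]) (simp_all add: p 2)
  let ?cfg3 = "cfg2\<lparr>pc := length pre\<rparr>"
  have 4: "(step w A prog ^^ (Suc (k2 + Suc (length (comp2 a b))))) cfg = ?cfg3"
    using steps_comp[OF 1(1) 2(2)] 3 by simp
  have 5: "srel s ?cfg3"
    using 2(3) by (cases s) (auto intro: rel_set_pc)
  obtain k4 cfg4 where 6: "k4 \<le> (snd (snd (snd s')) - snd (snd (snd s))) * length prog"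
    "(step w A prog ^^ k4) ?cfg3 = cfg4" "srel s' cfg4" "pc cfg4 = length pre + size_com (Loop a b c)"
    using big_LoopT.IH(2)[OF big_LoopT.prems(1,2), of ?cfg3] 5 by auto
  have "Suc t \<le> snd (snd (snd s))" using big_time[OF big_LoopT.hyps(4)] by simp
  then obtain e where e: "snd (snd (snd s)) = Suc t + e" using le_Suc_ex by blast
  have "snd (snd (snd s)) \<le> snd (snd (snd s'))" using big_time[OF big_LoopT.hyps(5)] by simp
  then obtain e' where e': "snd (snd (snd s')) = Suc t + e + e'" using le_Suc_ex e by metis
  \<comment> \<open>Here the second extra instruction is the jump back to the test.\<close>
  have "Suc (Suc (length (comp2 a b))) \<le> length prog" unfolding p by simp
  then have "k4 + Suc (k2 + Suc (length (comp2 a b))) \<le> (snd (snd (snd s')) - t) * length prog"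
    using 2(1) 6(1) unfolding e' unfolding e by (simp add: add_mult_distrib)
  then show ?case using steps_comp[OF 4 6(2)] 6
    by (intro exI[of _ "k4 + Suc (k2 + Suc (length (comp2 a b)))"]) auto
next
  case (big_LoopF r h a b c out t)
  let ?q = "length pre + length (comp2 a b)"
  have p: "prog = pre @ comp2 a b @ Jump_less T0 (Suc T0) (?q + 2) #
     (Jump (?q + size_com c + 3) # compile (?q + 2) c @ [Jump (length pre)] @ post)"
    using big_LoopF.prems(2) by (simp add: Let_def)
  obtain cfg1 where 1: "(step w A prog ^^ Suc (length (comp2 a b))) cfg = cfg1" "rel r h out cfg1"
    "pc cfg1 = ?q + 1"
    using test_steps[OF p, of cfg] big_LoopF by auto
  have 3: "step w A prog cfg1 = exec_instr w A 0 (Jump (?q + size_com c + 3)) cfg1"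
    by (rule step_at[where pre = "pre @ comp2 a b @ [Jump_less T0 (Suc T0) (?q + 2)]"
          and post = "compile (?q + 2) c @ [Jump (length pre)] @ post"]) (simp_all add: p 1)
  have "(step w A prog ^^ Suc (Suc (length (comp2 a b)))) cfg = cfg1\<lparr>pc := ?q + size_com c + 3\<rparr>"
    unfolding funpow.simps(2)[of "Suc _"] o_apply 1(1) 3 by simp
  moreover have "Suc (Suc (length (comp2 a b))) \<le> length prog" unfolding p by simp
  ultimately show ?case using 1(2)
    by (intro exI[of _ "Suc (Suc (length (comp2 a b)))"]) (auto intro: rel_set_pc)
qed

end

section \<open>From deterministic runs to expected time\<close>

lemma prob_space_coins: "prob_space (coins w)"
  unfolding coins_def by (intro prob_space.prob_space_stream_space measure_pmf.prob_space_axioms)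

text \<open>Without \<open>Rand\<close> every run is the same iteration of \<open>step\<close>, and
  a halted configuration is a fixed point, so all halted configurations coincide. The running time
  is then at most \<open>k\<close> for every \<open>\<omega>\<close>, and integration over a
  probability space keeps the bound.\<close>

lemma det_run_bounds:
  assumes "\<And>i. i \<in> set prog \<Longrightarrow> \<not> is_Rand i"
    and "halted prog ((step w A prog ^^ k) c)" "reported ((step w A prog ^^ k) c) = out"
  shows "finds_all w A prog c (set out)" "expected_time w A prog c \<le> of_nat k"
proof -
  show "finds_all w A prog c (set out)"
    unfolding finds_all_def
  proof (intro allI impI)
    fix \<omega> l
    assume "halted prog (run w A prog c \<omega> l)"
    then have h: "halted prog ((step w A prog ^^ l) c)" by (simp add: run_det[OF assms(1)])
    have "(step w A prog ^^ l) c = (step w A prog ^^ k) c"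
    proof (cases "k \<le> l")
      case True
      then show ?thesis using steps_halted[OF assms(2), of "l - k"]
          steps_comp[where w = w and A = A and prog = prog and k = k and c = c and l = "l - k"] by simp
    next
      case False
      then show ?thesis using steps_halted[OF h, of "k - l"]
          steps_comp[where w = w and A = A and prog = prog and k = l and c = c and l = "k - l"] by simp
    qed
    then show "set (reported (run w A prog c \<omega> l)) = set out"
      using assms(3) by (simp add: run_det[OF assms(1)])
  qed
  interpret prob_space "coins w" by (rule prob_space_coins)
  have "running_time w A prog c \<omega> \<le> of_nat k" for \<omega>
    unfolding running_time_def
    using assms(2) by (intro INF_lower) (simp add: run_det[OF assms(1)])
  then have "expected_time w A prog c \<le> (\<integral>\<^sup>+ \<omega>. of_nat k \<partial>coins w)"
    unfolding expected_time_def by (intro nn_integral_mono)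
  then show "expected_time w A prog c \<le> of_nat k" by (simp add: emeasure_space_1)
qed

text \<open>The two instructions in front store \<open>K * n\<close> in register
  \<open>nvars\<close>, reading \<open>n\<close> from register 0; hence the compiled code starts at
  address 2.\<close>

definition load_prog :: "nat \<Rightarrow> com \<Rightarrow> instr list" where
  "load_prog K c = [Const T0 K, Alu Mul nvars T0 0] @ compile 2 c"

text \<open>The initial configuration already represents a state of the structured language: the
  text occupies the cells \<open>1..n\<close>, which belong to array 0 because \<open>n < B\<close>,
  and all other entries are zero.\<close>

lemma wp_transfer:
  fixes K n :: nat and t :: "nat list"
  defines "B \<equiv> K * length t"
  assumes wp: "ram.wp w B A c (\<lambda>r h out t'. set out = occs \<and> t' \<le> T)
     ((\<lambda>_. 0)(0 := length t, 1 := d, 2 := r, 3 := w))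
     (\<lambda>k i. if k = 0 \<and> 1 \<le> i \<and> i \<le> length t then t ! (i - 1) else 0) [] 0"
    and wf: "wfc c" and space: "narrays * B \<le> 2 ^ w" and K: "K > 1" and n: "length t > 0"
    and small: "d < 2 ^ w" "r < 2 ^ w" "\<And>x. x \<in> set t \<Longrightarrow> x < 2 ^ w"
  shows "finds_all w A (load_prog K c) (initial_config w d r t) occs"
    "expected_time w A (load_prog K c) (initial_config w d r t) \<le> of_nat (2 + T * length (load_prog K c))"
proof -
  have B: "length t < B" using K n by (simp add: B_def)
  interpret big_ram w B A using space B by unfold_locales auto
  let ?prog = "load_prog K c" and ?c = "initial_config w d r t"
  let ?r = "(\<lambda>_. 0)(0 := length t, 1 := d, 2 := r, 3 := w)"
  let ?h = "\<lambda>k i. if k = 0 \<and> 1 \<le> i \<and> i \<le> length t then t ! (i - 1) else (0 :: nat)"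
  have "B < 2 ^ w" using cell_less[of 1 0] B_pos by simp
  moreover have "K \<le> B" using n by (cases t) (simp_all add: B_def)
  ultimately have lt: "B < 2 ^ w" "K < 2 ^ w" "length t < 2 ^ w" using B by auto
  let ?c2 = "set_reg w nvars B (set_reg w T0 K ?c)"
  have "straight [Const T0 K, Alu Mul nvars T0 0]" by simp
  from steps_straight[OF this, where prog = ?prog and pre = "[]" and post = "compile 2 c" and c = ?c
      and w = w and A = A]
  have c2: "(step w A ?prog ^^ 2) ?c = ?c2" "pc ?c2 = 2"
    using lt by (simp_all add: load_prog_def initial_config_def B_def numeral_2_eq_2)
  have rel: "rel ?r ?h [] ?c2"
    unfolding rel_def
  proof (intro conjI allI impI)
    fix v assume "v < nvars"
    then show "reg ?c2 v = ?r v" by (simp add: initial_config_def)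
    show "?r v < 2 ^ w" using lt small by simp
  next
    show "reg ?c2 nvars = B" using lt by (simp add: initial_config_def)
    show "reported ?c2 = []" by (simp add: initial_config_def)
  next
    fix k i assume ki: "k < narrays" "i < B"
    show "?h k i < 2 ^ w" using small(3) by auto
    show "mem ?c2 (k * B + i) = ?h k i"
    proof (cases "k = 0")
      case False
      then have "length t < k * B + i" using B by (cases k) auto
      then show ?thesis using False by (simp add: initial_config_def)
    qed (auto simp: initial_config_def)
  qed
  obtain r' h' out' t' where big: "big c (?r, ?h, [], 0) (r', h', out', t')" "set out' = occs" "t' \<le> T"
    using wp unfolding wp_def by blast
  have "?prog = [Const T0 K, Alu Mul nvars T0 0] @ compile (length [Const T0 K, Alu Mul nvars T0 0]) c @ []"
    by (simp add: load_prog_def numeral_2_eq_2)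
  from sim[OF big(1) wf this, of ?c2]
  obtain k cfg where k: "k \<le> t' * length ?prog" "(step w A ?prog ^^ k) ?c2 = cfg"
    "rel r' h' out' cfg" "pc cfg = 2 + size_com c"
    using rel c2(2) by auto
  have steps: "(step w A ?prog ^^ (k + 2)) ?c = cfg" using steps_comp[OF c2(1) k(2)] .
  have no_Rand: "\<not> is_Rand i" if "i \<in> set ?prog" for i
    using that no_Rand_compile by (auto simp: load_prog_def)
  have h: "halted ?prog cfg" using k(4) by (simp add: halted_def load_prog_def)
  have rep: "reported cfg = out'" using k(3) by (simp add: rel_def)
  show "finds_all w A ?prog ?c occs"
    using det_run_bounds(1)[OF no_Rand, where k = "k + 2"] h rep steps big(2) by metis
  have "expected_time w A ?prog ?c \<le> of_nat (k + 2)"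
    using det_run_bounds(2)[OF no_Rand, where k = "k + 2"] h rep steps by metis
  also have "\<dots> \<le> of_nat (2 + T * length ?prog)"
    using k(1) mult_le_mono1[OF big(3), of "length ?prog"] by (intro of_nat_mono) linarith
  finally show "expected_time w A ?prog ?c \<le> of_nat (2 + T * length ?prog)" .
qed

section \<open>Order isomorphism\<close>

lemma order_iso_refl [simp]: "order_iso u u"
  by (simp add: order_iso_def)

lemma order_iso_sym: "order_iso u v \<Longrightarrow> order_iso v u"
  by (auto simp: order_iso_def)

lemma order_iso_trans: "order_iso u v \<Longrightarrow> order_iso v z \<Longrightarrow> order_iso u z"
  by (auto simp: order_iso_def)

lemma order_iso_length: "order_iso u v \<Longrightarrow> length u = length v"
  by (simp add: order_iso_def)

lemma order_iso_take: "order_iso u v \<Longrightarrow> order_iso (take k u) (take k v)"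
  by (auto simp: order_iso_def)

lemma order_iso_drop: "order_iso u v \<Longrightarrow> order_iso (drop k u) (drop k v)"
  by (auto simp: order_iso_def)

text \<open>For \<open>a < b\<close> the definition speaks only of descents
  \<open>u ! a > u ! b\<close>; distinctness turns the absence of a descent into an ascent.\<close>

lemma order_iso_less:
  assumes "order_iso u v" "distinct u" "distinct v" "a < length u" "b < length u"
  shows "u ! a < u ! b \<longleftrightarrow> v ! a < v ! b"
proof (cases a b rule: linorder_cases)
  case less
  have "u ! a \<noteq> u ! b" "v ! a \<noteq> v ! b"
    using assms less nth_eq_iff_index_eq order_iso_length by (metis less_not_refl)+
  moreover have "u ! a > u ! b \<longleftrightarrow> v ! a > v ! b" using assms less by (simp add: order_iso_def)
  ultimately show ?thesis by linarith
next
  case greater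
  then show ?thesis using assms by (auto simp: order_iso_def)
qed simp

lemma order_iso_snoc:
  assumes "length u = length v"
  shows "order_iso (u @ [x]) (v @ [y]) \<longleftrightarrow> order_iso u v \<and> (\<forall>a<length u. x < u ! a \<longleftrightarrow> y < v ! a)"
  using assms by (auto simp: order_iso_def nth_append less_Suc_eq)

section \<open>Transition labels and order isomorphism\<close>

lemma pred_pos_0: "pred_pos u c = 0 \<longleftrightarrow> (\<forall>x\<in>set u. \<not> x < c)"
  by (auto simp: pred_pos_def)

lemma succ_pos_0: "succ_pos u c = 0 \<longleftrightarrow> (\<forall>x\<in>set u. \<not> x > c)"
  by (auto simp: succ_pos_def)

text \<open>Distinctness makes the position selected by \<open>THE\<close> unique, so the label can
  be described by comparisons alone, which is the form that transfers between order-isomorphic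
  strings.\<close>

lemma pred_pos_Suc:
  assumes "distinct u"
  shows "pred_pos u c = Suc j \<longleftrightarrow> j < length u \<and> u ! j < c \<and> (\<forall>x\<in>set u. x < c \<longrightarrow> x \<le> u ! j)"
proof (cases "\<exists>x\<in>set u. x < c")
  case True
  let ?M = "{x \<in> set u. x < c}"
  have M: "Max ?M \<in> ?M" using True by (intro Max_in) auto
  then obtain k where k: "k < length u" "u ! k = Max ?M" by (auto simp: in_set_conv_nth)
  have "(THE j. j < length u \<and> u ! j = Max ?M) = k"
    by (rule the_equality) (use k in simp, metis k assms nth_eq_iff_index_eq)
  then have p: "pred_pos u c = Suc k" using True by (simp add: pred_pos_def)
  have km: "\<forall>x\<in>set u. x < c \<longrightarrow> x \<le> u ! k" unfolding k(2) by simp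
  have kc: "u ! k < c" using M k(2) by simp
  show ?thesis
  proof
    assume "pred_pos u c = Suc j"
    then show "j < length u \<and> u ! j < c \<and> (\<forall>x\<in>set u. x < c \<longrightarrow> x \<le> u ! j)"
      using p k(1) km kc by simp
  next
    assume j: "j < length u \<and> u ! j < c \<and> (\<forall>x\<in>set u. x < c \<longrightarrow> x \<le> u ! j)"
    then have "u ! j = u ! k" using km kc k(1) by (intro antisym) auto
    then show "pred_pos u c = Suc j" using p j k(1) assms by (simp add: nth_eq_iff_index_eq)
  qed
next
  case False
  then have "pred_pos u c = 0" by (auto simp: pred_pos_0)
  then show ?thesis using False by auto
qed

lemma succ_pos_Suc:
  assumes "distinct u"
  shows "succ_pos u c = Suc j \<longleftrightarrow> j < length u \<and> c < u ! j \<and> (\<forall>x\<in>set u. c < x \<longrightarrow> u ! j \<le> x)"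
proof (cases "\<exists>x\<in>set u. x > c")
  case True
  let ?M = "{x \<in> set u. x > c}"
  have M: "Min ?M \<in> ?M" using True by (intro Min_in) auto
  then obtain k where k: "k < length u" "u ! k = Min ?M" by (auto simp: in_set_conv_nth)
  have "(THE j. j < length u \<and> u ! j = Min ?M) = k"
    by (rule the_equality) (use k in simp, metis k assms nth_eq_iff_index_eq)
  then have p: "succ_pos u c = Suc k" using True by (simp add: succ_pos_def)
  have km: "\<forall>x\<in>set u. c < x \<longrightarrow> u ! k \<le> x" unfolding k(2) by simp
  have kc: "c < u ! k" using M k(2) by simp
  show ?thesis
  proof
    assume "succ_pos u c = Suc j"
    then show "j < length u \<and> c < u ! j \<and> (\<forall>x\<in>set u. c < x \<longrightarrow> u ! j \<le> x)"
      using p k(1) km kc by simp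
  next
    assume j: "j < length u \<and> c < u ! j \<and> (\<forall>x\<in>set u. c < x \<longrightarrow> u ! j \<le> x)"
    then have "u ! j = u ! k" using km kc k(1) by (intro antisym) auto
    then show "succ_pos u c = Suc j" using p j k(1) assms by (simp add: nth_eq_iff_index_eq)
  qed
next
  case False
  then have "succ_pos u c = 0" by (auto simp: succ_pos_0)
  then show ?thesis using False by auto
qed

lemma pred_pos_le: "distinct u \<Longrightarrow> pred_pos u c \<le> length u"
  by (cases "pred_pos u c") (auto dest: pred_pos_Suc[THEN iffD1, rotated])

lemma succ_pos_le: "distinct u \<Longrightarrow> succ_pos u c \<le> length u"
  by (cases "succ_pos u c") (auto dest: succ_pos_Suc[THEN iffD1, rotated])

text \<open>The constant time test of an edge label \<open>(a, b)\<close> against the next symbol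
  \<open>x\<close>: one comparison with each named neighbour, and none where 0 marks a missing
  one.\<close>

definition fits :: "nat list \<Rightarrow> nat \<Rightarrow> nat \<Rightarrow> nat \<Rightarrow> bool" where
  "fits v x a b \<longleftrightarrow> (0 < a \<longrightarrow> v ! (a - 1) < x) \<and> (0 < b \<longrightarrow> x < v ! (b - 1))"

lemma fits_self: "distinct v \<Longrightarrow> fits v x (pred_pos v x) (succ_pos v x)"
  by (cases "pred_pos v x"; cases "succ_pos v x")
    (auto simp: fits_def dest: pred_pos_Suc[THEN iffD1, rotated] succ_pos_Suc[THEN iffD1, rotated])

text \<open>Every earlier symbol is at most the predecessor or at least the successor of
  \<open>c\<close>, so the comparisons with these two neighbours decide the comparisons with all
  earlier symbols.\<close>

lemma fits_iff:
  assumes iso: "order_iso v u" and d: "distinct (v @ [x])" "distinct (u @ [c])"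
  shows "fits v x (pred_pos u c) (succ_pos u c) \<longleftrightarrow> order_iso (v @ [x]) (u @ [c])"
proof
  have len: "length v = length u" using iso by (rule order_iso_length)
  have lt: "v ! a < v ! b \<longleftrightarrow> u ! a < u ! b" if "a < length u" "b < length u" for a b
    using order_iso_less[OF iso] d that len by simp
  {
    assume f: "fits v x (pred_pos u c) (succ_pos u c)"
    have "x < v ! k \<longleftrightarrow> c < u ! k" if k: "k < length u" for k
    proof (cases "c < u ! k")
      case True
      then obtain j where j: "succ_pos u c = Suc j"
        using succ_pos_0[of u c] k by (cases "succ_pos u c") auto
      then have "j < length u" "u ! j \<le> u ! k" using succ_pos_Suc[of u c j] d True k by auto
      then have "v ! j \<le> v ! k" using lt[of k j] k by linarith
      moreover have "x < v ! j" using f j by (simp add: fits_def)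
      ultimately show ?thesis using True by simp
    next
      case False
      moreover have "u ! k \<noteq> c" using d k by auto
      ultimately have lc: "u ! k < c" by simp
      then obtain j where j: "pred_pos u c = Suc j"
        using pred_pos_0[of u c] k by (cases "pred_pos u c") auto
      then have "j < length u" "u ! k \<le> u ! j" using pred_pos_Suc[of u c j] d lc k by auto
      then have "v ! k \<le> v ! j" using lt[of j k] k by linarith
      moreover have "v ! j < x" using f j by (simp add: fits_def)
      ultimately show ?thesis using False by simp
    qed
    then show "order_iso (v @ [x]) (u @ [c])" using iso len by (simp add: order_iso_snoc)
  }
  {
    assume "order_iso (v @ [x]) (u @ [c])"
    then have *: "x < v ! k \<longleftrightarrow> c < u ! k" if "k < length u" for k
      using that len by (simp add: order_iso_snoc)
    have "v ! j < x" if "pred_pos u c = Suc j" for j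
    proof -
      have j: "j < length u" "u ! j < c" using that pred_pos_Suc[of u c j] d by auto
      moreover have "v ! j \<noteq> x" using d j len by auto
      ultimately show ?thesis using *[of j] by linarith
    qed
    moreover have "x < v ! j" if "succ_pos u c = Suc j" for j
    proof -
      have j: "j < length u" "c < u ! j" using that succ_pos_Suc[of u c j] d by auto
      then show ?thesis using *[of j] by simp
    qed
    ultimately show "fits v x (pred_pos u c) (succ_pos u c)"
      unfolding fits_def by (cases "pred_pos u c"; cases "succ_pos u c") auto
  }
qed

text \<open>A label is characterized by comparisons, and these agree in order-isomorphic strings. So
  the label computed from a window is the one stored with the representative prefix.\<close>

lemma order_iso_snoc_pos:
  assumes iso: "order_iso (v @ [x]) (u @ [c])" and d: "distinct (v @ [x])" "distinct (u @ [c])"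
  shows "pred_pos v x = pred_pos u c" "succ_pos v x = succ_pos u c"
proof -
  have len: "length v = length u" using order_iso_length[OF iso] by simp
  have L: "(v @ [x]) ! a < (v @ [x]) ! b \<longleftrightarrow> (u @ [c]) ! a < (u @ [c]) ! b"
    if "a < Suc (length u)" "b < Suc (length u)" for a b
    using order_iso_less[OF iso d, of a b] that len by simp
  have 1: "v ! a < v ! b \<longleftrightarrow> u ! a < u ! b" if "a < length u" "b < length u" for a b
    using L[of a b] that len by (simp add: nth_append)
  have 2: "v ! a < x \<longleftrightarrow> u ! a < c" "x < v ! a \<longleftrightarrow> c < u ! a" if "a < length u" for a
    using L[of a "length u"] L[of "length u" a] that len by (simp_all add: nth_append)
  have 3: "v ! a \<le> v ! b \<longleftrightarrow> u ! a \<le> u ! b" if "a < length u" "b < length u" for a b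
    using 1[of b a] that by linarith
  have "pred_pos v x = Suc j \<longleftrightarrow> pred_pos u c = Suc j" for j
    using d len 2 3 by (auto simp: pred_pos_Suc all_set_conv_all_nth)
  then show "pred_pos v x = pred_pos u c"
    by (metis not0_implies_Suc)
  have "succ_pos v x = Suc j \<longleftrightarrow> succ_pos u c = Suc j" for j
    using d len 2 3 by (auto simp: succ_pos_Suc all_set_conv_all_nth)
  then show "succ_pos v x = succ_pos u c"
    by (metis not0_implies_Suc)
qed


section \<open>States of the automaton\<close>

text \<open>Suffixes are indexed by length, so that the suffixes of two order-isomorphic strings can
  be paired with each other.\<close>

definition sfx :: "nat \<Rightarrow> nat list \<Rightarrow> nat list" where
  "sfx l u = drop (length u - l) u"

lemma length_sfx [simp]: "length (sfx l u) = min l (length u)"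
  by (simp add: sfx_def)

lemma sfx_full [simp]: "sfx (length u) u = u"
  by (simp add: sfx_def)

lemma order_iso_sfx: "order_iso u v \<Longrightarrow> order_iso (sfx l u) (sfx l v)"
  using order_iso_length[of u v] by (simp add: sfx_def order_iso_drop)

lemma suffix_sfx: "suffix v u \<longleftrightarrow> length v \<le> length u \<and> v = sfx (length v) u"
  by (auto simp: sfx_def suffix_def) (metis append_take_drop_id)

locale ac =
  fixes n :: nat and S :: "nat list set" and num :: "nat list set \<Rightarrow> nat" and A :: ac_tables
  assumes pats: "pattern_set n S" and stores: "stores_AC S num A"
begin

definition valid :: "nat list \<Rightarrow> bool" where
  "valid v \<longleftrightarrow> (\<exists>u\<in>pattern_prefixes S. order_iso v u)"

definition accepting :: "nat list \<Rightarrow> bool" where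
  "accepting v \<longleftrightarrow> (\<exists>q\<in>S. order_iso v q)"

definition state :: "nat list \<Rightarrow> nat" where
  "state v = num (state_of S v)"

lemma distinct_prefixes: "u \<in> pattern_prefixes S \<Longrightarrow> distinct u"
proof -
  assume "u \<in> pattern_prefixes S"
  then obtain q v where "q \<in> S" "q = u @ v" by (auto simp: pattern_prefixes_def prefix_def)
  then show ?thesis using pats by (force simp: pattern_set_def)
qed

lemma prefixes_take: "u @ v \<in> pattern_prefixes S \<Longrightarrow> u \<in> pattern_prefixes S"
  by (auto simp: pattern_prefixes_def dest: append_prefixD)

lemma patterns_prefixes: "q \<in> S \<Longrightarrow> q \<in> pattern_prefixes S"
  by (auto simp: pattern_prefixes_def)

lemma valid_prefixes: "u \<in> pattern_prefixes S \<Longrightarrow> valid u"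
  unfolding valid_def using order_iso_refl by blast

lemma accepting_valid: "accepting v \<Longrightarrow> valid v"
  using patterns_prefixes by (auto simp: accepting_def valid_def)

lemma accepting_not_Nil: "accepting v \<Longrightarrow> v \<noteq> []"
  using pats by (auto simp: accepting_def pattern_set_def dest: order_iso_length)

lemma state_of_cong: "order_iso v v' \<Longrightarrow> state_of S v = state_of S v'"
  unfolding state_of_def using order_iso_sym order_iso_trans by blast

lemma valid_cong: "order_iso v v' \<Longrightarrow> valid v \<Longrightarrow> valid v'"
  unfolding valid_def using order_iso_sym order_iso_trans by blast

lemma accepting_cong: "order_iso v v' \<Longrightarrow> accepting v \<Longrightarrow> accepting v'"
  unfolding accepting_def using order_iso_sym order_iso_trans by blast

text \<open>Validity excludes the empty class, which \<open>state_of\<close> yields for every string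
  without a state.\<close>

lemma state_of_eq: "valid v \<Longrightarrow> state_of S v = state_of S v' \<Longrightarrow> order_iso v v'"
proof -
  assume "valid v" "state_of S v = state_of S v'"
  then obtain u where "u \<in> state_of S v" "u \<in> state_of S v'"
    by (auto simp: valid_def state_of_def)
  then have "order_iso v u" "order_iso v' u" by (auto simp: state_of_def)
  then show ?thesis using order_iso_sym order_iso_trans by blast
qed

lemma state_of_ac_states: "state_of S v \<in> ac_states S \<longleftrightarrow> valid v"
proof
  assume "valid v"
  then obtain u where u: "u \<in> pattern_prefixes S" "order_iso v u" by (auto simp: valid_def)
  have "state_of S v = state_of S u" using u(2) by (rule state_of_cong)
  also have "\<dots> = {(u, v). u \<in> pattern_prefixes S \<and> v \<in> pattern_prefixes S \<and> order_iso u v} `` {u}"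
    using u(1) by (auto simp: state_of_def)
  finally show "state_of S v \<in> ac_states S"
    using u(1) unfolding ac_states_def by (simp only: quotientI)
next
  assume "state_of S v \<in> ac_states S"
  then obtain u where "u \<in> pattern_prefixes S" "u \<in> state_of S v"
    by (auto simp: ac_states_def elim!: quotientE)
  then show "valid v" by (auto simp: valid_def state_of_def)
qed

lemma valid_Nil: "valid []"
proof -
  obtain q where "q \<in> S" using pats by (auto simp: pattern_set_def)
  then have "[] \<in> pattern_prefixes S" by (auto simp: pattern_prefixes_def)
  then show ?thesis by (rule valid_prefixes)
qed

lemma valid_single: "valid [x]"
proof -
  obtain q where "q \<in> S" using pats by (auto simp: pattern_set_def)
  moreover then have "q \<noteq> []" using pats by (auto simp: pattern_set_def)
  moreover then have "prefix [hd q] q" by (cases q) auto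
  ultimately have "[hd q] \<in> pattern_prefixes S"
    by (auto simp: pattern_prefixes_def)
  moreover have "order_iso [x] [hd q]" by (simp add: order_iso_def)
  ultimately show ?thesis by (auto simp: valid_def)
qed

lemma valid_snocE:
  assumes "valid (v @ [x])"
  obtains u c where "u @ [c] \<in> pattern_prefixes S" "order_iso (v @ [x]) (u @ [c])"
    "order_iso v u" "u \<in> pattern_prefixes S"
proof -
  obtain z where z: "z \<in> pattern_prefixes S" "order_iso (v @ [x]) z"
    using assms by (auto simp: valid_def)
  then have len: "length z = Suc (length v)" by (auto dest: order_iso_length)
  then obtain u c where uc: "z = u @ [c]" by (metis length_Suc_conv_rev)
  have "order_iso v u" using z(2) len by (simp add: uc order_iso_snoc)
  then show thesis using that z prefixes_take by (auto simp: uc)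
qed

lemma valid_prefix: "valid (v @ [x]) \<Longrightarrow> valid v"
  by (erule valid_snocE) (auto simp: valid_def)

lemma num_bounds: "s \<in> ac_states S \<Longrightarrow> 1 \<le> num s \<and> num s \<le> card (ac_states S)"
  using stores by (auto simp: stores_AC_def dest!: bij_betwE)

lemma state_bounds: "valid v \<Longrightarrow> 0 < state v \<and> state v \<le> card (ac_states S)"
  using num_bounds[of "state_of S v"] state_of_ac_states by (auto simp: state_def)

lemma state_cong: "order_iso v v' \<Longrightarrow> state v = state v'"
  by (simp add: state_def state_of_cong)

lemma state_Nil: "state [] = 1"
  using stores by (simp add: stores_AC_def state_def)

lemma forward_intro:
  assumes "valid (v @ [x])" "distinct (v @ [x])"
  shows "(state_of S v, (pred_pos v x, succ_pos v x), state_of S (v @ [x])) \<in> ac_forward S"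
proof -
  obtain u c where uc: "u @ [c] \<in> pattern_prefixes S" "order_iso (v @ [x]) (u @ [c])" "order_iso v u"
    using assms(1) by (rule valid_snocE)
  have "distinct (u @ [c])" using uc(1) by (rule distinct_prefixes)
  then have "pred_pos v x = pred_pos u c" "succ_pos v x = succ_pos u c"
    using order_iso_snoc_pos[OF uc(2) assms(2)] by auto
  moreover have "state_of S v = state_of S u" "state_of S (v @ [x]) = state_of S (u @ [c])"
    using uc state_of_cong by auto
  ultimately show ?thesis using uc(1) unfolding ac_forward_def by auto
qed

text \<open>Edges are defined through a representative \<open>u\<close>, whereas the automaton runs
  on windows \<open>v\<close>; \<open>fits_iff\<close> moves the test across. In particular, all
  edges that fit lead to the same state.\<close>

lemma forward_fits:
  assumes "(state_of S v, (a, b), s') \<in> ac_forward S" "valid v" "distinct (v @ [x])" "fits v x a b"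
  shows "valid (v @ [x]) \<and> s' = state_of S (v @ [x])"
proof -
  obtain u c where uc: "u @ [c] \<in> pattern_prefixes S" "state_of S v = state_of S u"
    "a = pred_pos u c" "b = succ_pos u c" "s' = state_of S (u @ [c])"
    using assms(1) by (auto simp: ac_forward_def)
  have "order_iso v u" using state_of_eq[OF assms(2) uc(2)] .
  then have "order_iso (v @ [x]) (u @ [c])"
    using fits_iff assms uc distinct_prefixes by blast
  then show ?thesis using uc state_of_cong by (auto simp: valid_def)
qed

lemma forward_bounds:
  assumes "(state_of S v, (a, b), s') \<in> ac_forward S" "valid v"
  shows "a \<le> length v \<and> b \<le> length v \<and> s' \<in> ac_states S"
proof -
  obtain u c where uc: "u @ [c] \<in> pattern_prefixes S" "state_of S v = state_of S u"
    "a = pred_pos u c" "b = succ_pos u c" "s' = state_of S (u @ [c])"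
    using assms(1) by (auto simp: ac_forward_def)
  have "order_iso v u" using state_of_eq[OF assms(2) uc(2)] .
  moreover have "distinct u" using distinct_prefixes[OF uc(1)] by simp
  moreover have "valid (u @ [c])" using uc(1) by (rule valid_prefixes)
  ultimately show ?thesis
    using uc pred_pos_le succ_pos_le state_of_ac_states by (auto dest: order_iso_length)
qed

text \<open>A label always fits its own symbol, so an entry stored under the label of the window
  would make the extension valid; an invalid extension therefore meets the default 0.\<close>

lemma lookup:
  assumes "valid v" "distinct (v @ [x])"
  shows "ac_lookup A (state v) (pred_pos v x) (succ_pos v x) =
    (if valid (v @ [x]) then state (v @ [x]) else 0)"
proof -
  have s: "state_of S v \<in> ac_states S" using assms(1) state_of_ac_states by simp
  show ?thesis
  proof (cases "valid (v @ [x])")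
    case True
    then have "(state_of S v, (pred_pos v x, succ_pos v x), state_of S (v @ [x])) \<in> ac_forward S"
      using forward_intro assms by blast
    then show ?thesis using stores s True by (simp add: stores_AC_def state_def)
  next
    case False
    have "\<nexists>s'. (state_of S v, (pred_pos v x, succ_pos v x), s') \<in> ac_forward S"
      using forward_fits[OF _ assms fits_self] assms(2) False by (meson distinct_append)
    then show ?thesis using stores s False by (simp add: stores_AC_def state_def)
  qed
qed

lemma set_edges:
  "valid v \<Longrightarrow> set (ac_edges A (state v)) = {(a, b, num s') | a b s'. (state_of S v, (a, b), s') \<in> ac_forward S}"
  using stores state_of_ac_states[of v] by (simp add: stores_AC_def state_def)

lemma edge_fits:
  assumes "valid v" "distinct (v @ [x])" "(a, b, s') \<in> set (ac_edges A (state v))" "fits v x a b"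
  shows "valid (v @ [x]) \<and> s' = state (v @ [x])"
proof -
  obtain t where "(state_of S v, (a, b), t) \<in> ac_forward S" "s' = num t"
    using assms(3) by (auto simp: set_edges[OF assms(1)])
  then show ?thesis using forward_fits[OF _ assms(1,2,4)] by (simp add: state_def)
qed

lemma edge_bounds:
  assumes "valid v" "(a, b, s') \<in> set (ac_edges A (state v))"
  shows "a \<le> length v \<and> b \<le> length v \<and> s' \<le> card (ac_states S)"
  using assms forward_bounds[OF _ assms(1)] num_bounds by (fastforce simp: set_edges)

lemma edge_exists:
  assumes "valid (v @ [x])" "distinct (v @ [x])"
  shows "\<exists>a b s'. (a, b, s') \<in> set (ac_edges A (state v)) \<and> fits v x a b"
proof -
  have v: "valid v" using assms(1) by (rule valid_prefix)
  have "(pred_pos v x, succ_pos v x, num (state_of S (v @ [x]))) \<in> set (ac_edges A (state v))"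
    using forward_intro[OF assms] by (auto simp: set_edges[OF v])
  moreover have "fits v x (pred_pos v x) (succ_pos v x)"
    using fits_self assms(2) by auto
  ultimately show ?thesis by blast
qed

text \<open>Each edge leads towards some pattern, and the depth of the source state tells which edge
  this is.\<close>

lemma degree_le:
  assumes "valid v"
  shows "length (ac_edges A (state v)) \<le> card S"
proof -
  let ?f = "\<lambda>q. (pred_pos (take (length v) q) (q ! length v), succ_pos (take (length v) q) (q ! length v),
     num (state_of S (take (Suc (length v)) q)))"
  have sub: "set (ac_edges A (state v)) \<subseteq> ?f ` S"
  proof
    fix e assume "e \<in> set (ac_edges A (state v))"
    then obtain u c where uc: "u @ [c] \<in> pattern_prefixes S" "state_of S v = state_of S u"
      "e = (pred_pos u c, succ_pos u c, num (state_of S (u @ [c])))"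
      by (auto simp: set_edges[OF assms] ac_forward_def)
    have len: "length v = length u"
      using state_of_eq[OF assms uc(2)] by (rule order_iso_length)
    obtain q z where q: "q \<in> S" "q = u @ c # z" using uc(1) by (auto simp: pattern_prefixes_def prefix_def)
    then have "e = ?f q" using uc(3) len by simp
    then show "e \<in> ?f ` S" using q(1) by blast
  qed
  have "distinct (ac_edges A (state v))"
    using stores state_of_ac_states[of v] assms by (simp add: stores_AC_def state_def)
  then have "length (ac_edges A (state v)) = card (set (ac_edges A (state v)))"
    by (simp add: distinct_card)
  also have "\<dots> \<le> card (?f ` S)" using sub pats by (intro card_mono) (auto simp: pattern_set_def)
  also have "\<dots> \<le> card S" using pats by (intro card_image_le) (simp add: pattern_set_def)
  finally show ?thesis .
qed

text \<open>A string is a prefix of itself, so two order-isomorphic patterns would violate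
  prefix-freeness, and different patterns have different states. This is how \<open>d\<close> is
  bounded by a word.\<close>

lemma card_patterns_le: "card S \<le> card (ac_states S)"
proof (rule card_inj_on_le)
  show "inj_on (state_of S) S"
  proof (rule inj_onI, rule ccontr)
    fix p q assume pq: "p \<in> S" "q \<in> S" "state_of S p = state_of S q" "p \<noteq> q"
    then have "order_iso p q" using state_of_eq valid_prefixes patterns_prefixes by blast
    then show False using pq pats unfolding pattern_set_def iso_prefix_free_def by blast
  qed
  show "state_of S ` S \<subseteq> ac_states S"
    using state_of_ac_states valid_prefixes patterns_prefixes by blast
  have "bij_betw num (ac_states S) {1..card (ac_states S)}" using stores by (simp add: stores_AC_def)
  then show "finite (ac_states S)" using bij_betw_finite by blast
qed

section \<open>Depth, failure and output of the state of a window\<close>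

lemma depth_state: "valid v \<Longrightarrow> ac_depth A (state v) = length v"
proof -
  assume "valid v"
  then obtain u where u: "u \<in> pattern_prefixes S" "order_iso v u" by (auto simp: valid_def)
  then have "ac_depth A (state u) = length u" using stores by (simp add: stores_AC_def state_def)
  then show ?thesis using state_cong[OF u(2)] order_iso_length[OF u(2)] by simp
qed

text \<open>The failure table refers to suffixes of the representative \<open>u\<close>; equal
  lengths select order-isomorphic suffixes of \<open>v\<close>, so the maximal length is the same.
  The empty suffix ensures that some length qualifies.\<close>

lemma fail_state:
  assumes "valid v" "v \<noteq> []"
  shows "\<exists>l<length v. ac_fail A (state v) = state (sfx l v) \<and> valid (sfx l v) \<and>
    (\<forall>l'<length v. valid (sfx l' v) \<longrightarrow> l' \<le> l)"
proof -
  obtain u where u: "u \<in> pattern_prefixes S" "order_iso v u" using assms(1) by (auto simp: valid_def)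
  have len: "length v = length u" using u(2) by (rule order_iso_length)
  let ?L = "{l. l < length v \<and> valid (sfx l v)}"
  have "0 \<in> ?L" using assms(2) valid_Nil by (simp add: sfx_def)
  then have M: "Max ?L \<in> ?L" by (intro Max_in) auto
  define l where "l = Max ?L"
  have l: "l < length v" "valid (sfx l v)" using M by (auto simp: l_def)
  have max: "l' \<le> l" if "l' < length v" "valid (sfx l' v)" for l'
    unfolding l_def using that by (intro Max_ge) auto
  have iso: "order_iso (sfx k v) (sfx k u)" for k using u(2) by (rule order_iso_sfx)
  have "(state_of S u, state_of S (sfx l u)) \<in> ac_failure S"
    unfolding ac_failure_def
  proof (intro CollectI exI conjI allI impI)
    have "sfx l u \<noteq> u"
    proof
      assume "sfx l u = u"
      then have "length (sfx l u) = length u" by (rule arg_cong)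
      then show False using l(1) len by simp
    qed
    then show "strict_suffix (sfx l u) u" using l(1) len by (auto simp: strict_suffix_def suffix_sfx)
    show "state_of S (sfx l u) \<in> ac_states S"
      using l(2) valid_cong[OF iso] by (simp add: state_of_ac_states)
    fix v' assume v': "strict_suffix v' u \<and> state_of S v' \<in> ac_states S"
    then have "suffix v' u" "v' \<noteq> u" by (auto simp: strict_suffix_def)
    then have e: "v' = sfx (length v') u" and "length v' \<le> length u" by (auto simp: suffix_sfx)
    then have lt: "length v' < length u" using \<open>v' \<noteq> u\<close> by (metis le_neq_implies_less sfx_full)
    have "valid (sfx (length v') v)"
      using v' valid_cong[OF order_iso_sym[OF iso]] e by (metis state_of_ac_states)
    then have "length v' \<le> l" using max lt len by simp
    then show "length v' \<le> length (sfx l u)" using l(1) len by simp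
  qed (use u in auto)
  moreover have "state_of S u \<in> ac_states S" using u valid_prefixes by (simp add: state_of_ac_states)
  ultimately have "ac_fail A (state u) = state (sfx l u)"
    using stores by (simp add: stores_AC_def state_def)
  then have "ac_fail A (state v) = state (sfx l v)"
    using state_cong[OF u(2)] state_cong[OF iso] by simp
  then show ?thesis using l max by blast
qed

lemma out_cases:
  assumes "valid v"
  shows "(ac_out A (state v) = 0 \<and> (\<forall>l\<le>length v. \<not> accepting (sfx l v))) \<or>
    (\<exists>l\<le>length v. ac_out A (state v) = state (sfx l v) \<and> accepting (sfx l v) \<and>
      (\<forall>l'\<le>length v. accepting (sfx l' v) \<longrightarrow> l' \<le> l))"
proof -
  obtain u where u: "u \<in> pattern_prefixes S" "order_iso v u" using assms(1) by (auto simp: valid_def)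
  have len: "length v = length u" using u(2) by (rule order_iso_length)
  have su: "state_of S u \<in> ac_states S" using u valid_prefixes by (simp add: state_of_ac_states)
  have iso: "order_iso (sfx k v) (sfx k u)" for k using u(2) by (rule order_iso_sfx)
  let ?L = "{l. l \<le> length v \<and> accepting (sfx l v)}"
  show ?thesis
  proof (cases "?L = {}")
    case True
    have "\<nexists>s'. (state_of S u, s') \<in> ac_output S"
    proof
      assume "\<exists>s'. (state_of S u, s') \<in> ac_output S"
      then obtain u' v' where u': "u' \<in> pattern_prefixes S" "state_of S u = state_of S u'"
        "suffix v' u'" "\<exists>q\<in>S. order_iso v' q" by (auto simp: ac_output_def)
      have "order_iso u u'" using state_of_eq valid_prefixes u(1) u'(2) by blast
      then have vu': "order_iso v u'" using u(2) order_iso_trans by blast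
      then have "order_iso (sfx (length v') v) (sfx (length v') u')" by (rule order_iso_sfx)
      moreover have "v' = sfx (length v') u'" "length v' \<le> length u'"
        using u'(3) by (auto simp: suffix_sfx)
      ultimately have "order_iso (sfx (length v') v) v'" by simp
      moreover have "length v' \<le> length v"
        using \<open>length v' \<le> length u'\<close> order_iso_length[OF vu'] by simp
      ultimately show False
        using True u'(4) accepting_cong[OF order_iso_sym, of "sfx (length v') v" v'] 
        by (auto simp: accepting_def)
    qed
    then have "ac_out A (state u) = 0" using stores su by (simp add: stores_AC_def state_def)
    then show ?thesis using True state_cong[OF u(2)] by auto
  next
    case False
    then have M: "Max ?L \<in> ?L" by (intro Max_in) auto
    define l where "l = Max ?L"
    have l: "l \<le> length v" "accepting (sfx l v)" using M by (auto simp: l_def)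
    have max: "l' \<le> l" if "l' \<le> length v" "accepting (sfx l' v)" for l'
      unfolding l_def using that by (intro Max_ge) auto
    have "(state_of S u, state_of S (sfx l u)) \<in> ac_output S"
      unfolding ac_output_def
    proof (intro CollectI exI conjI allI impI)
      show "suffix (sfx l u) u" using l(1) len by (auto simp: suffix_sfx)
      show "\<exists>q\<in>S. order_iso (sfx l u) q"
        using accepting_cong[OF iso l(2)] by (simp add: accepting_def)
      fix v' assume v': "suffix v' u \<and> (\<exists>q\<in>S. order_iso v' q)"
      then have e: "v' = sfx (length v') u" and le: "length v' \<le> length u" by (auto simp: suffix_sfx)
      have "accepting v'" using v' by (simp add: accepting_def)
      then have "accepting (sfx (length v') v)"
        using accepting_cong[OF order_iso_sym[OF iso]] e by metis
      then have "length v' \<le> l" using max le len by simp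
      then show "length v' \<le> length (sfx l u)" using l(1) len by simp
    qed (use u in auto)
    then have "ac_out A (state u) = state (sfx l u)"
      using stores su by (simp add: stores_AC_def state_def)
    then have "ac_out A (state v) = state (sfx l v)"
      using state_cong[OF u(2)] state_cong[OF iso] by simp
    then show ?thesis using l max by blast
  qed
qed

text \<open>If two patterns of different lengths matched at the same start, the shorter one would be
  order-isomorphic to a prefix of the longer one.\<close>

lemma unique_start:
  assumes "accepting (take k v)" "accepting (take l v)" "k \<le> length v" "l \<le> length v"
  shows "k = l"
proof -
  have *: False if kl: "k < l" "accepting (take k v)" "accepting (take l v)" "l \<le> length v" for k l
  proof -
    obtain p q where pq: "p \<in> S" "q \<in> S" "order_iso (take k v) p" "order_iso (take l v) q"
      using kl by (auto simp: accepting_def)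
    have "order_iso (take k (take l v)) (take k q)" using pq(4) by (rule order_iso_take)
    then have "order_iso (take k v) (take k q)" using kl by (simp add: min_def)
    then have iso: "order_iso p (take k q)" using pq(3) order_iso_sym order_iso_trans by blast
    have "length p = k" "length q = l" using pq(3,4) kl by (auto dest!: order_iso_length)
    then have "p \<noteq> q" using kl(1) by auto
    moreover have "prefix (take k q) q" by (rule take_is_prefix)
    ultimately show False using pq iso pats unfolding pattern_set_def iso_prefix_free_def by blast
  qed
  show ?thesis using *[of k l] *[of l k] assms by (cases k l rule: linorder_cases) auto
qed

end

section \<open>Van Emde Boas sets\<close>

text \<open>The square root rounded up: \<open>u \<le> p * p\<close> lets \<open>p\<close> clusters
  of size \<open>p\<close> cover the universe, whether or not \<open>u\<close> is a square.\<close>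

definition usqrt :: "nat \<Rightarrow> nat" where
  "usqrt u = (LEAST p. u \<le> p * p)"

lemma usqrt_sq: "u \<le> usqrt u * usqrt u"
  unfolding usqrt_def by (rule LeastI[of _ u]) simp

lemma usqrt_le: "u \<le> p * p \<Longrightarrow> usqrt u \<le> p"
  unfolding usqrt_def by (rule Least_le)

lemma usqrt_less: "2 < u \<Longrightarrow> usqrt u < u"
proof -
  assume "2 < u"
  then obtain v where v: "u = v + 3" using less_imp_Suc_add[of 2 u] by (auto simp: eval_nat_numeral)
  have "u \<le> (u - 1) * (u - 1)" unfolding v by (simp add: algebra_simps)
  then have "usqrt u \<le> u - 1" by (rule usqrt_le)
  then show ?thesis using v by simp
qed

lemma less_usqrt: "p * p < u \<Longrightarrow> p < usqrt u"
  using usqrt_sq[of u] mult_le_mono[of "usqrt u" p "usqrt u" p] by (cases "p < usqrt u") auto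

lemma usqrt_ge2: "2 < u \<Longrightarrow> 2 \<le> usqrt u"
  using less_usqrt[of 1 u] by simp

text \<open>Two cells for minimum and maximum, then one summary and \<open>p\<close> clusters, each
  over a universe of size \<open>p\<close>. The base case has a third cell, the dummy that is tested
  for emptiness of the recursive part.\<close>

function sz :: "nat \<Rightarrow> nat" where
  "sz u = (if u \<le> 2 then 3 else 2 + (usqrt u + 1) * sz (usqrt u))"
  by auto
termination by (relation "Wellfounded.measure id") (auto simp: usqrt_less)

function dep :: "nat \<Rightarrow> nat" where
  "dep u = (if u \<le> 2 then 0 else Suc (dep (usqrt u)))"
  by auto
termination by (relation "Wellfounded.measure id") (auto simp: usqrt_less)

declare sz.simps [simp del] dep.simps [simp del]

lemma sz_ge3: "3 \<le> sz u"
proof (induction u rule: sz.induct)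
  case (1 u)
  show ?case
  proof (cases "u \<le> 2")
    case False
    then have "1 * 3 \<le> (usqrt u + 1) * sz (usqrt u)" using 1 by (intro mult_le_mono) auto
    then show ?thesis using False by (subst sz.simps) simp
  qed (simp add: sz.simps)
qed

text \<open>Taking the root halves the exponent \<open>2 ^ j\<close>, so \<open>j\<close> rounds
  reach a universe of size 2.\<close>

lemma dep_le: "u \<le> 2 ^ 2 ^ j \<Longrightarrow> dep u \<le> j"
proof (induction j arbitrary: u)
  case (Suc j)
  have "usqrt u \<le> 2 ^ 2 ^ j"
    using Suc.prems by (intro usqrt_le) (simp add: power_add[symmetric] mult_2)
  then show ?case using Suc.IH by (subst dep.simps) auto
qed (simp add: dep.simps)

lemma usqrt_eq: "(p - 1) * (p - 1) < u \<Longrightarrow> u \<le> p * p \<Longrightarrow> usqrt u = p"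
  using usqrt_le[of u p] less_usqrt[of "p - 1" u] by simp

text \<open>The bound has the form \<open>23 * (u - 3)\<close> because
  \<open>(p + 1) * (p - 3) = (p - 1) ^ 2 - 4\<close> and \<open>(p - 1) ^ 2 < u\<close>, so the
  subtracted constant absorbs the factor \<open>p + 1\<close>. The factor 23 is forced at
  \<open>u = 5\<close>, where \<open>sz 5 = 46\<close>.\<close>

lemma sz_le:
  assumes "4 \<le> u"
  shows "sz u + 69 \<le> 23 * u"
  using assms
proof (induction u rule: less_induct)
  case (less u)
  have sz3: "sz 3 = 11" using usqrt_eq[of 2 3] by (simp add: sz.simps[of 3] sz.simps[of 2])
  let ?p = "usqrt u"
  consider "u = 4" | "5 \<le> u" "u \<le> 9" | "10 \<le> u" using less.prems by linarith
  then show ?case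
  proof cases
    case 1
    then show ?thesis using usqrt_eq[of 2 4] by (simp add: sz.simps[of 4] sz.simps[of 2])
  next
    case 2
    then have "?p = 3" using usqrt_eq[of 3 u] by simp
    then show ?thesis using 2 by (simp add: sz.simps[of u] sz3)
  next
    case 3
    then have p: "4 \<le> ?p" using less_usqrt[of 3 u] by simp
    then obtain q where q: "?p = q + 4" using le_Suc_ex by (metis add.commute)
    have "?p < u" using 3 by (intro usqrt_less) simp
    then have IH: "sz ?p + 69 \<le> 23 * ?p" using less.IH p by blast
    then obtain s where s: "23 * ?p = sz ?p + 69 + s" using le_Suc_ex by blast
    have lt: "(?p - 1) * (?p - 1) < u"
      using usqrt_le[of u "?p - 1"] p by (cases "u \<le> (?p - 1) * (?p - 1)") auto
    have "(?p + 1) * sz ?p \<le> (?p + 1) * (23 * ?p - 69)" using IH by (intro mult_le_mono2) simp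
    also have "\<dots> = (q + 5) * (23 * q + 23)" unfolding q by (simp add: algebra_simps)
    finally have "sz u \<le> 2 + (q + 5) * (23 * q + 23)" using 3 by (subst sz.simps) simp
    moreover have "(q + 3) * (q + 3) < u" using lt by (simp add: q add.commute)
    ultimately show ?thesis by (simp add: algebra_simps)
  qed
qed

section \<open>Representation of a set in memory\<close>

definition inner :: "nat set \<Rightarrow> nat set" where
  "inner X = X - {Min X, Max X}"

definition slice :: "nat \<Rightarrow> nat \<Rightarrow> nat set \<Rightarrow> nat set" where
  "slice p c X = {y. y < p \<and> c * p + y \<in> X}"

abbreviation clu :: "nat \<Rightarrow> nat \<Rightarrow> nat \<Rightarrow> nat" where
  "clu a p c \<equiv> a + 2 + Suc c * sz p"

text \<open>The structure for a set \<open>X\<close> of numbers below \<open>u\<close> occupies the cells from \<open>a\<close> to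
  \<open>a + sz u - 1\<close>. Neither the minimum nor the maximum is stored recursively, so every operation
  is tail recursive, except for the final computation in the predecessor search. Cell \<open>a + 2\<close> is 0
  iff nothing is stored recursively, also for \<open>u \<le> 2\<close>, where it is a dummy.\<close>

function rep :: "(nat \<Rightarrow> nat) \<Rightarrow> nat \<Rightarrow> nat \<Rightarrow> nat set \<Rightarrow> bool" where
  "rep m u a X \<longleftrightarrow> X \<subseteq> {..<u} \<and> m a = (if X = {} then 0 else Suc (Min X)) \<and>
     m (Suc a) = (if X = {} then 0 else Suc (Max X)) \<and>
     (if u \<le> 2 then m (a + 2) = 0
      else rep m (usqrt u) (a + 2) ((\<lambda>x. x div usqrt u) ` inner X) \<and>
        (\<forall>c<usqrt u. rep m (usqrt u) (clu a (usqrt u) c) (slice (usqrt u) c (inner X))))"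
  by auto
termination by (relation "Wellfounded.measure (\<lambda>(m, u, a, X). u)") (auto simp: usqrt_less)

declare rep.simps [simp del]

text \<open>The recursive half of \<open>rep\<close> for an arbitrary set \<open>Y\<close>.
  Separating it from the minimum and maximum cells lets updates of the two halves be verified
  independently.\<close>

definition subrep :: "(nat \<Rightarrow> nat) \<Rightarrow> nat \<Rightarrow> nat \<Rightarrow> nat set \<Rightarrow> bool" where
  "subrep m p a Y \<longleftrightarrow> rep m p (a + 2) ((\<lambda>x. x div p) ` Y) \<and> (\<forall>c<p. rep m p (clu a p c) (slice p c Y))"

lemma rep_iff: "rep m u a X \<longleftrightarrow> X \<subseteq> {..<u} \<and> m a = (if X = {} then 0 else Suc (Min X)) \<and>
     m (Suc a) = (if X = {} then 0 else Suc (Max X)) \<and>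
     (if u \<le> 2 then m (a + 2) = 0 else subrep m (usqrt u) a (inner X))"
  unfolding subrep_def by (subst rep.simps) simp

lemma rep_finite: "rep m u a X \<Longrightarrow> finite X"
  by (subst (asm) rep_iff) (auto intro: finite_subset)

lemma rep_cells:
  assumes "rep m u a X"
  shows "X \<subseteq> {..<u}" "m a = (if X = {} then 0 else Suc (Min X))"
    "m (Suc a) = (if X = {} then 0 else Suc (Max X))"
  using assms by (subst (asm) rep_iff; simp)+

lemma clu_bounds:
  assumes "2 < u" "c < usqrt u"
  shows "a + 2 + sz (usqrt u) \<le> clu a (usqrt u) c" "clu a (usqrt u) c + sz (usqrt u) \<le> a + sz u"
    "a + 2 + sz (usqrt u) \<le> a + sz u"
proof -
  have s: "sz u = 2 + (usqrt u + 1) * sz (usqrt u)" using assms by (subst sz.simps) simp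
  have "(c + 2) * sz (usqrt u) \<le> (usqrt u + 1) * sz (usqrt u)" using assms by (intro mult_le_mono1) simp
  then show "clu a (usqrt u) c + sz (usqrt u) \<le> a + sz u" unfolding s by simp
  show "a + 2 + sz (usqrt u) \<le> clu a (usqrt u) c" by simp
  show "a + 2 + sz (usqrt u) \<le> a + sz u" unfolding s by simp
qed

lemma clu_disjoint:
  assumes "c \<noteq> c'"
  shows "clu a p c + sz p \<le> clu a p c' \<or> clu a p c' + sz p \<le> clu a p c"
proof -
  have *: "clu a p c + sz p \<le> clu a p c'" if "c < c'" for c c'
  proof -
    have "(c + 2) * sz p \<le> (c' + 1) * sz p" using that by (intro mult_le_mono1) simp
    then show ?thesis by simp
  qed
  show ?thesis using *[of c c'] *[of c' c] assms by linarith
qed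

text \<open>The locality principle behind all updates: writing outside a substructure cannot affect
  it, so work on one cluster leaves the summary and the other clusters intact.\<close>

lemma rep_frame:
  assumes "rep m u a X" "\<And>i. a \<le> i \<Longrightarrow> i < a + sz u \<Longrightarrow> m' i = m i"
  shows "rep m' u a X"
  using assms
proof (induction u arbitrary: a X rule: less_induct)
  case (less u)
  have s3: "3 \<le> sz u" by (rule sz_ge3)
  note r = less.prems(1)[unfolded rep_iff[of m u a X]]
  have cells: "m' a = m a" "m' (Suc a) = m (Suc a)" "m' (a + 2) = m (a + 2)"
    using s3 by (auto intro!: less.prems(2))
  have "subrep m' (usqrt u) a (inner X)" if u: "2 < u"
    unfolding subrep_def
  proof (intro conjI allI impI)
    have p: "usqrt u < u" using u by (rule usqrt_less)
    show "rep m' (usqrt u) (a + 2) ((\<lambda>x. x div usqrt u) ` inner X)"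
      using r u clu_bounds(3)[OF u, of 0 a] usqrt_ge2[OF u]
      by (intro less.IH[OF p] less.prems(2)) (auto simp: subrep_def)
    fix c assume c: "c < usqrt u"
    show "rep m' (usqrt u) (clu a (usqrt u) c) (slice (usqrt u) c (inner X))"
      using r u clu_bounds[OF u c, of a] c
      by (intro less.IH[OF p] less.prems(2)) (auto simp: subrep_def)
  qed
  then show ?case using r cells by (auto simp: rep_iff[of m' u])
qed

lemma inner_simps [simp]: "inner {} = {}" "inner {x} = {}"
  by (auto simp: inner_def)

lemma slice_empty [simp]: "slice p c {} = {}"
  by (simp add: slice_def)

text \<open>Since 0 encodes absence throughout, zeroed memory is already the empty set, and creating
  a set costs nothing.\<close>

lemma rep_zero: "(\<And>i. a \<le> i \<Longrightarrow> i < a + sz u \<Longrightarrow> m i = 0) \<Longrightarrow> rep m u a {}"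
proof (induction u arbitrary: a rule: less_induct)
  case (less u)
  have s3: "3 \<le> sz u" by (rule sz_ge3)
  have cells: "m a = 0" "m (Suc a) = 0" "m (a + 2) = 0"
    using s3 by (auto intro!: less.prems)
  have "subrep m (usqrt u) a {}" if u: "2 < u"
    unfolding subrep_def
  proof (intro conjI allI impI)
    have p: "usqrt u < u" using u by (rule usqrt_less)
    show "rep m (usqrt u) (a + 2) ((\<lambda>x. x div usqrt u) ` {})"
      using clu_bounds(3)[OF u, of 0 a] usqrt_ge2[OF u]
      by (simp, intro less.IH[OF p] less.prems) auto
    fix c assume c: "c < usqrt u"
    show "rep m (usqrt u) (clu a (usqrt u) c) (slice (usqrt u) c {})"
      using clu_bounds[OF u c, of a] c
      by (simp, intro less.IH[OF p] less.prems) auto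
  qed
  then show ?case using cells by (auto simp: rep_iff)
qed

lemma rep_update:
  assumes r: "rep m u a X" and "Y \<subseteq> {..<u}" "inner Y = inner X"
    "m' a = (if Y = {} then 0 else Suc (Min Y))" "m' (Suc a) = (if Y = {} then 0 else Suc (Max Y))"
    and fr: "\<And>i. a + 2 \<le> i \<Longrightarrow> m' i = m i"
  shows "rep m' u a Y"
proof -
  have "subrep m' (usqrt u) a (inner X)" if u: "2 < u"
  proof -
    have s: "subrep m (usqrt u) a (inner X)" using r u by (simp add: rep_iff)
    show ?thesis unfolding subrep_def
    proof (intro conjI allI impI)
      show "rep m' (usqrt u) (a + 2) ((\<lambda>x. x div usqrt u) ` inner X)"
        by (rule rep_frame[of m]) (use s fr in \<open>auto simp: subrep_def\<close>)
      fix c assume "c < usqrt u"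
      then show "rep m' (usqrt u) (clu a (usqrt u) c) (slice (usqrt u) c (inner X))"
        by - (rule rep_frame[of m], use s fr in \<open>auto simp: subrep_def\<close>)
    qed
  qed
  moreover have "m' (a + 2) = 0" if "u \<le> 2" using r that fr by (simp add: rep_iff)
  ultimately show ?thesis using assms by (simp add: rep_iff[of m'])
qed

lemma rep_single: "rep m u a {} \<Longrightarrow> x < u \<Longrightarrow> rep (m(a := Suc x, Suc a := Suc x)) u a {x}"
  by (erule rep_update) auto

lemma rep_clear: "rep m u a {x} \<Longrightarrow> rep (m(a := 0, Suc a := 0)) u a {}"
  by (erule rep_update) auto

text \<open>A universe of size at most 2 has nothing strictly between minimum and maximum, which is
  why its dummy cell may be constantly 0. One test then serves both cases.\<close>

lemma inner_empty:
  assumes "rep m u a X"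
  shows "m (a + 2) = 0 \<longleftrightarrow> inner X = {}"
proof (cases "u \<le> 2")
  case True
  then have X: "X \<subseteq> {..<2}" "m (a + 2) = 0" using assms by (auto simp: rep_iff)
  have "x \<in> {Min X, Max X}" if x: "x \<in> X" for x
  proof -
    have "finite X" "X \<noteq> {}" using assms x rep_finite by auto
    then have "Min X \<in> X" "Max X \<in> X" "Min X \<le> x" "x \<le> Max X" using x by auto
    then have "Min X < 2" "Max X < 2" "x < 2" using X x by auto
    then show ?thesis
    proof (cases "x = Min X")
      case False
      then have "x = 1" "Max X = 1" using \<open>Min X \<le> x\<close> \<open>x \<le> Max X\<close> \<open>x < 2\<close> \<open>Max X < 2\<close> by linarith+
      then show ?thesis by simp
    qed simp
  qed
  then show ?thesis using X by (auto simp: inner_def)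
next
  case False
  then have "rep m (usqrt u) (a + 2) ((\<lambda>x. x div usqrt u) ` inner X)"
    using assms by (simp add: rep_iff[of m u] subrep_def)
  from rep_cells(2)[OF this] show ?thesis by auto
qed

lemma slice_image: "slice p c Y \<noteq> {} \<longleftrightarrow> c \<in> (\<lambda>x. x div p) ` Y" if "0 < p"
proof
  assume "slice p c Y \<noteq> {}"
  then obtain y where "y < p" "c * p + y \<in> Y" by (auto simp: slice_def)
  moreover then have "(c * p + y) div p = c" by simp
  ultimately show "c \<in> (\<lambda>x. x div p) ` Y" by force
next
  assume "c \<in> (\<lambda>x. x div p) ` Y"
  then obtain x where "x \<in> Y" "c = x div p" by auto
  then have "x mod p \<in> slice p c Y" using that by (simp add: slice_def)
  then show "slice p c Y \<noteq> {}" by auto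
qed

lemma slice_insert:
  assumes "0 < p"
  shows "slice p c (insert x Y) = (if c = x div p then insert (x mod p) (slice p c Y) else slice p c Y)"
proof -
  have *: "y < p \<and> c * p + y = x \<longleftrightarrow> c = x div p \<and> y = x mod p" for y using assms by auto
  have "slice p c (insert x Y) = {y. y < p \<and> c * p + y = x} \<union> slice p c Y"
    by (auto simp: slice_def)
  then show ?thesis unfolding * by auto
qed

lemma slice_remove:
  assumes "0 < p"
  shows "slice p c (Y - {x}) = (if c = x div p then slice p c Y - {x mod p} else slice p c Y)"
proof -
  have *: "y < p \<and> c * p + y = x \<longleftrightarrow> c = x div p \<and> y = x mod p" for y using assms by auto
  have "slice p c (Y - {x}) = slice p c Y - {y. y < p \<and> c * p + y = x}"
    by (auto simp: slice_def)
  then show ?thesis unfolding * by auto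
qed

lemma mem_slice: "0 < p \<Longrightarrow> x mod p \<in> slice p (x div p) Y \<longleftrightarrow> x \<in> Y"
  by (simp add: slice_def)

lemma subrep_inD: "subrep m p a Y \<Longrightarrow> c < p \<Longrightarrow> rep m p (clu a p c) (slice p c Y)"
  by (simp add: subrep_def)

text \<open>Only the summary and one cluster may differ. The last assumption frames the remaining
  cells, so the other clusters follow by locality.\<close>

lemma subrep_update:
  assumes "subrep m p a Y"
    and "rep m' p (a + 2) ((\<lambda>x. x div p) ` Y')" "rep m' p (clu a p c) (slice p c Y')"
    and "\<And>c'. c' \<noteq> c \<Longrightarrow> slice p c' Y' = slice p c' Y"
    and fr: "\<And>i. a + 2 + sz p \<le> i \<Longrightarrow> i < clu a p c \<or> clu a p c + sz p \<le> i \<Longrightarrow> m' i = m i"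
  shows "subrep m' p a Y'"
  unfolding subrep_def
proof (intro conjI allI impI)
  fix c' assume c': "c' < p"
  show "rep m' p (clu a p c') (slice p c' Y')"
  proof (cases "c' = c")
    case False
    have "rep m' p (clu a p c') (slice p c' Y)"
      by (rule rep_frame[OF subrep_inD[OF assms(1) c']])
        (use clu_disjoint[OF False, of a p] in \<open>auto intro!: fr\<close>)
    then show ?thesis using assms(4)[OF False] by simp
  qed (use assms in simp)
qed (use assms in simp)

lemma rep_Min_Max:
  assumes "rep m u a X" "X \<noteq> {}"
  shows "Min X \<in> X" "Max X \<in> X" "\<And>x. x \<in> X \<Longrightarrow> Min X \<le> x" "\<And>x. x \<in> X \<Longrightarrow> x \<le> Max X"
  using assms rep_finite by auto

lemma inner_between:
  assumes "finite X" "x \<in> inner X"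
  shows "Min X < x" "x < Max X" "x \<in> X"
proof -
  have x: "x \<in> X" "x \<noteq> Min X" "x \<noteq> Max X" using assms by (auto simp: inner_def)
  have "Min X \<le> x" "x \<le> Max X" using assms(1) x(1) by auto
  then show "Min X < x" "x < Max X" "x \<in> X" using x by auto
qed

section \<open>Insertion, deletion and predecessor search as functions on memory\<close>

lemma Min_insert_below: "finite X \<Longrightarrow> X \<noteq> {} \<Longrightarrow> x < Min X \<Longrightarrow> Min (insert x X) = x"
  by (rule Min_eqI) auto

lemma Max_insert_above: "finite X \<Longrightarrow> X \<noteq> {} \<Longrightarrow> Max X < x \<Longrightarrow> Max (insert x X) = (x :: nat)"
  by (rule Max_eqI) auto

text \<open>Minimum and maximum live outside the recursive part, so a new extreme element displaces
  the old one, and the displaced key is what has to be inserted recursively. Cells hold keys plus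
  one, hence \<open>Suc x\<close> and the subtractions.\<close>

definition ins_key :: "nat \<Rightarrow> nat \<Rightarrow> (nat \<Rightarrow> nat) \<Rightarrow> nat" where
  "ins_key a x m = (if Suc x < m a then m a - 1 else if m (Suc a) < Suc x then m (Suc a) - 1 else x)"

definition ins_mem :: "nat \<Rightarrow> nat \<Rightarrow> (nat \<Rightarrow> nat) \<Rightarrow> (nat \<Rightarrow> nat)" where
  "ins_mem a x m =
    (if Suc x < m a then m(a := Suc x) else if m (Suc a) < Suc x then m(Suc a := Suc x) else m)"

text \<open>Deleting an extreme element promotes its neighbour from the recursive part, so that
  neighbour is the key to be deleted recursively. It is found in constant time: the extreme cells of
  the summary, at \<open>a + 2\<close> and \<open>a + 3\<close>, name the cluster, whose own extreme
  cell gives the low part.\<close>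

definition del_key :: "nat \<Rightarrow> nat \<Rightarrow> nat \<Rightarrow> (nat \<Rightarrow> nat) \<Rightarrow> nat" where
  "del_key p a x m =
    (if Suc x = m a then (m (a + 2) - 1) * p + (m (clu a p (m (a + 2) - 1)) - 1)
     else if Suc x = m (Suc a) then (m (a + 3) - 1) * p + (m (Suc (clu a p (m (a + 3) - 1))) - 1)
     else x)"

definition del_mem :: "nat \<Rightarrow> nat \<Rightarrow> nat \<Rightarrow> (nat \<Rightarrow> nat) \<Rightarrow> (nat \<Rightarrow> nat)" where
  "del_mem p a x m =
    (if Suc x = m a then m(a := Suc (del_key p a x m))
     else if Suc x = m (Suc a) then m(Suc a := Suc (del_key p a x m)) else m)"

text \<open>At most one recursive call: an empty cluster becomes a singleton in constant time and
  only the summary recurses, while a nonempty cluster is already listed in the summary. The branch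
  \<open>u \<le> 2\<close> serves termination; a represented set and a new key never reach
  it.\<close>

function vins :: "nat \<Rightarrow> nat \<Rightarrow> nat \<Rightarrow> (nat \<Rightarrow> nat) \<Rightarrow> (nat \<Rightarrow> nat)" where
  "vins u a x m =
    (if m a = 0 then m(a := Suc x, Suc a := Suc x)
     else if m a = m (Suc a) then (if Suc x < m a then m(a := Suc x) else m(Suc a := Suc x))
     else if u \<le> 2 then m
     else let p = usqrt u; x' = ins_key a x m; m' = ins_mem a x m; b = clu a p (x' div p)
       in if m' b = 0 then vins p (a + 2) (x' div p) (m'(b := Suc (x' mod p), Suc b := Suc (x' mod p)))
          else vins p b (x' mod p) m')"
  by pat_completeness auto
termination by (relation "Wellfounded.measure (\<lambda>(u, a, x, m). u)") (auto simp: usqrt_less)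

text \<open>Dual to insertion: a cluster whose minimum and maximum coincide is a singleton and is
  cleared in constant time, which leaves the recursion for the summary.\<close>

function vdel :: "nat \<Rightarrow> nat \<Rightarrow> nat \<Rightarrow> (nat \<Rightarrow> nat) \<Rightarrow> (nat \<Rightarrow> nat)" where
  "vdel u a x m =
    (if m a = m (Suc a) then m(a := 0, Suc a := 0)
     else if m (a + 2) = 0 then (if Suc x = m a then m(a := m (Suc a)) else m(Suc a := m a))
     else if u \<le> 2 then m
     else let p = usqrt u; x' = del_key p a x m; m' = del_mem p a x m; b = clu a p (x' div p)
       in if m' b = m' (Suc b) then vdel p (a + 2) (x' div p) (m'(b := 0, Suc b := 0))
          else vdel p b (x' mod p) m')"
  by pat_completeness auto
termination by (relation "Wellfounded.measure (\<lambda>(u, a, x, m). u)") (auto simp: usqrt_less)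

text \<open>The result is 0 if there is no predecessor, and otherwise 1 more than the predecessor.\<close>

function vpred :: "nat \<Rightarrow> nat \<Rightarrow> nat \<Rightarrow> (nat \<Rightarrow> nat) \<Rightarrow> nat" where
  "vpred u a x m =
    (if Suc x \<le> m a then 0
     else if m (Suc a) < Suc x then m (Suc a)
     else if m (a + 2) = 0 then m a
     else if u \<le> 2 then m a
     else let p = usqrt u; b = clu a p (x div p)
       in if 0 < m b \<and> m b < Suc (x mod p) then x div p * p + vpred p b (x mod p) m
          else let v = vpred p (a + 2) (x div p) m
            in if v = 0 then m a else (v - 1) * p + m (Suc (clu a p (v - 1))))"
  by pat_completeness auto
termination by (relation "Wellfounded.measure (\<lambda>(u, a, x, m). u)") (auto simp: usqrt_less)

declare vins.simps [simp del] vdel.simps [simp del] vpred.simps [simp del]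

text \<open>The preconditions of the recursive call, collected because both the correctness of
  \<open>vins\<close> and the verification of the loop that implements it rely on them.\<close>

lemma subrep_insert_child:
  assumes s: "subrep m p a Y" and p: "0 < p" and x: "x \<notin> Y" "x < p * p"
    and b: "b = clu a p (x div p)"
  shows "rep m p b (slice p (x div p) Y)" "x mod p \<notin> slice p (x div p) Y" "x div p < p"
    "m b = 0 \<Longrightarrow> rep (m(b := Suc (x mod p), Suc b := Suc (x mod p))) p (a + 2) ((\<lambda>x. x div p) ` Y)"
    "m b = 0 \<Longrightarrow> x div p \<notin> (\<lambda>x. x div p) ` Y"
proof -
  let ?c = "x div p" and ?y = "x mod p"
  show c: "?c < p" using x(2) p by (simp add: less_mult_imp_div_less)
  show rc: "rep m p b (slice p ?c Y)" unfolding b by (rule subrep_inD[OF s c])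
  show "?y \<notin> slice p ?c Y" using mem_slice[OF p] x(1) by blast
  have blo: "a + 2 + sz p \<le> b" unfolding b by simp
  show "rep (m(b := Suc (x mod p), Suc b := Suc (x mod p))) p (a + 2) ((\<lambda>x. x div p) ` Y)"
    by (rule rep_frame[of m]) (use s blo in \<open>auto simp: subrep_def\<close>)
  assume "m b = 0"
  then show "?c \<notin> (\<lambda>x. x div p) ` Y"
    using rep_cells(2)[OF rc] by (simp only: slice_image[OF p, symmetric]) (simp split: if_splits)
qed

text \<open>The induction hypothesis appears as an explicit assumption, which separates the case of
  an empty cluster and that of a nonempty one from the recursion on the universe.\<close>

lemma subrep_insert:
  assumes s: "subrep m p a Y" and p: "0 < p" and x: "x \<notin> Y" "x < p * p"
    and IH: "\<And>m a X x. rep m p a X \<Longrightarrow> x < p \<Longrightarrow> x \<notin> X \<Longrightarrow>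
      rep (vins p a x m) p a (insert x X) \<and> (\<forall>i. i < a \<or> a + sz p \<le> i \<longrightarrow> vins p a x m i = m i)"
    and b: "b = clu a p (x div p)"
  shows "let m' = (if m b = 0 then vins p (a + 2) (x div p) (m(b := Suc (x mod p), Suc b := Suc (x mod p)))
       else vins p b (x mod p) m)
    in subrep m' p a (insert x Y) \<and> (\<forall>i. i < a + 2 \<or> a + 2 + Suc p * sz p \<le> i \<longrightarrow> m' i = m i)"
proof -
  let ?c = "x div p" and ?y = "x mod p"
  note child = subrep_insert_child[OF s p x b]
  note c = child(3) and rc = child(1) and ny = child(2)
  have y: "?y < p" using p by simp
  have s3: "3 \<le> sz p" by (rule sz_ge3)
  have bhi: "b + sz p \<le> a + 2 + Suc p * sz p"
  proof -
    have "(?c + 2) * sz p \<le> Suc p * sz p" using c by (intro mult_le_mono1) simp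
    then show ?thesis unfolding b by simp
  qed
  have blo: "a + 2 + sz p \<le> b" unfolding b by simp
  have e: "m b = 0 \<longleftrightarrow> slice p ?c Y = {}" using rep_cells(2)[OF rc] by simp
  have other: "slice p c' (insert x Y) = slice p c' Y" if "c' \<noteq> ?c" for c'
    using that by (simp add: slice_insert[OF p])
  have ths: "slice p ?c (insert x Y) = insert ?y (slice p ?c Y)" by (simp add: slice_insert[OF p])
  show ?thesis
  proof (cases "m b = 0")
    case True
    let ?m1 = "m(b := Suc ?y, Suc b := Suc ?y)"
    let ?m2 = "vins p (a + 2) ?c ?m1"
    have 2: "rep ?m2 p (a + 2) (insert ?c ((\<lambda>x. x div p) ` Y))"
      "\<And>i. i < a + 2 \<or> a + 2 + sz p \<le> i \<Longrightarrow> ?m2 i = ?m1 i"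
      using IH[OF child(4)[OF True] c child(5)[OF True]] by auto
    have "rep ?m1 p b {?y}" using rep_single[OF _ y] rc e True by simp
    then have 3: "rep ?m2 p b {?y}" by (rule rep_frame) (use blo 2(2) in auto)
    have "subrep ?m2 p a (insert x Y)"
    proof (rule subrep_update[OF s])
      show "rep ?m2 p (a + 2) ((\<lambda>x. x div p) ` insert x Y)" using 2(1) by simp
      show "rep ?m2 p (clu a p ?c) (slice p ?c (insert x Y))"
        unfolding ths b[symmetric] using 3 e True by simp
      fix i assume i: "a + 2 + sz p \<le> i" "i < clu a p ?c \<or> clu a p ?c + sz p \<le> i"
      then have "i < b \<or> b + sz p \<le> i" unfolding b by simp
      then have "?m1 i = m i" using s3 by auto
      then show "?m2 i = m i" using 2(2)[of i] i by simp
    qed (rule other)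
    moreover have "?m2 i = m i" if "i < a + 2 \<or> a + 2 + Suc p * sz p \<le> i" for i
    proof -
      have "i < b \<or> b + sz p \<le> i" "i < a + 2 \<or> a + 2 + sz p \<le> i" using that bhi blo by auto
      then show ?thesis using 2(2)[of i] s3 by auto
    qed
    ultimately show ?thesis using True by (simp add: Let_def)
  next
    case False
    let ?m2 = "vins p b ?y m"
    have 2: "rep ?m2 p b (insert ?y (slice p ?c Y))"
      "\<And>i. i < b \<or> b + sz p \<le> i \<Longrightarrow> ?m2 i = m i"
      using IH[OF rc y ny] by auto
    have "slice p ?c Y \<noteq> {}" using False e by simp
    then have "?c \<in> (\<lambda>x. x div p) ` Y" by (simp only: slice_image[OF p])
    then have im: "(\<lambda>x. x div p) ` insert x Y = (\<lambda>x. x div p) ` Y" by auto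
    have "subrep ?m2 p a (insert x Y)"
    proof (rule subrep_update[OF s])
      show "rep ?m2 p (a + 2) ((\<lambda>x. x div p) ` insert x Y)"
        unfolding im by (rule rep_frame[of m]) (use s blo 2(2) in \<open>auto simp: subrep_def\<close>)
      show "rep ?m2 p (clu a p ?c) (slice p ?c (insert x Y))"
        unfolding ths b[symmetric] using 2(1) .
      fix i assume "a + 2 + sz p \<le> i" "i < clu a p ?c \<or> clu a p ?c + sz p \<le> i"
      then show "?m2 i = m i" unfolding b[symmetric] by (intro 2(2)) 
    qed (rule other)
    moreover have "?m2 i = m i" if "i < a + 2 \<or> a + 2 + Suc p * sz p \<le> i" for i
      using that bhi blo by (intro 2(2)) auto
    ultimately show ?thesis using False by (simp add: Let_def)
  qed
qed

lemma subrep_frame: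
  assumes "subrep m p a Y" "\<And>i. a + 2 \<le> i \<Longrightarrow> m' i = m i"
  shows "subrep m' p a Y"
  unfolding subrep_def
proof (intro conjI allI impI)
  show "rep m' p (a + 2) ((\<lambda>x. x div p) ` Y)"
    by (rule rep_frame[of m]) (use assms in \<open>auto simp: subrep_def\<close>)
  fix c assume "c < p"
  then show "rep m' p (clu a p c) (slice p c Y)"
    by - (rule rep_frame[of m], use assms in \<open>auto simp: subrep_def\<close>)
qed

text \<open>The constant time part of an insertion. \<open>x'\<close> is the one key that enters the
  recursive part, be it \<open>x\<close>, the old minimum or the old maximum.\<close>

lemma vins_step:
  assumes r: "rep m u a X" and x: "x < u" "x \<notin> X" and ne: "X \<noteq> {}" "Min X \<noteq> Max X"
  defines "x' \<equiv> ins_key a x m" and "m' \<equiv> ins_mem a x m"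
  shows "2 < u" "x' \<notin> inner X" "x' < u" "inner (insert x X) = insert x' (inner X)"
    "m' a = Suc (Min (insert x X))" "m' (Suc a) = Suc (Max (insert x X))"
    "subrep m' (usqrt u) a (inner X)"
proof -
  have fin: "finite X" using r by (rule rep_finite)
  note cells = rep_cells[OF r]
  have lt: "Min X < Max X" using ne fin by (meson Max_ge Min_in le_neq_implies_less)
  have mm: "Min X \<in> X" "Max X \<in> X" using ne fin by auto
  \<comment> \<open>\<open>x\<close>, the minimum and the maximum are three different numbers, too
    many for a universe of size 2.\<close>
  show u: "2 < u"
  proof (rule ccontr)
    assume "\<not> 2 < u"
    then have "{x, Min X, Max X} \<subseteq> {..<2}" using cells(1) mm x(1) by auto
    then have "card {x, Min X, Max X} \<le> card {..<2 :: nat}" by (intro card_mono) auto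
    moreover have "x \<noteq> Min X" "x \<noteq> Max X" using mm x(2) by auto
    ultimately show False using lt by simp
  qed
  show "subrep m' (usqrt u) a (inner X)"
    by (rule subrep_frame[of m]) (use r u in \<open>auto simp: rep_iff[of m u] m'_def ins_mem_def\<close>)
  have xne: "x \<noteq> Min X" "x \<noteq> Max X" using mm x(2) by auto
  have "x' \<notin> inner X \<and> x' < u \<and> inner (insert x X) = insert x' (inner X) \<and>
    m' a = Suc (Min (insert x X)) \<and> m' (Suc a) = Suc (Max (insert x X))"
  proof -
    consider "x < Min X" | "Max X < x" | "Min X < x" "x < Max X" using xne by linarith
    then show ?thesis
    proof cases
      case 1
      have mi: "Min (insert x X) = x" using 1 ne fin Min_insert_below by blast
      have ma: "Max (insert x X) = Max X" using 1 ne fin lt by simp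
      have "x' = Min X" "m' = m(a := Suc x)" using 1 ne cells by (simp_all add: x'_def m'_def ins_key_def ins_mem_def)
      moreover have "inner (insert x X) = insert (Min X) (inner X)"
        unfolding inner_def mi ma using x(2) lt mm by auto
      ultimately show ?thesis using mi ma mm cells ne by (auto simp: inner_def)
    next
      case 2
      have mi: "Min (insert x X) = Min X" using 2 ne fin lt by simp
      have ma: "Max (insert x X) = x" using 2 ne fin Max_insert_above by blast
      have "x' = Max X" "m' = m(Suc a := Suc x)"
        using 2 ne lt cells by (simp_all add: x'_def m'_def ins_key_def ins_mem_def)
      moreover have "inner (insert x X) = insert (Max X) (inner X)"
        unfolding inner_def mi ma using x(2) lt mm by auto
      ultimately show ?thesis using mi ma mm cells ne by (auto simp: inner_def)
    next
      case c: 3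
      have mi: "Min (insert x X) = Min X" using c ne fin by simp
      have ma: "Max (insert x X) = Max X" using c ne fin by simp
      have "x' = x" "m' = m" using c ne cells by (simp_all add: x'_def m'_def ins_key_def ins_mem_def)
      moreover have "inner (insert x X) = insert x (inner X)"
        unfolding inner_def mi ma using c by auto
      ultimately show ?thesis using mi ma cells ne x by (auto simp: inner_def)
    qed
  qed
  then show "x' \<notin> inner X" "x' < u" "inner (insert x X) = insert x' (inner X)"
    "m' a = Suc (Min (insert x X))" "m' (Suc a) = Suc (Max (insert x X))" by auto
qed

lemma vins_correct:
  assumes "rep m u a X" "x < u" "x \<notin> X"
  shows "rep (vins u a x m) u a (insert x X) \<and>
    (\<forall>i. i < a \<or> a + sz u \<le> i \<longrightarrow> vins u a x m i = m i)"
  using assms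
proof (induction u arbitrary: m a X x rule: less_induct)
  case (less u)
  note r = less.prems(1)
  have fin: "finite X" using r by (rule rep_finite)
  have s3: "3 \<le> sz u" by (rule sz_ge3)
  note cells = rep_cells[OF r]
  consider "X = {}" | "X \<noteq> {}" "Min X = Max X" | "X \<noteq> {}" "Min X \<noteq> Max X" by blast
  then show ?case
  proof cases
    case 1
    then have "vins u a x m = m(a := Suc x, Suc a := Suc x)" using cells by (subst vins.simps) simp
    moreover have "rep (m(a := Suc x, Suc a := Suc x)) u a {x}"
      using 1 rep_single r less.prems(2) by blast
    ultimately show ?thesis using s3 unfolding 1 by (simp only:) auto
  next
    case 2
    have "X = {Min X}"
    proof (intro equalityI subsetI)
      fix z assume "z \<in> X"
      then have "Min X \<le> z" "z \<le> Max X" using fin by auto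
      then show "z \<in> {Min X}" using 2(2) by simp
    qed (use 2 fin in auto)
    then obtain z where X: "X = {z}" by blast
    have xz: "x \<noteq> z" using X less.prems by auto
    have inn: "inner {x, z} = {}" by (auto simp: inner_def min_def max_def)
    have "rep (if Suc x < m a then m(a := Suc x) else m(Suc a := Suc x)) u a {x, z}"
      by (rule rep_update[OF r]) (use X xz less.prems inn cells in \<open>auto simp: min_def max_def\<close>)
    then show ?thesis using X cells s3 by (simp add: vins.simps[of u])
  next
    case 3
    define p where "p = usqrt u"
    define x' where "x' = ins_key a x m"
    define m' where "m' = ins_mem a x m"
    define b where "b = clu a p (x' div p)"
    note key = vins_step[OF less.prems 3, folded x'_def m'_def p_def]
    have p: "p < u" "0 < p" "u \<le> p * p"
      using usqrt_less[OF key(1)] usqrt_ge2[OF key(1)] usqrt_sq[of u] by (auto simp: p_def)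
    have sz: "a + sz u = a + 2 + Suc p * sz p"
      using key(1) by (simp add: sz.simps[of u] p_def[symmetric])
    define m'' where "m'' = (if m' b = 0 then vins p (a + 2) (x' div p) (m'(b := Suc (x' mod p), Suc b := Suc (x' mod p)))
       else vins p b (x' mod p) m')"
    have m'': "vins u a x m = m''"
    proof -
      have "m a \<noteq> 0" "m a \<noteq> m (Suc a)" "\<not> u \<le> 2" using cells 3 key(1) by simp_all
      then show ?thesis
        by (subst vins.simps) (simp only: Let_def m''_def p_def[symmetric] x'_def[symmetric] m'_def[symmetric]
            b_def[symmetric] if_False)
    qed
    have 4: "subrep m'' p a (insert x' (inner X))"
      "\<And>i. i < a + 2 \<or> a + 2 + Suc p * sz p \<le> i \<Longrightarrow> m'' i = m' i"
      using subrep_insert[OF key(7) p(2) _ _ less.IH[OF p(1)] b_def] key(2,3) p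
      unfolding Let_def m''_def[symmetric] by (auto simp del: mult_Suc)
    have "rep m'' u a (insert x X)"
      using 4(1) 4(2)[of a] 4(2)[of "Suc a"] key cells(1) less.prems(2)
      by (auto simp: rep_iff[of m''] p_def[symmetric] simp del: mult_Suc)
    moreover have "m'' i = m i" if "i < a \<or> a + sz u \<le> i" for i
    proof -
      have "m'' i = m' i" using that unfolding sz by (intro 4(2)) auto
      also have "m' i = m i" using that s3 by (auto simp: m'_def ins_mem_def)
      finally show ?thesis .
    qed
    ultimately show ?thesis unfolding m'' by blast
  qed
qed

section \<open>Correctness of deletion\<close>

lemma subrep_delete_child:
  assumes s: "subrep m p a Y" and p: "0 < p" and x: "x \<in> Y" "x < p * p"
    and b: "b = clu a p (x div p)"
  shows "rep m p b (slice p (x div p) Y)" "x mod p \<in> slice p (x div p) Y" "x div p < p"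
    "rep (m(b := 0, Suc b := 0)) p (a + 2) ((\<lambda>x. x div p) ` Y)"
    "m b \<le> m (Suc b)"
proof -
  let ?c = "x div p" and ?y = "x mod p"
  show c: "?c < p" using x(2) p by (simp add: less_mult_imp_div_less)
  show rc: "rep m p b (slice p ?c Y)" unfolding b by (rule subrep_inD[OF s c])
  show "?y \<in> slice p ?c Y" using mem_slice[OF p] x(1) by blast
  have blo: "a + 2 + sz p \<le> b" unfolding b by simp
  show "rep (m(b := 0, Suc b := 0)) p (a + 2) ((\<lambda>x. x div p) ` Y)"
    by (rule rep_frame[of m]) (use s blo in \<open>auto simp: subrep_def\<close>)
  show "m b \<le> m (Suc b)" using rep_cells[OF rc] rep_finite[OF rc] by (auto intro: Max_ge Min_in)
qed

text \<open>The cluster of \<open>x\<close> is nonempty, so equal extreme cells mean a singleton.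
  Then its number leaves the summary; otherwise another element keeps the number there.\<close>

lemma subrep_delete:
  assumes s: "subrep m p a Y" and p: "0 < p" and x: "x \<in> Y" "x < p * p"
    and IH: "\<And>m a X x. rep m p a X \<Longrightarrow> x \<in> X \<Longrightarrow>
      rep (vdel p a x m) p a (X - {x}) \<and> (\<forall>i. i < a \<or> a + sz p \<le> i \<longrightarrow> vdel p a x m i = m i)"
    and b: "b = clu a p (x div p)"
  shows "let m' = (if m b = m (Suc b) then vdel p (a + 2) (x div p) (m(b := 0, Suc b := 0))
       else vdel p b (x mod p) m)
    in subrep m' p a (Y - {x}) \<and> (\<forall>i. i < a + 2 \<or> a + 2 + Suc p * sz p \<le> i \<longrightarrow> m' i = m i)"
proof -
  let ?c = "x div p" and ?y = "x mod p"
  note child = subrep_delete_child[OF s p x b]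
  note c = child(3) and rc = child(1) and yin = child(2)
  have s3: "3 \<le> sz p" by (rule sz_ge3)
  have bhi: "b + sz p \<le> a + 2 + Suc p * sz p"
  proof -
    have "(?c + 2) * sz p \<le> Suc p * sz p" using c by (intro mult_le_mono1) simp
    then show ?thesis unfolding b by simp
  qed
  have blo: "a + 2 + sz p \<le> b" unfolding b by simp
  have other: "slice p c' (Y - {x}) = slice p c' Y" if "c' \<noteq> ?c" for c'
    using that by (simp add: slice_remove[OF p])
  have ths: "slice p ?c (Y - {x}) = slice p ?c Y - {?y}" by (simp add: slice_remove[OF p])
  have div_other: "z div p \<in> (\<lambda>x. x div p) ` (Y - {x})" if "z \<in> Y" "z div p \<noteq> ?c" for z
    using that by auto
  show ?thesis
  proof (cases "m b = m (Suc b)")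
    case True
    let ?m1 = "m(b := 0, Suc b := 0)"
    let ?m2 = "vdel p (a + 2) ?c ?m1"
    have fin: "finite (slice p ?c Y)" using rc by (rule rep_finite)
    have MM: "Min (slice p ?c Y) = Max (slice p ?c Y)" using True rep_cells[OF rc] yin by (cases "slice p ?c Y = {}") simp_all
    have sl: "slice p ?c Y = {?y}"
    proof (intro equalityI subsetI)
      fix z assume "z \<in> slice p ?c Y"
      then show "z \<in> {?y}"
        using MM Min_le[OF fin, of z] Max_ge[OF fin, of z] Min_le[OF fin yin] Max_ge[OF fin yin] by simp
    qed (use yin in auto)
    have im: "(\<lambda>x. x div p) ` (Y - {x}) = (\<lambda>x. x div p) ` Y - {?c}"
    proof -
      have "?c \<notin> (\<lambda>x. x div p) ` (Y - {x})"
        using sl ths by (simp only: slice_image[OF p, symmetric]) simp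
      then show ?thesis using div_other by (intro equalityI subsetI) blast+
    qed
    have "?c \<in> (\<lambda>x. x div p) ` Y" using x(1) by simp
    then have 2: "rep ?m2 p (a + 2) ((\<lambda>x. x div p) ` Y - {?c})"
      "\<And>i. i < a + 2 \<or> a + 2 + sz p \<le> i \<Longrightarrow> ?m2 i = ?m1 i"
      using IH[OF child(4)] by auto
    have "rep ?m1 p b {}" using rep_clear rc sl by simp
    then have 3: "rep ?m2 p b {}" by (rule rep_frame) (use blo 2(2) in auto)
    have "subrep ?m2 p a (Y - {x})"
    proof (rule subrep_update[OF s])
      show "rep ?m2 p (a + 2) ((\<lambda>x. x div p) ` (Y - {x}))" unfolding im by (rule 2(1))
      show "rep ?m2 p (clu a p ?c) (slice p ?c (Y - {x}))"
        unfolding ths b[symmetric] using 3 sl by simp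
      fix i assume i: "a + 2 + sz p \<le> i" "i < clu a p ?c \<or> clu a p ?c + sz p \<le> i"
      then have "i < b \<or> b + sz p \<le> i" unfolding b by simp
      then have "?m1 i = m i" using s3 by auto
      then show "?m2 i = m i" using 2(2)[of i] i by simp
    qed (rule other)
    moreover have "?m2 i = m i" if "i < a + 2 \<or> a + 2 + Suc p * sz p \<le> i" for i
    proof -
      have "i < b \<or> b + sz p \<le> i" "i < a + 2 \<or> a + 2 + sz p \<le> i" using that bhi blo by auto
      then show ?thesis using 2(2)[of i] s3 by auto
    qed
    ultimately show ?thesis using True by (simp add: Let_def)
  next
    case False
    let ?m2 = "vdel p b ?y m"
    have 2: "rep ?m2 p b (slice p ?c Y - {?y})"
      "\<And>i. i < b \<or> b + sz p \<le> i \<Longrightarrow> ?m2 i = m i"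
      using IH[OF rc yin] by auto
    have "slice p ?c Y - {?y} \<noteq> {}"
    proof
      assume "slice p ?c Y - {?y} = {}"
      then have "slice p ?c Y = {?y}" using yin by auto
      then show False using False rep_cells[OF rc] by simp
    qed
    then have "?c \<in> (\<lambda>x. x div p) ` (Y - {x})"
      unfolding ths[symmetric] by (simp only: slice_image[OF p])
    then have im: "(\<lambda>x. x div p) ` (Y - {x}) = (\<lambda>x. x div p) ` Y" using div_other by auto
    have "subrep ?m2 p a (Y - {x})"
    proof (rule subrep_update[OF s])
      show "rep ?m2 p (a + 2) ((\<lambda>x. x div p) ` (Y - {x}))"
        unfolding im by (rule rep_frame[of m]) (use s blo 2(2) in \<open>auto simp: subrep_def\<close>)
      show "rep ?m2 p (clu a p ?c) (slice p ?c (Y - {x}))"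
        unfolding ths b[symmetric] using 2(1) .
      fix i assume "a + 2 + sz p \<le> i" "i < clu a p ?c \<or> clu a p ?c + sz p \<le> i"
      then show "?m2 i = m i" unfolding b[symmetric] by (intro 2(2)) 
    qed (rule other)
    moreover have "?m2 i = m i" if "i < a + 2 \<or> a + 2 + Suc p * sz p \<le> i" for i
      using that bhi blo by (intro 2(2)) auto
    ultimately show ?thesis using False by (simp add: Let_def)
  qed
qed

text \<open>Numbers below \<open>p * p\<close> are ordered lexicographically by high and low part:
  the least high part is the minimum of the summary, and the least low part is the minimum of that
  cluster.\<close>

lemma subrep_Min:
  assumes s: "subrep m p a Y" and p: "0 < p" and Y: "Y \<noteq> {}" "finite Y" "Y \<subseteq> {..<p * p}"
  shows "(m (a + 2) - 1) * p + (m (clu a p (m (a + 2) - 1)) - 1) = Min Y"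
proof -
  have r: "rep m p (a + 2) ((\<lambda>x. x div p) ` Y)" using s by (simp add: subrep_def)
  define c where "c = Min ((\<lambda>x. x div p) ` Y)"
  have c: "m (a + 2) = Suc c" using rep_cells(2)[OF r] Y by (simp add: c_def)
  have c_in: "c \<in> (\<lambda>x. x div p) ` Y" unfolding c_def using Y by (intro Min_in) auto
  then have cp: "c < p" using Y(3) p by (auto simp: less_mult_imp_div_less)
  have rc: "rep m p (clu a p c) (slice p c Y)" by (rule subrep_inD[OF s cp])
  have ne: "slice p c Y \<noteq> {}" using c_in by (simp only: slice_image[OF p])
  define y where "y = Min (slice p c Y)"
  have y: "m (clu a p c) = Suc y" using rep_cells(2)[OF rc] ne by (simp add: y_def)
  have y_in: "y \<in> slice p c Y" unfolding y_def using ne rep_finite[OF rc] by (intro Min_in)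
  have "c * p + y \<le> z" if z: "z \<in> Y" for z
  proof -
    have "c \<le> z div p" unfolding c_def using z Y by (intro Min_le) auto
    then consider "c = z div p" | "Suc c \<le> z div p" by linarith
    then show ?thesis
    proof cases
      case 1
      then have "z mod p \<in> slice p c Y" using mem_slice[OF p] z by simp
      then have "y \<le> z mod p" unfolding y_def using rep_finite[OF rc] by simp
      then show ?thesis using 1 div_mult_mod_eq[of z p] by (metis add_le_cancel_left)
    next
      case 2
      have "y < p" using y_in by (simp add: slice_def)
      moreover have "Suc c * p \<le> z div p * p" using 2 by (rule mult_le_mono1)
      ultimately show ?thesis using div_mult_mod_eq[of z p] unfolding mult_Suc by linarith
    qed
  qed
  then have "Min Y = c * p + y" using y_in Y by (intro Min_eqI) (auto simp: slice_def)
  then show ?thesis using c y by simp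
qed

lemma subrep_Max:
  assumes s: "subrep m p a Y" and p: "0 < p" and Y: "Y \<noteq> {}" "finite Y" "Y \<subseteq> {..<p * p}"
  shows "(m (a + 3) - 1) * p + (m (Suc (clu a p (m (a + 3) - 1))) - 1) = Max Y"
proof -
  have r: "rep m p (a + 2) ((\<lambda>x. x div p) ` Y)" using s by (simp add: subrep_def)
  define c where "c = Max ((\<lambda>x. x div p) ` Y)"
  have c: "m (a + 3) = Suc c" using rep_cells(3)[OF r] Y by (simp add: c_def eval_nat_numeral)
  have c_in: "c \<in> (\<lambda>x. x div p) ` Y" unfolding c_def using Y by (intro Max_in) auto
  then have cp: "c < p" using Y(3) p by (auto simp: less_mult_imp_div_less)
  have rc: "rep m p (clu a p c) (slice p c Y)" by (rule subrep_inD[OF s cp])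
  have ne: "slice p c Y \<noteq> {}" using c_in by (simp only: slice_image[OF p])
  define y where "y = Max (slice p c Y)"
  have y: "m (Suc (clu a p c)) = Suc y" using rep_cells(3)[OF rc] ne by (simp add: y_def)
  have y_in: "y \<in> slice p c Y" unfolding y_def using ne rep_finite[OF rc] by (intro Max_in)
  have "z \<le> c * p + y" if z: "z \<in> Y" for z
  proof -
    have "z div p \<le> c" unfolding c_def using z Y by (intro Max_ge) auto
    then consider "c = z div p" | "Suc (z div p) \<le> c" by linarith
    then show ?thesis
    proof cases
      case 1
      then have "z mod p \<in> slice p c Y" using mem_slice[OF p] z by simp
      then have "z mod p \<le> y" unfolding y_def using rep_finite[OF rc] by simp
      then show ?thesis using 1 div_mult_mod_eq[of z p] by (metis add_le_cancel_left)
    next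
      case 2
      have "z mod p < p" using p by simp
      moreover have "Suc (z div p) * p \<le> c * p" using 2 by (rule mult_le_mono1)
      ultimately show ?thesis using div_mult_mod_eq[of z p] unfolding mult_Suc by linarith
    qed
  qed
  then have "Max Y = c * p + y" using y_in Y by (intro Max_eqI) (auto simp: slice_def)
  then show ?thesis using c y by simp
qed

text \<open>The constant time part of a deletion. Promoting \<open>x'\<close> to the vacated extreme
  position turns the removal of \<open>x\<close> into the removal of \<open>x'\<close> from the
  recursive part; if \<open>x\<close> is not extreme, \<open>x' = x\<close>.\<close>

lemma vdel_step:
  assumes r: "rep m u a X" and x: "x \<in> X" and 3: "inner X \<noteq> {}"
  defines "x' \<equiv> del_key (usqrt u) a x m" and "m' \<equiv> del_mem (usqrt u) a x m"
  shows "Min X < Max X" "2 < u" "x' \<in> inner X" "inner (X - {x}) = inner X - {x'}" "X - {x} \<noteq> {}"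
    "m' a = Suc (Min (X - {x}))" "m' (Suc a) = Suc (Max (X - {x}))"
    "subrep m' (usqrt u) a (inner X)" "subrep m (usqrt u) a (inner X)"
proof -
  have fin: "finite X" using r by (rule rep_finite)
  note cells = rep_cells[OF r]
  have ne: "X \<noteq> {}" using x by auto
  have mm: "Min X \<in> X" "Max X \<in> X" using ne fin by auto
    have inn: "Min X < z" "z < Max X" "z \<in> X" if "z \<in> inner X" for z
      using inner_between[OF fin that] by auto
  show lt: "Min X < Max X" using 3 inn by fastforce
  have nz: "m (a + 2) \<noteq> 0" using inner_empty[OF r] 3 by simp
  show u: "2 < u" using nz r by (cases "u \<le> 2") (simp_all add: rep_iff[of m u])
  define p where "p = usqrt u"
  have p: "p < u" "0 < p" "u \<le> p * p"
    using usqrt_less[OF u] usqrt_ge2[OF u] usqrt_sq[of u] by (auto simp: p_def)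
  show sub0': "subrep m (usqrt u) a (inner X)" using r u by (simp add: rep_iff)
  then have sub0: "subrep m p a (inner X)" by (simp add: p_def)
  have fi: "finite (inner X)" using fin by (simp add: inner_def)
  have sbs: "inner X \<subseteq> {..<p * p}" using cells(1) p(3) by (auto simp: inner_def)
  have x': "x' = (if x = Min X then Min (inner X) else if x = Max X then Max (inner X) else x)"
    unfolding x'_def del_key_def p_def[symmetric] subrep_Min[OF sub0 p(2) 3(1) fi sbs] subrep_Max[OF sub0 p(2) 3(1) fi sbs]
    using cells ne by simp
  show "subrep m' (usqrt u) a (inner X)"
    by (rule subrep_frame[OF sub0']) (simp add: m'_def del_mem_def)
  note m'_def = m'_def[unfolded del_mem_def x'_def[symmetric]]
  have "x' \<in> inner X \<and> inner (X - {x}) = inner X - {x'} \<and> X - {x} \<noteq> {} \<and>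
    m' a = Suc (Min (X - {x})) \<and> m' (Suc a) = Suc (Max (X - {x}))"
  proof -
    consider "x = Min X" | "x = Max X" | "x \<in> inner X"
      using x by (auto simp: inner_def)
    then show ?thesis
    proof cases
      case c: 1
      have x'm: "x' = Min (inner X)" using c x' by simp
      have x'i: "x' \<in> inner X" unfolding x'm using fi 3 by (intro Min_in)
      have lo: "x' \<le> z" if "z \<in> X - {x}" for z
      proof (cases "z = Max X")
        case False
        then have "z \<in> inner X" using that c by (auto simp: inner_def)
        then show ?thesis unfolding x'm using fi by simp
      qed (use inn[OF x'i] in simp)
      have mi: "Min (X - {x}) = x'"
        using lo fin x'i by (intro Min_eqI) (auto simp: inner_def c)
      have ma: "Max (X - {x}) = Max X"
        using mm lt c fin by (intro Max_eqI) auto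
      have "inner (X - {x}) = inner X - {x'}" unfolding inner_def mi ma using c by auto
      moreover have "m' = m(a := Suc x')" using c cells ne by (simp add: m'_def)
      ultimately show ?thesis using x'i mi ma mm lt c cells ne by auto
    next
      case c: 2
      have x'm: "x' = Max (inner X)" using c x' lt by simp
      have x'i: "x' \<in> inner X" unfolding x'm using fi 3 by (intro Max_in)
      have hi: "z \<le> x'" if "z \<in> X - {x}" for z
      proof (cases "z = Min X")
        case False
        then have "z \<in> inner X" using that c by (auto simp: inner_def)
        then show ?thesis unfolding x'm using fi by simp
      qed (use inn[OF x'i] in simp)
      have ma: "Max (X - {x}) = x'"
        using hi fin x'i by (intro Max_eqI) (auto simp: inner_def c)
      have mi: "Min (X - {x}) = Min X"
        using mm lt c fin by (intro Min_eqI) auto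
      have "inner (X - {x}) = inner X - {x'}" unfolding inner_def mi ma using c by auto
      moreover have "m' = m(Suc a := Suc x')" using c cells ne lt by (simp add: m'_def)
      ultimately show ?thesis using x'i mi ma mm lt c cells ne by auto
    next
      case c: 3
      note ci = inn[OF c]
      have "x' = x" using ci x' by simp
      moreover have mi: "Min (X - {x}) = Min X" using mm ci fin by (intro Min_eqI) auto
      moreover have ma: "Max (X - {x}) = Max X" using mm ci fin by (intro Max_eqI) auto
      moreover have "inner (X - {x}) = inner X - {x}" unfolding inner_def mi ma by auto
      moreover have "m' = m" using ci cells ne by (simp add: m'_def)
      ultimately show ?thesis using c mm ci cells ne by auto
    qed
  qed
  then show "x' \<in> inner X" "inner (X - {x}) = inner X - {x'}" "X - {x} \<noteq> {}"
    "m' a = Suc (Min (X - {x}))" "m' (Suc a) = Suc (Max (X - {x}))" by auto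
qed

lemma vdel_correct:
  assumes "rep m u a X" "x \<in> X"
  shows "rep (vdel u a x m) u a (X - {x}) \<and>
    (\<forall>i. i < a \<or> a + sz u \<le> i \<longrightarrow> vdel u a x m i = m i)"
  using assms
proof (induction u arbitrary: m a X x rule: less_induct)
  case (less u)
  note r = less.prems(1)
  have fin: "finite X" using r by (rule rep_finite)
  have s3: "3 \<le> sz u" by (rule sz_ge3)
  note cells = rep_cells[OF r]
  have ne: "X \<noteq> {}" using less.prems(2) by auto
  have mm: "Min X \<in> X" "Max X \<in> X" using ne fin by auto
  have xb: "Min X \<le> x" "x \<le> Max X" using fin less.prems(2) by auto
  consider "Min X = Max X" | "Min X \<noteq> Max X" "inner X = {}" | "inner X \<noteq> {}" "Min X \<noteq> Max X" by blast
  then show ?case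
  proof cases
    case 1
    have X: "X = {x}"
    proof (intro equalityI subsetI)
      fix z assume "z \<in> X"
      then have "Min X \<le> z" "z \<le> Max X" using fin by auto
      then show "z \<in> {x}" using 1 xb by simp
    qed (use less.prems in auto)
    then have "vdel u a x m = m(a := 0, Suc a := 0)" using cells by (subst vdel.simps) simp
    moreover have "rep (m(a := 0, Suc a := 0)) u a {}"
      using X rep_clear r by blast
    moreover have "X - {x} = {}" using X by simp
    ultimately show ?thesis using s3 by (simp only:) auto
  next
    case 2
    then have X: "X = {Min X, Max X}" using mm by (auto simp: inner_def)
    have mem: "z \<in> X \<longleftrightarrow> z = Min X \<or> z = Max X" for z using mm 2(2) by (auto simp: inner_def)
    have z: "m (a + 2) = 0" using inner_empty[OF r] 2 by simp
    have lt: "Min X < Max X" using 2 xb by linarith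
    consider "x = Min X" | "x = Max X" using X less.prems(2) by blast
    then show ?thesis
    proof cases
      case c: 1
      have "vdel u a x m = m(a := m (Suc a))" using c z lt ne cells(2,3) by (subst vdel.simps) simp
      moreover have "X - {x} = {Max X}" by (intro set_eqI) (use mem c lt in auto)
      moreover have "rep (m(a := m (Suc a))) u a {Max X}"
      proof (rule rep_update[OF r])
        show "{Max X} \<subseteq> {..<u}" using cells(1) mm(2) by blast
      qed (simp_all add: 2 cells ne)
      ultimately show ?thesis using s3 by (simp only:) auto
    next
      case c: 2
      have "vdel u a x m = m(Suc a := m a)" using c z lt ne cells(2,3) by (subst vdel.simps) simp
      moreover have "X - {x} = {Min X}" by (intro set_eqI) (use mem c lt in auto)
      moreover have "rep (m(Suc a := m a)) u a {Min X}"
      proof (rule rep_update[OF r])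
        show "{Min X} \<subseteq> {..<u}" using cells(1) mm(1) by blast
      qed (simp_all add: 2 cells ne)
      ultimately show ?thesis using s3 by (simp only:) auto
    qed
  next
    case 3
    define p where "p = usqrt u"
    define x' where "x' = del_key p a x m"
    define m' where "m' = del_mem p a x m"
    define b where "b = clu a p (x' div p)"
    note key = vdel_step[OF less.prems 3(1), folded p_def, folded x'_def m'_def]
    have p: "p < u" "0 < p" "u \<le> p * p"
      using usqrt_less[OF key(2)] usqrt_ge2[OF key(2)] usqrt_sq[of u] by (auto simp: p_def)
    have sz: "a + sz u = a + 2 + Suc p * sz p"
      using key(2) by (simp add: sz.simps[of u] p_def[symmetric])
    have nz: "m (a + 2) \<noteq> 0" using inner_empty[OF r] 3 by simp
    have sbs: "inner X \<subseteq> {..<p * p}" using cells(1) p(3) by (auto simp: inner_def)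
    define m'' where "m'' = (if m' b = m' (Suc b) then vdel p (a + 2) (x' div p) (m'(b := 0, Suc b := 0))
          else vdel p b (x' mod p) m')"
    have m'': "vdel u a x m = m''"
    proof -
      have "m a \<noteq> m (Suc a)" "\<not> u \<le> 2" using cells ne key(1,2) by simp_all
      then show ?thesis using nz
        by (subst vdel.simps) (simp only: Let_def m''_def p_def[symmetric] x'_def[symmetric] m'_def[symmetric]
            b_def[symmetric] if_False)
    qed
    have x'lt: "x' < p * p" using key(3) sbs by auto
    have 4: "subrep m'' p a (inner X - {x'})"
      "\<And>i. i < a + 2 \<or> a + 2 + Suc p * sz p \<le> i \<Longrightarrow> m'' i = m' i"
      using subrep_delete[OF key(8) p(2) key(3) x'lt less.IH[OF p(1)] b_def]
      unfolding Let_def m''_def[symmetric] by (auto simp del: mult_Suc)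
    have "rep m'' u a (X - {x})"
      using 4(1) 4(2)[of a] 4(2)[of "Suc a"] key cells(1)
      by (auto simp: rep_iff[of m''] p_def[symmetric] simp del: mult_Suc)
    moreover have "m'' i = m i" if "i < a \<or> a + sz u \<le> i" for i
    proof -
      have "m'' i = m' i" using that unfolding sz by (intro 4(2)) auto
      also have "m' i = m i" using that s3 by (auto simp: m'_def del_mem_def)
      finally show ?thesis .
    qed
    ultimately show ?thesis unfolding m'' by blast
  qed
qed

section \<open>Correctness of the predecessor search\<close>

definition is_pred :: "nat set \<Rightarrow> nat \<Rightarrow> nat \<Rightarrow> bool" where
  "is_pred X x v \<longleftrightarrow> (case v of 0 \<Rightarrow> \<forall>y\<in>X. \<not> y < x
     | Suc y \<Rightarrow> y \<in> X \<and> y < x \<and> (\<forall>z\<in>X. z < x \<longrightarrow> z \<le> y))"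

text \<open>An inner key below \<open>x\<close> lies in an earlier cluster, or in the cluster of
  \<open>x\<close> with a smaller low part. The minimum of that cluster tells in constant time
  whether the second case occurs, and the maximum of an earlier cluster is read off directly, so one
  recursive call suffices.\<close>

lemma vpred_correct:
  assumes "rep m u a X" "x < u"
  shows "is_pred X x (vpred u a x m)"
  using assms
proof (induction u arbitrary: a X x rule: less_induct)
  case (less u)
  note r = less.prems(1)
  have fin: "finite X" using r by (rule rep_finite)
  note cells = rep_cells[OF r]
  show ?case
  proof (cases "Suc x \<le> m a")
    case True
    then have "X \<noteq> {}" "x \<le> Min X" using cells by (auto split: if_splits)
    then have "\<forall>y\<in>X. \<not> y < x" using fin Min_le by fastforce
    then show ?thesis using True by (subst vpred.simps) (simp add: is_pred_def)
  next
    case F1: False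
    show ?thesis
    proof (cases "m (Suc a) < Suc x")
      case True
      then have v: "vpred u a x m = m (Suc a)" using F1 by (subst vpred.simps) simp
      show ?thesis
      proof (cases "X = {}")
        case False
        then have "Max X \<in> X" "\<forall>z\<in>X. z \<le> Max X" "m (Suc a) = Suc (Max X)" using fin cells by auto
        then show ?thesis using True unfolding v by (simp add: is_pred_def)
      qed (use cells v in \<open>simp add: is_pred_def\<close>)
    next
      case F2: False
      then have ne: "X \<noteq> {}" using cells by auto
      have mm: "Min X \<in> X" "Max X \<in> X" using ne fin by auto
      have xb: "Min X < x" "x \<le> Max X" using F1 F2 cells ne by auto
      \<comment> \<open>\<open>x\<close> does not exceed the maximum, so a key below
        \<open>x\<close> cannot be the maximum.\<close>
      have char: "z = Min X \<or> z \<in> inner X" if "z \<in> X" "z < x" for z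
        using that xb by (auto simp: inner_def)
      show ?thesis
      proof (cases "m (a + 2) = 0")
        case True
        then have "inner X = {}" using inner_empty[OF r] by simp
        then have "\<forall>z\<in>X. z < x \<longrightarrow> z \<le> Min X" using char by blast
        moreover have "vpred u a x m = Suc (Min X)" using True F1 F2 cells ne by (subst vpred.simps) simp
        ultimately show ?thesis using mm xb by (simp add: is_pred_def)
      next
        case nz: False
        have u: "2 < u" using nz r by (cases "u \<le> 2") (simp_all add: rep_iff[of m u])
        define p where "p = usqrt u"
        have p: "p < u" "0 < p" "u \<le> p * p"
          using usqrt_less[OF u] usqrt_ge2[OF u] usqrt_sq[of u] by (auto simp: p_def)
        have sub: "subrep m p a (inner X)" using r u by (simp add: rep_iff p_def)
        let ?c = "x div p" and ?y = "x mod p"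
        define b where "b = clu a p ?c"
        have c: "?c < p" using less.prems(2) p by (simp add: less_mult_imp_div_less)
        have y: "?y < p" using p by simp
        have rc: "rep m p b (slice p ?c (inner X))" unfolding b_def by (rule subrep_inD[OF sub c])
        have rs: "rep m p (a + 2) ((\<lambda>x. x div p) ` inner X)" using sub by (simp add: subrep_def)
        have xeq: "x = ?c * p + ?y" by simp
        have split: "z div p < ?c \<or> z div p = ?c \<and> z mod p < ?y" if "z < x" for z
        proof -
          have "z div p \<le> ?c" using that by (intro div_le_mono) simp
          moreover have "z mod p < ?y" if "z div p = ?c"
            using \<open>z < x\<close> xeq div_mult_mod_eq[of z p] that by (metis add_less_cancel_left)
          ultimately show ?thesis by linarith
        qed
        have unf: "vpred u a x m = (if 0 < m b \<and> m b < Suc ?y then ?c * p + vpred p b ?y m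
          else let v = vpred p (a + 2) ?c m
            in if v = 0 then m a else (v - 1) * p + m (Suc (clu a p (v - 1))))"
          using F1 F2 nz u
          by (subst vpred.simps) (simp only: Let_def p_def[symmetric] b_def[symmetric] if_False not_le[symmetric])
        show ?thesis
        proof (cases "0 < m b \<and> m b < Suc ?y")
          case True
          have "is_pred (slice p ?c (inner X)) ?y (vpred p b ?y m)"
            by (rule less.IH[OF p(1) rc y])
          moreover have "\<exists>z\<in>slice p ?c (inner X). z < ?y"
            using True rep_cells(2)[OF rc] rep_Min_Max(1)[OF rc] by (auto split: if_splits)
          ultimately obtain v where v: "vpred p b ?y m = Suc v" "v \<in> slice p ?c (inner X)" "v < ?y"
            "\<forall>z\<in>slice p ?c (inner X). z < ?y \<longrightarrow> z \<le> v"
            by (cases "vpred p b ?y m") (auto simp: is_pred_def)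
          have vi: "?c * p + v \<in> inner X" using v(2) by (simp add: slice_def)
          have "z \<le> ?c * p + v" if z: "z \<in> X" "z < x" for z
            using char[OF z]
          proof
            assume "z = Min X"
            then show ?thesis using inner_between(1)[OF fin vi] by simp
          next
            assume zi: "z \<in> inner X"
            show ?thesis
              using split[OF z(2)]
            proof (elim disjE conjE)
              assume "z div p < ?c"
              then have "Suc (z div p) * p \<le> ?c * p" by (intro mult_le_mono1) simp
              moreover have "z mod p < p" using p by simp
              ultimately show ?thesis using div_mult_mod_eq[of z p] unfolding mult_Suc by linarith
            next
              assume e: "z div p = ?c" "z mod p < ?y"
              then have "z mod p \<in> slice p ?c (inner X)" using mem_slice[OF p(2)] zi by metis
              then show ?thesis using v(4) e div_mult_mod_eq[of z p] by (metis add_le_cancel_left)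
            qed
          qed
          moreover have "?c * p + v < x" using v(3) xeq by linarith
          moreover have "vpred u a x m = Suc (?c * p + v)" unfolding unf using True v(1) by simp
          ultimately show ?thesis using inner_between(3)[OF fin vi] by (simp add: is_pred_def)
        next
          case False
          have none: "\<not> z < ?y" if "z \<in> slice p ?c (inner X)" for z
            using False that rep_cells(2)[OF rc] rep_Min_Max(3)[OF rc, of z] by (auto split: if_splits)
          have div_less: "z div p < ?c" if "z \<in> inner X" "z < x" for z
            using split[OF that(2)] none mem_slice[OF p(2)] that(1) by metis
          have ps: "is_pred ((\<lambda>x. x div p) ` inner X) ?c (vpred p (a + 2) ?c m)"
            by (rule less.IH[OF p(1) rs c])
          show ?thesis
          proof (cases "vpred p (a + 2) ?c m")
            case 0
            \<comment> \<open>No earlier cluster is occupied, which leaves the minimum, stored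
              outside the recursive part, as the answer.\<close>
            then have "\<not> z div p < ?c" if "z \<in> inner X" for z using ps that by (simp add: is_pred_def)
            then have "\<forall>z\<in>X. z < x \<longrightarrow> z \<le> Min X" using char div_less by blast
            moreover have "vpred u a x m = Suc (Min X)" unfolding unf using False 0 cells ne by auto
            ultimately show ?thesis using mm xb by (simp add: is_pred_def)
          next
            case (Suc d)
            then have d: "d \<in> (\<lambda>x. x div p) ` inner X" "d < ?c"
              "\<forall>z\<in>inner X. z div p < ?c \<longrightarrow> z div p \<le> d" using ps by (auto simp: is_pred_def)
            have rd: "rep m p (clu a p d) (slice p d (inner X))"
              using d(2) c by (intro subrep_inD[OF sub]) simp
            have sne: "slice p d (inner X) \<noteq> {}" using d(1) by (simp only: slice_image[OF p(2)])
            define v where "v = Max (slice p d (inner X))"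
            have v: "v \<in> slice p d (inner X)" "\<And>z. z \<in> slice p d (inner X) \<Longrightarrow> z \<le> v"
              unfolding v_def using rep_Min_Max[OF rd sne] by auto
            have vi: "d * p + v \<in> inner X" "v < p" using v(1) by (auto simp: slice_def)
            have mv: "m (Suc (clu a p d)) = Suc v" using rep_cells(3)[OF rd] sne by (simp add: v_def)
            have "z \<le> d * p + v" if z: "z \<in> X" "z < x" for z
              using char[OF z]
            proof
              assume "z = Min X"
              then show ?thesis using inner_between(1)[OF fin vi(1)] by simp
            next
              assume zi: "z \<in> inner X"
              then have "z div p \<le> d" using d(3) div_less z by blast
              then consider "z div p = d" | "Suc (z div p) \<le> d" by linarith
              then show ?thesis
              proof cases
                case 1
                then have "z mod p \<le> v" using v(2) mem_slice[OF p(2)] zi by metis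
                then show ?thesis using 1 div_mult_mod_eq[of z p] by (metis add_le_cancel_left)
              next
                case 2
                then have "Suc (z div p) * p \<le> d * p" by (intro mult_le_mono1)
                moreover have "z mod p < p" using p by simp
                ultimately show ?thesis using div_mult_mod_eq[of z p] unfolding mult_Suc by linarith
              qed
            qed
            moreover have "d * p + v < x"
            proof -
              have "Suc d * p \<le> ?c * p" using d(2) by (intro mult_le_mono1) simp
              then show ?thesis using vi(2) xeq unfolding mult_Suc by linarith
            qed
            moreover have "vpred u a x m = Suc (d * p + v)"
              unfolding unf Suc using False mv by (auto simp: Let_def)
            ultimately show ?thesis using inner_between(3)[OF fin vi(1)] by (simp add: is_pred_def)
          qed
        qed
      qed
    qed
  qed
qed

section \<open>Programs for van Emde Boas sets\<close>

abbreviation Add_exp (infixl "[+]" 65) where "a [+] b \<equiv> Bin Add a b"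
abbreviation Sub_exp (infixl "[-]" 65) where "a [-] b \<equiv> Bin Sub a b"
abbreviation Mul_exp (infixl "[*]" 70) where "a [*] b \<equiv> Bin Mul a b"
abbreviation Div_exp (infixl "[div]" 70) where "a [div] b \<equiv> Bin Div a b"
abbreviation Mod_exp (infixl "[mod]" 70) where "a [mod] b \<equiv> Bin Mod a b"
abbreviation Asg_com (infix "::=" 62) where "v ::= e \<equiv> Asg v e"
abbreviation Seq_com (infixr ";;" 61) where "c1 ;; c2 \<equiv> Seq c1 c2"

text \<open>Registers from 40 on are scratch space of the set operations; their specifications
  preserve only the registers below 40, where the callers keep their data.\<close>

abbreviation (input) vKey :: nat where "vKey \<equiv> 40"
abbreviation (input) vRes :: nat where "vRes \<equiv> 41"
abbreviation (input) vBase :: nat where "vBase \<equiv> 42"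
abbreviation (input) vLev :: nat where "vLev \<equiv> 43"
abbreviation (input) vRoot :: nat where "vRoot \<equiv> 44"
abbreviation (input) vClu :: nat where "vClu \<equiv> 45"
abbreviation (input) vMin :: nat where "vMin \<equiv> 46"
abbreviation (input) vMax :: nat where "vMax \<equiv> 47"
abbreviation (input) vTmp :: nat where "vTmp \<equiv> 48"
abbreviation (input) vGo :: nat where "vGo \<equiv> 49"
abbreviation (input) vHi :: nat where "vHi \<equiv> 50"
abbreviation (input) vLo :: nat where "vLo \<equiv> 51"
abbreviation (input) vOld :: nat where "vOld \<equiv> 52"
abbreviation (input) vIn :: nat where "vIn \<equiv> 53"

abbreviation (input) aRoot :: nat where "aRoot \<equiv> 5"
abbreviation (input) aSize :: nat where "aSize \<equiv> 6"
abbreviation (input) aStackClu :: nat where "aStackClu \<equiv> 7"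
abbreviation (input) aStackBase :: nat where "aStackBase \<equiv> 8"

text \<open>Root and size are read from tables indexed by the recursion level, because the summary
  and the clusters below a level all have the same universe. So no root is computed during an
  operation.\<close>

definition descend :: com where
  "descend = (vRoot ::= Arr aRoot (V vLev);; vHi ::= V vKey [div] V vRoot;; vLo ::= V vKey [mod] V vRoot;;
    vClu ::= (V vBase [+] N 2) [+] (V vHi [+] N 1) [*] Arr aSize (V vLev);; vLev ::= V vLev [+] N 1)"

definition ins_minmax :: "nat \<Rightarrow> com" where
  "ins_minmax k =
    Cond (V vKey [+] N 1) (V vMin)
      (St k (V vBase) (V vKey [+] N 1);; vKey ::= V vMin [-] N 1)
      (Cond (V vMax) (V vKey [+] N 1)
        (St k (V vBase [+] N 1) (V vKey [+] N 1);; vKey ::= V vMax [-] N 1) Skip)"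

text \<open>One recursion level per round: the recursion of \<open>vins\<close> is a tail call and
  becomes a loop over base address, level and key, ended by clearing \<open>vGo\<close>.\<close>

definition ins_body :: "nat \<Rightarrow> com" where
  "ins_body k = (
    vMin ::= Arr k (V vBase);; vMax ::= Arr k (V vBase [+] N 1);;
    Cond (V vMin) (N 1)
     (St k (V vBase) (V vKey [+] N 1);; St k (V vBase [+] N 1) (V vKey [+] N 1);; vGo ::= N 0)
     (Cond (V vMin) (V vMax)
       (ins_minmax k;; descend;;
        Cond (Arr k (V vClu)) (N 1)
          (St k (V vClu) (V vLo [+] N 1);; St k (V vClu [+] N 1) (V vLo [+] N 1);;
           vKey ::= V vHi;; vBase ::= V vBase [+] N 2)
          (vKey ::= V vLo;; vBase ::= V vClu))
       (Cond (V vKey [+] N 1) (V vMin)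
          (St k (V vBase) (V vKey [+] N 1)) (St k (V vBase [+] N 1) (V vKey [+] N 1));;
        vGo ::= N 0)))"

abbreviation veb_start :: com where
  "veb_start \<equiv> (vBase ::= N 0;; vLev ::= N 0;; vGo ::= N 1)"

definition veb_ins :: "nat \<Rightarrow> com" where
  "veb_ins k = (veb_start;; Loop (N 0) (V vGo) (ins_body k))"

definition del_minmax :: "nat \<Rightarrow> com" where
  "del_minmax k =
    Cond (V vMin) (V vKey [+] N 1)
      (Cond (V vKey [+] N 1) (V vMax) Skip
        (vHi ::= Arr k (V vBase [+] N 3) [-] N 1;;
         vClu ::= (V vBase [+] N 2) [+] (V vHi [+] N 1) [*] Arr aSize (V vLev);;
         vKey ::= V vHi [*] Arr aRoot (V vLev) [+] (Arr k (V vClu [+] N 1) [-] N 1);;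
         St k (V vBase [+] N 1) (V vKey [+] N 1)))
      (vHi ::= V vTmp [-] N 1;;
       vClu ::= (V vBase [+] N 2) [+] (V vHi [+] N 1) [*] Arr aSize (V vLev);;
       vKey ::= V vHi [*] Arr aRoot (V vLev) [+] (Arr k (V vClu) [-] N 1);;
       St k (V vBase) (V vKey [+] N 1))"

definition del_body :: "nat \<Rightarrow> com" where
  "del_body k = (
    vMin ::= Arr k (V vBase);; vMax ::= Arr k (V vBase [+] N 1);;
    Cond (V vMin) (V vMax)
     (vTmp ::= Arr k (V vBase [+] N 2);;
      Cond (V vTmp) (N 1)
       (Cond (V vKey [+] N 1) (V vMax) (St k (V vBase) (V vMax)) (St k (V vBase [+] N 1) (V vMin));;
        vGo ::= N 0)
       (del_minmax k;;
        descend;;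
        Cond (Arr k (V vClu)) (Arr k (V vClu [+] N 1))
          (vKey ::= V vLo;; vBase ::= V vClu)
          (St k (V vClu) (N 0);; St k (V vClu [+] N 1) (N 0);;
           vKey ::= V vHi;; vBase ::= V vBase [+] N 2)))
     (St k (V vBase) (N 0);; St k (V vBase [+] N 1) (N 0);; vGo ::= N 0))"

definition veb_del :: "nat \<Rightarrow> com" where
  "veb_del k = (veb_start;; Loop (N 0) (V vGo) (del_body k))"

text \<open>The descent of the predecessor search pushes for each level the address of the structure
  and 0 if it continues in the summary, and 1 more than the cluster number otherwise. The ascent
  then computes the result.\<close>

definition pred_down :: "nat \<Rightarrow> com" where
  "pred_down k = (
    vMin ::= Arr k (V vBase);; vMax ::= Arr k (V vBase [+] N 1);;
    Cond (V vMin) (V vKey [+] N 1)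
     (Cond (V vMax) (V vKey [+] N 1) (vRes ::= V vMax;; vGo ::= N 0)
       (Cond (Arr k (V vBase [+] N 2)) (N 1) (vRes ::= V vMin;; vGo ::= N 0)
         (St aStackBase (V vLev) (V vBase);; vOld ::= V vLev;;
          descend;;
          vTmp ::= Arr k (V vClu);; vIn ::= N 0;;
          Cond (N 0) (V vTmp) (Cond (V vTmp) (V vLo [+] N 1) (vIn ::= N 1) Skip) Skip;;
          Cond (N 0) (V vIn)
            (St aStackClu (V vOld) (V vHi [+] N 1);; vKey ::= V vLo;; vBase ::= V vClu)
            (St aStackClu (V vOld) (N 0);; vKey ::= V vHi;; vBase ::= V vBase [+] N 2))))
     (vRes ::= N 0;; vGo ::= N 0))"

definition pred_up :: "nat \<Rightarrow> com" where
  "pred_up k = (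
    vLev ::= V vLev [-] N 1;; vHi ::= Arr aStackClu (V vLev);;
    Cond (N 0) (V vHi)
      (vRes ::= (V vHi [-] N 1) [*] Arr aRoot (V vLev) [+] V vRes)
      (vBase ::= Arr aStackBase (V vLev);;
       Cond (V vRes) (N 1) (vRes ::= Arr k (V vBase))
         (vRes ::= (V vRes [-] N 1) [*] Arr aRoot (V vLev) [+]
            Arr k (((V vBase [+] N 2) [+] V vRes [*] Arr aSize (V vLev)) [+] N 1))))"

definition veb_pred :: "nat \<Rightarrow> com" where
  "veb_pred k = (veb_start;; Loop (N 0) (V vGo) (pred_down k);; Loop (N 0) (V vLev) (pred_up k))"

definition lev :: "nat \<Rightarrow> nat \<Rightarrow> nat" where
  "lev u i = (usqrt ^^ i) u"

lemma lev_simps [simp]: "lev u 0 = u" "lev u (Suc i) = usqrt (lev u i)"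
  by (simp_all add: lev_def)

lemma dep_lev: "dep (lev u i) = dep u - i"
proof (induction i)
  case (Suc i)
  have "dep (usqrt v) = dep v - 1" for v
    using usqrt_le[of v 2] by (cases "v \<le> 2") (auto simp: dep.simps[of v] dep.simps[of "usqrt v"])
  then show ?case using Suc by simp
qed simp

lemma less_dep: "2 < lev u i \<longleftrightarrow> i < dep u"
  using dep_lev[of u i] dep.simps[of "lev u i"] by (auto split: if_splits)

lemma dep_le_self: "dep u \<le> u"
proof (rule dep_le)
  have "u < 2 ^ u" by (rule less_exp)
  also have "(2 :: nat) ^ u \<le> 2 ^ 2 ^ u" using less_exp[of u] by (intro power_increasing) auto
  finally show "u \<le> 2 ^ 2 ^ u" by simp
qed

section \<open>Execution of the set operations under word bounds\<close>

context ram
begin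

text \<open>An opaque name for \<open>2 ^ w\<close>, so that overflow conditions become linear facts
  about an atom.\<close>

definition W :: nat where "W = 2 ^ w"

lemma ok_W:
  "ok r h (N c) \<longleftrightarrow> c < W"
  "ok r h (V v) \<longleftrightarrow> True"
  "ok r h (Bin f a b) \<longleftrightarrow> ok r h a \<and> ok r h b \<and> (f = Sub \<longrightarrow> val r h b \<le> val r h a) \<and>
     val r h (Bin f a b) < W"
  "ok r h (Arr k e) \<longleftrightarrow> ok r h e \<and> val r h e < B"
  "ok r h (Edges e) \<longleftrightarrow> ok r h e \<and> val r h (Edges e) < W"
  "ok r h (EPred e e') \<longleftrightarrow> ok r h e \<and> ok r h e' \<and> val r h (EPred e e') < W"
  "ok r h (ESucc e e') \<longleftrightarrow> ok r h e \<and> ok r h e' \<and> val r h (ESucc e e') < W"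
  "ok r h (ETarget e e') \<longleftrightarrow> ok r h e \<and> ok r h e' \<and> val r h (ETarget e e') < W"
  "ok r h (Look e a b) \<longleftrightarrow> ok r h e \<and> ok r h a \<and> ok r h b \<and> val r h (Look e a b) < W"
  "ok r h (Failure e) \<longleftrightarrow> ok r h e \<and> val r h (Failure e) < W"
  "ok r h (Output e) \<longleftrightarrow> ok r h e \<and> val r h (Output e) < W"
  "ok r h (Level e) \<longleftrightarrow> ok r h e \<and> val r h (Level e) < W"
  by (auto simp: W_def)

declare ok.simps [simp del] ok_W [simp]

end

text \<open>Besides the \<open>sz U\<close> cells of a set, the slack in \<open>U_B\<close> covers
  keys, recursion levels and the literals of the programs.\<close>

locale veb_ram = ram +
  fixes U :: nat
  assumes U_B: "sz U + 3 * U + 200 \<le> B" and B_W: "B < W"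
begin

definition tabs :: "(nat \<Rightarrow> nat \<Rightarrow> nat) \<Rightarrow> bool" where
  "tabs h \<longleftrightarrow> (\<forall>i<dep U. h aRoot i = lev U (Suc i) \<and> h aSize i = sz (lev U (Suc i)))"

lemma tabsD: "tabs h \<Longrightarrow> 2 < lev U l \<Longrightarrow> h aRoot l = usqrt (lev U l) \<and> h aSize l = sz (usqrt (lev U l)) \<and> l < U"
  using less_dep[of U l] dep_le_self[of U] by (auto simp: tabs_def)

lemma lev_le: "lev U l \<le> U"
proof (induction l)
  case (Suc l)
  have "usqrt v \<le> v" for v by (rule usqrt_le) simp
  then show ?case using Suc le_trans[of "usqrt (lev U l)" "lev U l" U] by simp
qed simp

lemma ins_minmax:
  assumes "x' = ins_key a x (h k)" "m' = ins_mem a x (h k)"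
    and "h k a = r vMin" "h k (Suc a) = r vMax" "0 < r vMin" "r vMin < r vMax" "r vBase = a" "r vKey = x"
    and bnd: "Suc x < W" "Suc a < W" "Suc a < B" "r vMax < W" "Suc 0 < W"
  shows "wp (ins_minmax k) (\<lambda>r' h' out' t'. r' = r(vKey := x') \<and> h' = h(k := m') \<and> out' = out \<and>
    t' \<le> t + 5) r h out t"
  using assms by (auto simp: ins_minmax_def ins_key_def ins_mem_def fun_upd_idem)

text \<open>Symbolic execution of a round that recurses, kept apart from the induction over levels.
  \<open>R1\<close> and \<open>R2\<close> are the continuations into the summary and into the
  cluster, matching the two calls of \<open>vins\<close>.\<close>

lemma ins_body_rec:
  assumes "x' = ins_key a x (h k)" "m' = ins_mem a x (h k)" "h aRoot l = p" "h aSize l = z"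
    "b = Suc (Suc (a + Suc (x' div p) * z))"
    and regs: "r vKey = x" "r vBase = a" "r vLev = l"
    and cells: "0 < h k a" "h k a < h k (Suc a)" and k: "8 < k"
    and bnd: "Suc x < W" "Suc a < B" "h k (Suc a) < W" "l < B" "x' < W" "Suc (x' div p) < W"
      "Suc (x' mod p) < W" "Suc b < B" "100 < B" "B < W"
    and R1: "\<And>r' t'. m' b = 0 \<Longrightarrow> (\<forall>v<40. r' v = r v) \<Longrightarrow> r' vGo = r vGo \<Longrightarrow> r' vKey = x' div p \<Longrightarrow>
      r' vBase = Suc (Suc a) \<Longrightarrow> r' vLev = Suc l \<Longrightarrow> t' \<le> t + 25 \<Longrightarrow>
      R r' (h(k := m'(b := Suc (x' mod p), Suc b := Suc (x' mod p)))) out t'"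
    and R2: "\<And>r' t'. m' b \<noteq> 0 \<Longrightarrow> (\<forall>v<40. r' v = r v) \<Longrightarrow> r' vGo = r vGo \<Longrightarrow> r' vKey = x' mod p \<Longrightarrow>
      r' vBase = b \<Longrightarrow> r' vLev = Suc l \<Longrightarrow> t' \<le> t + 25 \<Longrightarrow> R r' (h(k := m')) out t'"
  shows "wp (ins_body k) R r h out t"
proof -
  have k': "k \<noteq> aRoot" "k \<noteq> aSize" using k by auto
  have bnd2: "Suc 0 < W" "0 < W" "2 < W" "a < B" "Suc a < W" "Suc (Suc a) < W" "x' div p < W" "x' mod p < W"
    "Suc (x' div p) * z < W" "b < B" "b < W" "Suc b < W" "Suc l < W"
    using bnd assms(5) by linarith+
  have nz: "h k a \<noteq> 0" using cells(1) by simp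
  show ?thesis
    apply (simp add: ins_body_def regs cells nz bnd bnd2)
    apply (rule wp_mono)
     apply (rule ins_minmax[where h = h and k = k and a = a and x = x, OF assms(1,2)])
               apply (simp_all add: regs cells bnd bnd2)[11]
    apply (elim conjE, hypsubst)
    apply (simp add: descend_def regs k' k'[symmetric] bnd bnd2 assms(3,4) assms(5)[symmetric]
        del: mult_Suc mult_Suc_right)
    apply (intro conjI impI)
    subgoal by (rule R1) simp_all
    subgoal by (rule R2) simp_all
    done
qed

text \<open>The postcondition speaks of \<open>vins\<close> at the current level; by tail recursion
  the same memory is the result of \<open>vins\<close> one level deeper, so \<open>Q\<close> passes
  through unchanged. Each round fits into 30 units.\<close>

lemma ins_loop:
  assumes "rep (h k) u a X" "x < u" "x \<notin> X" "u = lev U l" "tabs h" "8 < k" "a + sz u \<le> sz U"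
    "r vKey = x" "r vBase = a" "r vLev = l" "r vGo = 1"
    and "\<And>r' t'. (\<forall>v<40. r' v = r v) \<Longrightarrow> t' \<le> t + 30 * (dep u + 1) \<Longrightarrow>
      Q r' (h(k := vins u a x (h k))) out t'"
  shows "wp (Loop (N 0) (V vGo) (ins_body k)) Q r h out t"
  using assms
proof (induction u arbitrary: h a X x l r t rule: less_induct)
  case (less u)
  note r = less.prems(1)
  note cells = rep_cells[OF r]
  note regs = less.prems(8-11)
  note Q = less.prems(12)
  have fin: "finite X" using r by (rule rep_finite)
  have s3: "3 \<le> sz u" by (rule sz_ge3)
  have uU: "u \<le> U" using lev_le less.prems(4) by simp
  have bnd: "x < W" "Suc x < W" "Suc a < B" "a < B" "Suc a < W" "a < W" "Suc 0 < W" "0 < W" "2 < W"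
    using U_B B_W s3 less.prems(2,7) uU by linarith+
  consider "X = {}" | "X \<noteq> {}" "Min X = Max X" | "X \<noteq> {}" "Min X \<noteq> Max X" by blast
  then show ?case
  proof cases
    case 1
    then have v: "vins u a x (h k) = (h k)(a := Suc x, Suc a := Suc x)" using cells by (subst vins.simps) simp
    show ?thesis
      apply (subst wp_Loop)
      apply (simp add: regs ins_body_def cells 1 bnd)
      apply (subst wp_Loop)
      apply (simp add: regs bnd)
      apply (rule Q[unfolded v])
       apply simp_all
      done
  next
    case 2
    then have mm: "h k a = Suc (Max X)" "h k (Suc a) = Suc (Max X)" using cells by auto
    then have v: "vins u a x (h k) = (if x < Max X then (h k)(a := Suc x) else (h k)(Suc a := Suc x))"
      by (subst vins.simps) simp
    have Q1: "Q r' (h(k := (h k)(a := Suc x))) out t'"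
      if "x < Max X" "\<forall>v<40. r' v = r v" "t' \<le> t + 30 * (dep u + 1)" for r' t'
      using Q[OF that(2,3)] that(1) by (simp only: v if_True)
    have Q2: "Q r' (h(k := (h k)(Suc a := Suc x))) out t'"
      if "\<not> x < Max X" "\<forall>v<40. r' v = r v" "t' \<le> t + 30 * (dep u + 1)" for r' t'
      using Q[OF that(2,3)] that(1) by (simp only: v if_False)
    show ?thesis
      apply (subst wp_Loop)
      apply (simp add: regs ins_body_def mm bnd)
      apply (intro conjI impI)
      subgoal by (subst wp_Loop, simp add: regs bnd, rule Q1) simp_all
      subgoal by (subst wp_Loop, simp add: regs bnd, rule Q2) simp_all
      done
  next
    case 3
    define p where "p = usqrt u"
    define x' where "x' = ins_key a x (h k)"
    define m' where "m' = ins_mem a x (h k)"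
    define b where "b = clu a p (x' div p)"
    note key = vins_step[OF less.prems(1-3) 3, folded x'_def m'_def p_def]
    have p: "p < u" "0 < p" "u \<le> p * p"
      using usqrt_less[OF key(1)] usqrt_ge2[OF key(1)] usqrt_sq[of u] by (auto simp: p_def)
    note child = subrep_insert_child[OF key(7) p(2) key(2) less_le_trans[OF key(3) p(3)] b_def]
    have tab: "h aRoot l = p" "h aSize l = sz p" "l < U"
      using tabsD[OF less.prems(5), of l] key(1) less.prems(4) by (auto simp: p_def)
    have lev: "p = lev U (Suc l)" using less.prems(4) by (simp add: p_def)
    have "Min X \<le> Max X" "Max X \<in> X" using 3 fin by auto
    then have mm: "Min X < Max X" "Max X < u" using 3 cells(1) by auto
    have bb: "b + sz p \<le> a + sz u" "a + 2 + sz p \<le> a + sz u"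
      using clu_bounds[OF key(1), of "x' div p" a] child(3) by (auto simp: b_def p_def)
    have s3': "3 \<le> sz p" by (rule sz_ge3)
    have mod: "x' mod p < p" using p(2) by simp
    have cell: "h k (Suc a) = Suc (Max X)" using cells(3) 3(1) by simp
    then have bnd2: "Suc x < W" "Suc a < B" "h k (Suc a) < W" "l < B" "x' < W" "Suc (x' div p) < W"
      "Suc (x' mod p) < W" "Suc b < B" "100 < B"
      using U_B B_W bb s3' tab(3) key(3) uU less.prems(2,7) p(1) child(3) mm cell mod by linarith+
    have dep: "dep u = Suc (dep p)" using key(1) by (simp add: dep.simps[of u] p_def)
    have v: "vins u a x (h k) = (if m' b = 0 then vins p (a + 2) (x' div p) (m'(b := Suc (x' mod p), Suc b := Suc (x' mod p)))
          else vins p b (x' mod p) m')"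
    proof -
      have "h k a \<noteq> 0" "h k a \<noteq> h k (Suc a)" "\<not> u \<le> 2" using cells 3 key(1) by simp_all
      then show ?thesis
        by (subst vins.simps) (simp only: Let_def p_def[symmetric] x'_def[symmetric] m'_def[symmetric]
            b_def[symmetric] if_False)
    qed
    have tabs': "tabs (h(k := f))" for f using less.prems(5,6) by (simp add: tabs_def)
    have body: "wp (ins_body k) (wp (Loop (N 0) (V vGo) (ins_body k)) Q) r h out (Suc t)"
    proof (rule ins_body_rec[OF x'_def m'_def tab(1,2) _ regs(1-3) _ _ less.prems(6) bnd2 B_W])
      fix r' t'
      assume m0: "m' b = 0" and r': "\<forall>v<40. r' v = r v" "r' vGo = r vGo" "r' vKey = x' div p"
        "r' vBase = Suc (Suc a)" "r' vLev = Suc l" "t' \<le> Suc t + 25"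
      show "wp (Loop (N 0) (V vGo) (ins_body k)) Q r'
          (h(k := m'(b := Suc (x' mod p), Suc b := Suc (x' mod p)))) out t'"
        by (rule less.IH[OF p(1), of _ "a + 2" "(\<lambda>x. x div p) ` inner X" "x' div p" "Suc l"])
          (use m0 r' child bb less.prems(6,7) lev tabs' dep Q v regs in \<open>simp_all add: fun_upd_same del: fun_upd_apply\<close>)
    next
      fix r' t'
      assume m0: "m' b \<noteq> 0" and r': "\<forall>v<40. r' v = r v" "r' vGo = r vGo" "r' vKey = x' mod p"
        "r' vBase = b" "r' vLev = Suc l" "t' \<le> Suc t + 25"
      show "wp (Loop (N 0) (V vGo) (ins_body k)) Q r' (h(k := m')) out t'"
        by (rule less.IH[OF p(1), of _ b "slice p (x' div p) (inner X)" "x' mod p" "Suc l"])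
          (use m0 r' p child bb less.prems(6,7) lev tabs' dep Q v regs in \<open>simp_all add: fun_upd_same del: fun_upd_apply\<close>)
    qed (use mm 3 cells in \<open>simp_all add: b_def\<close>)
    show ?thesis
      by (subst wp_Loop) (simp add: regs bnd body)
  qed
qed

text \<open>\<open>c1\<close> and \<open>c2\<close> name the clusters of the smallest and the
  largest inner key. That their cells are positive keeps the subtractions of 1 from
  underflowing.\<close>

lemma del_minmax:
  assumes "x' = del_key p a x (h k)" "m' = del_mem p a x (h k)" "h 5 l = p" "h 6 l = z"
    and cells: "h k a = r vMin" "h k (Suc a) = r vMax" "h k (Suc (Suc a)) = r vTmp" "z = sz p"
    and regs: "r vBase = a" "r vKey = x" "r vLev = l"
    and ord: "r vMin < r vMax" "r vMin \<le> Suc x" "Suc x \<le> r vMax"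
    and 1: "r vTmp = Suc c1" "0 < h k (clu a p c1)"
    and 2: "h k (a + 3) = Suc c2" "0 < h k (Suc (clu a p c2))"
    and bnd: "Suc x < W" "a + 3 < B" "r vMax < W" "Suc x' < W" "Suc (clu a p c1) < B"
      "Suc (clu a p c2) < B" "l < B" "100 < B" "B < W"
  shows "wp (del_minmax k) (\<lambda>r' h' out' t'. (\<forall>v<40. r' v = r v) \<and> r' vGo = r vGo \<and>
    r' vBase = a \<and> r' vLev = l \<and> r' vKey = x' \<and> h' = h(k := m') \<and> out' = out \<and>
    t' \<le> t + 7) r h out t"
proof -
  have b: "Suc 0 < W" "0 < W" "2 < W" "3 < W" "a < B" "Suc a < B" "Suc a < W" "Suc (Suc a) < W" "a + 3 < W"
    using bnd by linarith+
  have c: "c1 < W" "Suc c1 < W" "Suc c1 * z < W" "Suc (Suc (a + Suc c1 * z)) < W"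
      "Suc (Suc (a + Suc c1 * z)) < B"
    "c2 < W" "Suc c2 < W" "Suc c2 * z < W" "Suc (Suc (a + Suc c2 * z)) < W"
      "Suc (Suc (Suc (a + Suc c2 * z))) < W" "Suc (Suc (Suc (a + Suc c2 * z))) < B"
  proof -
    have "3 \<le> z" using cells(4) sz_ge3 by simp
    then have "Suc c1 * 1 \<le> Suc c1 * z" "Suc c2 * 1 \<le> Suc c2 * z" by (intro mult_le_mono2; simp)+
    then show "c1 < W" "Suc c1 < W" "Suc c1 * z < W" "Suc (Suc (a + Suc c1 * z)) < W"
      "Suc (Suc (a + Suc c1 * z)) < B"
    "c2 < W" "Suc c2 < W" "Suc c2 * z < W" "Suc (Suc (a + Suc c2 * z)) < W"
      "Suc (Suc (Suc (a + Suc c2 * z))) < W" "Suc (Suc (Suc (a + Suc c2 * z))) < B"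
      using bnd cells(4) by simp_all
  qed
  have e1: "h k (Suc (Suc (a + Suc c1 * z))) \<noteq> 0" using 1(2) cells(4) by simp
  have e2: "h k (Suc (Suc (Suc (a + Suc c2 * z)))) \<noteq> 0" using 2(2) cells(4) by simp
  consider "Suc x = r vMin" | "Suc x = r vMax" "r vMin < Suc x" | "r vMin < Suc x" "Suc x < r vMax"
    using ord by linarith
  then show ?thesis
  proof cases
    case 1
    have x': "x' = c1 * p + (h k (Suc (Suc (a + Suc c1 * z))) - 1)" "m' = (h k)(a := Suc x')"
      using assms(1,2) 1 cells \<open>r vTmp = Suc c1\<close> by (simp_all add: del_key_def del_mem_def)
    have lt: "c1 * p < W" "h k (Suc (Suc (a + Suc c1 * z))) - 1 < W" using x'(1) bnd(4) by linarith+
    show ?thesis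
      using e1 lt bnd(4) b(1-6) bnd(1,7)
      by (simp add: del_minmax_def regs cells(1,2) 1[symmetric] \<open>r vTmp = Suc c1\<close> c b bnd assms(3,4) x'
          Suc_le_eq del: mult_Suc mult_Suc_right)
  next
    case c2: 2
    have x': "x' = c2 * p + (h k (Suc (Suc (Suc (a + Suc c2 * z)))) - 1)" "m' = (h k)(Suc a := Suc x')"
      using assms(1,2) c2 cells 2(1) by (simp_all add: del_key_def del_mem_def)
    have lt: "c2 * p < W" "h k (Suc (Suc (Suc (a + Suc c2 * z)))) - 1 < W" using x'(1) bnd(4) by linarith+
    show ?thesis
      using e2 lt bnd(4) b(1-6) bnd(1,7) c2(2)
      by (simp add: del_minmax_def regs cells(1,2) c2(1)[symmetric] 2(1) c b bnd assms(3,4) x'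
          Suc_le_eq del: mult_Suc mult_Suc_right)
  next
    case 3
    then have "x' = x" "m' = h k" using assms(1,2) cells by (simp_all add: del_key_def del_mem_def)
    then show ?thesis
      using 3 by (simp add: del_minmax_def regs cells b bnd)
  qed
qed

lemma del_body_rec:
  assumes "x' = del_key p a x (h k)" "m' = del_mem p a x (h k)" "h 5 l = p" "h 6 l = z" "z = sz p"
    "b = Suc (Suc (a + Suc (x' div p) * z))"
    and regs: "r vKey = x" "r vBase = a" "r vLev = l"
    and k: "8 < k"
    and ord: "h k a < h k (Suc a)" "h k a \<le> Suc x" "Suc x \<le> h k (Suc a)"
    and 1: "h k (Suc (Suc a)) = Suc c1" "0 < h k (clu a p c1)"
    and 2: "h k (a + 3) = Suc c2" "0 < h k (Suc (clu a p c2))"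
    and bnd: "Suc x < W" "a + 3 < B" "h k (Suc a) < W" "Suc x' < W" "Suc (clu a p c1) < B"
      "Suc (clu a p c2) < B" "l < B" "100 < B" "B < W" "Suc b < B" "Suc (x' div p) < W"
    and R1: "\<And>r' t'. \<not> m' b < m' (Suc b) \<Longrightarrow> (\<forall>v<40. r' v = r v) \<Longrightarrow> r' vGo = r vGo \<Longrightarrow> r' vKey = x' div p \<Longrightarrow>
      r' vBase = Suc (Suc a) \<Longrightarrow> r' vLev = Suc l \<Longrightarrow> t' \<le> t + 25 \<Longrightarrow>
      R r' (h(k := m'(b := 0, Suc b := 0))) out t'"
    and R2: "\<And>r' t'. m' b < m' (Suc b) \<Longrightarrow> (\<forall>v<40. r' v = r v) \<Longrightarrow> r' vGo = r vGo \<Longrightarrow> r' vKey = x' mod p \<Longrightarrow>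
      r' vBase = b \<Longrightarrow> r' vLev = Suc l \<Longrightarrow> t' \<le> t + 25 \<Longrightarrow> R r' (h(k := m')) out t'"
  shows "wp (del_body k) R r h out t"
proof -
  have k': "k \<noteq> 5" "k \<noteq> 6" using k by auto
  have "x' div p \<le> x'" "x' mod p \<le> x'" by auto
  then have bnd2: "Suc 0 < W" "0 < W" "2 < W" "a < B" "Suc a < B" "Suc (Suc a) < B" "Suc a < W" "Suc (Suc a) < W"
    "x' div p < W" "x' mod p < W"
    "Suc (x' div p) * z < W" "b < B" "b < W" "Suc b < W" "Suc l < W"
    using bnd assms(6) by linarith+
  show ?thesis
    apply (simp add: del_body_def regs ord 1(1) bnd bnd2)
    apply (rule wp_mono)
     apply (rule del_minmax[where h = h and k = k and a = a and x = x and l = l and z = z and ?c1.0 = c1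
          and ?c2.0 = c2, OF assms(1-4)])
                      using ord 1 2 bnd assms(5) apply (simp_all add: regs del: mult_Suc mult_Suc_right)[23]
    apply (elim conjE)
    apply (simp only: simp_thms)
    apply (simp add: descend_def regs k' k'[symmetric] bnd bnd2 assms(3,4) assms(6)[symmetric]
        del: mult_Suc mult_Suc_right)
    apply (intro conjI impI)
    subgoal by (rule R2) simp_all
    subgoal by (rule R1) simp_all
    done
qed

lemma subrep_nonempty:
  assumes s: "subrep m p a Y" and p: "0 < p" and Y: "Y \<noteq> {}" "Y \<subseteq> {..<p * p}"
  shows "\<exists>c1 c2. c1 < p \<and> c2 < p \<and> m (Suc (Suc a)) = Suc c1 \<and> 0 < m (clu a p c1) \<and>
    m (a + 3) = Suc c2 \<and> 0 < m (Suc (clu a p c2))"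
proof -
  let ?I = "(\<lambda>x. x div p) ` Y"
  have r: "rep m p (a + 2) ?I" using s by (simp add: subrep_def)
  have mm: "Min ?I \<in> ?I" "Max ?I \<in> ?I" using rep_Min_Max[OF r] Y by auto
  have lt: "c < p" if "c \<in> ?I" for c using that Y(2) p by (auto simp: less_mult_imp_div_less)
  have rc: "rep m p (clu a p c) (slice p c Y)" if "c \<in> ?I" for c
    using subrep_inD[OF s lt[OF that]] .
  have ne: "slice p c Y \<noteq> {}" if "c \<in> ?I" for c using that by (simp only: slice_image[OF p])
  have "m (Suc (Suc a)) = Suc (Min ?I)" "m (a + 3) = Suc (Max ?I)"
    using rep_cells[OF r] Y by (simp_all add: eval_nat_numeral)
  moreover have "0 < m (clu a p (Min ?I))" using rep_cells(2)[OF rc[OF mm(1)]] ne[OF mm(1)] by simp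
  moreover have "0 < m (Suc (clu a p (Max ?I)))" using rep_cells(3)[OF rc[OF mm(2)]] ne[OF mm(2)] by simp
  ultimately show ?thesis using lt[OF mm(1)] lt[OF mm(2)] by blast
qed

lemma del_loop:
  assumes "rep (h k) u a X" "x \<in> X" "u = lev U l" "tabs h" "8 < k" "a + sz u \<le> sz U"
    "r vKey = x" "r vBase = a" "r vLev = l" "r vGo = 1"
    and "\<And>r' t'. (\<forall>v<40. r' v = r v) \<Longrightarrow> t' \<le> t + 30 * (dep u + 1) \<Longrightarrow>
      Q r' (h(k := vdel u a x (h k))) out t'"
  shows "wp (Loop (N 0) (V vGo) (del_body k)) Q r h out t"
  using assms
proof (induction u arbitrary: h a X x l r t rule: less_induct)
  case (less u)
  note r = less.prems(1)
  note cells = rep_cells[OF r]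
  note regs = less.prems(7-10)
  note Q = less.prems(11)
  have fin: "finite X" using r by (rule rep_finite)
  have s3: "3 \<le> sz u" by (rule sz_ge3)
  have uU: "u \<le> U" using lev_le less.prems(3) by simp
  have ne: "X \<noteq> {}" and xu: "x < u" using less.prems(2) cells(1) by auto
  have bnd: "x < W" "Suc x < W" "Suc (Suc a) < B" "Suc a < B" "a < B" "Suc a < W" "Suc (Suc a) < W" "a < W"
    "Suc 0 < W" "0 < W" "2 < W"
    using U_B B_W s3 xu less.prems(6) uU by linarith+
  have mm: "Min X \<in> X" "Max X \<in> X" "Min X \<le> x" "x \<le> Max X" using ne fin less.prems(2) by auto
  have cell: "h k a = Suc (Min X)" "h k (Suc a) = Suc (Max X)" using cells ne by auto
  have cW: "Suc (Min X) < W" "Suc (Max X) < W"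
  proof -
    have "Min X < u" "Max X < u" using mm cells(1) by blast+
    then show "Suc (Min X) < W" "Suc (Max X) < W" using U_B B_W uU by linarith+
  qed
  consider "Min X = Max X" | "Min X \<noteq> Max X" "inner X = {}" | "inner X \<noteq> {}" by blast
  then show ?case
  proof cases
    case 1
    then have v: "vdel u a x (h k) = (h k)(a := 0, Suc a := 0)" using cell by (subst vdel.simps) simp
    show ?thesis
      apply (subst wp_Loop)
      apply (simp add: regs del_body_def cell 1 bnd)
      apply (subst wp_Loop)
      apply (simp add: regs bnd)
      apply (rule Q[unfolded v])
       apply simp_all
      done
  next
    case 2
    have z: "h k (Suc (Suc a)) = 0" using inner_empty[OF r] 2 by simp
    have lt: "Min X < Max X" using 2 mm by linarith
    have x: "x = Min X \<or> x = Max X" using 2 less.prems(2) by (auto simp: inner_def)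
    have v: "vdel u a x (h k) = (if x = Min X then (h k)(a := Suc (Max X)) else (h k)(Suc a := Suc (Min X)))"
      using 2 z cell by (subst vdel.simps) simp
    have Q1: "Q r' (h(k := (h k)(a := Suc (Max X)))) out t'"
      if "x = Min X" "\<forall>v<40. r' v = r v" "t' \<le> t + 30 * (dep u + 1)" for r' t'
      using Q[OF that(2,3)] unfolding v if_P[OF that(1)] .
    have Q2: "Q r' (h(k := (h k)(Suc a := Suc (Min X)))) out t'"
      if "x \<noteq> Min X" "\<forall>v<40. r' v = r v" "t' \<le> t + 30 * (dep u + 1)" for r' t'
      using Q[OF that(2,3)] that(1) by (simp only: v if_False)
    show ?thesis
      apply (subst wp_Loop)
      apply (simp add: regs del_body_def cell lt z bnd)
      apply (intro conjI impI)
      subgoal by (subst wp_Loop, simp add: regs bnd, rule Q1) (use x in simp_all)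
      subgoal by (subst wp_Loop, simp add: regs bnd, rule Q2) (use x lt in simp_all)
      done
  next
    case 3
    define p where "p = usqrt u"
    define x' where "x' = del_key p a x (h k)"
    define m' where "m' = del_mem p a x (h k)"
    define b where "b = clu a p (x' div p)"
    note key = vdel_step[OF less.prems(1,2) 3, folded p_def, folded x'_def m'_def]
    have p: "p < u" "0 < p" "u \<le> p * p"
      using usqrt_less[OF key(2)] usqrt_ge2[OF key(2)] usqrt_sq[of u] by (auto simp: p_def)
    have sbs: "inner X \<subseteq> {..<p * p}" "inner X \<subseteq> {..<u}" using cells(1) p(3) by (auto simp: inner_def)
    then have x'u: "x' < u" "x' < p * p" using key(3) by auto
    note child = subrep_delete_child[OF key(8) p(2) key(3) x'u(2) b_def]
    obtain c1 c2 where c: "c1 < p" "c2 < p" "h k (Suc (Suc a)) = Suc c1" "0 < h k (clu a p c1)"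
      "h k (a + 3) = Suc c2" "0 < h k (Suc (clu a p c2))"
      using subrep_nonempty[OF key(9) p(2) 3 sbs(1)] by blast
    have tab: "h 5 l = p" "h 6 l = sz p" "l < U"
      using tabsD[OF less.prems(4), of l] key(2) less.prems(3) by (auto simp: p_def)
    have lev: "p = lev U (Suc l)" using less.prems(3) by (simp add: p_def)
    have s3': "3 \<le> sz p" by (rule sz_ge3)
    have bb: "clu a p c + sz p \<le> a + sz u" "a + 2 + sz p \<le> a + sz u" if "c < p" for c
      using clu_bounds[OF key(2), of c a] that by (auto simp: p_def)
    have cB: "Suc (clu a p c) < B" if "c < p" for c
      using bb(1)[OF that] s3' U_B less.prems(6) by linarith
    have bb': "b + sz p \<le> a + sz u" unfolding b_def by (rule bb(1)[OF child(3)])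
    have bnd2: "Suc x < W" "a + 3 < B" "h k (Suc a) < W" "Suc x' < W" "Suc (clu a p c1) < B"
      "Suc (clu a p c2) < B" "l < B" "100 < B" "B < W" "Suc b < B" "Suc (x' div p) < W"
      using U_B B_W bb' s3' tab(3) uU less.prems(6) p(1) child(3) cell(2) cW bnd x'u(1) s3
        cB[OF c(1)] cB[OF c(2)] by linarith+
    have dep: "dep u = Suc (dep p)" using key(2) by (simp add: dep.simps[of u] p_def)
    have v: "vdel u a x (h k) = (if m' b = m' (Suc b) then vdel p (a + 2) (x' div p) (m'(b := 0, Suc b := 0))
          else vdel p b (x' mod p) m')"
    proof -
      have "h k a \<noteq> h k (Suc a)" "\<not> u \<le> 2" "h k (a + 2) \<noteq> 0" using cell key(1,2) c(3) by simp_all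
      then show ?thesis
        by (subst vdel.simps) (simp only: Let_def p_def[symmetric] x'_def[symmetric] m'_def[symmetric]
            b_def[symmetric] if_False)
    qed
    have tabs': "tabs (h(k := f))" for f using less.prems(4,5) by (simp add: tabs_def)
    have body: "wp (del_body k) (wp (Loop (N 0) (V vGo) (del_body k)) Q) r h out (Suc t)"
    proof (rule del_body_rec[OF x'_def m'_def tab(1,2) refl _ regs(1-3) less.prems(5) _ _ _ c(3-6) bnd2])
      fix r' t'
      assume m0: "\<not> m' b < m' (Suc b)" and r': "\<forall>v<40. r' v = r v" "r' vGo = r vGo" "r' vKey = x' div p"
        "r' vBase = Suc (Suc a)" "r' vLev = Suc l" "t' \<le> Suc t + 25"
      have m1: "m' b = m' (Suc b)" using m0 child(5) by simp
      have c_in: "x' div p \<in> (\<lambda>x. x div p) ` inner X" using key(3) by simp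
      note v' = v[unfolded if_P[OF m1]]
      show "wp (Loop (N 0) (V vGo) (del_body k)) Q r' (h(k := m'(b := 0, Suc b := 0))) out t'"
        by (rule less.IH[OF p(1), of _ "a + 2" "(\<lambda>x. x div p) ` inner X" "x' div p" "Suc l"])
          (use r' child c_in bb(2)[OF c(1)] less.prems(5,6) lev tabs' dep Q v' regs
            in \<open>simp_all add: fun_upd_same del: fun_upd_apply\<close>)
    next
      fix r' t'
      assume m0: "m' b < m' (Suc b)" and r': "\<forall>v<40. r' v = r v" "r' vGo = r vGo" "r' vKey = x' mod p"
        "r' vBase = b" "r' vLev = Suc l" "t' \<le> Suc t + 25"
      have m1: "m' b \<noteq> m' (Suc b)" using m0 by simp
      note v' = v[unfolded if_not_P[OF m1]]
      show "wp (Loop (N 0) (V vGo) (del_body k)) Q r' (h(k := m')) out t'"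
        by (rule less.IH[OF p(1), of _ b "slice p (x' div p) (inner X)" "x' mod p" "Suc l"])
          (use r' child bb' less.prems(5,6) lev tabs' dep Q v' regs
            in \<open>simp_all add: fun_upd_same del: fun_upd_apply\<close>)
    qed (use key(1) mm cell in \<open>simp_all add: b_def\<close>)
    show ?thesis
      by (subst wp_Loop) (simp add: regs bnd body)
  qed
qed

section \<open>Descent and ascent of the predecessor search\<close>

definition upv :: "(nat \<Rightarrow> nat \<Rightarrow> nat) \<Rightarrow> nat \<Rightarrow> nat \<Rightarrow> nat \<Rightarrow> nat" where
  "upv h k i v = (if 0 < h 7 i then (h 7 i - 1) * h 5 i + v else if v = 0 then h k (h 8 i)
     else (v - 1) * h 5 i + h k (Suc (Suc (Suc (h 8 i + v * h 6 i)))))"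

definition upok :: "(nat \<Rightarrow> nat \<Rightarrow> nat) \<Rightarrow> nat \<Rightarrow> nat \<Rightarrow> nat \<Rightarrow> bool" where
  "upok h k i v \<longleftrightarrow> upv h k i v < B \<and> i < B \<and> h 7 i < B \<and> (h 7 i = 0 \<longrightarrow> h 8 i < B \<and>
     (0 < v \<longrightarrow> Suc (Suc (Suc (h 8 i + v * h 6 i))) < B))"

text \<open>The recursion stack as data: \<open>n\<close> levels pushed from level \<open>l\<close>
  on are folded from the innermost outwards, where \<open>upv\<close> is the work that remains at a
  level after its recursive call.\<close>

primrec unw :: "(nat \<Rightarrow> nat \<Rightarrow> nat) \<Rightarrow> nat \<Rightarrow> nat \<Rightarrow> nat \<Rightarrow> nat \<Rightarrow> nat" where
  "unw h k 0 l v = v"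
| "unw h k (Suc n) l v = upv h k l (unw h k n (Suc l) v)"

primrec unwok :: "(nat \<Rightarrow> nat \<Rightarrow> nat) \<Rightarrow> nat \<Rightarrow> nat \<Rightarrow> nat \<Rightarrow> nat \<Rightarrow> bool" where
  "unwok h k 0 l v \<longleftrightarrow> True"
| "unwok h k (Suc n) l v \<longleftrightarrow> unwok h k n (Suc l) v \<and> upok h k l (unw h k n (Suc l) v)"

text \<open>The definition peels off the outermost level, as \<open>vpred\<close> does, while the
  ascent starts at the innermost one; this converts between the two orders.\<close>

lemma unw_snoc: "unw h k (Suc n) l v = unw h k n l (upv h k (l + n) v)"
  by (induction n arbitrary: l) simp_all

lemma unwok_snoc: "unwok h k (Suc n) l v \<longleftrightarrow> upok h k (l + n) v \<and> unwok h k n l (upv h k (l + n) v)"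
proof (induction n arbitrary: l)
  case (Suc n)
  have "unwok h k (Suc (Suc n)) l v \<longleftrightarrow> unwok h k (Suc n) (Suc l) v \<and> upok h k l (unw h k (Suc n) (Suc l) v)"
    by simp
  then show ?case unfolding Suc unw_snoc by auto
qed simp

lemma pred_up_loop:
  assumes "unwok h k n 0 (r vRes)" "r vLev = n" "r vRes < B" "n < B" "100 < B"
    and "\<And>r' t'. (\<forall>v<40. r' v = r v) \<Longrightarrow> r' vRes = unw h k n 0 (r vRes) \<Longrightarrow> t' \<le> t + 15 * (n + 1) \<Longrightarrow>
      Q r' h out t'"
  shows "wp (Loop (N 0) (V vLev) (pred_up k)) Q r h out t"
  using assms
proof (induction n arbitrary: r t)
  case 0
  have "0 < W" using B_W by simp
  then show ?case using 0 by (subst wp_Loop) simp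
next
  case (Suc n)
  let ?v = "r vRes"
  have ok: "upok h k n ?v" "unwok h k n 0 (upv h k n ?v)"
    using Suc.prems(1) unfolding unwok_snoc by simp_all
  have u: "unw h k (Suc n) 0 ?v = unw h k n 0 (upv h k n ?v)" unfolding unw_snoc by simp
  have W: "0 < W" "Suc 0 < W" "2 < W" "n < W" "n < B" "Suc n < W" "?v < W" "upv h k n ?v < W" using B_W Suc.prems ok(1)
    by (auto simp: upok_def)
  have step: "wp (pred_up k) (\<lambda>r' h' out' t'. (\<forall>v<40. r' v = r v) \<and> r' vLev = n \<and>
      r' vRes = upv h k n ?v \<and> h' = h \<and> out' = out \<and> t' \<le> Suc t + 7) r h out (Suc t)"
  proof (cases "0 < h 7 n")
    case True
    then have e: "upv h k n ?v = (h 7 n - 1) * h 5 n + ?v" by (simp add: upv_def)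
    then have "(h 7 n - 1) * h 5 n < W" "h 7 n - 1 < W" using W ok(1) B_W by (auto simp: upok_def)
    then show ?thesis using True W Suc.prems(2) e by (simp add: pred_up_def Suc_le_eq)
  next
    case False
    then have 7: "h 7 n = 0" by simp
    show ?thesis
    proof (cases "?v = 0")
      case True
      then show ?thesis using 7 ok(1) W Suc.prems(2) by (simp add: pred_up_def upv_def upok_def)
    next
      case v: False
      have e: "upv h k n ?v = (?v - 1) * h 5 n + h k (Suc (Suc (Suc (h 8 n + ?v * h 6 n))))"
        using 7 v by (simp add: upv_def)
      have 1: "h 8 n < B" "Suc (Suc (Suc (h 8 n + ?v * h 6 n))) < B" using ok(1) 7 v by (auto simp: upok_def)
      then have 2: "?v - 1 < W" "(?v - 1) * h 5 n < W" "?v * h 6 n < W" "Suc (Suc (h 8 n)) < W"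
        "Suc (h 8 n) < W" "Suc (Suc (h 8 n + ?v * h 6 n)) < W" "Suc (Suc (Suc (h 8 n + ?v * h 6 n))) < W"
        using W B_W e by linarith+
      show ?thesis using 7 v 1 2 W Suc.prems(2) e by (simp add: pred_up_def Suc_le_eq)
    qed
  qed
  show ?case
    apply (subst wp_Loop)
    apply (simp add: Suc.prems(2) W)
    apply (rule wp_mono[OF step])
    apply (elim conjE)
    apply (simp only: simp_thms)
    apply (rule Suc.IH)
    using ok(2) ok(1) Suc.prems u apply (simp_all add: upok_def)
    done
qed

lemma pred_down_rec:
  assumes "h 5 l = p" "h 6 l = z" "b = Suc (Suc (a + Suc (x div p) * z))"
    and regs: "r vKey = x" "r vBase = a" "r vLev = l"
    and k: "8 < k"
    and ord: "h k a < Suc x" "\<not> h k (Suc a) < Suc x" "h k (Suc (Suc a)) \<noteq> 0"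
    and bnd: "Suc x < W" "Suc (Suc a) < B" "l < B" "100 < B" "B < W" "Suc b < B" "Suc (x div p) < W"
    and R1: "\<And>r' t'. 0 < h k b \<and> h k b < Suc (x mod p) \<Longrightarrow> (\<forall>v<40. r' v = r v) \<Longrightarrow> r' vGo = r vGo \<Longrightarrow>
      r' vKey = x mod p \<Longrightarrow> r' vBase = b \<Longrightarrow> r' vLev = Suc l \<Longrightarrow> t' \<le> t + 25 \<Longrightarrow>
      R r' (h(8 := (h 8)(l := a), 7 := (h 7)(l := Suc (x div p)))) out t'"
    and R2: "\<And>r' t'. \<not> (0 < h k b \<and> h k b < Suc (x mod p)) \<Longrightarrow> (\<forall>v<40. r' v = r v) \<Longrightarrow> r' vGo = r vGo \<Longrightarrow>
      r' vKey = x div p \<Longrightarrow> r' vBase = Suc (Suc a) \<Longrightarrow> r' vLev = Suc l \<Longrightarrow> t' \<le> t + 25 \<Longrightarrow>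
      R r' (h(8 := (h 8)(l := a), 7 := (h 7)(l := 0))) out t'"
  shows "wp (pred_down k) R r h out t"
proof -
  have k': "k \<noteq> 5" "k \<noteq> 6" "k \<noteq> 8" "8 \<noteq> k" using k by auto
  have "x div p \<le> x" "x mod p \<le> x" by auto
  then have bnd2: "Suc 0 < W" "0 < W" "2 < W" "a < B" "Suc a < B" "Suc a < W" "Suc (Suc a) < W"
    "x div p < W" "x mod p < W" "Suc (x mod p) < W"
    "Suc (x div p) * z < W" "b < B" "b < W" "Suc b < W" "Suc l < W"
    using bnd assms(3) by linarith+
  show ?thesis
    apply (simp add: pred_down_def regs ord bnd bnd2)
    apply (simp add: descend_def regs k' bnd bnd2 assms(1,2) assms(3)[symmetric]
        del: mult_Suc mult_Suc_right)
    apply (intro conjI impI)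
    subgoal by (rule R1) simp_all
    subgoal by (rule R2) simp_all
    subgoal by (rule R2) simp_all
    done
qed

lemma vpred_le: "rep m u a X \<Longrightarrow> x < u \<Longrightarrow> vpred u a x m \<le> x"
  using vpred_correct[of m u a X x] by (cases "vpred u a x m") (auto simp: is_pred_def)

text \<open>The descent only prepares the result: it leaves a stack whose unwinding is
  \<open>vpred\<close>. Entries below \<open>l\<close> stay untouched, so levels pushed earlier
  remain valid, and \<open>unwok\<close> records that the ascent stays within bounds.\<close>

lemma pred_down_loop:
  assumes "rep (h k) u a X" "x < u" "u = lev U l" "tabs h" "8 < k" "a + sz u \<le> sz U"
    "r vKey = x" "r vBase = a" "r vLev = l" "r vGo = 1"
    and "\<And>r' h' t' n. (\<forall>v<40. r' v = r v) \<Longrightarrow> r' vLev = l + n \<Longrightarrow> (\<forall>j. j \<noteq> 7 \<and> j \<noteq> 8 \<longrightarrow> h' j = h j) \<Longrightarrow>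
      (\<forall>j<l. h' 7 j = h 7 j \<and> h' 8 j = h 8 j) \<Longrightarrow> unw h' k n l (r' vRes) = vpred u a x (h k) \<Longrightarrow>
      unwok h' k n l (r' vRes) \<Longrightarrow> r' vRes \<le> x \<Longrightarrow> n \<le> dep u \<Longrightarrow> t' \<le> t + 30 * (dep u + 1) \<Longrightarrow>
      Q r' h' out t'"
  shows "wp (Loop (N 0) (V vGo) (pred_down k)) Q r h out t"
  using assms
proof (induction u arbitrary: h a X x l r t rule: less_induct)
  case (less u)
  note r = less.prems(1)
  note regs = less.prems(7-10)
  note Q = less.prems(11)
  note xu = less.prems(2)
  have s3: "3 \<le> sz u" by (rule sz_ge3)
  have uU: "u \<le> U" using lev_le less.prems(3) by simp
  have bnd: "x < W" "Suc x < W" "Suc (Suc a) < B" "Suc a < B" "a < B" "Suc a < W" "Suc (Suc a) < W" "a < W"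
    "Suc 0 < W" "0 < W" "2 < W"
    using U_B B_W s3 xu less.prems(6) uU by linarith+
  have vle: "vpred u a x (h k) \<le> x" by (rule vpred_le[OF r xu])
  consider "\<not> h k a < Suc x" | "h k a < Suc x" "h k (Suc a) < Suc x"
    | "h k a < Suc x" "\<not> h k (Suc a) < Suc x" "h k (Suc (Suc a)) = 0"
    | "h k a < Suc x" "\<not> h k (Suc a) < Suc x" "h k (Suc (Suc a)) \<noteq> 0" by blast
  then show ?case
  proof cases
    case 1
    then have "vpred u a x (h k) = 0" by (subst vpred.simps) simp
    then show ?thesis
      using 1 by (subst wp_Loop, simp add: regs pred_down_def bnd, subst wp_Loop, simp add: regs bnd)
        (rule Q[of _ 0], simp_all add: regs)
  next
    case 2
    then have "vpred u a x (h k) = h k (Suc a)" by (subst vpred.simps) simp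
    then show ?thesis
      using 2 by (subst wp_Loop, simp add: regs pred_down_def bnd, subst wp_Loop, simp add: regs bnd)
        (rule Q[of _ 0], simp_all add: regs)
  next
    case 3
    then have "vpred u a x (h k) = h k a" by (subst vpred.simps) simp
    then show ?thesis
      using 3 vle by (subst wp_Loop, simp add: regs pred_down_def bnd, subst wp_Loop, simp add: regs bnd)
        (rule Q[of _ 0], simp_all add: regs)
  next
    case 4
    have u2: "2 < u" using 4(3) r by (cases "u \<le> 2") (simp_all add: rep_iff[of "h k" u])
    define p where "p = usqrt u"
    have p: "p < u" "0 < p" "u \<le> p * p"
      using usqrt_less[OF u2] usqrt_ge2[OF u2] usqrt_sq[of u] by (auto simp: p_def)
    have sub: "subrep (h k) p a (inner X)" using r u2 by (simp add: rep_iff p_def)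
    define b where "b = clu a p (x div p)"
    have cp: "x div p < p" using xu p by (simp add: less_mult_imp_div_less)
    have yp: "x mod p < p" using p by simp
    have rc: "rep (h k) p b (slice p (x div p) (inner X))" unfolding b_def by (rule subrep_inD[OF sub cp])
    have rs: "rep (h k) p (a + 2) ((\<lambda>x. x div p) ` inner X)" using sub by (simp add: subrep_def)
    have tab: "h 5 l = p" "h 6 l = sz p" "l < U"
      using tabsD[OF less.prems(4), of l] u2 less.prems(3) by (auto simp: p_def)
    have lev: "p = lev U (Suc l)" using less.prems(3) by (simp add: p_def)
    have s3': "3 \<le> sz p" by (rule sz_ge3)
    have bb: "clu a p c + sz p \<le> a + sz u" "a + 2 + sz p \<le> a + sz u" if "c < p" for c
      using clu_bounds[OF u2, of c a] that by (auto simp: p_def)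
    have bb': "b + sz p \<le> a + sz u" unfolding b_def by (rule bb(1)[OF cp])
    have bnd2: "Suc x < W" "Suc (Suc a) < B" "l < B" "100 < B" "B < W" "Suc b < B" "Suc (x div p) < W"
      using U_B B_W bb' s3' tab(3) uU less.prems(6) p(1) cp bnd by linarith+
    have dep: "dep u = Suc (dep p)" using u2 by (simp add: dep.simps[of u] p_def)
    have v: "vpred u a x (h k) = (if 0 < h k b \<and> h k b < Suc (x mod p) then x div p * p + vpred p b (x mod p) (h k)
        else let v = vpred p (a + 2) (x div p) (h k)
            in if v = 0 then h k a else (v - 1) * p + h k (Suc (clu a p (v - 1))))"
    proof -
      have "\<not> u \<le> 2" "\<not> Suc x \<le> h k a" "h k (a + 2) \<noteq> 0" using 4 u2 by simp_all
      then show ?thesis using 4(2)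
        by (subst vpred.simps) (simp only: Let_def p_def[symmetric] b_def[symmetric] if_False)
    qed
    have tabs': "tabs (h(8 := f, 7 := g))" for f g using less.prems(4) by (simp add: tabs_def)
    have xx: "x div p \<le> x" "x mod p \<le> x" by auto
    have body: "wp (pred_down k) (wp (Loop (N 0) (V vGo) (pred_down k)) Q) r h out (Suc t)"
    proof (rule pred_down_rec[OF tab(1,2) _ regs(1-3) less.prems(5) 4(1,2,3) bnd2])
      fix r' t'
      assume c: "0 < h k b \<and> h k b < Suc (x mod p)" and r': "\<forall>v<40. r' v = r v" "r' vGo = r vGo"
        "r' vKey = x mod p" "r' vBase = b" "r' vLev = Suc l" "t' \<le> Suc t + 25"
      let ?h = "h(8 := (h 8)(l := a), 7 := (h 7)(l := Suc (x div p)))"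
      have hk: "?h k = h k" using less.prems(5) by simp
      show "wp (Loop (N 0) (V vGo) (pred_down k)) Q r' ?h out t'"
      proof (rule less.IH[OF p(1), of ?h b "slice p (x div p) (inner X)" "x mod p" "Suc l"])
        show "rep (?h k) p b (slice p (x div p) (inner X))" unfolding hk by (rule rc)
        show "tabs ?h" by (rule tabs')
        fix r2 h2 t2 n
        assume A: "\<forall>v<40. r2 v = r' v" "r2 vLev = Suc l + n" "\<forall>j. j \<noteq> 7 \<and> j \<noteq> 8 \<longrightarrow> h2 j = ?h j"
          "\<forall>j<Suc l. h2 7 j = ?h 7 j \<and> h2 8 j = ?h 8 j"
          "unw h2 k n (Suc l) (r2 vRes) = vpred p b (x mod p) (?h k)"
          "unwok h2 k n (Suc l) (r2 vRes)" "r2 vRes \<le> x mod p" "n \<le> dep p" "t2 \<le> t' + 30 * (dep p + 1)"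
        have e: "h2 7 l = Suc (x div p)" "h2 5 l = p" using A(3,4) tab by auto
        have up: "upv h2 k l (vpred p b (x mod p) (h k)) = vpred u a x (h k)"
          using e v c by (simp add: upv_def)
        show "Q r2 h2 out t2"
        proof (rule Q[of _ "Suc n"])
          show "unw h2 k (Suc n) l (r2 vRes) = vpred u a x (h k)" using A(5) up hk by simp
          show "unwok h2 k (Suc n) l (r2 vRes)"
            using A(5,6) up hk e vle U_B xu uU cp p(1) tab(3) by (simp add: upok_def)
          show "\<forall>j. j \<noteq> 7 \<and> j \<noteq> 8 \<longrightarrow> h2 j = h j" using A(3) by simp
          show "\<forall>j<l. h2 7 j = h 7 j \<and> h2 8 j = h 8 j" using A(4) by simp
          show "r2 vRes \<le> x" using A(7) xx(2) by (rule le_trans)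
        qed (use A r' dep in simp_all)
      qed (use r' yp lev tabs' less.prems(5,6) bb' regs in simp_all)
    next
      fix r' t'
      assume c: "\<not> (0 < h k b \<and> h k b < Suc (x mod p))" and r': "\<forall>v<40. r' v = r v" "r' vGo = r vGo"
        "r' vKey = x div p" "r' vBase = Suc (Suc a)" "r' vLev = Suc l" "t' \<le> Suc t + 25"
      let ?h = "h(8 := (h 8)(l := a), 7 := (h 7)(l := 0))"
      have hk: "?h k = h k" using less.prems(5) by simp
      let ?v = "vpred p (a + 2) (x div p) (h k)"
      have vc: "?v \<le> x div p" by (rule vpred_le[OF rs cp])
      show "wp (Loop (N 0) (V vGo) (pred_down k)) Q r' ?h out t'"
      proof (rule less.IH[OF p(1), of ?h "a + 2" "(\<lambda>x. x div p) ` inner X" "x div p" "Suc l"])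
        show "rep (?h k) p (a + 2) ((\<lambda>x. x div p) ` inner X)" unfolding hk by (rule rs)
        show "tabs ?h" by (rule tabs')
        fix r2 h2 t2 n
        assume A: "\<forall>v<40. r2 v = r' v" "r2 vLev = Suc l + n" "\<forall>j. j \<noteq> 7 \<and> j \<noteq> 8 \<longrightarrow> h2 j = ?h j"
          "\<forall>j<Suc l. h2 7 j = ?h 7 j \<and> h2 8 j = ?h 8 j"
          "unw h2 k n (Suc l) (r2 vRes) = vpred p (a + 2) (x div p) (?h k)"
          "unwok h2 k n (Suc l) (r2 vRes)" "r2 vRes \<le> x div p" "n \<le> dep p" "t2 \<le> t' + 30 * (dep p + 1)"
        have e: "h2 7 l = 0" "h2 8 l = a" "h2 5 l = p" "h2 6 l = sz p" "h2 k = h k"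
          using A(3,4) tab less.prems(5) by auto
        have vS: "clu a p (?v - 1) = Suc (Suc (a + ?v * sz p))" if "0 < ?v"
          using that by (cases ?v) simp_all
        have up: "upv h2 k l ?v = vpred u a x (h k)"
          using e v[unfolded if_not_P[OF c]] vS by (simp add: upv_def Let_def)
        have "Suc (Suc (Suc (a + ?v * sz p))) < B" if "0 < ?v"
        proof -
          have "?v - 1 < p" using vc cp by simp
          then show ?thesis using bb(1)[of "?v - 1"] vS[OF that] s3' U_B less.prems(6) by linarith
        qed
        then have ok: "upok h2 k l ?v"
          using up e vle U_B xu uU tab(3) bnd(5) by (simp add: upok_def)
        show "Q r2 h2 out t2"
        proof (rule Q[of _ "Suc n"])
          show "unw h2 k (Suc n) l (r2 vRes) = vpred u a x (h k)" using A(5) up hk by simp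
          show "unwok h2 k (Suc n) l (r2 vRes)" using A(5,6) ok hk by simp
          show "\<forall>j. j \<noteq> 7 \<and> j \<noteq> 8 \<longrightarrow> h2 j = h j" using A(3) by simp
          show "\<forall>j<l. h2 7 j = h 7 j \<and> h2 8 j = h 8 j" using A(4) by simp
          show "r2 vRes \<le> x" using A(7) xx by linarith
        qed (use A r' dep in simp_all)
      qed (use r' cp lev tabs' less.prems(5,6) bb(2)[OF cp] regs in simp_all)
    qed (simp_all add: b_def)
    show ?thesis
      by (subst wp_Loop) (simp add: regs bnd body)
  qed
qed

lemma veb_ins:
  assumes "rep (h k) U 0 X" "r vKey < U" "r vKey \<notin> X" "tabs h" "8 < k"
    and Q: "\<And>r' m t'. (\<forall>v<40. r' v = r v) \<Longrightarrow> rep m U 0 (insert (r vKey) X) \<Longrightarrow>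
      t' \<le> t + 30 * (dep U + 2) \<Longrightarrow> Q r' (h(k := m)) out t'"
  shows "wp (veb_ins k) Q r h out t"
proof -
  have "0 < W" "Suc 0 < W" using U_B B_W by linarith+
  then show ?thesis
    unfolding veb_ins_def
    apply simp
    apply (rule ins_loop[where x = "r vKey", OF assms(1-3) _ assms(4,5)])
    using vins_correct[OF assms(1-3)] apply (auto intro!: Q)
    done
qed

lemma veb_del:
  assumes "rep (h k) U 0 X" "r vKey \<in> X" "tabs h" "8 < k"
    and Q: "\<And>r' m t'. (\<forall>v<40. r' v = r v) \<Longrightarrow> rep m U 0 (X - {r vKey}) \<Longrightarrow>
      t' \<le> t + 30 * (dep U + 2) \<Longrightarrow> Q r' (h(k := m)) out t'"
  shows "wp (veb_del k) Q r h out t"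
proof -
  have "0 < W" "Suc 0 < W" using U_B B_W by linarith+
  then show ?thesis
    unfolding veb_del_def
    apply simp
    apply (rule del_loop[where x = "r vKey", OF assms(1-2) _ assms(3,4)])
    using vdel_correct[OF assms(1-2)] apply (auto intro!: Q)
    done
qed

lemma veb_pred:
  assumes "rep (h k) U 0 X" "r vKey < U" "tabs h" "8 < k"
    and Q: "\<And>r' h' t'. (\<forall>v<40. r' v = r v) \<Longrightarrow> is_pred X (r vKey) (r' vRes) \<Longrightarrow>
      (\<forall>j. j \<noteq> 7 \<and> j \<noteq> 8 \<longrightarrow> h' j = h j) \<Longrightarrow> t' \<le> t + 60 * (dep U + 2) \<Longrightarrow> Q r' h' out t'"
  shows "wp (veb_pred k) Q r h out t"
proof -
  have 0: "0 < W" "Suc 0 < W" using U_B B_W by linarith+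
  note v = vpred_correct[OF assms(1,2)]
  have "wp (Loop (N 0) (V vGo) (pred_down k)) (wp (Loop (N 0) (V vLev) (pred_up k)) Q)
     (r(vBase := 0, vLev := 0, vGo := 1)) h out (t + 3)"
  proof (rule pred_down_loop[where x = "r vKey" and l = 0, OF assms(1-2) _ assms(3,4)])
    fix r2 h2 t2 n
    assume A: "\<forall>v<40. r2 v = (r(vBase := 0, vLev := 0, vGo := 1)) v" "r2 vLev = 0 + n"
      "\<forall>j. j \<noteq> 7 \<and> j \<noteq> 8 \<longrightarrow> h2 j = h j" "unw h2 k n 0 (r2 vRes) = vpred U 0 (r vKey) (h k)"
      "unwok h2 k n 0 (r2 vRes)" "r2 vRes \<le> r vKey" "n \<le> dep U" "t2 \<le> t + 3 + 30 * (dep U + 1)"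
    show "wp (Loop (N 0) (V vLev) (pred_up k)) Q r2 h2 out t2"
    proof (rule pred_up_loop[where r = r2 and h = h2 and k = k and n = n, OF A(5)])
      show "r2 vRes < B" "n < B" "100 < B" using A(6,7) dep_le_self[of U] U_B assms(2) by linarith+
      fix r3 t3
      assume C: "\<forall>v<40. r3 v = r2 v" "r3 vRes = unw h2 k n 0 (r2 vRes)" "t3 \<le> t2 + 15 * (n + 1)"
      show "Q r3 h2 out t3"
        using C A v by (intro Q) auto
    qed (use A in simp)
  qed simp_all
  then show ?thesis
    unfolding veb_pred_def using 0 by (simp add: numeral_3_eq_3)
qed

end

section \<open>Matching in one block\<close>

text \<open>Registers: 4 mode (0 iff van Emde Boas sets are used), 5 offset of the keys of the block,
  6 offset of the block in the text, 7 length of the block, 8 state, 9 position of the next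
  symbol, 10 start of the window, 11 next symbol, 12 target of the transition, 22 universe size.
  Arrays: 3 keys, 9 positions of the keys in the window, 10 keys in the window, 11 the same keys
  mirrored, so that a predecessor search in it finds successors.\<close>

definition pred_position :: com where
  "pred_position =
    Cond (N 0) (V vRes) (13 ::= (Arr 9 (V vRes [-] N 1) [-] V 10) [+] N 1) (13 ::= N 0)"

text \<open>The mirrored set holds \<open>U - 1 - x\<close> and results are shifted by one, so
  \<open>U - vRes\<close> is the successor key itself. The position is counted from 1 at the window
  start.\<close>

definition succ_position :: com where
  "succ_position =
    Cond (N 0) (V vRes) (14 ::= (Arr 9 (V 22 [-] V vRes) [-] V 10) [+] N 1) (14 ::= N 0)"

definition find_veb :: com where
  "find_veb = (
    vKey ::= V 11;; veb_pred 10;; pred_position;;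
    vKey ::= (V 22 [-] N 1) [-] V 11;; veb_pred 11;; succ_position;;
    12 ::= Look (V 8) (V 13) (V 14))"

text \<open>Label positions count from 1, so position \<open>p\<close> refers to the key with index
  \<open>p - 1\<close> in the window. Register 16 is set in advance and cleared by a failed
  comparison.\<close>

definition check_fit :: com where
  "check_fit = (
    13 ::= EPred (V 8) (V 15);; 14 ::= ESucc (V 8) (V 15);; 16 ::= N 1;;
    Cond (N 0) (V 13)
      (Cond (Arr 3 (((V 5 [+] V 10) [+] V 13) [-] N 1)) (V 11) Skip (16 ::= N 0)) Skip;;
    Cond (N 0) (V 14)
      (Cond (V 11) (Arr 3 (((V 5 [+] V 10) [+] V 14) [-] N 1)) Skip (16 ::= N 0)) Skip)"

definition scan_body :: com where
  "scan_body = (check_fit;;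
    Cond (N 0) (V 16) (12 ::= ETarget (V 8) (V 15)) Skip;;
    15 ::= V 15 [+] N 1)"

definition find_scan :: com where
  "find_scan = (12 ::= N 0;; 15 ::= N 0;; 17 ::= Edges (V 8);; Loop (V 15) (V 17) scan_body)"

definition find :: com where
  "find = Cond (V 4) (N 1) find_veb find_scan"

definition put :: com where
  "put = Cond (V 4) (N 1)
    (vKey ::= V 11;; veb_ins 10;; vKey ::= (V 22 [-] N 1) [-] V 11;; veb_ins 11;; St 9 (V 11) (V 9)) Skip"

definition drop_first :: com where
  "drop_first = (
    Cond (V 4) (N 1)
      (21 ::= Arr 3 (V 5 [+] V 10);; vKey ::= V 21;; veb_del 10;;
       vKey ::= (V 22 [-] N 1) [-] V 21;; veb_del 11) Skip;;
    10 ::= V 10 [+] N 1)"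

definition emit_body :: com where
  "emit_body = (19 ::= Level (V 18);; Rep (((V 6 [+] V 9) [-] V 19) [+] N 1) (V 18);;
     18 ::= Output (Failure (V 18)))"

definition emit_loop :: com where
  "emit_loop = Loop (N 0) (V 18) emit_body"

text \<open>A failed attempt keeps the symbol and shortens the window, so every round advances one
  of the two window ends.\<close>

definition match_step :: com where
  "match_step = (
    11 ::= Arr 3 (V 5 [+] V 9);; find;;
    Cond (N 0) (V 12)
      (8 ::= V 12;; put;; 9 ::= V 9 [+] N 1;; 18 ::= Output (V 8);; emit_loop)
      (8 ::= Failure (V 8);; 19 ::= Level (V 8);; Loop (V 10 [+] V 19) (V 9) drop_first))"

text \<open>The second loop empties the window, so that the sets are empty again when the next block
  starts.\<close>

definition match_block :: com where
  "match_block = (8 ::= N 1;; 9 ::= N 0;; 10 ::= N 0;; Loop (V 9) (V 7) match_step;;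
    Loop (V 10) (V 9) drop_first)"

section \<open>Windows and invariants within a block\<close>

locale matcher = veb_ram w B A U + ac n S num A
  for w B :: nat and A :: ac_tables and U n :: nat and S num +
  assumes states_W: "card (ac_states S) < W"

text \<open>\<open>X\<close> holds the keys of one block, stored in array 3 from \<open>off\<close>
  on, and \<open>s0\<close> is the number of text symbols before the block. \<open>G\<close> bounds
  the cost of a transition attempt up to a constant, through the depth of the sets or through the
  number of patterns.\<close>

locale block = matcher +
  fixes X :: "nat list" and off s0 G :: nat
  assumes X: "distinct X" "\<And>x. x \<in> set X \<Longrightarrow> x < U"
    and off: "off + length X \<le> B" and s0: "s0 + length X + 1 < W"
begin

abbreviation len :: nat where "len \<equiv> length X"

definition win :: "nat \<Rightarrow> nat \<Rightarrow> nat list" where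
  "win b i = drop b (take i X)"

lemma length_win: "i \<le> len \<Longrightarrow> length (win b i) = i - b"
  by (simp add: win_def)

lemma nth_win: "i \<le> len \<Longrightarrow> j < i - b \<Longrightarrow> win b i ! j = X ! (b + j)"
  by (simp add: win_def)

lemma win_snoc: "b \<le> i \<Longrightarrow> i < len \<Longrightarrow> win b (Suc i) = win b i @ [X ! i]"
  by (simp add: win_def take_Suc_conv_app_nth)

lemma distinct_win: "distinct (win b i)"
  using X by (simp add: win_def)

lemma sfx_win: "b \<le> i \<Longrightarrow> i \<le> len \<Longrightarrow> l \<le> i - b \<Longrightarrow> sfx l (win b i) = win (i - l) i"
  by (simp add: sfx_def win_def)

lemma win_map: "i \<le> len \<Longrightarrow> win b i = map ((!) X) [b..<i]"
  by (rule nth_equalityI) (simp_all add: length_win nth_win)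

lemma set_win: "i \<le> len \<Longrightarrow> set (win b i) = (!) X ` {b..<i}"
  by (simp add: win_map)

definition keys :: "(nat \<Rightarrow> nat \<Rightarrow> nat) \<Rightarrow> bool" where
  "keys h \<longleftrightarrow> (\<forall>j<len. h 3 (off + j) = X ! j)"

text \<open>Array 9 has to be correct only for keys in the window; entries of other keys may be
  stale.\<close>

definition vebs :: "(nat \<Rightarrow> nat \<Rightarrow> nat) \<Rightarrow> nat \<Rightarrow> nat \<Rightarrow> bool" where
  "vebs h b i \<longleftrightarrow> tabs h \<and> rep (h 10) U 0 ((!) X ` {b..<i}) \<and>
    rep (h 11) U 0 ((\<lambda>j. U - 1 - X ! j) ` {b..<i}) \<and> (\<forall>j. b \<le> j \<longrightarrow> j < i \<longrightarrow> h 9 (X ! j) = j)"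

definition inv :: "(nat \<Rightarrow> nat \<Rightarrow> nat) \<Rightarrow> nat \<Rightarrow> nat \<Rightarrow> nat \<Rightarrow> bool" where
  "inv h m b i \<longleftrightarrow> keys h \<and> (m = 0 \<longrightarrow> vebs h b i)"

definition regs :: "(nat \<Rightarrow> nat) \<Rightarrow> bool" where
  "regs r \<longleftrightarrow> r 5 = off \<and> r 6 = s0 \<and> r 7 = len \<and> r 22 = U \<and> (r 4 = 0 \<longrightarrow> dep U \<le> G) \<and>
     (r 4 \<noteq> 0 \<longrightarrow> card S \<le> G)"

definition target :: "nat \<Rightarrow> nat \<Rightarrow> nat" where
  "target b i = (if valid (win b (Suc i)) then state (win b (Suc i)) else 0)"

section \<open>Finding a transition\<close>

lemma key_less: "j < len \<Longrightarrow> X ! j < U"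
  using X(2) by simp

lemma key_eq: "i < len \<Longrightarrow> j < len \<Longrightarrow> X ! i = X ! j \<longleftrightarrow> i = j"
  using X(1) by (simp add: nth_eq_iff_index_eq)

lemma mirror_eq: "i < len \<Longrightarrow> j < len \<Longrightarrow> U - 1 - X ! i = U - 1 - X ! j \<longleftrightarrow> i = j"
  using key_less[of i] key_less[of j] key_eq[of i j] by auto

lemma consts_W: "0 < W" "Suc 0 < W" "U < W" "B < W"
  using U_B B_W by linarith+

lemma state_W: "valid v \<Longrightarrow> state v < W"
  using state_bounds[of v] states_W by simp

text \<open>The search yields a key but a label needs a position; array 9, here \<open>f\<close>,
  translates, relative to the window start and counting from 1. The second part keeps these accesses
  in range.\<close>

lemma pred_pos_window:
  assumes p: "is_pred ((!) X ` {b..<i}) (X ! i) v" and i: "b \<le> i" "i < len"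
    and pos: "\<forall>j. b \<le> j \<longrightarrow> j < i \<longrightarrow> f (X ! j) = j"
  shows "pred_pos (win b i) (X ! i) = (if 0 < v then Suc (f (v - 1) - b) else 0)"
    "0 < v \<Longrightarrow> v \<le> U \<and> b \<le> f (v - 1) \<and> f (v - 1) < i"
proof -
  have il: "i \<le> len" using i by simp
  show "pred_pos (win b i) (X ! i) = (if 0 < v then Suc (f (v - 1) - b) else 0)"
  proof (cases v)
    case 0
    then show ?thesis using p by (simp add: is_pred_def pred_pos_0 set_win[OF il])
  next
    case (Suc y)
    then obtain j where j: "b \<le> j" "j < i" "y = X ! j" "X ! j < X ! i"
      "\<forall>z\<in>(!) X ` {b..<i}. z < X ! i \<longrightarrow> z \<le> X ! j" using p by (auto simp: is_pred_def)
    have "pred_pos (win b i) (X ! i) = Suc (j - b)"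
      using j i il by (subst pred_pos_Suc[OF distinct_win]) (simp add: length_win nth_win set_win)
    then show ?thesis using Suc j pos by simp
  qed
  assume "0 < v"
  then obtain y where y: "v = Suc y" by (cases v) auto
  then obtain j where j: "b \<le> j" "j < i" "y = X ! j" using p by (auto simp: is_pred_def)
  then show "v \<le> U \<and> b \<le> f (v - 1) \<and> f (v - 1) < i"
    using y pos key_less[of j] i by auto
qed

text \<open>Mirroring \<open>x\<close> to \<open>U - 1 - x\<close> reverses the order, so a
  predecessor among the mirrored keys is a successor among the keys.\<close>

lemma succ_pos_window:
  assumes p: "is_pred ((\<lambda>j. U - 1 - X ! j) ` {b..<i}) (U - 1 - X ! i) v" and i: "b \<le> i" "i < len"
    and pos: "\<forall>j. b \<le> j \<longrightarrow> j < i \<longrightarrow> f (X ! j) = j"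
  shows "succ_pos (win b i) (X ! i) = (if 0 < v then Suc (f (U - v) - b) else 0)"
    "0 < v \<Longrightarrow> v \<le> U \<and> b \<le> f (U - v) \<and> f (U - v) < i \<and> U - v < U"
proof -
  have il: "i \<le> len" using i by simp
  have less: "U - 1 - X ! j < U - 1 - X ! k \<longleftrightarrow> X ! k < X ! j" if "j < len" "k < len" for j k
    using key_less[OF that(1)] key_less[OF that(2)] by linarith
  show "succ_pos (win b i) (X ! i) = (if 0 < v then Suc (f (U - v) - b) else 0)"
  proof (cases v)
    case 0
    then show ?thesis using p less i by (auto simp: is_pred_def succ_pos_0 set_win[OF il])
  next
    case (Suc y)
    then obtain j where j: "b \<le> j" "j < i" "y = U - 1 - X ! j" "U - 1 - X ! j < U - 1 - X ! i"
      "\<forall>k\<in>{b..<i}. U - 1 - X ! k < U - 1 - X ! i \<longrightarrow> U - 1 - X ! k \<le> U - 1 - X ! j"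
      using p by (auto simp: is_pred_def)
    have "X ! j \<le> X ! k" if "k \<in> {b..<i}" "X ! i < X ! k" for k
      using j(5) that less[of k i] less[of j k] i j(2) by (metis atLeastLessThan_iff less_trans not_less)
    then have "succ_pos (win b i) (X ! i) = Suc (j - b)"
      using j i il less[of j i]
      by (subst succ_pos_Suc[OF distinct_win]) (auto simp: length_win nth_win set_win)
    moreover have "U - v = X ! j" using Suc j(3) key_less[of j] j(2) i by simp
    ultimately show ?thesis using Suc j pos by simp
  qed
  assume "0 < v"
  then obtain y where y: "v = Suc y" by (cases v) auto
  then obtain j where j: "b \<le> j" "j < i" "y = U - 1 - X ! j" using p by (auto simp: is_pred_def)
  then have "U - v = X ! j" "v \<le> U" "X ! j < U" using y key_less[of j] i by auto
  then show "v \<le> U \<and> b \<le> f (U - v) \<and> f (U - v) < i \<and> U - v < U" using pos j by simp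
qed

lemma target_eq: "b \<le> i \<Longrightarrow> i < len \<Longrightarrow> valid (win b i) \<Longrightarrow>
    ac_lookup A (state (win b i)) (pred_pos (win b i) (X ! i)) (succ_pos (win b i) (X ! i)) = target b i"
  using lookup[of "win b i" "X ! i"] distinct_win[of b "Suc i"] by (simp add: win_snoc target_def)

lemma target_W: "target b i < W"
  using state_W consts_W by (simp add: target_def)

lemma find_veb:
  assumes v: "vebs h b i" and r: "regs r" and G: "dep U \<le> G" and i: "b \<le> i" "i < len" "valid (win b i)"
    and rr: "r 8 = state (win b i)" "r 10 = b" "r 11 = X ! i"
    and Q: "\<And>r' h' t'. (\<forall>v<40. v \<notin> {12..17} \<longrightarrow> r' v = r v) \<Longrightarrow> r' 12 = target b i \<Longrightarrow>
      (\<forall>j. j \<noteq> 7 \<and> j \<noteq> 8 \<longrightarrow> h' j = h j) \<Longrightarrow> t' \<le> t + 180 * (G + 2) \<Longrightarrow> Q r' h' out t'"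
  shows "wp find_veb Q r h out t"
proof -
  note V = v[unfolded vebs_def]
  have x: "X ! i < U" using i key_less by simp
  have U: "r 22 = U" "1 \<le> U" using r x by (auto simp: regs_def)
  have W: "0 < W" "Suc 0 < W" "U < W" "B < W" using consts_W by auto
  have UB: "U \<le> B" using U_B by simp
  have lB: "j < W" "j < B" "Suc (j - b) < W" if "j < i" for j using that i off W by auto
  define pp where "pp = pred_pos (win b i) (X ! i)"
  define sp where "sp = succ_pos (win b i) (X ! i)"
  have last: "wp succ_position (wp (12 ::= Look (V 8) (V 13) (V 14)) Q) r2 h2 out t2"
    if r2: "\<forall>v<40. v \<noteq> 13 \<longrightarrow> r2 v = r v" "r2 13 = pp"
      and p: "is_pred ((\<lambda>j. U - 1 - X ! j) ` {b..<i}) (U - 1 - X ! i) (r2 41)"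
      and h2: "\<forall>j. j \<noteq> 7 \<and> j \<noteq> 8 \<longrightarrow> h2 j = h j" and t2: "t2 \<le> t + 150 * (G + 2)" for r2 h2 t2
  proof -
    note s = succ_pos_window[OF p i(1,2), of "h 9", folded sp_def]
    have s1: "sp = (if 0 < r2 41 then Suc (h 9 (U - r2 41) - b) else 0)" using s(1) V by blast
    have s2: "r2 41 \<le> U" "b \<le> h 9 (U - r2 41)" "h 9 (U - r2 41) < i" "U - r2 41 < U" if "0 < r2 41"
      using s(2)[OF _ that] V by auto
    have l: "ac_lookup A (state (win b i)) pp sp = target b i" unfolding pp_def sp_def by (rule target_eq[OF i])
    have h9: "h2 9 = h 9" using h2 by simp
    have rs: "r2 8 = state (win b i)" "r2 10 = b" "r2 22 = U" using r2 rr U by simp_all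
    show ?thesis
    proof (cases "0 < r2 41")
      case True
      have b3: "U - r2 41 < B" "U - r2 41 < W" using s2(4)[OF True] UB W by linarith+
      have "Suc (h 9 (U - r2 41) - b) < W" "h 9 (U - r2 41) - b < W" using s2(3)[OF True] lB[of "h 9 (U - r2 41)"]
        by linarith+
      moreover have "sp = Suc (h 9 (U - r2 41) - b)" using s1 True by simp
      ultimately show ?thesis
        using True s2[OF True] b3 l target_W[of b i]
        by (simp add: succ_position_def rs h9 W r2(2), intro Q) (use r2 h2 t2 in auto)
    next
      case False
      then have "sp = 0" using s1 by simp
      then show ?thesis
        using False l target_W[of b i]
        by (simp add: succ_position_def rs W r2(2), intro Q) (use r2 h2 t2 in auto)
    qed
  qed
  have middle: "wp pred_position (wp (vKey ::= (V 22 [-] N 1) [-] V 11;; veb_pred 11;; succ_position;;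
      12 ::= Look (V 8) (V 13) (V 14)) Q) r1 h1 out t1"
    if r1: "\<forall>v<40. r1 v = r v" and p: "is_pred ((!) X ` {b..<i}) (X ! i) (r1 41)"
      and h1: "\<forall>j. j \<noteq> 7 \<and> j \<noteq> 8 \<longrightarrow> h1 j = h j" and t1: "t1 \<le> t + 1 + 60 * (dep U + 2)" for r1 h1 t1
  proof -
    note s = pred_pos_window[OF p i(1,2), of "h 9", folded pp_def]
    have s1: "pp = (if 0 < r1 41 then Suc (h 9 (r1 41 - 1) - b) else 0)" using s(1) V by blast
    have s2: "r1 41 \<le> U" "b \<le> h 9 (r1 41 - 1)" "h 9 (r1 41 - 1) < i" if "0 < r1 41"
      using s(2)[OF _ that] V by auto
    have h9: "h1 9 = h 9" using h1 by simp
    have rs: "r1 8 = state (win b i)" "r1 10 = b" "r1 22 = U" "r1 11 = X ! i" using r1 rr U by simp_all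
    have rest: "wp (veb_pred 11) (wp (succ_position;; 12 ::= Look (V 8) (V 13) (V 14)) Q) r2 h1 out t2"
      if r2: "\<forall>v<40. v \<noteq> 13 \<longrightarrow> r2 v = r v" "r2 13 = pp" "r2 40 = U - 1 - X ! i"
        and t2: "t2 \<le> t + 10 + 60 * (dep U + 2)" for r2 t2
    proof (rule veb_pred[where X = "(\<lambda>j. U - 1 - X ! j) ` {b..<i}"])
      show "rep (h1 11) U 0 ((\<lambda>j. U - 1 - X ! j) ` {b..<i})" "tabs h1"
        using V h1 by (simp_all add: tabs_def)
      show "r2 40 < U" using r2(3) U by simp
      fix r3 h3 t3
      assume A: "\<forall>v<40. r3 v = r2 v" "is_pred ((\<lambda>j. U - 1 - X ! j) ` {b..<i}) (r2 40) (r3 41)"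
        "\<forall>j. j \<noteq> 7 \<and> j \<noteq> 8 \<longrightarrow> h3 j = h1 j" "t3 \<le> t2 + 60 * (dep U + 2)"
      show "wp (succ_position;; 12 ::= Look (V 8) (V 13) (V 14)) Q r3 h3 out t3"
        unfolding wp_Seq
      proof (rule last)
        show "t3 \<le> t + 150 * (G + 2)" using A(4) t2 mult_le_mono2[OF G, of 120] by (simp add: algebra_simps)
      qed (use A r2 h1 in auto)
    qed simp
    show ?thesis
    proof (cases "0 < r1 41")
      case True
      have b3: "r1 41 - 1 < B" "r1 41 - 1 < W" using s2(1)[OF True] True UB W by linarith+
      have "Suc (h 9 (r1 41 - 1) - b) < W" "h 9 (r1 41 - 1) - b < W"
        using s2(3)[OF True] lB[of "h 9 (r1 41 - 1)"] by linarith+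
      moreover have "pp = Suc (h 9 (r1 41 - 1) - b)" using s1 True by simp
      moreover have "X ! i \<le> U - 1" "U - 1 < W" "U - 1 - X ! i < W" using x W by linarith+
      ultimately show ?thesis
        using True s2[OF True] b3 U
        by (simp add: pred_position_def rs h9 W Suc_le_eq, intro rest, use r1 t1 in auto)
    next
      case False
      then have "pp = 0" using s1 by simp
      moreover have "X ! i \<le> U - 1" "U - 1 < W" "U - 1 - X ! i < W" using x W by linarith+
      ultimately show ?thesis
        using False U
        by (simp add: pred_position_def rs W Suc_le_eq, intro rest, use r1 t1 in auto)
    qed
  qed
  have start: "wp (veb_pred 10) (wp (pred_position;; vKey ::= (V 22 [-] N 1) [-] V 11;; veb_pred 11;; succ_position;;
      12 ::= Look (V 8) (V 13) (V 14)) Q) (r(40 := X ! i)) h out (Suc t)"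
  proof (rule veb_pred[where X = "(!) X ` {b..<i}"])
    fix r1 h1 t1
    assume A: "\<forall>v<40. r1 v = (r(40 := X ! i)) v" "is_pred ((!) X ` {b..<i}) ((r(40 := X ! i)) 40) (r1 41)"
      "\<forall>j. j \<noteq> 7 \<and> j \<noteq> 8 \<longrightarrow> h1 j = h j" "t1 \<le> Suc t + 60 * (dep U + 2)"
    show "wp (pred_position;; vKey ::= (V 22 [-] N 1) [-] V 11;; veb_pred 11;; succ_position;;
      12 ::= Look (V 8) (V 13) (V 14)) Q r1 h1 out t1"
      unfolding wp_Seq[where ?c1.0 = pred_position] by (rule middle) (use A in auto)
  qed (use V x in auto)
  show ?thesis
    unfolding find_veb_def wp_Seq[where ?c1.0 = "Asg 40 (V 11)"] wp_Asg
    unfolding wp_Seq[where ?c1.0 = "veb_pred 10"] using start by (simp add: rr)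
qed

text \<open>All edges are scanned, and there are at most \<open>card S\<close> of them. Since every
  fitting edge has the same target, the invariant can fix the value of register 12 by whether any
  scanned edge fits.\<close>

lemma find_scan:
  assumes k: "keys h" and r: "regs r" and G: "card S \<le> G" and i: "b \<le> i" "i < len" "valid (win b i)"
    and rr: "r 8 = state (win b i)" "r 10 = b" "r 11 = X ! i"
    and Q: "\<And>r' t'. (\<forall>v<40. v \<notin> {12..17} \<longrightarrow> r' v = r v) \<Longrightarrow> r' 12 = target b i \<Longrightarrow>
      t' \<le> t + 180 * (G + 2) \<Longrightarrow> Q r' h out t'"
  shows "wp find_scan Q r h out t"
proof -
  let ?E = "ac_edges A (state (win b i))"
  have degG: "length ?E \<le> G" using degree_le[OF i(3)] G by linarith
  have degW: "length ?E < W"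
    using degree_le[OF i(3)] card_patterns_le states_W by linarith
  have W: "0 < W" "Suc 0 < W" "U < W" "B < W" using consts_W by auto
  have dist: "distinct (win b i @ [X ! i])" using distinct_win[of b "Suc i"] i by (simp add: win_snoc)
  define P where "P j = (case ?E ! j of (a, c, s') \<Rightarrow> fits (win b i) (X ! i) a c)" for j
  have E_fits: "valid (win b (Suc i)) \<and> snd (snd (?E ! j)) = target b i" if "j < length ?E" "P j" for j
  proof -
    obtain a c s' where e: "?E ! j = (a, c, s')" by (cases "?E ! j") auto
    then have "(a, c, s') \<in> set ?E" using that(1) by (metis nth_mem)
    then have "valid (win b i @ [X ! i]) \<and> s' = state (win b i @ [X ! i])"
      using edge_fits[OF i(3) dist] that(2) e by (auto simp: P_def)
    then show ?thesis using i e by (simp add: target_def win_snoc)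
  qed
  have exP: "\<exists>j<length ?E. P j" if "valid (win b (Suc i))"
  proof -
    have "valid (win b i @ [X ! i])" using that i by (simp add: win_snoc)
    then obtain a c s' where "(a, c, s') \<in> set ?E" "fits (win b i) (X ! i) a c"
      using edge_exists dist by blast
    then show ?thesis by (force simp: in_set_conv_nth P_def)
  qed
  define I where "I r' h' out' t' \<longleftrightarrow> (\<forall>v<40. v \<notin> {12..17} \<longrightarrow> r' v = r v) \<and> h' = h \<and> out' = out \<and>
      r' 17 = length ?E \<and> r' 15 \<le> length ?E \<and> t' \<le> t + 3 + 15 * r' 15 \<and>
      r' 12 = (if \<exists>j<r' 15. P j then target b i else 0)" for r' h' out' t'
  have body: "wp scan_body (\<lambda>r2 h2 out2 t2. I r2 h2 out2 t2 \<and> length ?E - r2 15 < length ?E - r1 15) r1 h out (Suc t1)"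
    if I1: "I r1 h out t1" and lt: "r1 15 < length ?E" for r1 t1
  proof -
    let ?j = "r1 15"
    obtain a c s' where e: "?E ! ?j = (a, c, s')" by (cases "?E ! ?j") auto
    then have in_E: "(a, c, s') \<in> set ?E" using lt by (metis nth_mem)
    have ac: "a \<le> i - b" "c \<le> i - b" "s' < W"
      using edge_bounds[OF i(3) in_E] i states_W by (auto simp: length_win)
    have ed: "edge A (state (win b i)) ?j = (a, c, s')" using e lt by (simp add: edge_def)
    have r1: "r1 8 = state (win b i)" "r1 10 = b" "r1 11 = X ! i" "r1 5 = off"
      using I1 rr r by (simp_all add: I_def regs_def)
    have bnd: "a < W" "c < W" "Suc ?j < W" "off + b < W" "off + b + a < W" "off + b + c < W"
      "off + b < B" "off + b + a - Suc 0 < W" "off + b + c - Suc 0 < W"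
      using ac i off W lt degW by linarith+
    have key: "h 3 (off + b + y - Suc 0) = win b i ! (y - Suc 0)" "off + b + y - Suc 0 < B"
      if "0 < y" "y \<le> i - b" for y
    proof -
      have "h 3 (off + (b + y - 1)) = X ! (b + y - 1)"
        by (rule k[unfolded keys_def, rule_format]) (use that i in linarith)
      moreover have "off + b + y - Suc 0 = off + (b + y - 1)" "b + (y - 1) = b + y - 1" using that by auto
      ultimately show "h 3 (off + b + y - Suc 0) = win b i ! (y - Suc 0)"
        using that i nth_win[of i "y - 1" b] by simp
      show "off + b + y - Suc 0 < B" using that i off by linarith
    qed
    have P: "P ?j \<longleftrightarrow> (0 < a \<longrightarrow> win b i ! (a - Suc 0) < X ! i) \<and> (0 < c \<longrightarrow> X ! i < win b i ! (c - Suc 0))"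
      using e by (simp add: P_def fits_def)
    have ka: "h 3 (off + b + a - Suc 0) = win b i ! (a - Suc 0)" "off + b + a - Suc 0 < B"
      "Suc 0 \<le> off + b + a" if "0 < a" using key[of a] that ac by auto
    have kc: "h 3 (off + b + c - Suc 0) = win b i ! (c - Suc 0)" "off + b + c - Suc 0 < B"
      "Suc 0 \<le> off + b + c" if "0 < c" using key[of c] that ac by auto
    have chk: "wp check_fit (\<lambda>r2 h2 out2 t2. (\<forall>v<40. v \<notin> {13, 14, 16} \<longrightarrow> r2 v = r1 v) \<and>
      r2 16 = (if P ?j then 1 else 0) \<and> h2 = h \<and> out2 = out \<and> t2 \<le> t1 + 10) r1 h out (Suc t1)"
    proof (cases "0 < a")
      case True
      note ka = ka[OF True]
      show ?thesis
      proof (cases "0 < c")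
        case True
        note kc = kc[OF True]
        show ?thesis unfolding P check_fit_def using \<open>0 < a\<close> True by (simp add: r1 ed W bnd ac ka kc)
      next
        case False
        then show ?thesis unfolding P check_fit_def using \<open>0 < a\<close> by (simp add: r1 ed W bnd ac ka)
      qed
    next
      case a: False
      show ?thesis
      proof (cases "0 < c")
        case True
        note kc = kc[OF True]
        show ?thesis unfolding P check_fit_def using a True by (simp add: r1 ed W bnd ac kc)
      next
        case False
        then show ?thesis unfolding P check_fit_def using a by (simp add: r1 ed W bnd ac)
      qed
    qed
    have ex: "(\<exists>j<Suc ?j. P j) \<longleftrightarrow> (\<exists>j<?j. P j) \<or> P ?j" by (auto simp: less_Suc_eq)
    have tgt: "s' = target b i" if "P ?j" using E_fits[OF lt that] e by simp
    have fin: "I (r2(12 := v, 15 := Suc ?j)) h out t2"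
      if "\<forall>v<40. v \<notin> {13, 14, 16} \<longrightarrow> r2 v = r1 v" "t2 \<le> t1 + 13"
        "v = (if P ?j then target b i else r1 12)" for r2 v t2
    proof -
      note J = I1[unfolded I_def]
      have "(r2(12 := v, 15 := Suc ?j)) q = r q" if q: "q < 40" "q \<notin> {12..17}" for q
      proof -
        have "r2 q = r1 q" "q \<noteq> 12" "q \<noteq> 15" using \<open>\<forall>v<40. v \<notin> {13, 14, 16} \<longrightarrow> r2 v = r1 v\<close> q by auto
        then show ?thesis using J q by simp
      qed
      moreover have "r2 17 = length ?E" using that(1) J by simp
      moreover have "v = (if \<exists>j<Suc ?j. P j then target b i else 0)"
      proof (cases "P ?j")
        case False
        have "r1 12 = (if \<exists>j<?j. P j then target b i else 0)" using J by blast
        then show ?thesis using that(3) False unfolding ex by (simp only: if_False simp_thms)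
      qed (use that(3) in \<open>simp add: ex\<close>)
      moreover have "t2 \<le> t + 3 + 15 * Suc ?j" using that(2) J by simp
      moreover have "Suc ?j \<le> length ?E" using lt by simp
      ultimately show ?thesis unfolding I_def by simp
    qed
    show ?thesis
      unfolding scan_body_def wp_Seq
    proof (rule wp_mono[OF chk], elim conjE)
      fix r2 h2 out2 t2
      assume A: "\<forall>v<40. v \<notin> {13, 14, 16} \<longrightarrow> r2 v = r1 v" "r2 16 = (if P ?j then 1 else 0)" "h2 = h"
        "out2 = out" "t2 \<le> t1 + 10"
      have r2: "r2 15 = ?j" "r2 8 = state (win b i)" "r2 12 = r1 12" using A(1) r1 by simp_all
      have dl: "length ?E - Suc ?j < length ?E - ?j" using lt by linarith
      have triv: "r2(15 := Suc ?j) = r2(12 := r1 12, 15 := Suc ?j)" using r2(3) by auto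
      show "wp (Cond (N 0) (V 16) (12 ::= ETarget (V 8) (V 15)) Skip) (wp (15 ::= V 15 [+] N 1)
         (\<lambda>r2 h2 out2 t2. I r2 h2 out2 t2 \<and> length ?E - r2 15 < length ?E - r1 15)) r2 h2 out2 t2"
      proof (cases "P ?j")
        case True
        have "s' < W" by (rule ac(3))
        then show ?thesis
          using fin[OF A(1), of "Suc (Suc (Suc t2))" "target b i"] A(5) True tgt[OF True] dl bnd(3)
          by (simp add: A(2-4) r2 W ed del: fun_upd_apply) (simp add: r2)
      next
        case False
        then show ?thesis
          using fin[OF A(1), of "Suc (Suc t2)" "r1 12"] A(5) False dl bnd(3) unfolding triv[symmetric]
          by (simp add: A(2-4) r2 W ed del: fun_upd_apply) (simp add: r2)
      qed
    qed
  qed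
  have "wp (Loop (V 15) (V 17) scan_body) Q (r(12 := 0, 15 := 0, 17 := length ?E)) h out (t + 3)"
  proof (rule wp_Loop_inv[where I = I and \<mu> = "\<lambda>r h. length ?E - r 15"])
    show "I (r(12 := 0, 15 := 0, 17 := length ?E)) h out (t + 3)" by (simp add: I_def)
    fix r1 h1 out1 t1
    assume I1: "I r1 h1 out1 t1"
    then have h1: "h1 = h" "out1 = out" "r1 17 = length ?E" by (auto simp: I_def)
    have fin: "Q r1 h out (Suc t1)" if "\<not> r1 15 < length ?E"
    proof (rule Q)
      have eq: "r1 15 = length ?E" using I1 that by (simp add: I_def)
      show "r1 12 = target b i"
      proof (cases "valid (win b (Suc i))")
        case True
        then show ?thesis using I1 exP eq by (auto simp: I_def)
      next
        case False
        then show ?thesis using I1 E_fits eq by (auto simp: I_def target_def)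
      qed
      show "Suc t1 \<le> t + 180 * (G + 2)" using I1 eq degG by (simp add: I_def)
    qed (use I1 in \<open>simp add: I_def\<close>)
    show "ok r1 h1 (V 15) \<and> ok r1 h1 (V 17) \<and>
       (if val r1 h1 (V 15) < val r1 h1 (V 17)
        then wp scan_body (\<lambda>r2 h2 out2 t2. I r2 h2 out2 t2 \<and> length ?E - r2 15 < length ?E - r1 15) r1 h1 out1 (Suc t1)
        else Q r1 h1 out1 (Suc t1))"
      using body[of r1 t1] fin I1 by (simp add: h1)
  qed
  then show ?thesis
    unfolding find_scan_def using degW W by (simp add: rr numeral_3_eq_3)
qed

lemma find:
  assumes "inv h (r 4) b i" and r: "regs r" and i: "b \<le> i" "i < len" "valid (win b i)"
    and rr: "r 8 = state (win b i)" "r 10 = b" "r 11 = X ! i"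
    and Q: "\<And>r' h' t'. (\<forall>v<40. v \<notin> {12..17} \<longrightarrow> r' v = r v) \<Longrightarrow> r' 12 = target b i \<Longrightarrow>
      (\<forall>j. j \<noteq> 7 \<and> j \<noteq> 8 \<longrightarrow> h' j = h j) \<Longrightarrow> t' \<le> t + 200 * (G + 2) \<Longrightarrow> Q r' h' out t'"
  shows "wp find Q r h out t"
proof (cases "r 4 = 0")
  case True
  have "wp find_veb Q r h out (Suc t)"
    by (rule find_veb[OF _ r _ i rr]) (use True assms(1) r in \<open>auto simp: inv_def regs_def intro!: Q\<close>)
  then show ?thesis using True consts_W by (simp add: find_def)
next
  case False
  have "wp find_scan Q r h out (Suc t)"
    by (rule find_scan[OF _ r _ i rr]) (use False assms(1) r in \<open>auto simp: inv_def regs_def intro!: Q\<close>)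
  then show ?thesis using False consts_W by (simp add: find_def)
qed

section \<open>Moving the ends of the window\<close>

lemma put:
  assumes "inv h (r 4) b i" and r: "regs r" and i: "b \<le> i" "i < len"
    and rr: "r 9 = i" "r 11 = X ! i"
    and Q: "\<And>r' h' t'. (\<forall>v<40. r' v = r v) \<Longrightarrow> inv h' (r 4) b (Suc i) \<Longrightarrow>
      (\<forall>j<7. h' j = h j) \<Longrightarrow> t' \<le> t + 100 * (G + 2) \<Longrightarrow> Q r' h' out t'"
  shows "wp put Q r h out t"
proof (cases "r 4 = 0")
  case False
  then show ?thesis using consts_W assms(1) by (auto simp: put_def inv_def intro!: Q)
next
  case True
  have V: "keys h" "tabs h" "rep (h 10) U 0 ((!) X ` {b..<i})"
    "rep (h 11) U 0 ((\<lambda>j. U - 1 - X ! j) ` {b..<i})" "\<forall>j. b \<le> j \<longrightarrow> j < i \<longrightarrow> h 9 (X ! j) = j"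
    using assms(1) True by (auto simp: inv_def vebs_def)
  have dG: "dep U \<le> G" using r True by (simp add: regs_def)
  have x: "X ! i < U" "X ! i \<notin> (!) X ` {b..<i}" "U - 1 - X ! i \<notin> (\<lambda>j. U - 1 - X ! j) ` {b..<i}"
    using key_less key_eq[of i] mirror_eq[of i] i by (auto simp: image_iff)
  have U: "r 22 = U" using r by (simp add: regs_def)
  have W: "0 < W" "Suc 0 < W" "U < W" "B < W" "U - Suc 0 < W" "U - Suc (X ! i) < W" "U \<le> B" "X ! i < B"
    "X ! i \<le> U - Suc 0" "Suc 0 \<le> U" "U - Suc (X ! i) < U"
    using consts_W U_B x by linarith+
  have ins: "{b..<Suc i} = insert i {b..<i}" using i by auto
  have "wp (veb_ins 10) (wp (vKey ::= (V 22 [-] N 1) [-] V 11;; veb_ins 11;; St 9 (V 11) (V 9)) Q)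
     (r(40 := X ! i)) h out (Suc (Suc t))"
  proof (rule veb_ins[where X = "(!) X ` {b..<i}"])
    fix r1 m1 t1
    assume A: "\<forall>v<40. r1 v = (r(40 := X ! i)) v" "rep m1 U 0 (insert ((r(40 := X ! i)) 40) ((!) X ` {b..<i}))"
      "t1 \<le> Suc (Suc t) + 30 * (dep U + 2)"
    let ?h1 = "h(10 := m1)"
    have r1: "r1 22 = U" "r1 11 = X ! i" using A U rr by simp_all
    have "wp (veb_ins 11) (wp (St 9 (V 11) (V 9)) Q) (r1(40 := U - 1 - X ! i)) ?h1 out (Suc t1)"
    proof (rule veb_ins[where X = "(\<lambda>j. U - 1 - X ! j) ` {b..<i}"])
      show "rep (?h1 11) U 0 ((\<lambda>j. U - 1 - X ! j) ` {b..<i})" using V(4) by simp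
      show "tabs ?h1" using V(2) by (simp add: tabs_def)
      fix r2 m2 t2
      assume C: "\<forall>v<40. r2 v = (r1(40 := U - 1 - X ! i)) v"
        "rep m2 U 0 (insert ((r1(40 := U - 1 - X ! i)) 40) ((\<lambda>j. U - 1 - X ! j) ` {b..<i}))"
        "t2 \<le> Suc t1 + 30 * (dep U + 2)"
      let ?h2 = "?h1(11 := m2, 9 := (h 9)(X ! i := i))"
      have "inv ?h2 (r 4) b (Suc i)"
        unfolding inv_def vebs_def ins image_insert
      proof (intro conjI impI allI)
        show "keys ?h2" using V(1) by (simp add: keys_def)
        show "tabs ?h2" using V(2) by (simp add: tabs_def)
        show "rep (?h2 10) U 0 (insert (X ! i) ((!) X ` {b..<i}))" using A(2) by simp
        show "rep (?h2 11) U 0 (insert (U - 1 - X ! i) ((\<lambda>j. U - 1 - X ! j) ` {b..<i}))" using C(2) by simp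
        \<comment> \<open>Keys are distinct, so recording position \<open>i\<close> overwrites no
          other position of the window.\<close>
        fix j assume "b \<le> j" "j < Suc i"
        then show "?h2 9 (X ! j) = j" using V(5) key_eq[of i j] i by (auto simp: less_Suc_eq)
      qed
      moreover have "r2 11 = X ! i" "r2 9 = i" using C A rr by simp_all
      ultimately show "wp (St 9 (V 11) (V 9)) Q r2 (?h1(11 := m2)) out t2"
        using W C A dG by (simp, intro Q) auto
    qed (use W x in simp_all)
    then show "wp (vKey ::= (V 22 [-] N 1) [-] V 11;; veb_ins 11;; St 9 (V 11) (V 9)) Q r1 ?h1 out t1"
      using W by (simp add: r1)
  qed (use V x in simp_all)
  then show ?thesis using True W by (simp add: put_def rr)
qed

lemma drop_first:
  assumes "inv h (r 4) b i" and r: "regs r" and i: "b < i" "i \<le> len"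
    and rr: "r 10 = b"
    and Q: "\<And>r' h' t'. (\<forall>v<40. v \<noteq> 10 \<and> v \<noteq> 21 \<longrightarrow> r' v = r v) \<Longrightarrow> r' 10 = Suc b \<Longrightarrow> inv h' (r 4) (Suc b) i \<Longrightarrow>
      (\<forall>j<7. h' j = h j) \<Longrightarrow> t' \<le> t + 100 * (G + 2) \<Longrightarrow> Q r' h' out t'"
  shows "wp drop_first Q r h out t"
proof (cases "r 4 = 0")
  case False
  have "b < W" "Suc b < W" using i off consts_W by linarith+
  then show ?thesis using False consts_W assms(1) rr by (auto simp: drop_first_def inv_def intro!: Q)
next
  case True
  have V: "keys h" "tabs h" "rep (h 10) U 0 ((!) X ` {b..<i})"
    "rep (h 11) U 0 ((\<lambda>j. U - 1 - X ! j) ` {b..<i})" "\<forall>j. b \<le> j \<longrightarrow> j < i \<longrightarrow> h 9 (X ! j) = j"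
    using assms(1) True by (auto simp: inv_def vebs_def)
  have dG: "dep U \<le> G" using r True by (simp add: regs_def)
  have x: "X ! b < U" using key_less i by simp
  have U: "r 22 = U" "r 5 = off" using r by (simp_all add: regs_def)
  have W: "0 < W" "Suc 0 < W" "U < W" "B < W" "U - Suc 0 < W" "U - Suc (X ! b) < W" "U \<le> B" "X ! b < B"
    "X ! b \<le> U - Suc 0" "Suc 0 \<le> U" "b < W" "Suc b < W" "off + b < W" "off + b < B"
    using consts_W U_B x i off by linarith+
  have hb: "h 3 (off + b) = X ! b" using V(1) i by (simp add: keys_def)
  have ins: "{b..<i} = insert b {Suc b..<i}" using i by auto
  have del: "(!) X ` {b..<i} - {X ! b} = (!) X ` {Suc b..<i}"
    "(\<lambda>j. U - 1 - X ! j) ` {b..<i} - {U - 1 - X ! b} = (\<lambda>j. U - 1 - X ! j) ` {Suc b..<i}"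
    unfolding ins image_insert using key_eq[of _ b] mirror_eq[of _ b] i by auto
  have "wp (veb_del 10) (wp (vKey ::= (V 22 [-] N 1) [-] V 21;; veb_del 11) (wp (10 ::= V 10 [+] N 1) Q))
     (r(21 := X ! b, 40 := X ! b)) h out (Suc (Suc (Suc t)))"
  proof (rule veb_del[where X = "(!) X ` {b..<i}"])
    fix r1 m1 t1
    assume A: "\<forall>v<40. r1 v = (r(21 := X ! b, 40 := X ! b)) v"
      "rep m1 U 0 ((!) X ` {b..<i} - {(r(21 := X ! b, 40 := X ! b)) 40})"
      "t1 \<le> Suc (Suc (Suc t)) + 30 * (dep U + 2)"
    let ?h1 = "h(10 := m1)"
    have r1: "r1 22 = U" "r1 21 = X ! b" using A U rr by simp_all
    have "wp (veb_del 11) (wp (10 ::= V 10 [+] N 1) Q) (r1(40 := U - 1 - X ! b)) ?h1 out (Suc t1)"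
    proof (rule veb_del[where X = "(\<lambda>j. U - 1 - X ! j) ` {b..<i}"])
      show "rep (?h1 11) U 0 ((\<lambda>j. U - 1 - X ! j) ` {b..<i})" using V(4) by simp
      show "tabs ?h1" using V(2) by (simp add: tabs_def)
      fix r2 m2 t2
      assume C: "\<forall>v<40. r2 v = (r1(40 := U - 1 - X ! b)) v"
        "rep m2 U 0 ((\<lambda>j. U - 1 - X ! j) ` {b..<i} - {(r1(40 := U - 1 - X ! b)) 40})"
        "t2 \<le> Suc t1 + 30 * (dep U + 2)"
      let ?h2 = "?h1(11 := m2)"
      have "inv ?h2 (r 4) (Suc b) i"
        unfolding inv_def vebs_def
      proof (intro conjI impI allI)
        show "keys ?h2" using V(1) by (simp add: keys_def)
        show "tabs ?h2" using V(2) by (simp add: tabs_def)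
        show "rep (?h2 10) U 0 ((!) X ` {Suc b..<i})" using A(2) del by simp
        show "rep (?h2 11) U 0 ((\<lambda>j. U - 1 - X ! j) ` {Suc b..<i})" using C(2) del by simp
        fix j assume "Suc b \<le> j" "j < i"
        then show "?h2 9 (X ! j) = j" using V(5) by simp
      qed
      moreover have "r2 10 = b" using C A rr by simp
      ultimately show "wp (10 ::= V 10 [+] N 1) Q r2 ?h2 out t2"
        using W C A dG by (simp, intro Q) auto
    qed (use W x i in auto)
    then show "wp (vKey ::= (V 22 [-] N 1) [-] V 21;; veb_del 11) (wp (10 ::= V 10 [+] N 1) Q) r1 ?h1 out t1"
      using W by (simp add: r1)
  qed (use V x i in auto)
  then show ?thesis using True W by (simp add: drop_first_def rr U hb)
qed

text \<open>The guard is abstracted to register 10 plus \<open>L\<close>, which covers both uses: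
  shrinking to the failure suffix of length \<open>L\<close>, and emptying the window with
  \<open>L = 0\<close>.\<close>

lemma drop_loop:
  assumes "inv h (r 4) b i" "regs r" "b + L \<le> i" "i \<le> len" "r 10 = b" "r 9 = i"
    and e: "\<And>r' h'. r' 10 + L \<le> i \<Longrightarrow> r' 19 = r 19 \<Longrightarrow> val r' h' e = r' 10 + L \<and> ok r' h' e"
    and Q: "\<And>r' h' t'. (\<forall>v<40. v \<noteq> 10 \<and> v \<noteq> 21 \<longrightarrow> r' v = r v) \<Longrightarrow> r' 10 = i - L \<Longrightarrow>
      inv h' (r 4) (i - L) i \<Longrightarrow> (\<forall>j<7. h' j = h j) \<Longrightarrow>
      t' \<le> t + (i - L - b) * (100 * (G + 2) + 1) + 1 \<Longrightarrow> Q r' h' out t'"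
  shows "wp (Loop e (V 9) drop_first) Q r h out t"
  using assms
proof (induction "i - L - b" arbitrary: b r h t)
  case 0
  have v: "val r h e = r 10 + L \<and> ok r h e" using 0 by simp
  have b: "b = i - L" "b + L = i" using 0 by simp_all
  have "Q r h out (Suc t)" using 0(2,6) b by (intro 0(9)) simp_all
  then show ?case using v 0(6,7) b by (subst wp_Loop) simp
next
  case (Suc k)
  note e = Suc.prems(7) and Q = Suc.prems(8)
  have lt: "b < i - L" "b < i" using Suc.hyps(2) by linarith+
  have v: "val r h e = r 10 + L \<and> ok r h e" using Suc.prems by simp
  have "wp drop_first (wp (Loop e (V 9) drop_first) Q) r h out (Suc t)"
  proof (rule drop_first[OF Suc.prems(1,2) lt(2) Suc.prems(4,5)])
    fix r' h' t'
    assume A: "\<forall>v<40. v \<noteq> 10 \<and> v \<noteq> 21 \<longrightarrow> r' v = r v" "r' 10 = Suc b" "inv h' (r 4) (Suc b) i"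
      "\<forall>j<7. h' j = h j" "t' \<le> Suc t + 100 * (G + 2)"
    have k: "k = i - L - Suc b" using Suc.hyps(2) by linarith
    have r4: "r' 4 = r 4" "r' 19 = r 19" using A(1) by simp_all
    show "wp (Loop e (V 9) drop_first) Q r' h' out t'"
    proof (rule Suc.hyps(1)[OF k])
      show "regs r'" using Suc.prems(2) A(1) by (simp add: regs_def)
      fix r2 h2 t2
      assume C: "\<forall>v<40. v \<noteq> 10 \<and> v \<noteq> 21 \<longrightarrow> r2 v = r' v" "r2 10 = i - L" "inv h2 (r' 4) (i - L) i"
        "\<forall>j<7. h2 j = h' j" "t2 \<le> t' + (i - L - Suc b) * (100 * (G + 2) + 1) + 1"
      show "Q r2 h2 out t2"
      proof (rule Q)
        have "i - L - b = Suc (i - L - Suc b)" using lt by simp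
        then have "(i - L - b) * (100 * (G + 2) + 1) =
            (100 * (G + 2) + 1) + (i - L - Suc b) * (100 * (G + 2) + 1)"
          by (simp only: mult_Suc)
        then show "t2 \<le> t + (i - L - b) * (100 * (G + 2) + 1) + 1" using C(5) A(5) by linarith
      qed (use A C r4 in simp_all)
    qed (use A r4 lt Suc.prems e in simp_all)
  qed
  moreover have "b + L < i" using lt by simp
  ultimately show ?case using v Suc.prems(5,6) by (subst wp_Loop) simp
qed

section \<open>Reporting the patterns that end at a position\<close>

definition hits :: "nat \<Rightarrow> nat set" where
  "hits e = {l. l \<le> e \<and> accepting (win (e - l) e)}"

lemma finite_hits: "finite (hits e)"
  by (simp add: hits_def)

text \<open>After the longest pattern that ends here, the shorter ones are proper suffixes of it
  and, being valid, suffixes of its failure string. So the output of the failure state continues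
  with the remaining ones, and every round reports a new pattern.\<close>

lemma emit_loop:
  assumes i: "i \<le> len" "m \<le> i" "valid (win (i - m) i)"
    and "r 18 = ac_out A (state (win (i - m) i))" "r 6 = s0" "r 9 = i"
    and "\<And>r' out' t'. (\<forall>v<40. v \<noteq> 18 \<and> v \<noteq> 19 \<longrightarrow> r' v = r v) \<Longrightarrow>
      set out' = set out \<union> (\<lambda>l. (s0 + Suc (i - l), state (win (i - l) i))) ` {l \<in> hits i. l \<le> m} \<Longrightarrow>
      t' \<le> t + 4 * card {l \<in> hits i. l \<le> m} + 1 \<Longrightarrow> Q r' h out' t'"
  shows "wp emit_loop Q r h out t"
  using assms
proof (induction m arbitrary: r out t rule: less_induct)
  case (less m)
  let ?u = "win (i - m) i"
  note Q = less.prems(7)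
  have len_u: "length ?u = m" using less.prems by (simp add: length_win)
  have sfx: "sfx l ?u = win (i - l) i" if "l \<le> m" for l
  proof -
    have "sfx l ?u = win (i - l) i" using that less.prems by (intro sfx_win) auto
    then show ?thesis .
  qed
  have W: "0 < W" "Suc 0 < W" using consts_W by auto
  from out_cases[OF less.prems(3)] show ?case
  proof (elim disjE exE conjE)
    assume z: "ac_out A (state ?u) = 0" "\<forall>l\<le>length ?u. \<not> accepting (sfx l ?u)"
    then have e: "{l \<in> hits i. l \<le> m} = {}" using sfx by (auto simp: hits_def len_u)
    have "Q r h out (Suc t)" by (rule Q) (simp_all only: e image_empty Un_empty_right card.empty, simp_all)
    then show ?thesis
      using z(1) less.prems(4) W unfolding emit_loop_def
      by (subst wp_Loop) simp
  next
    fix l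
    assume l: "l \<le> length ?u" "ac_out A (state ?u) = state (sfx l ?u)" "accepting (sfx l ?u)"
      "\<forall>l'\<le>length ?u. accepting (sfx l' ?u) \<longrightarrow> l' \<le> l"
    let ?v = "win (i - l) i"
    have lm: "l \<le> m" using l(1) len_u by simp
    have v: "sfx l ?u = ?v" using sfx[OF lm] .
    have valid_v: "valid ?v" using accepting_valid l(3) v by simp
    have li: "l \<le> i" using lm less.prems(2) by simp
    have len_v: "length ?v = l" using li less.prems(1) by (simp add: length_win)
    have ne: "?v \<noteq> []" using accepting_not_Nil l(3) v by simp
    obtain l' where l': "l' < l" "ac_fail A (state ?v) = state (sfx l' ?v)" "valid (sfx l' ?v)"
      "\<forall>l2<l. valid (sfx l2 ?v) \<longrightarrow> l2 \<le> l'"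
      using fail_state[OF valid_v ne] len_v by auto
    have sfx_v: "sfx k ?v = win (i - k) i" if "k \<le> l" for k
      using that li less.prems(1) by (intro sfx_win) auto
    have v': "sfx l' ?v = win (i - l') i" using l'(1) by (intro sfx_v) simp
    have split: "{k \<in> hits i. k \<le> m} = insert l {k \<in> hits i. k \<le> l'}"
    proof (intro equalityI subsetI)
      fix k assume k: "k \<in> {k \<in> hits i. k \<le> m}"
      then have acc: "accepting (win (i - k) i)" "k \<le> m" by (auto simp: hits_def)
      then have "k \<le> l" using l(4) sfx[of k] len_u by simp
      moreover have "k \<le> l'" if "k < l"
        using l'(4) that sfx_v[of k] accepting_valid acc(1) by simp
      ultimately show "k \<in> insert l {k \<in> hits i. k \<le> l'}" using k by (cases "k = l") auto
    next
      fix k assume k: "k \<in> insert l {k \<in> hits i. k \<le> l'}"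
      show "k \<in> {k \<in> hits i. k \<le> m}"
      proof (cases "k = l")
        case True
        then show ?thesis using l(3) v li lm by (simp add: hits_def)
      qed (use k l'(1) lm in auto)
    qed
    have card: "card {k \<in> hits i. k \<le> m} = Suc (card {k \<in> hits i. k \<le> l'})"
      unfolding split using l'(1) finite_hits[of i] by (subst card_insert_disjoint) auto
    have out_W: "ac_out A (state (win (i - l') i)) < W"
      using out_cases[of "win (i - l') i"] l'(3) v' W state_W accepting_valid by fastforce
    have fW: "state (win (i - l') i) < W" using state_W l'(3) v' by simp
    have vW: "0 < state ?v" "state ?v < W" using state_bounds[OF valid_v] state_W[OF valid_v] by auto
    have dep: "ac_depth A (state ?v) = l" using depth_state[OF valid_v] len_v by simp
    have bnd: "l < W" "s0 + i < W" "s0 + i - l < W" "Suc (s0 + i - l) < W" "Suc (s0 + (i - l)) < W"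
      using s0 li less.prems(1) by linarith+
    have pos: "Suc (s0 + i - l) = s0 + Suc (i - l)" using li by simp
    have IH: "wp emit_loop Q (r(19 := l, 18 := ac_out A (state (win (i - l') i)))) h
        ((s0 + Suc (i - l), state ?v) # out) (Suc (Suc (Suc (Suc t))))"
    proof (rule less.IH[of l'])
      fix r' out' t'
      assume A: "\<forall>v<40. v \<noteq> 18 \<and> v \<noteq> 19 \<longrightarrow> r' v = (r(19 := l, 18 := ac_out A (state (win (i - l') i)))) v"
        "set out' = set ((s0 + Suc (i - l), state ?v) # out) \<union>
           (\<lambda>l. (s0 + Suc (i - l), state (win (i - l) i))) ` {k \<in> hits i. k \<le> l'}"
        "t' \<le> Suc (Suc (Suc (Suc t))) + 4 * card {k \<in> hits i. k \<le> l'} + 1"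
      show "Q r' h out' t'"
      proof (rule Q)
        show "set out' = set out \<union> (\<lambda>l. (s0 + Suc (i - l), state (win (i - l) i))) ` {l \<in> hits i. l \<le> m}"
          unfolding split image_insert using A(2) by simp
        show "t' \<le> t + 4 * card {l \<in> hits i. l \<le> m} + 1" unfolding card using A(3) by simp
      qed (use A in simp)
    qed (use l' lm less.prems v' in auto)
    have r: "r 18 = state ?v" using less.prems(4) l(2) v by simp
    have "l \<le> s0 + i" using li by simp
    then have "wp emit_body (wp emit_loop Q) r h out (Suc t)"
      using IH l'(2) v' by (simp add: emit_body_def r dep bnd W fW out_W less.prems(5,6) pos)
    then show ?thesis
      unfolding emit_loop_def using vW W r by (subst wp_Loop) simp
  qed
qed

text \<open>The state of the window stands for the pattern: order-isomorphic strings share their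
  state, so this is the pair by which the occurrence is reported.\<close>

definition occ :: "nat \<Rightarrow> (nat \<times> nat) set" where
  "occ i = {(s0 + Suc a, state (win a e)) | a e. a \<le> e \<and> e \<le> i \<and> accepting (win a e)}"

lemma occ_Suc: "occ (Suc i) = occ i \<union>
    (\<lambda>l. (s0 + Suc (Suc i - l), state (win (Suc i - l) (Suc i)))) ` hits (Suc i)" (is "?L = ?R")
proof (intro equalityI subsetI)
  fix x assume "x \<in> ?L"
  then obtain a e where x: "x = (s0 + Suc a, state (win a e))" "a \<le> e" "e \<le> Suc i" "accepting (win a e)"
    by (auto simp: occ_def)
  show "x \<in> ?R"
  proof (cases "e = Suc i")
    case True
    then have "Suc i - a \<in> hits (Suc i)" "Suc i - (Suc i - a) = a" using x by (simp_all add: hits_def)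
    then have "x \<in> (\<lambda>l. (s0 + Suc (Suc i - l), state (win (Suc i - l) (Suc i)))) ` hits (Suc i)"
      using x True by (intro image_eqI[of _ _ "Suc i - a"]) simp_all
    then show ?thesis by simp
  next
    case False
    then have "e \<le> i" using x(3) by simp
    then show ?thesis using x by (auto simp: occ_def)
  qed
next
  fix x assume "x \<in> ?R"
  then show "x \<in> ?L"
  proof
    assume "x \<in> occ i"
    then obtain a e where "x = (s0 + Suc a, state (win a e))" "a \<le> e" "e \<le> i" "accepting (win a e)"
      by (auto simp: occ_def)
    then show ?thesis using le_SucI[of e i] by (auto simp: occ_def)
  next
    assume "x \<in> (\<lambda>l. (s0 + Suc (Suc i - l), state (win (Suc i - l) (Suc i)))) ` hits (Suc i)"
    then obtain l where "x = (s0 + Suc (Suc i - l), state (win (Suc i - l) (Suc i)))" "l \<in> hits (Suc i)"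
      by auto
    then show ?thesis unfolding occ_def hits_def
      by (intro CollectI exI[of _ "Suc i - l"] exI[of _ "Suc i"]) simp
  qed
qed

lemma occ_0: "occ 0 = {}"
  using accepting_not_Nil by (auto simp: occ_def win_def)

text \<open>By prefix-freeness at most one pattern starts at each position.\<close>

lemma sum_hits: "(\<Sum>e\<le>len. card (hits e)) \<le> len"
proof -
  have "(\<Sum>e\<le>len. card (hits e)) = card (SIGMA e:{..len}. hits e)"
    using finite_hits by (simp add: card_SigmaI)
  also have "\<dots> \<le> card {..<len}"
  proof (rule card_inj_on_le)
    have win: "win a e = take (e - a) (drop a X)" for a e by (simp add: win_def drop_take)
    show "inj_on (\<lambda>(e, l). e - l) (SIGMA e:{..len}. hits e)"
    proof (rule inj_onI, clarify)
      fix e l e' l'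
      assume A: "e \<le> len" "e' \<le> len" "l \<in> hits e" "l' \<in> hits e'" "e - l = e' - l'"
      define a where "a = e - l"
      have l: "l = e - a" "l' = e' - a" "a \<le> e" "a \<le> e'" using A by (auto simp: a_def hits_def)
      have "accepting (take (e - a) (drop a X))" "accepting (take (e' - a) (drop a X))"
        using A by (auto simp: hits_def win a_def)
      then have "e - a = e' - a" using unique_start A(1,2) by simp
      then show "e = e' \<and> l = l'" using l by simp
    qed
    show "(\<lambda>(e, l). e - l) ` (SIGMA e:{..len}. hits e) \<subseteq> {..<len}"
    proof (clarify)
      fix e l assume "e \<le> len" "l \<in> hits e"
      then have "win (e - l) e \<noteq> []" "l \<le> e" using accepting_not_Nil by (auto simp: hits_def)
      then have "l \<noteq> 0" "e \<noteq> 0" using \<open>e \<le> len\<close> by (auto simp: win_def)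
      then show "e - l < len" using \<open>e \<le> len\<close> \<open>l \<le> e\<close> by linarith
    qed
  qed simp
  finally show ?thesis by simp
qed

section \<open>Amortized cost of a block\<close>

definition frame :: "(nat \<Rightarrow> nat) \<Rightarrow> (nat \<Rightarrow> nat \<Rightarrow> nat) \<Rightarrow> (nat \<Rightarrow> nat) \<Rightarrow> (nat \<Rightarrow> nat \<Rightarrow> nat) \<Rightarrow> bool" where
  "frame r h r' h' \<longleftrightarrow> (\<forall>v<40. v < 8 \<or> 22 \<le> v \<longrightarrow> r' v = r v) \<and> (\<forall>j<7. h' j = h j)"

text \<open>The last part says that no proper extension of the window to the left is a state, even
  after reading the next symbol.\<close>

definition at_window :: "(nat \<Rightarrow> nat) \<Rightarrow> (nat \<Rightarrow> nat \<Rightarrow> nat) \<Rightarrow> nat \<Rightarrow> nat \<Rightarrow> bool" where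
  "at_window r h b i \<longleftrightarrow> regs r \<and> inv h (r 4) b i \<and> b \<le> i \<and> i \<le> len \<and> valid (win b i) \<and>
     r 8 = state (win b i) \<and> r 9 = i \<and> r 10 = b \<and> (i < len \<longrightarrow> (\<forall>b'<b. \<not> valid (win b' (Suc i))))"

text \<open>A failed transition is charged to the \<open>b' - b\<close> keys that it drops, a
  successful one to the symbol that it consumes, and the reports to the patterns found.\<close>

lemma match_step:
  assumes w: "at_window r h b i" and i: "i < len"
    and Q1: "\<And>r' h' out' t'. at_window r' h' b (Suc i) \<Longrightarrow> frame r h r' h' \<Longrightarrow>
      set out' = set out \<union> (\<lambda>l. (s0 + Suc (Suc i - l), state (win (Suc i - l) (Suc i)))) ` hits (Suc i) \<Longrightarrow>
      t' \<le> t + 305 * (G + 2) + 4 * card (hits (Suc i)) \<Longrightarrow> Q r' h' out' t'"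
    and Q2: "\<And>r' h' b' t'. b < b' \<Longrightarrow> at_window r' h' b' i \<Longrightarrow> frame r h r' h' \<Longrightarrow>
      t' \<le> t + 305 * (G + 2) * (b' - b) \<Longrightarrow> Q r' h' out t'"
  shows "wp match_step Q r h out t"
proof -
  note w' = w[unfolded at_window_def]
  have r: "regs r" "r 8 = state (win b i)" "r 9 = i" "r 10 = b" "r 5 = off" and bi: "b \<le> i" "i \<le> len"
    and v: "valid (win b i)" and I: "inv h (r 4) b i" and max: "\<forall>b'<b. \<not> valid (win b' (Suc i))"
    using w' i by (simp_all add: regs_def)
  have W: "0 < W" "Suc 0 < W" "off + i < W" "off + i < B" "Suc i < W" using consts_W off i by linarith+
  have key: "h 3 (off + i) = X ! i" using I i by (simp add: inv_def keys_def)
  let ?r1 = "r(11 := X ! i)"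
  let ?succ = "8 ::= V 12;; put;; 9 ::= V 9 [+] N 1;; 18 ::= Output (V 8);; emit_loop"
  let ?fail = "8 ::= Failure (V 8);; 19 ::= Level (V 8);; Loop (V 10 [+] V 19) (V 9) drop_first"
  have "wp find (wp (Cond (N 0) (V 12) ?succ ?fail) Q) ?r1 h out (Suc t)"
  proof (rule find[where b = b and i = i])
    show "regs ?r1" using r(1) by (simp add: regs_def)
    fix r2 h2 t2
    assume A: "\<forall>v<40. v \<notin> {12..17} \<longrightarrow> r2 v = ?r1 v" "r2 12 = target b i"
      "\<forall>j. j \<noteq> 7 \<and> j \<noteq> 8 \<longrightarrow> h2 j = h j" "t2 \<le> Suc t + 200 * (G + 2)"
    have r2: "regs r2" "r2 8 = state (win b i)" "r2 9 = i" "r2 10 = b" "r2 11 = X ! i" "r2 4 = r 4"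
      using A(1) r by (simp_all add: regs_def)
    have I2: "inv h2 (r 4) b i" using I A(3) by (simp add: inv_def keys_def vebs_def tabs_def)
    have f2: "frame r h r2 h2" using A(1,3) by (simp add: frame_def)
    show "wp (Cond (N 0) (V 12) ?succ ?fail) Q r2 h2 out t2"
    proof (cases "valid (win b (Suc i))")
      case True
      then have tgt: "r2 12 = state (win b (Suc i))" "0 < r2 12"
        using A(2) state_bounds by (simp_all add: target_def)
      let ?r3 = "r2(8 := state (win b (Suc i)))"
      have "wp put (wp (9 ::= V 9 [+] N 1;; 18 ::= Output (V 8);; emit_loop) Q) ?r3 h2 out (Suc (Suc t2))"
      proof (rule put[where b = b and i = i])
        show "regs ?r3" using r2(1) by (simp add: regs_def)
        fix r4 h4 t4
        assume C: "\<forall>v<40. r4 v = ?r3 v" "inv h4 (?r3 4) b (Suc i)" "\<forall>j<7. h4 j = h2 j"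
          "t4 \<le> Suc (Suc t2) + 100 * (G + 2)"
        let ?o = "ac_out A (state (win b (Suc i)))"
        let ?r5 = "r4(9 := Suc i, 18 := ?o)"
        have oW: "?o < W" using out_cases[OF True] W state_W accepting_valid by fastforce
        \<comment> \<open>Patterns that end here start inside the window, since no extension of the
          window to the left is a state.\<close>
        have sub: "{l \<in> hits (Suc i). l \<le> Suc i - b} = hits (Suc i)"
        proof (intro equalityI subsetI)
          fix l assume l: "l \<in> hits (Suc i)"
          then have "valid (win (Suc i - l) (Suc i))" "l \<le> Suc i"
            using accepting_valid by (auto simp: hits_def)
          then have "\<not> Suc i - l < b" using max by blast
          then have "l \<le> Suc i - b" using \<open>l \<le> Suc i\<close> bi by linarith
          then show "l \<in> {l \<in> hits (Suc i). l \<le> Suc i - b}" using l by simp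
        qed simp
        have "wp emit_loop Q ?r5 h4 out (Suc (Suc t4))"
        proof (rule emit_loop[where m = "Suc i - b" and i = "Suc i"])
          show "Suc i \<le> len" using i by simp
          have e: "Suc i - (Suc i - b) = b" using bi by simp
          show "valid (win (Suc i - (Suc i - b)) (Suc i))" unfolding e by (rule True)
          show "?r5 18 = ac_out A (state (win (Suc i - (Suc i - b)) (Suc i)))" unfolding e by simp
          show "?r5 6 = s0" using C(1) r2(1) by (simp add: regs_def)
          fix r6 out6 t6
          assume D: "\<forall>v<40. v \<noteq> 18 \<and> v \<noteq> 19 \<longrightarrow> r6 v = ?r5 v"
            "set out6 = set out \<union> (\<lambda>l. (s0 + Suc (Suc i - l), state (win (Suc i - l) (Suc i)))) `
               {l \<in> hits (Suc i). l \<le> Suc i - b}"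
            "t6 \<le> Suc (Suc t4) + 4 * card {l \<in> hits (Suc i). l \<le> Suc i - b} + 1"
          show "Q r6 h4 out6 t6"
          proof (rule Q1)
            have "\<not> valid (win b' (Suc (Suc i)))" if "b' < b" "Suc i < len" for b'
              using max that bi valid_prefix win_snoc[of b' "Suc i"] by (metis le_SucI less_imp_le le_trans)
            then show "at_window r6 h4 b (Suc i)"
              using C D(1) r2 bi i True by (simp add: at_window_def regs_def)
            show "frame r h r6 h4" using f2 C D(1) by (simp add: frame_def)
            show "t6 \<le> t + 305 * (G + 2) + 4 * card (hits (Suc i))"
              using D(3) C(4) A(4) unfolding sub by simp
          qed (use D(2) sub in simp)
        qed simp_all
        moreover have "r4 8 = state (win b (Suc i))" "r4 9 = i" using C(1) r2 by simp_all
        ultimately show "wp (9 ::= V 9 [+] N 1;; 18 ::= Output (V 8);; emit_loop) Q r4 h4 out t4"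
          using W oW by simp
      qed (use I2 r2 bi i in simp_all)
      then show ?thesis using tgt W by simp
    next
      case False
      then have z: "r2 12 = 0" using A(2) by (simp add: target_def)
      \<comment> \<open>A single symbol always has a state, so a transition from the empty window
        cannot fail.\<close>
      have ne: "win b i \<noteq> []"
      proof
        assume "win b i = []"
        then have "win b (Suc i) = [X ! i]" using win_snoc[OF bi(1) i] by simp
        then show False using False valid_single by simp
      qed
      have lw: "length (win b i) = i - b" using bi by (simp add: length_win)
      obtain l where l: "l < i - b" "ac_fail A (state (win b i)) = state (sfx l (win b i))"
        "valid (sfx l (win b i))" "\<forall>l'<i - b. valid (sfx l' (win b i)) \<longrightarrow> l' \<le> l"
        using fail_state[OF v ne] lw by auto
      have sfx: "sfx k (win b i) = win (i - k) i" if "k < i - b" for k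
        using that bi by (intro sfx_win) auto
      let ?s = "state (win (i - l) i)"
      have vl: "valid (win (i - l) i)" using l(3) sfx[OF l(1)] by simp
      have d: "ac_depth A ?s = l" using depth_state[OF vl] l(1) bi by (simp add: length_win)
      let ?r3 = "r2(8 := ?s, 19 := l)"
      have lW: "l < W" "?s < W" using l(1) W(5) state_W[OF vl] by linarith+
      have "wp (Loop (V 10 [+] V 19) (V 9) drop_first) Q ?r3 h2 out (Suc (Suc (Suc t2)))"
      proof (rule drop_loop[where b = b and i = i and L = l])
        show "inv h2 (?r3 4) b i" using I2 r2 by simp
        show "regs ?r3" using r2(1) by (simp add: regs_def)
        fix r4 h4 t4
        assume C: "\<forall>v<40. v \<noteq> 10 \<and> v \<noteq> 21 \<longrightarrow> r4 v = ?r3 v" "r4 10 = i - l" "inv h4 (?r3 4) (i - l) i"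
          "\<forall>j<7. h4 j = h2 j" "t4 \<le> Suc (Suc (Suc t2)) + (i - l - b) * (100 * (G + 2) + 1) + 1"
        show "Q r4 h4 out t4"
        proof (rule Q2[of "i - l"])
          show "b < i - l" using l(1) by simp
          \<comment> \<open>Starts up to \<open>b\<close> are excluded by the old invariant and the
            failed transition, starts between \<open>b\<close> and \<open>i - l\<close> because the
            failure suffix is the longest one.\<close>
          have "\<not> valid (win b' (Suc i))" if b': "b' < i - l" for b'
          proof (cases "b' \<le> b")
            case True
            then show ?thesis using max False by (cases "b' = b") auto
          next
            case F: False
            have e: "i - (i - b') = b'" using b' by simp
            have "\<not> valid (sfx (i - b') (win b i))" using l(4)[rule_format, of "i - b'"] F b' l(1) by linarith
            then have "\<not> valid (win b' i)" using sfx[of "i - b'"] F b' e by simp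
            then show ?thesis using valid_prefix win_snoc[of b' i] b' i by fastforce
          qed
          then show "at_window r4 h4 (i - l) i"
            using C r2 bi vl by (simp add: at_window_def regs_def)
          show "frame r h r4 h4" using f2 C by (simp add: frame_def)
          define k where "k = i - l - b"
          have k: "1 \<le> k" using l(1) by (simp add: k_def)
          have "t4 \<le> t + 200 * (G + 2) + 5 + k * (100 * (G + 2) + 1)"
            using C(5) A(4) unfolding k_def by linarith
          moreover have "200 * (G + 2) + 5 + k * (100 * (G + 2) + 1) \<le> 305 * (G + 2) * k"
          proof -
            have "(200 * (G + 2) + 5) * 1 \<le> (200 * (G + 2) + 5) * k" using k by (intro mult_le_mono2)
            then have "200 * (G + 2) + 5 + k * (100 * (G + 2) + 1) \<le> (200 * (G + 2) + 5) * k + k * (100 * (G + 2) + 1)"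
              by simp
            also have "\<dots> = (300 * (G + 2) + 6) * k" by (simp add: algebra_simps)
            also have "\<dots> \<le> 305 * (G + 2) * k" by (intro mult_le_mono1) simp
            finally show ?thesis .
          qed
          ultimately show "t4 \<le> t + 305 * (G + 2) * (i - l - b)" unfolding k_def by linarith
        qed
      next
        fix r' :: "nat \<Rightarrow> nat" and h' :: "nat \<Rightarrow> nat \<Rightarrow> nat"
        assume "r' 10 + l \<le> i" "r' 19 = ?r3 19"
        then show "val r' h' (V 10 [+] V 19) = r' 10 + l \<and> ok r' h' (V 10 [+] V 19)"
          using W(5) by simp
      qed (use l(1) bi r2 in simp_all)
      then show ?thesis using z W r2 l(2) sfx[OF l(1)] d lW by simp
    qed
  qed (use I r bi i v in simp_all)
  then show ?thesis unfolding match_step_def using W r key by simp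
qed

text \<open>\<open>K * (i + b)\<close> is the potential: every round increases \<open>i\<close> or
  \<open>b\<close>, and neither exceeds \<open>len\<close>. By \<open>sum_hits\<close> the reports
  add at most \<open>4 * len\<close>.\<close>

lemma match_block:
  assumes k: "keys h" and r: "regs r" and U: "0 < len" 
    and z: "r 4 = 0 \<Longrightarrow> tabs h \<and> rep (h 10) U 0 {} \<and> rep (h 11) U 0 {}"
    and Q: "\<And>r' h' out' t'. frame r h r' h' \<Longrightarrow> (r 4 = 0 \<Longrightarrow> rep (h' 10) U 0 {} \<and> rep (h' 11) U 0 {}) \<Longrightarrow>
      set out' = set out \<union> occ len \<Longrightarrow> t' \<le> t + 1000 * (G + 2) * len \<Longrightarrow> Q r' h' out' t'"
  shows "wp match_block Q r h out t"
proof -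
  have W: "0 < W" "Suc 0 < W" using consts_W by auto
  let ?r0 = "r(8 := 1, 9 := 0, 10 := 0)"
  \<comment> \<open>The step from 305 to 306 pays for the loop test.\<close>
  define K where "K = 306 * (G + 2)"
  have K5: "305 * (G + 2) + 1 \<le> K" by (simp add: K_def)
  define I where "I r1 h1 out1 t1 \<longleftrightarrow> (\<exists>b i. at_window r1 h1 b i \<and> frame r h r1 h1 \<and>
      set out1 = set out \<union> occ i \<and> t1 \<le> t + 3 + K * (i + b) + 4 * (\<Sum>e\<le>i. card (hits e)))" for r1 h1 out1 t1
  have "wp (Loop (V 9) (V 7) match_step) (wp (Loop (V 10) (V 9) drop_first) Q) ?r0 h out (t + 3)"
  proof (rule wp_Loop_inv[where I = I and \<mu> = "\<lambda>r h. (len - r 9) + (len - r 10)"])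
    have "win 0 0 = []" by (simp add: win_def)
    then have "at_window ?r0 h 0 0"
      using k r z valid_Nil state_Nil by (auto simp: at_window_def regs_def inv_def vebs_def)
    then show "I ?r0 h out (t + 3)"
      unfolding I_def by (intro exI[of _ 0]) (simp add: occ_0 frame_def)
  next
    fix r1 h1 out1 t1
    assume "I r1 h1 out1 t1"
    then obtain b i where w: "at_window r1 h1 b i" and f: "frame r h r1 h1"
      and o: "set out1 = set out \<union> occ i" and t1: "t1 \<le> t + 3 + K * (i + b) + 4 * (\<Sum>e\<le>i. card (hits e))"
      by (auto simp: I_def)
    have r1: "r1 9 = i" "r1 10 = b" "r1 7 = len" "b \<le> i" "i \<le> len" "regs r1" "inv h1 (r1 4) b i"
      using w by (auto simp: at_window_def regs_def)
    let ?P = "\<lambda>r2 h2 out2 t2. I r2 h2 out2 t2 \<and> len - r2 9 + (len - r2 10) < len - r1 9 + (len - r1 10)"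
    have trans: "frame r h r2 h2" if "frame r1 h1 r2 h2" for r2 h2
      using f that by (simp add: frame_def)
    have "wp match_step ?P r1 h1 out1 (Suc t1)" if lt: "i < len"
    proof (rule match_step[OF w lt])
      fix r2 h2 out2 t2
      assume A: "at_window r2 h2 b (Suc i)" "frame r1 h1 r2 h2"
        "set out2 = set out1 \<union> (\<lambda>l. (s0 + Suc (Suc i - l), state (win (Suc i - l) (Suc i)))) ` hits (Suc i)"
        "t2 \<le> Suc t1 + 305 * (G + 2) + 4 * card (hits (Suc i))"
      have "K * (Suc i + b) = K + K * (i + b)" by simp
      moreover have "(\<Sum>e\<le>Suc i. card (hits e)) = (\<Sum>e\<le>i. card (hits e)) + card (hits (Suc i))" by simp
      ultimately have "t2 \<le> t + 3 + K * (Suc i + b) + 4 * (\<Sum>e\<le>Suc i. card (hits e))"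
        using A(4) t1 K5 by linarith
      moreover have "set out2 = set out \<union> occ (Suc i)" unfolding occ_Suc A(3) o by blast
      ultimately have "I r2 h2 out2 t2" unfolding I_def using A(1) trans[OF A(2)] by blast
      moreover have "r2 9 = Suc i" "r2 10 = b" using A(1) by (auto simp: at_window_def)
      ultimately show "?P r2 h2 out2 t2" using lt r1 by simp
    next
      fix r2 h2 b' t2
      assume A: "b < b'" "at_window r2 h2 b' i" "frame r1 h1 r2 h2"
        "t2 \<le> Suc t1 + 305 * (G + 2) * (b' - b)"
      obtain c where c: "b' = b + Suc c" using less_imp_Suc_add[OF A(1)] by auto
      have "K * (i + b') = K * (i + b) + K * Suc c" by (simp add: c algebra_simps)
      moreover have "305 * (G + 2) * (b' - b) + 1 \<le> K * Suc c"
      proof -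
        have "305 * (G + 2) * Suc c + 1 \<le> (305 * (G + 2) + 1) * Suc c" by (simp add: algebra_simps)
        also have "\<dots> \<le> K * Suc c" using K5 by (rule mult_le_mono1)
        finally show ?thesis by (simp add: c)
      qed
      ultimately have "t2 \<le> t + 3 + K * (i + b') + 4 * (\<Sum>e\<le>i. card (hits e))"
        using A(4) t1 by linarith
      then have "I r2 h2 out1 t2" unfolding I_def using A(2) trans[OF A(3)] o by blast
      moreover have "r2 9 = i" "r2 10 = b'" "b' \<le> i" using A(2) by (auto simp: at_window_def)
      ultimately show "?P r2 h2 out1 t2" using A(1) r1 by simp
    qed
    moreover have "wp (Loop (V 10) (V 9) drop_first) Q r1 h1 out1 (Suc t1)" if ge: "\<not> i < len"
    proof (rule drop_loop[where b = b and i = i and L = 0])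
      have il: "i = len" using ge r1 by simp
      fix r2 h2 t2
      assume A: "\<forall>v<40. v \<noteq> 10 \<and> v \<noteq> 21 \<longrightarrow> r2 v = r1 v" "r2 10 = i - 0" "inv h2 (r1 4) (i - 0) i"
        "\<forall>j<7. h2 j = h1 j" "t2 \<le> Suc t1 + (i - 0 - b) * (100 * (G + 2) + 1) + 1"
      show "Q r2 h2 out1 t2"
      proof (rule Q)
        show "frame r h r2 h2" using f A by (simp add: frame_def)
        show "set out1 = set out \<union> occ len" using o il by simp
        show "rep (h2 10) U 0 {} \<and> rep (h2 11) U 0 {}" if "r 4 = 0"
          using A(3) f that by (simp add: inv_def vebs_def frame_def)
        have "(i - b) * (100 * (G + 2) + 1) \<le> (i - b) * K" by (intro mult_le_mono2) (simp add: K_def)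
        moreover have "K * (i + b) + (i - b) * K = K * (2 * i)"
        proof -
          have "i + b + (i - b) = 2 * i" using r1(4) by simp
          then show ?thesis by (metis add_mult_distrib2 mult.commute)
        qed
        moreover have "t2 \<le> t1 + 2 + (i - b) * (100 * (G + 2) + 1)" using A(5) by simp
        ultimately have "t2 \<le> t + 5 + K * (2 * len) + 4 * len"
          using t1 sum_hits unfolding il by linarith
        also have "\<dots> \<le> t + 1000 * (G + 2) * len"
        proof -
          have "5 + K * (2 * len) + 4 * len \<le> 5 * len + K * (2 * len) + 4 * len" using U by linarith
          also have "\<dots> = (2 * K + 9) * len" by (simp add: algebra_simps)
          also have "\<dots> \<le> 1000 * (G + 2) * len" by (intro mult_le_mono1) (simp add: K_def)
          finally show ?thesis by simp
        qed
        finally show "t2 \<le> t + 1000 * (G + 2) * len" .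
      qed
    qed (use r1 in simp_all)
    ultimately show "ok r1 h1 (V 9) \<and> ok r1 h1 (V 7) \<and>
       (if val r1 h1 (V 9) < val r1 h1 (V 7) then wp match_step ?P r1 h1 out1 (Suc t1)
        else wp (Loop (V 10) (V 9) drop_first) Q r1 h1 out1 (Suc t1))"
      using r1 by simp
  qed
  then show ?thesis
    unfolding match_block_def using W by (simp add: numeral_3_eq_3)
qed

end

section \<open>The complete program\<close>

definition sqrt_loop :: com where
  "sqrt_loop = Loop (V 25 [*] V 25) (V 24) (25 ::= V 25 [+] N 1)"

definition roots_body :: com where
  "roots_body = (25 ::= N 1;; sqrt_loop;; St 5 (V 23) (V 25);; 24 ::= V 25;; 23 ::= V 23 [+] N 1)"

text \<open>Sizes are filled in from the deepest level upwards, as each follows from the next one;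
  register 27 starts with 3, the size of the base case.\<close>

definition sizes_body :: com where
  "sizes_body = (23 ::= V 23 [-] N 1;; St 6 (V 23) (V 27);;
     27 ::= N 2 [+] (Arr 5 (V 23) [+] N 1) [*] V 27)"

text \<open>The final test chooses the search method: edges are scanned only if \<open>d\<close> is
  smaller than the recursion depth of the sets.\<close>

definition tables :: com where
  "tables = (22 ::= N 2 [*] V 2;; 23 ::= N 0;; 24 ::= V 22;; Loop (N 2) (V 24) roots_body;;
     26 ::= V 23;; 27 ::= N 3;; Loop (N 0) (V 23) sizes_body;;
     Cond (V 1) (V 26) (4 ::= N 1) (4 ::= N 0))"

definition invert_body :: com where
  "invert_body = (St 1 (Arr 0 (V 28)) (V 28);; 28 ::= V 28 [+] N 1)"

text \<open>Array 2 counts for each block the symbols visited so far, which gives the rank of the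
  current one. Since \<open>j + q * r = q * (2 * r) + (j - q * r)\<close>, consecutive blocks get
  disjoint segments of array 3.\<close>

definition rank_in :: "nat \<Rightarrow> com" where
  "rank_in v = (St 3 (V 29 [+] V v [*] V 2) (Arr 2 (V v));; St 2 (V v) (Arr 2 (V v) [+] N 1))"

text \<open>A position lies in block \<open>j div r\<close> and, unless that is block 0, also in the
  block before.\<close>

definition rank_body :: com where
  "rank_body = (29 ::= Arr 1 (V 28) [-] N 1;; 30 ::= V 29 [div] V 2;; rank_in 30;;
     Cond (N 0) (V 30) (31 ::= V 30 [-] N 1;; rank_in 31) Skip;; 28 ::= V 28 [+] N 1)"

definition block_body :: com where
  "block_body = (7 ::= V 22;; Cond (V 0 [-] V 6) (V 22) (7 ::= V 0 [-] V 6) Skip;;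
     match_block;; 6 ::= V 6 [+] V 2;; 5 ::= V 5 [+] V 22)"

definition main :: com where
  "main = (tables;; 28 ::= N 1;; Loop (V 28) (V 0 [+] N 1) invert_body;;
     28 ::= N 1;; Loop (V 28) (V 0 [+] N 1) rank_body;;
     5 ::= N 0;; 6 ::= N 0;; Loop (V 6) (V 0) block_body)"

lemma wfc_main: "wfc main"
  by (simp add: main_def tables_def sqrt_loop_def roots_body_def sizes_body_def invert_body_def
      rank_in_def rank_body_def block_body_def match_block_def match_step_def emit_loop_def emit_body_def
      drop_first_def put_def find_def find_scan_def scan_body_def check_fit_def find_veb_def
      pred_position_def succ_position_def veb_pred_def veb_del_def veb_ins_def pred_up_def
      pred_down_def del_body_def del_minmax_def ins_body_def ins_minmax_def descend_def)

section \<open>Bounds on the pattern lengths\<close>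

context ac
begin

lemma pattern_length_le: "q \<in> S \<Longrightarrow> 1 \<le> length q \<and> length q \<le> Max (length ` S)"
proof -
  assume q: "q \<in> S"
  then have "length q \<le> Max (length ` S)" using pats by (intro Max_ge) (auto simp: pattern_set_def)
  moreover have "q \<noteq> []" using q pats by (auto simp: pattern_set_def)
  ultimately show ?thesis by (cases q) auto
qed

lemma max_length_bounds: "1 \<le> Max (length ` S)" "Max (length ` S) \<le> n"
proof -
  have "Max (length ` S) \<in> length ` S" using pats by (intro Max_in) (auto simp: pattern_set_def)
  then obtain q where q: "q \<in> S" "Max (length ` S) = length q" by auto
  then show "1 \<le> Max (length ` S)" using pattern_length_le[of q] by simp
  have "distinct q" "set q \<subseteq> {1..n}" using q pats by (auto simp: pattern_set_def)
  then have "length q = card (set q)" "card (set q) \<le> card {1..n}"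
    by (simp add: distinct_card, intro card_mono) auto
  then show "Max (length ` S) \<le> n" using q(2) by simp
qed

end

text \<open>The block length \<open>2 * r\<close> is also the universe of the ranks. An array of
  length \<open>300 * n\<close> has room for \<open>sz U\<close>, which is below
  \<open>46 * r\<close>, for the \<open>2 * n\<close> keys of all blocks, and for the slack of
  \<open>U_B\<close>.\<close>

locale matching = matcher w B A U n S num
  for w B :: nat and A :: ac_tables and U n :: nat and S num +
  fixes t :: "nat list" and r :: nat
  assumes t: "distinct t" "set t = {1..n}" and r: "r = Max (length ` S)"
    and U: "U = 2 * r" and B: "B = 300 * n"
begin

lemma length_t: "length t = n"
  using t distinct_card[of t] by simp

lemmas pattern_length = pattern_length_le[folded r]
lemmas r_bounds = max_length_bounds[folded r]

lemma U_bounds: "2 \<le> U" "U \<le> 2 * n"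
  using U r_bounds by auto

lemma lits_W: "0 < W" "Suc 0 < W" "2 < W" "3 < W" "n < B" "Suc n < B" "n < W" "Suc n < W" "U < W" "U < B" "B < W"
  using r_bounds U_bounds B B_W by linarith+

section \<open>Tables of roots and sizes\<close>

lemma sz_lev: "l \<le> dep U \<Longrightarrow> sz (lev U l) \<le> sz U"
proof (induction l)
  case (Suc l)
  then have "2 < lev U l" using less_dep by simp
  then have "sz (usqrt (lev U l)) \<le> sz (lev U l)" using sz.simps[of "lev U l"] by simp
  then show ?case using Suc by simp
qed simp

text \<open>By the third part, the search for a root by trial is paid for by the shrinking of the
  universe, so the costs of all levels telescope to \<open>12 * U\<close>; the factor 12 is tight at
  \<open>u = 3\<close>. The second part keeps the trial squares within a word.\<close>

lemma usqrt_bounds: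
  assumes "2 < u"
  shows "(usqrt u - 1) * (usqrt u - 1) < u" "usqrt u * usqrt u \<le> 3 * u" "2 * usqrt u + 8 \<le> 12 * (u - usqrt u)"
proof -
  define p where "p = usqrt u"
  have p: "2 \<le> p" "p < u" using usqrt_ge2[OF assms] usqrt_less[OF assms] by (simp_all add: p_def)
  show *: "(usqrt u - 1) * (usqrt u - 1) < u"
    using usqrt_le[of u "p - 1"] p unfolding p_def by (cases "u \<le> (usqrt u - 1) * (usqrt u - 1)") auto
  obtain k where k: "p = k + 2" using p(1) le_Suc_ex by (metis add.commute)
  have lt: "(k + 1) * (k + 1) < u" using * k unfolding p_def[symmetric] by simp
  then show "usqrt u * usqrt u \<le> 3 * u" using p(2) unfolding p_def[symmetric] k by (simp add: algebra_simps)
  have "2 * p + 8 + 12 * p \<le> 12 * u"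
  proof (cases "k = 0")
    case False
    then obtain j where j: "k = Suc j" by (cases k) auto
    show ?thesis using lt unfolding k j by (simp add: algebra_simps)
  qed (use p k in simp)
  then show "2 * usqrt u + 8 \<le> 12 * (u - usqrt u)" unfolding p_def by simp
qed

lemma sqrt_loop:
  assumes "2 < u" "u \<le> U" "r1 24 = u" "r1 25 = 1"
    and Q: "\<And>t'. t' \<le> t1 + 2 * usqrt u \<Longrightarrow> Q (r1(25 := usqrt u)) h out t'"
  shows "wp sqrt_loop Q r1 h out t1"
proof -
  have sq: "p * p < W" "Suc p < W" if "p \<le> usqrt u" for p
  proof -
    have "p * p \<le> usqrt u * usqrt u" using that by (intro mult_le_mono)
    then show "p * p < W" using usqrt_bounds(2)[OF assms(1)] assms(2) U_bounds B lits_W by linarith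
    show "Suc p < W" using that usqrt_less[OF assms(1)] assms(2) lits_W by linarith
  qed
  have "wp sqrt_loop Q r2 h out t2"
    if "r2 = r1(25 := p)" "p \<le> usqrt u" "0 < p" "t2 \<le> t1 + 2 * (p - 1)" for r2 t2 p
    using that
  proof (induction "usqrt u - p" arbitrary: p r2 t2)
    case 0
    then have p: "p = usqrt u" by simp
    have "Q r2 h out (Suc t2)" unfolding 0(2) p using 0 p by (intro Q) simp
    then show ?case using 0 p assms sq[of p] usqrt_sq[of u] unfolding sqrt_loop_def
      by (subst wp_Loop) simp
  next
    case (Suc k)
    have lt: "p < usqrt u" using Suc.hyps(2) by simp
    then have "p * p < u" using usqrt_le[of u p] by (cases "u \<le> p * p") auto
    moreover have "wp sqrt_loop Q (r2(25 := Suc p)) h out (Suc (Suc t2))"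
      by (rule Suc.hyps(1)[of "Suc p"]) (use Suc lt in auto)
    ultimately show ?case
      using Suc.prems assms sq[of p] lits_W unfolding sqrt_loop_def by (subst wp_Loop) simp
  qed
  from this[of r1 1 t1] show ?thesis
    using assms(4) usqrt_ge2[OF assms(1)] by (simp add: fun_upd_idem)
qed

lemma tables:
  assumes r2: "r1 2 = r" "r1 1 = d"
    and Q: "\<And>r' h' t'. (\<forall>v<22. v \<noteq> 4 \<longrightarrow> r' v = r1 v) \<Longrightarrow> r' 22 = U \<Longrightarrow>
      r' 4 = (if d < dep U then 1 else 0) \<Longrightarrow> tabs h' \<Longrightarrow> (\<forall>j. j \<noteq> 5 \<and> j \<noteq> 6 \<longrightarrow> h' j = h j) \<Longrightarrow>
      t' \<le> t1 + 50 * n + 20 \<Longrightarrow> Q r' h' out t'"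
  shows "wp tables Q r1 h out t1"
proof -
  let ?mode = "Cond (V 1) (V 26) (4 ::= N 1) (4 ::= N 0)"
  have DU: "dep U \<le> U" by (rule dep_le_self)
  have lB: "l < B" "l < W" "Suc l < W" if "l \<le> dep U" for l using that DU lits_W by linarith+
  define I2 where "I2 r2 h2 out2 t2 \<longleftrightarrow> (\<forall>v<22. r2 v = r1 v) \<and> r2 22 = U \<and> r2 26 = dep U \<and>
     r2 23 \<le> dep U \<and> r2 27 = sz (lev U (r2 23)) \<and> (\<forall>j. j \<noteq> 5 \<and> j \<noteq> 6 \<longrightarrow> h2 j = h j) \<and>
     (\<forall>i<dep U. h2 5 i = lev U (Suc i)) \<and> (\<forall>i<dep U. r2 23 \<le> i \<longrightarrow> h2 6 i = sz (lev U (Suc i))) \<and>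
     out2 = out \<and> t2 + 4 * r2 23 \<le> t1 + 24 * n + 10 + 4 * dep U" for r2 h2 out2 t2
  have loop2: "wp (Loop (N 0) (V 23) sizes_body) (wp ?mode Q) r2 h2 out2 t2" if "I2 r2 h2 out2 t2" for r2 h2 out2 t2
  proof (rule wp_Loop_inv[where I = I2 and \<mu> = "\<lambda>r h. r 23", OF that])
    fix r2 h2 out2 t2
    assume I: "I2 r2 h2 out2 t2"
    note J = I[unfolded I2_def]
    have "wp sizes_body (\<lambda>r' h' out' t'. I2 r' h' out' t' \<and> r' 23 < r2 23) r2 h2 out2 (Suc t2)"
      if pos: "0 < r2 23"
    proof -
      define l where "l = r2 23 - 1"
      have "r2 23 \<le> dep U" using J by blast
      then have l: "r2 23 = Suc l" "l < dep U" using pos unfolding l_def by linarith+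
      have u: "2 < lev U l" using less_dep l(2) by simp
      have h5: "h2 5 l = usqrt (lev U l)" using J l(2) by simp
      have z: "r2 27 = sz (usqrt (lev U l))" using J l(1) by simp
      have s: "sz (lev U l) = 2 + Suc (usqrt (lev U l)) * sz (usqrt (lev U l))"
        using u sz.simps[of "lev U l"] by simp
      have "sz (lev U l) \<le> sz U" using sz_lev l(2) by simp
      then have sW: "2 + Suc (usqrt (lev U l)) * sz (usqrt (lev U l)) < W" using s U_B B_W by linarith
      then have "Suc (usqrt (lev U l)) * sz (usqrt (lev U l)) < W" by linarith
      moreover have "Suc (usqrt (lev U l)) < W" using usqrt_less[OF u] lev_le[of l] lits_W by linarith
      moreover have "I2 (r2(23 := l, 27 := 2 + Suc (usqrt (lev U l)) * sz (usqrt (lev U l))))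
          (h2(6 := (h2 6)(l := sz (usqrt (lev U l))))) out2 (Suc (Suc (Suc (Suc t2))))"
        using J l s unfolding I2_def by (auto simp: not_less_eq_eq le_Suc_eq)
      ultimately show ?thesis
        using l sW lB[of l] lits_W unfolding sizes_body_def
        by (simp add: z h5 del: mult_Suc)
    qed
    moreover have "wp ?mode Q r2 h2 out2 (Suc t2)" if z: "\<not> 0 < r2 23"
    proof -
      have "tabs h2" using J z by (simp add: tabs_def)
      moreover have "4 * dep U \<le> 8 * n" using DU U_bounds by linarith
      ultimately show ?thesis
        using J z r2 lits_W by (auto intro!: Q)
    qed
    ultimately show "ok r2 h2 (N 0) \<and> ok r2 h2 (V 23) \<and>
       (if val r2 h2 (N 0) < val r2 h2 (V 23)
        then wp sizes_body (\<lambda>r' h' out' t'. I2 r' h' out' t' \<and> r' 23 < r2 23) r2 h2 out2 (Suc t2)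
        else wp ?mode Q r2 h2 out2 (Suc t2))"
      using lits_W by (cases "0 < r2 23") (simp_all del: wp_Cond)
  qed
  define I1 where "I1 r2 h2 out2 t2 \<longleftrightarrow> (\<forall>v<22. r2 v = r1 v) \<and> r2 22 = U \<and>
     r2 23 \<le> dep U \<and> r2 24 = lev U (r2 23) \<and> (\<forall>j. j \<noteq> 5 \<longrightarrow> h2 j = h j) \<and>
     (\<forall>i<r2 23. h2 5 i = lev U (Suc i)) \<and>
     out2 = out \<and> t2 \<le> t1 + 3 + 12 * (U - r2 24)" for r2 h2 out2 t2
  let ?rest = "26 ::= V 23;; 27 ::= N 3;; Loop (N 0) (V 23) sizes_body;; ?mode"
  have "wp (Loop (N 2) (V 24) roots_body) (wp ?rest Q) (r1(22 := U, 23 := 0, 24 := U)) h out (Suc (Suc (Suc t1)))"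
  proof (rule wp_Loop_inv[where I = I1 and \<mu> = "\<lambda>r h. r 24"])
    show "I1 (r1(22 := U, 23 := 0, 24 := U)) h out (Suc (Suc (Suc t1)))" by (simp add: I1_def)
    fix r2 h2 out2 t2
    assume I: "I1 r2 h2 out2 t2"
    note J = I[unfolded I1_def]
    define l where "l = r2 23"
    have "wp roots_body (\<lambda>r' h' out' t'. I1 r' h' out' t' \<and> r' 24 < r2 24) r2 h2 out2 (Suc t2)"
      if u: "2 < r2 24"
    proof -
      let ?u = "lev U l"
      have ul: "r2 24 = ?u" "2 < ?u" using J u by (simp_all add: l_def)
      have l: "l < dep U" using less_dep ul by simp
      have uU: "?u \<le> U" by (rule lev_le)
      have "wp sqrt_loop (wp (St 5 (V 23) (V 25);; 24 ::= V 25;; 23 ::= V 23 [+] N 1)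
          (\<lambda>r' h' out' t'. I1 r' h' out' t' \<and> r' 24 < r2 24)) (r2(25 := 1)) h2 out2 (Suc (Suc t2))"
      proof (rule sqrt_loop[OF ul(2) uU])
        fix t3 assume t3: "t3 \<le> Suc (Suc t2) + 2 * usqrt ?u"
        have less: "usqrt ?u < ?u" using usqrt_less[OF ul(2)] .
        have "t3 + 3 \<le> t1 + 3 + 12 * (U - usqrt ?u)"
          using t3 J ul(1) usqrt_bounds(3)[OF ul(2)] uU less by linarith
        then have "I1 (r2(25 := usqrt ?u, 24 := usqrt ?u, 23 := Suc l)) (h2(5 := (h2 5)(l := usqrt ?u)))
            out2 (Suc (Suc (Suc t3)))"
          using J l unfolding I1_def by (auto simp: l_def less_Suc_eq)
        then show "wp (St 5 (V 23) (V 25);; 24 ::= V 25;; 23 ::= V 23 [+] N 1)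
          (\<lambda>r' h' out' t'. I1 r' h' out' t' \<and> r' 24 < r2 24) (r2(25 := 1, 25 := usqrt ?u)) h2 out2 t3"
          using lB[of l] l less ul lits_W by (simp add: l_def[symmetric])
      qed (use ul in simp_all)
      then show ?thesis unfolding roots_body_def using lits_W by simp
    qed
    moreover have "wp ?rest Q r2 h2 out2 (Suc t2)" if u: "\<not> 2 < r2 24"
    proof -
      have l: "l = dep U" using less_dep[of U l] u J by (simp add: l_def)
      then have "lev U l \<le> 2" using J u by (simp add: l_def)
      then have "sz (lev U l) = 3" using sz.simps[of "lev U l"] by simp
      then have "I2 (r2(26 := l, 27 := 3)) h2 out2 (Suc (Suc (Suc t2)))"
        using J l U_bounds unfolding I2_def by (auto simp: l_def)
      from loop2[OF this] show ?thesis using lits_W by (simp add: l_def)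
    qed
    ultimately show "ok r2 h2 (N 2) \<and> ok r2 h2 (V 24) \<and>
       (if val r2 h2 (N 2) < val r2 h2 (V 24)
        then wp roots_body (\<lambda>r' h' out' t'. I1 r' h' out' t' \<and> r' 24 < r2 24) r2 h2 out2 (Suc t2)
        else wp ?rest Q r2 h2 out2 (Suc t2))"
      using lits_W by simp
  qed
  then show ?thesis
    unfolding tables_def using lits_W U r2 by simp
qed


section \<open>Inverse of the text\<close>

lemma invert:
  assumes r0: "r1 0 = n" "r1 28 = 1" and h0: "\<And>i. 1 \<le> i \<Longrightarrow> i \<le> n \<Longrightarrow> h 0 i = t ! (i - 1)"
    and Q: "\<And>r' h' t'. (\<forall>v<40. v \<noteq> 28 \<longrightarrow> r' v = r1 v) \<Longrightarrow> (\<forall>j<n. h' 1 (t ! j) = Suc j) \<Longrightarrow>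
      (\<forall>j. j \<noteq> 1 \<longrightarrow> h' j = h j) \<Longrightarrow> t' \<le> t1 + 3 * n + 1 \<Longrightarrow> Q r' h' out t'"
  shows "wp (Loop (V 28) (V 0 [+] N 1) invert_body) Q r1 h out t1"
proof (rule wp_Loop_inv[where \<mu> = "\<lambda>r h. Suc n - r 28" and
    I = "\<lambda>r2 h2 out2 t2. (\<forall>v<40. v \<noteq> 28 \<longrightarrow> r2 v = r1 v) \<and> 1 \<le> r2 28 \<and> r2 28 \<le> Suc n \<and>
      (\<forall>j. Suc j < r2 28 \<longrightarrow> h2 1 (t ! j) = Suc j) \<and> (\<forall>j. j \<noteq> 1 \<longrightarrow> h2 j = h j) \<and> out2 = out \<and>
      t2 + 3 \<le> t1 + 3 * r2 28"])
  fix r2 h2 out2 t2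
  assume I: "(\<forall>v<40. v \<noteq> 28 \<longrightarrow> r2 v = r1 v) \<and> 1 \<le> r2 28 \<and> r2 28 \<le> Suc n \<and>
      (\<forall>j. Suc j < r2 28 \<longrightarrow> h2 1 (t ! j) = Suc j) \<and> (\<forall>j. j \<noteq> 1 \<longrightarrow> h2 j = h j) \<and> out2 = out \<and>
      t2 + 3 \<le> t1 + 3 * r2 28"
  define k where "k = r2 28"
  have r2: "r2 0 = n" "h2 0 = h 0" using I r0 by simp_all
  show "ok r2 h2 (V 28) \<and> ok r2 h2 (V 0 [+] N 1) \<and>
     (if val r2 h2 (V 28) < val r2 h2 (V 0 [+] N 1)
      then wp invert_body (\<lambda>r3 h3 out3 t3. ((\<forall>v<40. v \<noteq> 28 \<longrightarrow> r3 v = r1 v) \<and> 1 \<le> r3 28 \<and> r3 28 \<le> Suc n \<and>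
          (\<forall>j. Suc j < r3 28 \<longrightarrow> h3 1 (t ! j) = Suc j) \<and> (\<forall>j. j \<noteq> 1 \<longrightarrow> h3 j = h j) \<and> out3 = out \<and>
          t3 + 3 \<le> t1 + 3 * r3 28) \<and> Suc n - r3 28 < Suc n - r2 28) r2 h2 out2 (Suc t2)
      else Q r2 h2 out2 (Suc t2))"
  proof (cases "k < Suc n")
    case True
    obtain j where j: "k = Suc j" using I by (cases k) (auto simp: k_def)
    then have jn: "j < n" using True by simp
    have key: "h2 0 k = t ! j" using h0[of k] r2 j jn by simp
    have tj: "t ! j \<le> n" "t ! j < B" using jn t(2) length_t nth_mem[of j t] lits_W(5) by auto
    have kW: "k < B" "Suc k < W" using True lits_W by linarith+
    have inj: "t ! j' \<noteq> t ! j" if "j' < j" for j'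
      using that jn t(1) length_t by (simp add: nth_eq_iff_index_eq)
    show ?thesis
      using True I lits_W kW tj key inj r2 unfolding invert_body_def k_def[symmetric]
      by (auto simp: j less_Suc_eq k_def[symmetric])
  next
    case False
    then have "k = Suc n" using I by (simp add: k_def)
    moreover then have "Q r2 h2 out (Suc t2)" using I by (intro Q) (auto simp: k_def)
    ultimately show ?thesis using I lits_W r2 by (simp add: k_def)
  qed
qed (use r0 in auto)

section \<open>Overlapping blocks and ranks within a block\<close>

definition inblk :: "nat \<Rightarrow> nat \<Rightarrow> bool" where
  "inblk q j \<longleftrightarrow> j < n \<and> (j div r = q \<or> j div r = Suc q)"

definition below :: "nat \<Rightarrow> nat \<Rightarrow> nat set" where
  "below q v = {j. inblk q j \<and> t ! j < v}"

text \<open>The quotient form suits the program, which computes \<open>j div r\<close>; the interval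
  form suits the addresses.\<close>

lemma inblk_iff: "inblk q j \<longleftrightarrow> j < n \<and> q * r \<le> j \<and> j < q * r + U"
proof -
  have "j div r = q \<or> j div r = Suc q \<longleftrightarrow> q \<le> j div r \<and> j div r < Suc (Suc q)" by linarith
  also have "\<dots> \<longleftrightarrow> q * r \<le> j \<and> j < Suc (Suc q) * r"
    using r_bounds by (simp add: less_eq_div_iff_mult_less_eq div_less_iff_less_mult)
  also have "Suc (Suc q) * r = q * r + U" by (simp add: U)
  finally show ?thesis unfolding inblk_def by blast
qed

lemma finite_below: "finite (below q v)"
  by (rule finite_subset[of _ "{..<n}"]) (auto simp: below_def inblk_def)

lemma card_below:
  assumes "inblk q j"
  shows "card (below q (t ! j)) < U"
proof -
  have "below q (t ! j) \<subseteq> {q * r..<q * r + U} - {j}"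
    by (auto simp: below_def inblk_iff)
  then have "card (below q (t ! j)) \<le> card ({q * r..<q * r + U} - {j})"
    by (intro card_mono) auto
  also have "\<dots> = U - 1" using assms by (simp add: inblk_iff)
  finally show ?thesis using U_bounds by linarith
qed

text \<open>Within a block \<open>below\<close> grows strictly with the symbol, so its cardinality
  can replace the symbol without changing any comparison.\<close>

lemma below_mono:
  assumes "inblk q i" "inblk q j"
  shows "card (below q (t ! i)) < card (below q (t ! j)) \<longleftrightarrow> t ! i < t ! j"
proof -
  have *: "card (below q (t ! i)) < card (below q (t ! j))" if "t ! i < t ! j" "inblk q i" for i j
    using that finite_below by (intro psubset_card_mono) (auto simp: below_def)
  show ?thesis
  proof (cases "t ! i" "t ! j" rule: linorder_cases)
    case greater
    then show ?thesis using *[of j i] assms by simp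
  qed (use *[of i j] assms in simp_all)
qed

text \<open>\<open>j + q * r = q * U + (j - q * r)\<close> with \<open>j - q * r < U\<close>, so
  division by \<open>U\<close> recovers the block.\<close>

lemma index_inj:
  assumes "inblk q j" "inblk q' j'" "j + q * r = j' + q' * r"
  shows "q = q' \<and> j = j'"
proof -
  have *: "(j + q * r) div U = q" if "inblk q j" for q j
  proof -
    have "j + q * r = (j - q * r) + q * U" "j - q * r < U"
      using that by (auto simp: inblk_iff U)
    then show ?thesis by simp
  qed
  have "q = q'" using *[OF assms(1)] *[OF assms(2)] assms(3) by simp
  then show ?thesis using assms(3) by simp
qed

lemma index_bound: "inblk q j \<Longrightarrow> j + q * r < 2 * n"
  by (simp add: inblk_iff)

text \<open>Each symbol occurs once in the text, so passing from \<open>v\<close> to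
  \<open>Suc v\<close> adds one position, and only in the blocks that contain it. This is the update
  of the counters.\<close>

lemma below_Suc:
  assumes "j < n" "t ! j = v"
  shows "below q (Suc v) = (if inblk q j then insert j (below q v) else below q v)"
proof -
  have "t ! i = v \<longleftrightarrow> i = j" if "i < n" for i
    using that assms t(1) length_t by (auto simp: nth_eq_iff_index_eq)
  then show ?thesis using assms by (auto simp: below_def inblk_def less_Suc_eq)
qed

definition ranked :: "(nat \<Rightarrow> nat \<Rightarrow> nat) \<Rightarrow> nat \<Rightarrow> bool" where
  "ranked h v \<longleftrightarrow> (\<forall>q j. inblk q j \<longrightarrow> t ! j < v \<longrightarrow> h 3 (j + q * r) = card (below q (t ! j)))"

text \<open>\<open>D\<close> is the set of blocks that have already counted the current symbol.\<close>

lemma rank_in: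
  assumes v: "v \<noteq> 3" and regs: "r1 v = q" "r1 29 = j" "r1 2 = r" and j: "inblk q j" and q: "q \<notin> D"
    and cnt: "\<And>q. h 2 q = card (below q (t ! j)) + (if q \<in> D then 1 else 0)"
    and rk: "ranked h (t ! j)" and cur: "\<And>q. q \<in> D \<Longrightarrow> inblk q j \<Longrightarrow> h 3 (j + q * r) = card (below q (t ! j))"
    and Q: "\<And>h'. (\<And>p. h' 2 p = card (below p (t ! j)) + (if p \<in> insert q D then 1 else 0)) \<Longrightarrow>
      ranked h' (t ! j) \<Longrightarrow> (\<And>p. p \<in> insert q D \<Longrightarrow> inblk p j \<Longrightarrow> h' 3 (j + p * r) = card (below p (t ! j))) \<Longrightarrow>
      (\<forall>k. k \<noteq> 2 \<and> k \<noteq> 3 \<longrightarrow> h' k = h k) \<Longrightarrow> Q r1 h' out (Suc (Suc t1))"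
  shows "wp (rank_in v) Q r1 h out t1"
proof -
  let ?c = "card (below q (t ! j))"
  let ?h1 = "h(3 := (h 3)(j + q * r := ?c))"
  let ?h = "?h1(2 := (h 2)(q := Suc ?c))"
  have c: "h 2 q = ?c" using cnt[of q] q by simp
  have "q \<le> q * r" using r_bounds by simp
  then have b: "q < B" "j + q * r < B" "q * r < W" "j + q * r < W" "Suc ?c < W"
    using index_bound[OF j] card_below[OF j] lits_W B by linarith+
  have "Q r1 ?h out (Suc (Suc t1))"
  proof (rule Q)
    show "?h 2 p = card (below p (t ! j)) + (if p \<in> insert q D then 1 else 0)" for p
      using cnt[of p] q by auto
    show "ranked ?h (t ! j)"
      unfolding ranked_def
    proof (intro allI impI)
      fix p i assume i: "inblk p i" "t ! i < t ! j"
      then have "i + p * r \<noteq> j + q * r" using index_inj[OF i(1) j] by auto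
      then show "?h 3 (i + p * r) = card (below p (t ! i))" using rk i by (simp add: ranked_def)
    qed
    show "?h 3 (j + p * r) = card (below p (t ! j))" if "p \<in> insert q D" "inblk p j" for p
      using that cur[of p] r_bounds by (cases "p = q") auto
  qed simp
  then show ?thesis unfolding rank_in_def using b c regs lits_W by simp
qed

text \<open>Symbols are visited in increasing order, so at the visit of a symbol the counter of its
  block is the number of smaller symbols in that block.\<close>

lemma ranks:
  assumes r0: "r1 0 = n" "r1 2 = r" "r1 28 = 1" and h1: "\<forall>j<n. h 1 (t ! j) = Suc j" and h2: "\<And>q. h 2 q = 0"
    and Q: "\<And>r' h' t'. (\<forall>v<28. r' v = r1 v) \<Longrightarrow> ranked h' (Suc n) \<Longrightarrow>
      (\<forall>j. j \<noteq> 2 \<and> j \<noteq> 3 \<longrightarrow> h' j = h j) \<Longrightarrow> t' \<le> t1 + 10 * n + 1 \<Longrightarrow> Q r' h' out t'"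
  shows "wp (Loop (V 28) (V 0 [+] N 1) rank_body) Q r1 h out t1"
proof -
  define I where "I r2 h2 out2 t2 \<longleftrightarrow> (\<forall>v<28. r2 v = r1 v) \<and> 1 \<le> r2 28 \<and> r2 28 \<le> Suc n \<and>
      (\<forall>q. h2 2 q = card (below q (r2 28))) \<and> ranked h2 (r2 28) \<and>
      (\<forall>j. j \<noteq> 2 \<and> j \<noteq> 3 \<longrightarrow> h2 j = h j) \<and> out2 = out \<and> t2 + 10 \<le> t1 + 10 * r2 28" for r2 h2 out2 t2
  show ?thesis
  proof (rule wp_Loop_inv[where \<mu> = "\<lambda>r h. Suc n - r 28" and I = I])
    have pos: "0 < t ! j" if "j < n" for j using that t(2) length_t nth_mem[of j t] by auto
    then have "below q 1 = {}" for q by (force simp: below_def inblk_def)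
    moreover have "ranked h 1" using pos by (force simp: ranked_def inblk_def)
    ultimately show "I r1 h out t1" using r0 h2 by (simp add: I_def)
    fix r2 h2 out2 t2
    assume I: "I r2 h2 out2 t2"
    note J = I[unfolded I_def]
    define v where "v = r2 28"
    have r2: "r2 0 = n" "r2 2 = r" using J r0 by simp_all
    have "wp rank_body (\<lambda>r' h' out' t'. I r' h' out' t' \<and> Suc n - r' 28 < Suc n - r2 28) r2 h2 out2 (Suc t2)"
      (is "wp rank_body ?P r2 h2 out2 _") if lt: "v < Suc n"
    proof -
      have "v \<in> set t" using lt J t(2) by (simp add: v_def)
      then obtain j where j: "j < n" "t ! j = v" using length_t by (auto simp: in_set_conv_nth)
      define q where "q = j div r"
      have iq: "inblk q j" using j by (simp add: inblk_def q_def)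
      have h1j: "h2 1 v = Suc j" using J h1 j by auto
      have lits: "v < B" "v < W" "j < W" "q < W" "Suc v < W"
        using lt j(1) lits_W div_le_dividend[of j r] unfolding q_def by linarith+
      let ?r3 = "r2(29 := j, 30 := q)"
      have fin: "I (r3(28 := Suc v)) h3 out2 (Suc t3)"
        if "\<forall>v<29. r3 v = r2 v" "\<And>p. h3 2 p = card (below p v) + (if inblk p j then 1 else 0)"
          "ranked h3 v" "\<And>p. inblk p j \<Longrightarrow> h3 3 (j + p * r) = card (below p v)"
          "\<forall>k. k \<noteq> 2 \<and> k \<noteq> 3 \<longrightarrow> h3 k = h2 k" "t3 \<le> t2 + 9" for r3 h3 t3
      proof -
        have "h3 2 p = card (below p (Suc v))" for p
          unfolding below_Suc[OF j] that(2) using finite_below[of p v] j(2)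
          by (auto simp: below_def)
        moreover have "ranked h3 (Suc v)"
          unfolding ranked_def
        proof (intro allI impI)
          fix p i assume i: "inblk p i" "t ! i < Suc v"
          show "h3 3 (i + p * r) = card (below p (t ! i))"
          proof (cases "t ! i < v")
            case True
            then show ?thesis using that(3) i(1) by (simp add: ranked_def)
          next
            case False
            then have "t ! i = t ! j" using i(2) j(2) by simp
            then have "i = j" using i(1) j(1) t(1) length_t by (simp add: nth_eq_iff_index_eq inblk_def)
            then show ?thesis using that(4) i(1) j(2) by simp
          qed
        qed
        ultimately show ?thesis using that J lt by (simp add: I_def v_def[symmetric])
      qed
      let ?last = "28 ::= V 28 [+] N 1"
      let ?second = "Cond (N 0) (V 30) (31 ::= V 30 [-] N 1;; rank_in 31) Skip;; ?last"
      have "wp (rank_in 30) (wp ?second ?P) ?r3 h2 out2 (Suc (Suc (Suc t2)))"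
      proof (rule rank_in[where q = q and j = j and D = "{}"])
        fix h3
        assume A: "\<And>p. h3 2 p = card (below p (t ! j)) + (if p \<in> insert q {} then 1 else 0)"
          "ranked h3 (t ! j)" "\<And>p. p \<in> insert q {} \<Longrightarrow> inblk p j \<Longrightarrow> h3 3 (j + p * r) = card (below p (t ! j))"
          "\<forall>k. k \<noteq> 2 \<and> k \<noteq> 3 \<longrightarrow> h3 k = h2 k"
        show "wp ?second ?P ?r3 h3 out2 (Suc (Suc (Suc (Suc (Suc t2)))))"
        proof (cases "q = 0")
          case True
          have "inblk p j \<longleftrightarrow> p = q" for p using j(1) True by (auto simp: inblk_def q_def)
          then have "I (?r3(28 := Suc v)) h3 out2 (Suc (Suc (Suc (Suc (Suc (Suc (Suc t2)))))))"
            using A j(2) by (intro fin) auto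
          then show ?thesis using True lits lits_W lt by (simp add: v_def[symmetric])
        next
          case False
          then obtain q' where q': "q = Suc q'" by (cases q) auto
          have iff: "inblk p j \<longleftrightarrow> p \<in> insert q' {q}" for p using j(1) q' by (auto simp: inblk_def q_def)
          have "wp (rank_in 31) (wp ?last ?P) (?r3(31 := q')) h3 out2 (Suc (Suc (Suc (Suc (Suc (Suc (Suc t2)))))))"
          proof (rule rank_in[where q = q' and j = j and D = "{q}"])
            fix h4
            assume C: "\<And>p. h4 2 p = card (below p (t ! j)) + (if p \<in> insert q' {q} then 1 else 0)"
              "ranked h4 (t ! j)" "\<And>p. p \<in> insert q' {q} \<Longrightarrow> inblk p j \<Longrightarrow> h4 3 (j + p * r) = card (below p (t ! j))"
              "\<forall>k. k \<noteq> 2 \<and> k \<noteq> 3 \<longrightarrow> h4 k = h3 k"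
            have "I (?r3(31 := q', 28 := Suc v)) h4 out2
                (Suc (Suc (Suc (Suc (Suc (Suc (Suc (Suc (Suc (Suc t2))))))))))"
              using A(4) C j(2) iff by (intro fin) auto
            then show "wp ?last ?P (?r3(31 := q')) h4 out2 (Suc (Suc (Suc (Suc (Suc (Suc (Suc (Suc (Suc t2)))))))))"
              using lits lits_W lt by (simp add: v_def[symmetric])
          qed (use A q' r2 iff in auto)
          then show ?thesis using q' lits lits_W by simp
        qed
      qed (use iq J r2 j(2) in \<open>auto simp: v_def\<close>)
      then show ?thesis
        unfolding rank_body_def using lits lits_W h1j r2(2) by (simp add: v_def[symmetric] q_def)
    qed
    moreover have "Q r2 h2 out2 (Suc t2)" if "\<not> v < Suc n"
    proof -
      have "v = Suc n" using that J by (simp add: v_def)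
      then show ?thesis using J by (auto simp: v_def intro!: Q)
    qed
    ultimately show "ok r2 h2 (V 28) \<and> ok r2 h2 (V 0 [+] N 1) \<and>
       (if val r2 h2 (V 28) < val r2 h2 (V 0 [+] N 1)
        then wp rank_body (\<lambda>r' h' out' t'. I r' h' out' t' \<and> Suc n - r' 28 < Suc n - r2 28) r2 h2 out2 (Suc t2)
        else Q r2 h2 out2 (Suc t2))"
      using lits_W r2 by (simp add: v_def)
  qed
qed

section \<open>Occurrences in the blocks and in the text\<close>

definition block_keys :: "nat \<Rightarrow> nat list" where
  "block_keys q = map (\<lambda>o'. card (below q (t ! (q * r + o')))) [0..<min U (n - q * r)]"

lemma length_block_keys [simp]: "length (block_keys q) = min U (n - q * r)"
  by (simp add: block_keys_def)

lemma inblk_offset: "i < min U (n - q * r) \<Longrightarrow> inblk q (q * r + i)"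
  by (auto simp: inblk_iff)

lemma block_interpretation: "block w B A U n S num (block_keys q) (2 * (q * r)) (q * r)" if "q * r < n"
proof
  show "distinct (block_keys q)"
  proof -
    have "i = j" if ij: "i < min U (n - q * r)" "j < min U (n - q * r)"
      "card (below q (t ! (q * r + i))) = card (below q (t ! (q * r + j)))" for i j
    proof -
      have "\<not> t ! (q * r + i) < t ! (q * r + j)" "\<not> t ! (q * r + j) < t ! (q * r + i)"
        using below_mono[OF inblk_offset[OF ij(1)] inblk_offset[OF ij(2)]]
          below_mono[OF inblk_offset[OF ij(2)] inblk_offset[OF ij(1)]] ij(3) by simp_all
      then have "t ! (q * r + i) = t ! (q * r + j)" by simp
      then show ?thesis using ij t(1) length_t by (simp add: nth_eq_iff_index_eq)
    qed
    then show ?thesis unfolding block_keys_def by (auto simp: distinct_map inj_on_def)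
  qed
  show "x < U" if "x \<in> set (block_keys q)" for x
    using that card_below inblk_offset by (auto simp: block_keys_def)
  show "2 * (q * r) + length (block_keys q) \<le> B" "q * r + length (block_keys q) + 1 < W"
    using that B lits_W by (auto simp: min_def)
qed

lemma block_keys_iso: "order_iso (block_keys q) (take (length (block_keys q)) (drop (q * r) t))"
proof -
  have "block_keys q ! i < block_keys q ! j \<longleftrightarrow> t ! (q * r + i) < t ! (q * r + j)"
    if "i < min U (n - q * r)" "j < min U (n - q * r)" for i j
    using below_mono[OF inblk_offset[OF that(1)] inblk_offset[OF that(2)]] that by (simp add: block_keys_def)
  then show ?thesis by (auto simp: order_iso_def length_t)
qed

definition block_occs :: "nat \<Rightarrow> (nat \<times> nat) set" where
  "block_occs q = {(q * r + Suc a, state (drop a (take e (block_keys q)))) | a e.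
     a \<le> e \<and> e \<le> length (block_keys q) \<and> accepting (drop a (take e (block_keys q)))}"

text \<open>Order isomorphism passes to factors, so a window of ranks stands for the factor of the
  text at the same place.\<close>

lemma block_factor:
  assumes "a \<le> e" "e \<le> length (block_keys q)"
  shows "order_iso (drop a (take e (block_keys q))) (take (e - a) (drop (q * r + a) t))"
proof -
  have "take e (take (length (block_keys q)) (drop (q * r) t)) = take e (drop (q * r) t)"
    using assms(2) by (simp add: min_absorb1)
  then have "order_iso (drop a (take e (block_keys q))) (drop a (take e (drop (q * r) t)))"
    using order_iso_drop[OF order_iso_take[OF block_keys_iso, of e q], of a] by simp
  then show ?thesis by (simp add: drop_take add.commute)
qed

text \<open>The blocks have length \<open>2 * r\<close> and start at the multiples of \<open>r\<close>, so a factor of length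
  at most \<open>r\<close> lies in some block.\<close>

lemma union_block_occs: "(\<Union>q\<in>{q. q * r < n}. block_occs q) = all_occurrences S num t"
proof (intro equalityI subsetI)
  fix x assume "x \<in> (\<Union>q\<in>{q. q * r < n}. block_occs q)"
  then obtain q a e where q: "q * r < n" and ae: "a \<le> e" "e \<le> length (block_keys q)"
    and x: "x = (q * r + Suc a, state (drop a (take e (block_keys q))))"
    and acc: "accepting (drop a (take e (block_keys q)))"
    by (auto simp: block_occs_def)
  obtain p where p: "p \<in> S" "order_iso (drop a (take e (block_keys q))) p" using acc by (auto simp: accepting_def)
  have len: "length p = e - a" using order_iso_length[OF p(2)] ae by simp
  have "occurs_at p t (q * r + Suc a)"
    unfolding occurs_at_def
  proof (intro conjI)
    have "e \<le> n - q * r" using ae(2) by simp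
    then show "q * r + Suc a + length p \<le> length t + 1" using ae(1) len q length_t by linarith
    show "order_iso p (take (length p) (drop (q * r + Suc a - 1) t))"
      using order_iso_trans[OF order_iso_sym[OF p(2)] block_factor[OF ae]] len by simp
  qed simp
  moreover have "x = (q * r + Suc a, num (state_of S p))"
    using x state_cong[OF p(2)] by (simp add: state_def)
  ultimately show "x \<in> all_occurrences S num t" using p(1) by (auto simp: all_occurrences_def)
next
  fix x assume "x \<in> all_occurrences S num t"
  then obtain i p where p: "p \<in> S" "occurs_at p t i" "x = (i, num (state_of S p))"
    by (auto simp: all_occurrences_def)
  have i: "1 \<le> i" "i + length p \<le> n + 1" and iso: "order_iso p (take (length p) (drop (i - 1) t))"
    using p(2) length_t by (auto simp: occurs_at_def)
  have lp: "1 \<le> length p" "length p \<le> r" using pattern_length[OF p(1)] by auto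
  define q where "q = (i - 1) div r"
  define a where "a = (i - 1) mod r"
  have ia: "i = q * r + Suc a" "a < r" using i(1) r_bounds by (simp_all add: q_def a_def)
  define e where "e = a + length p"
  have qn: "q * r < n" using ia i lp by linarith
  have "a \<le> e" "e \<le> U" "e \<le> n - q * r" using ia i lp U unfolding e_def by linarith+
  then have ae: "a \<le> e" "e \<le> length (block_keys q)" by simp_all
  have "order_iso (drop a (take e (block_keys q))) p"
    using order_iso_trans[OF block_factor[OF ae] order_iso_sym] iso ia(1) by (simp add: e_def)
  then have "accepting (drop a (take e (block_keys q)))"
    "state (drop a (take e (block_keys q))) = num (state_of S p)"
    using p(1) state_cong by (auto simp: accepting_def state_def)
  then have "x \<in> block_occs q" using p(3) ia(1) ae by (auto simp: block_occs_def intro!: exI[of _ a] exI[of _ e])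
  then show "x \<in> (\<Union>q\<in>{q. q * r < n}. block_occs q)" using qn by blast
qed

text \<open>\<open>q * r < n + r\<close> and \<open>r \<le> n\<close> keep the total offset below
  \<open>2 * n\<close>, which doubles 2010 to 4020. An occurrence in the overlap of two blocks is
  reported twice; only the set of reports matters.\<close>

lemma blocks:
  fixes G :: nat
  assumes r0: "r1 0 = n" "r1 2 = r" "r1 22 = U" "r1 5 = 0" "r1 6 = 0"
    and mode: "r1 4 = 0 \<Longrightarrow> dep U \<le> G" "r1 4 \<noteq> 0 \<Longrightarrow> card S \<le> G"
    and h: "ranked h (Suc n)" "tabs h" "\<And>i. h 10 i = 0" "\<And>i. h 11 i = 0"
    and Q: "\<And>r' h' out' t'. set out' = set out \<union> all_occurrences S num t \<Longrightarrow>
      t' \<le> t1 + 4020 * (G + 2) * n + 1 \<Longrightarrow> Q r' h' out' t'"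
  shows "wp (Loop (V 6) (V 0) block_body) Q r1 h out t1"
proof -
  define I :: "(nat \<Rightarrow> nat) \<Rightarrow> (nat \<Rightarrow> nat \<Rightarrow> nat) \<Rightarrow> (nat \<times> nat) list \<Rightarrow> nat \<Rightarrow> bool"
    where "I r2 h2 out2 t2 \<longleftrightarrow> (\<exists>q. r2 0 = n \<and> r2 2 = r \<and> r2 4 = r1 4 \<and> r2 22 = U \<and>
      r2 5 = 2 * (q * r) \<and> r2 6 = q * r \<and> q * r < n + r \<and> (\<forall>j<7. h2 j = h j) \<and>
      (r1 4 = 0 \<longrightarrow> rep (h2 10) U 0 {} \<and> rep (h2 11) U 0 {}) \<and>
      set out2 = set out \<union> (\<Union>p<q. block_occs p) \<and> t2 \<le> t1 + 2010 * (G + 2) * (q * r))" for r2 h2 out2 t2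
  show ?thesis
  proof (rule wp_Loop_inv[where \<mu> = "\<lambda>r h. n - r 6" and I = I])
    have "rep (h 10) U 0 {}" "rep (h 11) U 0 {}" using h by (auto intro: rep_zero)
    then show "I r1 h out t1" unfolding I_def using r0 r_bounds by (intro exI[of _ 0]) simp
    fix r2 h2 out2 t2
    assume "I r2 h2 out2 t2"
    then obtain q where r2: "r2 0 = n" "r2 2 = r" "r2 4 = r1 4" "r2 22 = U" "r2 5 = 2 * (q * r)" "r2 6 = q * r"
      and q: "q * r < n + r" and h2: "\<forall>j<7. h2 j = h j"
      and z: "r1 4 = 0 \<longrightarrow> rep (h2 10) U 0 {} \<and> rep (h2 11) U 0 {}"
      and o: "set out2 = set out \<union> (\<Union>p<q. block_occs p)" and t2: "t2 \<le> t1 + 2010 * (G + 2) * (q * r)"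
      unfolding I_def by (elim exE conjE) (rule that)
    have "wp block_body (\<lambda>r' h' out' t'. I r' h' out' t' \<and> n - r' 6 < n - r2 6) r2 h2 out2 (Suc t2)"
      (is "wp _ ?P _ _ _ _") if lt: "q * r < n"
    proof -
      interpret b: block w B A U n S num "block_keys q" "2 * (q * r)" "q * r" G
        by (rule block_interpretation[OF lt])
      let ?len = "min U (n - q * r)"
      let ?r3 = "r2(7 := ?len)"
      have len: "0 < ?len" "?len \<le> 2 * r" using lt U U_bounds by auto
      have sW: "q * r + r < W" "2 * (q * r) + U < W" using q r_bounds U_bounds B lits_W lt by linarith+
      let ?next = "6 ::= V 6 [+] V 2;; 5 ::= V 5 [+] V 22"
      have mb: "wp match_block (wp ?next ?P) ?r3 h2 out2 t3" if t3: "t3 \<le> t2 + 5" for t3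
      proof (rule b.match_block)
        show "b.keys h2"
          unfolding b.keys_def
        proof (intro allI impI)
          fix j assume j: "j < length (block_keys q)"
          then have blk: "inblk q (q * r + j)" using inblk_offset by simp
          then have "q * r + j < n" by (simp add: inblk_def)
          then have "t ! (q * r + j) < Suc n" using nth_mem[of "q * r + j" t] t(2) length_t by auto
          then have "h 3 (q * r + j + q * r) = card (below q (t ! (q * r + j)))"
            using h(1) blk by (simp add: ranked_def)
          then show "h2 3 (2 * (q * r) + j) = block_keys q ! j"
            using h2 j by (simp add: block_keys_def mult_2 add.commute add.left_commute)
        qed
        show "b.regs ?r3" using r2 mode by (auto simp: b.regs_def)
        show "0 < length (block_keys q)" using len by simp
        show "tabs h2 \<and> rep (h2 10) U 0 {} \<and> rep (h2 11) U 0 {}" if "?r3 4 = 0"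
          using that r2(3) z h(2) h2 by (simp add: tabs_def)
        fix r4 h4 out4 t4
        assume A: "b.frame ?r3 h2 r4 h4" "?r3 4 = 0 \<Longrightarrow> rep (h4 10) U 0 {} \<and> rep (h4 11) U 0 {}"
          "set out4 = set out2 \<union> b.occ (length (block_keys q))"
          "t4 \<le> t3 + 1000 * (G + 2) * length (block_keys q)"
        have r4: "r4 0 = n" "r4 2 = r" "r4 4 = r1 4" "r4 22 = U" "r4 5 = 2 * (q * r)" "r4 6 = q * r"
          "\<forall>j<7. h4 j = h j" using A(1) r2 h2 by (simp_all add: b.frame_def)
        have occ: "b.occ (length (block_keys q)) = block_occs q"
          by (simp add: b.occ_def b.win_def block_occs_def)
        have "1000 * (G + 2) * length (block_keys q) \<le> 1000 * (G + 2) * (2 * r)"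
          using len(2) by (intro mult_le_mono2) simp
        moreover have "1000 * (G + 2) * (2 * r) + 10 \<le> 2010 * (G + 2) * r"
        proof -
          have "10 * 1 \<le> 10 * (G + 2) * r" using r_bounds by (intro mult_le_mono) auto
          then show ?thesis by (simp add: algebra_simps)
        qed
        moreover have "2010 * (G + 2) * (Suc q * r) = 2010 * (G + 2) * (q * r) + 2010 * (G + 2) * r"
          by (simp add: algebra_simps)
        ultimately have "Suc (Suc t4) \<le> t1 + 2010 * (G + 2) * (Suc q * r)"
          using A(4) t3 t2 by linarith
        then have "I (r4(6 := q * r + r, 5 := 2 * (q * r) + U)) h4 out4 (Suc (Suc t4))"
          unfolding I_def using r4 A(2) r2(3) lt A(3) occ o
          by (intro exI[of _ "Suc q"]) (auto simp: U lessThan_Suc)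
        moreover have "n - (q * r + r) < n - q * r" using lt r_bounds by linarith
        ultimately show "wp ?next ?P r4 h4 out4 t4" using r4 sW r2(6) by simp
      qed
      have nq: "n - q * r < W" using lits_W by linarith
      show ?thesis
      proof (cases "n - q * r < U")
        case True
        then have "?len = n - q * r" by simp
        then show ?thesis unfolding block_body_def using mb[of "Suc (Suc (Suc (Suc t2)))"] True lt nq r2
          by simp
      next
        case False
        then have "?len = U" by simp
        then show ?thesis unfolding block_body_def using mb[of "Suc (Suc (Suc t2))"] False lt nq r2
          by simp
      qed
    qed
    moreover have "Q r2 h2 out2 (Suc t2)" if ge: "\<not> q * r < n"
    proof (rule Q)
      have "{p. p * r < n} \<subseteq> {..<q}"
      proof
        fix p assume "p \<in> {p. p * r < n}"
        then have "p * r < n" by simp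
        with ge have "p * r < q * r" by (simp only: not_less)
        then have "p < q" by (rule mult_right_less_imp_less) simp
        then show "p \<in> {..<q}" by simp
      qed
      moreover have "p * r < n" if "p < q" for p
      proof -
        have "Suc p * r \<le> q * r" using that by (intro mult_le_mono1) simp
        then show ?thesis using q by simp
      qed
      ultimately have "{..<q} = {p. p * r < n}" by auto
      then show "set out2 = set out \<union> all_occurrences S num t" unfolding o union_block_occs[symmetric] by simp
      have "2010 * (G + 2) * (q * r) \<le> 2010 * (G + 2) * (2 * n)" using q r_bounds by (intro mult_le_mono2) simp
      also have "\<dots> = 4020 * (G + 2) * n" by simp
      finally show "Suc t2 \<le> t1 + 4020 * (G + 2) * n + 1" using t2 by (simp only: Suc_eq_plus1)
    qed
    ultimately show "ok r2 h2 (V 6) \<and> ok r2 h2 (V 0) \<and>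
       (if val r2 h2 (V 6) < val r2 h2 (V 0)
        then wp block_body (\<lambda>r' h' out' t'. I r' h' out' t' \<and> n - r' 6 < n - r2 6) r2 h2 out2 (Suc t2)
        else Q r2 h2 out2 (Suc t2))"
      using r2 by simp
  qed
qed

text \<open>If \<open>card S < dep U\<close>, edges are scanned and \<open>card S\<close> bounds an
  attempt; otherwise the sets are used and \<open>dep U \<le> card S\<close>. Either way the bound
  is the minimum. The linear preprocessing fits into the gap between 4020 and 5000.\<close>

lemma main:
  assumes r0: "r1 0 = n" "r1 1 = card S" "r1 2 = r"
    and h0: "\<And>k i. h k i = (if k = 0 \<and> 1 \<le> i \<and> i \<le> n then t ! (i - 1) else 0)"
  shows "wp main (\<lambda>r' h' out' t'. set out' = all_occurrences S num t \<and>
    t' \<le> 5000 * (min (card S) (dep U) + 2) * n) r1 h [] 0" (is "wp main ?Q _ _ _ _")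
proof -
  let ?G = "min (card S) (dep U)"
  let ?c5 = "5 ::= N 0;; 6 ::= N 0;; Loop (V 6) (V 0) block_body"
  let ?c4 = "28 ::= N 1;; Loop (V 28) (V 0 [+] N 1) rank_body;; ?c5"
  let ?c3 = "28 ::= N 1;; Loop (V 28) (V 0 [+] N 1) invert_body;; ?c4"
  have c5: "wp ?c5 ?Q r2 h2 [] t2"
    if r2: "r2 0 = n" "r2 2 = r" "r2 22 = U" "r2 4 = (if card S < dep U then 1 else 0)"
      and h2: "ranked h2 (Suc n)" "tabs h2" "\<And>i. h2 10 i = 0" "\<And>i. h2 11 i = 0"
      and t2: "t2 \<le> 63 * n + 24" for r2 h2 t2
  proof -
    have "wp (Loop (V 6) (V 0) block_body) ?Q (r2(5 := 0, 6 := 0)) h2 [] (Suc (Suc t2))"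
    proof (rule blocks[where G = ?G])
      fix r' h' out' t'
      assume A: "set out' = set [] \<union> all_occurrences S num t" "t' \<le> Suc (Suc t2) + 4020 * (?G + 2) * n + 1"
      have "63 * n + 27 \<le> 90 * n" using r_bounds by linarith
      also have "\<dots> \<le> 980 * (?G + 2) * n" by (intro mult_le_mono1) simp
      finally have "t' \<le> 980 * (?G + 2) * n + 4020 * (?G + 2) * n" using A(2) t2 by linarith
      also have "\<dots> = 5000 * (?G + 2) * n" by (simp add: add_mult_distrib[symmetric])
      finally show "?Q r' h' out' t'" using A(1) by simp
    qed (use r2 h2 in \<open>auto split: if_splits\<close>)
    then show ?thesis using lits_W by simp
  qed
  have c4: "wp ?c4 ?Q r2 h2 [] t2"
    if r2: "r2 0 = n" "r2 2 = r" "r2 22 = U" "r2 4 = (if card S < dep U then 1 else 0)"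
      and h2: "\<forall>j<n. h2 1 (t ! j) = Suc j" "tabs h2" "\<And>i. h2 2 i = 0" "\<And>i. h2 10 i = 0" "\<And>i. h2 11 i = 0"
      and t2: "t2 \<le> 53 * n + 22" for r2 h2 t2
  proof -
    have "wp (Loop (V 28) (V 0 [+] N 1) rank_body) (wp ?c5 ?Q) (r2(28 := 1)) h2 [] (Suc t2)"
    proof (rule ranks)
      fix r' h' t'
      assume A: "\<forall>v<28. r' v = (r2(28 := 1)) v" "ranked h' (Suc n)" "\<forall>j. j \<noteq> 2 \<and> j \<noteq> 3 \<longrightarrow> h' j = h2 j"
        "t' \<le> Suc t2 + 10 * n + 1"
      show "wp ?c5 ?Q r' h' [] t'"
        by (rule c5) (use A r2 h2 t2 in \<open>simp_all add: tabs_def\<close>)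
    qed (use r2 h2 in simp_all)
    then show ?thesis unfolding wp_Seq[of "28 ::= N 1"] wp_Seq[of "Loop _ _ _"] using lits_W by simp
  qed
  have c3: "wp ?c3 ?Q r2 h2 [] t2"
    if r2: "r2 0 = n" "r2 2 = r" "r2 22 = U" "r2 4 = (if card S < dep U then 1 else 0)"
      and h2: "tabs h2" "\<And>i. 1 \<le> i \<Longrightarrow> i \<le> n \<Longrightarrow> h2 0 i = t ! (i - 1)" "\<And>i. h2 2 i = 0" "\<And>i. h2 10 i = 0" "\<And>i. h2 11 i = 0"
      and t2: "t2 \<le> 50 * n + 20" for r2 h2 t2
  proof -
    have "wp (Loop (V 28) (V 0 [+] N 1) invert_body) (wp ?c4 ?Q) (r2(28 := 1)) h2 [] (Suc t2)"
    proof (rule invert)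
      fix r' h' t'
      assume A: "\<forall>v<40. v \<noteq> 28 \<longrightarrow> r' v = (r2(28 := 1)) v" "\<forall>j<n. h' 1 (t ! j) = Suc j"
        "\<forall>j. j \<noteq> 1 \<longrightarrow> h' j = h2 j" "t' \<le> Suc t2 + 3 * n + 1"
      show "wp ?c4 ?Q r' h' [] t'"
        by (rule c4) (use A r2 h2 t2 in \<open>simp_all add: tabs_def\<close>)
    qed (use r2 h2 in simp_all)
    then show ?thesis unfolding wp_Seq[of "28 ::= N 1"] wp_Seq[of "Loop _ _ _"] using lits_W by simp
  qed
  have "wp tables (wp ?c3 ?Q) r1 h [] 0"
  proof (rule tables)
    fix r' h' t'
    assume A: "\<forall>v<22. v \<noteq> 4 \<longrightarrow> r' v = r1 v" "r' 22 = U" "r' 4 = (if card S < dep U then 1 else 0)" "tabs h'"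
      "\<forall>j. j \<noteq> 5 \<and> j \<noteq> 6 \<longrightarrow> h' j = h j" "t' \<le> 0 + 50 * n + 20"
    show "wp ?c3 ?Q r' h' [] t'"
      by (rule c3) (use A r0 h0 in simp_all)
  qed (use r0 h0 in simp_all)
  then show ?thesis unfolding main_def wp_Seq[of tables] .
qed

end

section \<open>The time bound\<close>

text \<open>Cubing \<open>x * (2 / 9) \<le> exp (x * (ln 2 / 3))\<close> gives the constant
  \<open>(9 / 2) ^ 3 = 729 / 8\<close>, which is below 100.\<close>

lemma cube_le_powr:
  fixes x :: real
  assumes "0 \<le> x"
  shows "x ^ 3 \<le> 100 * 2 powr x"
proof -
  have "x * (2 / 9) \<le> x * (ln 2 / 3)" using ln2_ge_two_thirds assms by (intro mult_left_mono) auto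
  also have "\<dots> \<le> exp (x * (ln 2 / 3))" using exp_ge_add_one_self[of "x * (ln 2 / 3)"] by linarith
  finally have "(x * (2 / 9)) ^ 3 \<le> exp (x * (ln 2 / 3)) ^ 3" using assms by (intro power_mono) auto
  also have "\<dots> = 2 powr x" by (simp add: exp_of_nat_mult[symmetric] powr_def)
  finally have "8 * x ^ 3 \<le> 729 * 2 powr x" by (simp add: power_mult_distrib power3_eq_cube)
  moreover have "0 \<le> (2 :: real) powr x" by simp
  ultimately show ?thesis by linarith
qed

lemma loglog_ge_1:
  fixes y :: real
  assumes "4 \<le> y"
  shows "1 \<le> log 2 (log 2 y)" "2 \<le> log 2 y"
proof -
  have "2 = log 2 (2 ^ 2 :: real)" by (subst log_nat_power) auto
  also have "\<dots> \<le> log 2 y" using assms by (subst log_le_cancel_iff) auto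
  finally show 2: "2 \<le> log 2 y" .
  then have "log 2 2 \<le> log 2 (log 2 y)" by (subst log_le_cancel_iff) auto
  then show "1 \<le> log 2 (log 2 y)" by simp
qed

text \<open>For \<open>x = log 2 (log 2 y)\<close> the claim is the square root of
  \<open>x ^ 2 \<le> 100 * (2 powr x / x)\<close>, which is \<open>cube_le_powr\<close>.\<close>

lemma loglog_le_sqrt:
  fixes y :: real
  assumes "4 \<le> y"
  shows "log 2 (log 2 y) \<le> 10 * sqrt (log 2 y / log 2 (log 2 y))"
proof -
  define x where "x = log 2 (log 2 y)"
  have x: "1 \<le> x" and "2 \<le> log 2 y" using loglog_ge_1[OF assms] by (simp_all add: x_def)
  then have px: "2 powr x = log 2 y" by (simp add: x_def)
  have "x * x ^ 2 \<le> 100 * log 2 y" using cube_le_powr[of x] x px by (simp add: eval_nat_numeral)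
  then have "x ^ 2 \<le> 100 * (log 2 y / x)" using x by (simp add: field_simps)
  then have "sqrt (x ^ 2) \<le> sqrt (100 * (log 2 y / x))" by (rule real_sqrt_le_mono)
  moreover have "sqrt 100 = (10 :: real)" by (rule real_sqrt_unique) auto
  then have "sqrt (100 * (log 2 y / x)) = 10 * sqrt (log 2 y / x)" by (simp only: real_sqrt_mult)
  moreover have "sqrt (x ^ 2) = x" using x by simp
  ultimately show ?thesis unfolding x_def[symmetric] by linarith
qed

text \<open>Doubling raises the double logarithm \<open>x\<close> by at most 1 and rounding adds
  less than 1, so the depth is at most \<open>x + 2\<close>; and \<open>x \<ge> 1\<close> turns this
  into \<open>3 * x\<close>.\<close>

lemma dep_le_loglog: "real (dep (2 * r)) \<le> 3 * log 2 (log 2 (max 4 (real r)))"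
proof -
  define y where "y = max 4 (real r)"
  define x where "x = log 2 (log 2 y)"
  have x: "1 \<le> x" and l: "2 \<le> log 2 y" using loglog_ge_1[of y] by (simp_all add: x_def y_def)
  define j where "j = nat \<lceil>x + 1\<rceil>"
  have j: "x + 1 \<le> real j" "real j \<le> x + 2" using x by (simp_all add: j_def) linarith
  have "real (2 * r) \<le> 2 * y" by (simp add: y_def)
  also have "y = 2 powr (2 powr x)" using l by (simp add: x_def y_def)
  also have "2 * 2 powr (2 powr x) = 2 powr (1 + 2 powr x)" by (simp add: powr_add)
  also have "\<dots> \<le> 2 powr (2 powr (x + 1))"
  proof (intro powr_mono)
    have "1 \<le> (2 :: real) powr x" using x by (intro ge_one_powr_ge_zero) auto
    then show "1 + 2 powr x \<le> 2 powr (x + 1)" by (simp add: powr_add)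
  qed simp
  also have "\<dots> \<le> 2 powr (2 powr real j)" using j by (intro powr_mono) auto
  also have "\<dots> = real (2 ^ 2 ^ j)" by (simp add: powr_realpow[symmetric])
  finally have "2 * r \<le> 2 ^ 2 ^ j" by (simp only: of_nat_le_iff)
  then have "dep (2 * r) \<le> j" by (rule dep_le)
  then have "real (dep (2 * r)) \<le> real j" by simp
  then have "real (dep (2 * r)) \<le> 3 * x" using j x by linarith
  then show ?thesis by (simp only: x_def y_def)
qed

text \<open>30 is the 3 of the depth bound times the 10 of the square root comparison. The second
  part keeps \<open>tau\<close> away from 0, so that additive constants can be absorbed.\<close>

lemma depth_le_tau:
  assumes "r \<le> n" "1 \<le> d"
  shows "real (min d (dep (2 * r))) \<le> 30 * tau n r d" "1 \<le> 10 * tau n r d"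
proof -
  define y where "y = max 4 (real r)"
  define x where "x = log 2 (log 2 y)"
  define z where "z = log 2 (log 2 (max 4 (real n)))"
  define s where "s = sqrt (log 2 y / log 2 (log 2 y))"
  have y: "4 \<le> y" by (simp add: y_def)
  have x: "1 \<le> x" unfolding x_def using loglog_ge_1[OF y] by simp
  have xs: "x \<le> 10 * s" unfolding x_def s_def using loglog_le_sqrt[OF y] by simp
  have "log 2 y \<le> log 2 (max 4 (real n))" using assms by (subst log_le_cancel_iff) (auto simp: y_def)
  then have xz: "x \<le> z" unfolding x_def z_def using loglog_ge_1[OF y] by (subst log_le_cancel_iff) auto
  have tau: "tau n r d = Min {z, s, real d}" by (simp add: tau_def z_def s_def y_def)
  have dep: "real (dep (2 * r)) \<le> 3 * x" using dep_le_loglog by (simp add: x_def y_def)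
  have "real (min d (dep (2 * r))) / 30 \<le> tau n r d" unfolding tau
    using dep xs xz x by (subst Min_ge_iff) (auto simp: min_def)
  then show "real (min d (dep (2 * r))) \<le> 30 * tau n r d" by simp
  have "1 / 10 \<le> tau n r d" unfolding tau
    using xs xz x assms by (subst Min_ge_iff) auto
  then show "1 \<le> 10 * tau n r d" by simp
qed

text \<open>The case \<open>r = 1\<close> is separate because \<open>sz_le\<close> starts at
  universes of size 4.\<close>

lemma sz_bound: "1 \<le> r \<Longrightarrow> r \<le> n \<Longrightarrow> sz (2 * r) + 3 * (2 * r) + 200 \<le> 300 * n"
  using sz_le[of "2 * r"] sz.simps[of 2] by (cases "r = 1") auto

theorem theorem2:
  shows "\<exists>(prog :: instr list) (C :: real) (\<kappa> :: nat).
    \<forall>(n :: nat) (S :: nat list set) (d :: nat) (r :: nat) (t :: nat list)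
      (num :: nat list set \<Rightarrow> nat) (A :: ac_tables) (w :: nat).
      pattern_set n S \<and> card S = d \<and> Max (length ` S) = r \<and>
      distinct t \<and> set t = {1..n} \<and>
      stores_AC S num A \<and>
      \<kappa> * (n + card (ac_states S)) \<le> 2 ^ w
      \<longrightarrow> finds_all w A prog (initial_config w d r t) (all_occurrences S num t) \<and>
          expected_time w A prog (initial_config w d r t) \<le> ennreal (C * real n * tau n r d)"
proof -
  define prog where "prog = load_prog 300 main"
  \<comment> \<open>250000 is 5000 units of the clock times the 50 of
    \<open>min d (dep (2 * r)) + 2 \<le> 50 * tau n r d\<close>; 20 absorbs the two instructions of
    the prologue.\<close>
  define C where "C = 20 + 250000 * real (length prog)"
  \<comment> \<open>12 arrays of \<open>300 * n\<close> cells must be addressable, which gives 3600;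
    the number of states enters because states have to fit into words.\<close>
  have "finds_all w A prog (initial_config w d r t) (all_occurrences S num t) \<and>
      expected_time w A prog (initial_config w d r t) \<le> ennreal (C * real n * tau n r d)"
    if pats: "pattern_set n S" and d: "card S = d" and r: "Max (length ` S) = r"
      and t: "distinct t" "set t = {1..n}" and stores: "stores_AC S num A"
      and w: "3600 * (n + card (ac_states S)) \<le> 2 ^ w" for n S d r t num A w
  proof -
    interpret ac n S num A by unfold_locales (fact pats stores)+
    have rb: "1 \<le> r" "r \<le> n" using max_length_bounds r by auto
    have n: "length t = n" using t distinct_card[of t] by simp
    have d1: "1 \<le> d" using pats d by (auto simp: pattern_set_def Suc_le_eq card_gt_0_iff)
    define B where "B = 300 * n"
    interpret matching w B A "2 * r" n S num t r
      using sz_bound[OF rb] w rb t r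
      by unfold_locales (auto simp: B_def ram.W_def)
    let ?T = "5000 * (min d (dep (2 * r)) + 2) * n"
    have "wp main (\<lambda>r' h' out' t'. set out' = all_occurrences S num t \<and> t' \<le> ?T)
       ((\<lambda>_. 0)(0 := length t, 1 := d, 2 := r, 3 := w))
       (\<lambda>k i. if k = 0 \<and> 1 \<le> i \<and> i \<le> length t then t ! (i - 1) else 0) [] 0"
      using main[where ?r1.0 = "(\<lambda>_. 0)(0 := length t, 1 := d, 2 := r, 3 := w)" and
          h = "\<lambda>k i. if k = 0 \<and> 1 \<le> i \<and> i \<le> length t then t ! (i - 1) else 0"] n d by simp
    then have wp: "ram.wp w (300 * length t) A main (\<lambda>r' h' out' t'. set out' = all_occurrences S num t \<and> t' \<le> ?T)
       ((\<lambda>_. 0)(0 := length t, 1 := d, 2 := r, 3 := w))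
       (\<lambda>k i. if k = 0 \<and> 1 \<le> i \<and> i \<le> length t then t ! (i - 1) else 0) [] 0"
      by (simp add: B_def n)
    have small: "d < 2 ^ w" "r < 2 ^ w" "\<And>x. x \<in> set t \<Longrightarrow> x < 2 ^ w"
      using card_patterns_le d w rb t(2) by auto
    have space: "narrays * (300 * length t) \<le> 2 ^ w" using w n by simp
    have pos: "0 < length t" using rb n by linarith
    note tr = wp_transfer[OF wp wfc_main space _ pos small]
    have fa: "finds_all w A prog (initial_config w d r t) (all_occurrences S num t)"
      unfolding prog_def by (rule tr(1)) simp
    have "expected_time w A prog (initial_config w d r t) \<le> of_nat (2 + ?T * length prog)"
      unfolding prog_def by (rule tr(2)) simp
    also have "\<dots> = ennreal (real (2 + ?T * length prog))" by (simp only: ennreal_of_nat_eq_real_of_nat)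
    also have "\<dots> \<le> ennreal (C * real n * tau n r d)"
    proof (rule ennreal_leI)
      note tau = depth_le_tau[OF rb(2) d1]
      have m: "real (min d (dep (2 * r)) + 2) \<le> 50 * tau n r d" using tau by simp
      have "real (2 + ?T * length prog) =
          2 + (5000 * real n * real (length prog)) * real (min d (dep (2 * r)) + 2)"
        by (simp add: algebra_simps)
      also have "\<dots> \<le> 2 + (5000 * real n * real (length prog)) * (50 * tau n r d)"
        using m by (intro add_left_mono mult_left_mono) auto
      also have "2 \<le> 20 * real n * tau n r d"
      proof -
        have "1 * 1 \<le> real n * (10 * tau n r d)" using rb tau(2) by (intro mult_mono) auto
        then show ?thesis by simp
      qed
      finally show "real (2 + ?T * length prog) \<le> C * real n * tau n r d"
        by (simp add: C_def algebra_simps)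
    qed
    finally show ?thesis using fa by blast
  qed
  then show ?thesis by blast
qed

end
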